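(* For all $\mathfrak p\in\mathrm{Spec}(R)$, all integers $i$ and all $\underline\nu\in\mathbb Z^2$ with $\underline\nu\notin\mathfrak R_{\underline d}$, $$H^i_B(\mathcal S_I\otimes_R\kappa(\mathfrak p))_{\underline\nu}=0 .$$
   Context: Let $k$ be a field, $S=k[s_0,s_1,t_0,t_1]$ bigraded by $\deg s_j=(1,0)$, $\deg t_j=(0,1)$, and $R=k[x_0,x_1,x_2,x_3]$. Let $\phi:\mathbb P^1_k\times\mathbb P^1_k\dashrightarrow\mathbb P^3_k$ be a rational map given by four bihomogeneous polynomials $f_0,f_1,f_2,f_3\in S$ of the same bidegree $\underline d=(d_1,d_2)$, let $I=(f_0,f_1,f_2,f_3)\subset S$, and let $\mathscr S$ be the closure of the image of $\phi$. Standing assumptions: $\mathscr S$ is a surface in $\mathbb P^3_k$, $\phi$ is birational onto $\mathscr S$, and $V(I)\subset\mathbb P^1_k\times\mathbb P^1_k$ is finite and locally a complete intersection. $\mathcal S_I:=\mathrm{Sym}_S(I)$ is the symmetric algebra of $I$, i.e. the quotient of $S[x_0,\dots,x_3]$ by the ideal generated by all $\sum_i g_ix_i$ with $g_i\in S$ and $\sum_i g_if_i=0$; it is bigraded through $S$, with the $x_i$ of bidegree $(0,0)$. For $\mathfrak p\in\mathrm{Spec}(R)$, $\kappa(\mathfrak p)=R_\mathfrak p/\mathfrak pR_\mathfrak p$. $B:=(s_0,s_1)(t_0,t_1)\subset S$ is the product ideal, $H^i_B$ denotes local cohomology with support in $B$ (with its induced bigrading), and $$\mathfrak R_{\underline d}:=\{(n_1,n_2)\in\mathbb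 Z^2 : n_1\leq d_1-2,\ \text{or } n_2\leq d_2-2,\ \text{or } (n_1\leq 2d_1-2 \text{ and } n_2\leq 2d_2-2)\}.$$ *)

theory Defs
  imports
    "HOL-Algebra.QuotRing"
    "HOL-Algebra.Module"
    "HOL-Algebra.Ideal_Product"
    "HOL-Algebra.Product_Groups"
    "HOL-Algebra.Free_Abelian_Groups"
    "HOL-Library.Poly_Mapping"
    "HOL-Library.Numeral_Type"
    "HOL-Library.Product_Plus"
    "HOL-Computational_Algebra.Fraction_Field"
begin

section \<open>Generic commutative algebra\<close>

definition univ_ring :: "'a::comm_ring_1 ring" where
  "univ_ring = \<lparr>carrier = UNIV, monoid.mult = (*), one = 1, ring.zero = 0, add = (+)\<rparr>"

lemma cring_univ_ring: "cring (univ_ring :: 'a::comm_ring_1 ring)"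
proof (rule cringI)
  show "abelian_group (univ_ring :: 'a ring)"
  proof (rule abelian_groupI)
    fix x :: 'a
    show "\<exists>y\<in>carrier univ_ring. y \<oplus>\<^bsub>univ_ring\<^esub> x = \<zero>\<^bsub>univ_ring\<^esub>"
      by (rule bexI[of _ "- x"]) (simp_all add: univ_ring_def)
  qed (auto simp: univ_ring_def algebra_simps)
  show "comm_monoid (univ_ring :: 'a ring)"
    by (rule comm_monoidI) (auto simp: univ_ring_def algebra_simps)
qed (auto simp: univ_ring_def algebra_simps)

lemma ideal_univ_ringI:
  assumes "0 \<in> I" "\<And>a b. a \<in> I \<Longrightarrow> b \<in> I \<Longrightarrow> a + b \<in> I" "\<And>r a. a \<in> I \<Longrightarrow> r * a \<in> I"
  shows "ideal I (univ_ring :: 'a::comm_ring_1 ring)"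
proof -
  interpret cring "univ_ring :: 'a ring" by (rule cring_univ_ring)
  have uminus: "\<ominus>\<^bsub>univ_ring\<^esub> x = - x" for x :: 'a
    by (rule minus_equality) (auto simp: univ_ring_def)
  show ?thesis
  proof (rule idealI)
    show "ring (univ_ring :: 'a ring)" by (rule ring_axioms)
    show "subgroup I (add_monoid (univ_ring :: 'a ring))"
    proof (rule add.subgroupI)
      show "I \<subseteq> carrier univ_ring" by (simp add: univ_ring_def)
      show "I \<noteq> {}" using assms(1) by blast
      show "\<ominus>\<^bsub>univ_ring\<^esub> a \<in> I" if "a \<in> I" for a
        using assms(3)[OF that, of "-1"] by (simp add: uminus)
      show "a \<oplus>\<^bsub>univ_ring\<^esub> b \<in> I" if "a \<in> I" "b \<in> I" for a b
        using assms(2)[OF that] by (simp add: univ_ring_def)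
    qed
  qed (use assms(3) in \<open>auto simp: univ_ring_def mult.commute\<close>)
qed

text \<open>The module structure on a ring \<^term>\<open>A\<close> given by a ring homomorphism \<^term>\<open>h\<close> into \<^term>\<open>A\<close>.\<close>

definition module_via :: "('r \<Rightarrow> 'a) \<Rightarrow> ('a, 'c) ring_scheme \<Rightarrow> ('r, 'a) module" where
  "module_via h A = \<lparr>carrier = carrier A, monoid.mult = monoid.mult A, one = \<one>\<^bsub>A\<^esub>,
     ring.zero = \<zero>\<^bsub>A\<^esub>, add = add A, smult = (\<lambda>r x. h r \<otimes>\<^bsub>A\<^esub> x)\<rparr>"

text \<open>The fields \<^const>\<open>monoid.mult\<close> and \<^const>\<open>monoid.one\<close> of a module record carry no information for a module,
  and are left unspecified in the constructions below.\<close>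

definition quotient_module :: "('r, 'm) module \<Rightarrow> 'm set \<Rightarrow> ('r, 'm set) module" where
  "quotient_module M N = \<lparr>carrier = a_rcosets\<^bsub>M\<^esub> N, monoid.mult = undefined, one = undefined,
     ring.zero = N, add = set_add M, smult = (\<lambda>r X. \<Union>x\<in>X. N +>\<^bsub>M\<^esub> (r \<odot>\<^bsub>M\<^esub> x))\<rparr>"

subsection \<open>Localization at a multiplicatively closed set\<close>

definition loc_rel :: "('r, 'c) ring_scheme \<Rightarrow> 'r set \<Rightarrow> ('r, 'm) module \<Rightarrow> (('m \<times> 'r) \<times> ('m \<times> 'r)) set" where
  "loc_rel R U M = {((m, u), (n, v)). m \<in> carrier M \<and> u \<in> U \<and> n \<in> carrier M \<and> v \<in> U \<and>
     (\<exists>w\<in>U. w \<odot>\<^bsub>M\<^esub> (v \<odot>\<^bsub>M\<^esub> m) = w \<odot>\<^bsub>M\<^esub> (u \<odot>\<^bsub>M\<^esub> n))}"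

definition mfrac :: "('r, 'c) ring_scheme \<Rightarrow> 'r set \<Rightarrow> ('r, 'm) module \<Rightarrow> 'm \<Rightarrow> 'r \<Rightarrow> ('m \<times> 'r) set" where
  "mfrac R U M m u = loc_rel R U M `` {(m, u)}"

definition localization :: "('r, 'c) ring_scheme \<Rightarrow> 'r set \<Rightarrow> ('r, 'm) module \<Rightarrow> ('r, ('m \<times> 'r) set) module" where
  "localization R U M = \<lparr>carrier = (carrier M \<times> U) // loc_rel R U M,
     monoid.mult = undefined, one = undefined,
     ring.zero = mfrac R U M \<zero>\<^bsub>M\<^esub> \<one>\<^bsub>R\<^esub>,
     add = (\<lambda>X Y. \<Union>(m, u)\<in>X. \<Union>(n, v)\<in>Y. mfrac R U M (v \<odot>\<^bsub>M\<^esub> m \<oplus>\<^bsub>M\<^esub> u \<odot>\<^bsub>M\<^esub> n) (u \<otimes>\<^bsub>R\<^esub> v)),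
     smult = (\<lambda>r X. \<Union>(m, u)\<in>X. mfrac R U M (r \<odot>\<^bsub>M\<^esub> m) u)\<rparr>"

text \<open>The residue field \<open>R\<^sub>p / p R\<^sub>p\<close>, as an \<^term>\<open>R\<close>-module.\<close>

definition residue_field :: "('r, 'c) ring_scheme \<Rightarrow> 'r set \<Rightarrow> ('r, ('r \<times> 'r) set set) module" where
  "residue_field R p =
     quotient_module (localization R (carrier R - p) (module_via id R))
       {mfrac R (carrier R - p) (module_via id R) r u | r u. r \<in> p \<and> u \<in> carrier R - p}"

subsection \<open>Tensor products\<close>

definition tensor_relations ::
  "('r, 'c) ring_scheme \<Rightarrow> ('r, 'm) module \<Rightarrow> ('r, 'n) module \<Rightarrow> ('m \<times> 'n \<Rightarrow>\<^sub>0 int) set" where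
  "tensor_relations R M N =
     {frag_of (m \<oplus>\<^bsub>M\<^esub> m', n) - frag_of (m, n) - frag_of (m', n) | m m' n.
        m \<in> carrier M \<and> m' \<in> carrier M \<and> n \<in> carrier N} \<union>
     {frag_of (m, n \<oplus>\<^bsub>N\<^esub> n') - frag_of (m, n) - frag_of (m, n') | m n n'.
        m \<in> carrier M \<and> n \<in> carrier N \<and> n' \<in> carrier N} \<union>
     {frag_of (r \<odot>\<^bsub>M\<^esub> m, n) - frag_of (m, r \<odot>\<^bsub>N\<^esub> n) | r m n.
        r \<in> carrier R \<and> m \<in> carrier M \<and> n \<in> carrier N}"

definition tensor_kernel ::
  "('r, 'c) ring_scheme \<Rightarrow> ('r, 'm) module \<Rightarrow> ('r, 'n) module \<Rightarrow> ('m \<times> 'n \<Rightarrow>\<^sub>0 int) set" where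
  "tensor_kernel R M N =
     generate (free_Abelian_group (carrier M \<times> carrier N)) (tensor_relations R M N)"

text \<open>The tensor product of two \<^term>\<open>R\<close>-modules, as a module over a further ring whose elements
  act on \<^term>\<open>M\<close> through the \<^term>\<open>R\<close>-linear maps \<^term>\<open>act a\<close>.\<close>

definition tensor_module ::
  "('r, 'c) ring_scheme \<Rightarrow> ('a \<Rightarrow> 'm \<Rightarrow> 'm) \<Rightarrow> ('r, 'm) module \<Rightarrow> ('r, 'n) module \<Rightarrow>
   ('a, ('m \<times> 'n \<Rightarrow>\<^sub>0 int) set) module" where
  "tensor_module R act M N =
     (let F = free_Abelian_group (carrier M \<times> carrier N); K = tensor_kernel R M N in
      \<lparr>carrier = carrier (F Mod K), monoid.mult = undefined, one = undefined,
       ring.zero = \<one>\<^bsub>F Mod K\<^esub>, add = monoid.mult (F Mod K),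
       smult = (\<lambda>a X. \<Union>z\<in>X. K #>\<^bsub>F\<^esub> frag_extend (\<lambda>(m, n). frag_of (act a m, n)) z)\<rparr>)"

text \<open>If \<^term>\<open>M\<close> is graded with graded pieces \<^term>\<open>gM \<nu>\<close> and \<^term>\<open>N\<close> is placed in degree zero, the
  piece of degree \<^term>\<open>\<nu>\<close> of the tensor product is spanned by the pure tensors \<open>m \<otimes> n\<close> with
  \<^term>\<open>m \<in> gM \<nu>\<close>.\<close>

definition tensor_grading ::
  "('r, 'c) ring_scheme \<Rightarrow> ('r, 'm) module \<Rightarrow> ('r, 'n) module \<Rightarrow> ('d \<Rightarrow> 'm set) \<Rightarrow>
   'd \<Rightarrow> ('m \<times> 'n \<Rightarrow>\<^sub>0 int) set set" where
  "tensor_grading R M N gM \<nu> =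
     (\<lambda>z. tensor_kernel R M N #>\<^bsub>free_Abelian_group (carrier M \<times> carrier N)\<^esub> z) `
       carrier (free_Abelian_group (gM \<nu> \<times> carrier N))"

subsection \<open>Local cohomology\<close>

text \<open>Local cohomology with support in the ideal generated by a list \<^term>\<open>bs\<close>, as the cohomology of
  the Cech complex on \<^term>\<open>bs\<close>. Its term of degree \<^term>\<open>i\<close> is the direct sum, over the sets
  \<^term>\<open>A\<close> of \<^term>\<open>i\<close> indices, of the localizations of \<^term>\<open>M\<close> inverting \<^term>\<open>bs ! j\<close> for all
  \<^term>\<open>j \<in> A\<close>; it is zero unless \<open>0 \<le> i \<le> length bs\<close>. Inverting the powers of \<open>\<Prod>j\<in>A. bs ! j\<close> or,
  as here, all the monomials in the \<^term>\<open>bs ! j\<close> gives the same localization; with the second choice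
  the canonical map from the localization at \<^term>\<open>A - {j}\<close> to the one at \<^term>\<open>A\<close> is \<open>m/u \<mapsto> m/u\<close>.\<close>

definition monomials_on :: "('r, 'c) ring_scheme \<Rightarrow> 'r list \<Rightarrow> nat set \<Rightarrow> 'r set" where
  "monomials_on R bs A = range (\<lambda>e :: nat \<Rightarrow> nat. \<Otimes>\<^bsub>R\<^esub>j\<in>A. (bs ! j) [^]\<^bsub>R\<^esub> e j)"

definition cech_loc :: "('r, 'c) ring_scheme \<Rightarrow> 'r list \<Rightarrow> ('r, 'm) module \<Rightarrow> nat set \<Rightarrow> ('r, ('m \<times> 'r) set) module" where
  "cech_loc R bs M A = localization R (monomials_on R bs A) M"

definition cech_index :: "'r list \<Rightarrow> int \<Rightarrow> nat set set" where
  "cech_index bs i = {A. A \<subseteq> {..<length bs} \<and> int (card A) = i}"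

definition cech_cochains ::
  "('r, 'c) ring_scheme \<Rightarrow> 'r list \<Rightarrow> ('r, 'm) module \<Rightarrow> int \<Rightarrow> (nat set \<Rightarrow> ('m \<times> 'r) set) monoid" where
  "cech_cochains R bs M i = product_group (cech_index bs i) (\<lambda>A. add_monoid (cech_loc R bs M A))"

definition cech_res ::
  "('r, 'c) ring_scheme \<Rightarrow> 'r list \<Rightarrow> ('r, 'm) module \<Rightarrow> nat set \<Rightarrow> ('m \<times> 'r) set \<Rightarrow> ('m \<times> 'r) set" where
  "cech_res R bs M A X = (\<Union>(m, u)\<in>X. mfrac R (monomials_on R bs A) M m u)"

definition cech_diff ::
  "('r, 'c) ring_scheme \<Rightarrow> 'r list \<Rightarrow> ('r, 'm) module \<Rightarrow> int \<Rightarrow>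
   (nat set \<Rightarrow> ('m \<times> 'r) set) \<Rightarrow> nat set \<Rightarrow> ('m \<times> 'r) set" where
  "cech_diff R bs M i c = (\<lambda>A\<in>cech_index bs (i + 1).
     \<Oplus>\<^bsub>cech_loc R bs M A\<^esub>j\<in>A.
       (if even (card {l\<in>A. l < j}) then cech_res R bs M A (c (A - {j}))
        else \<ominus>\<^bsub>cech_loc R bs M A\<^esub> cech_res R bs M A (c (A - {j}))))"

definition cech_cocycles ::
  "('r, 'c) ring_scheme \<Rightarrow> 'r list \<Rightarrow> ('r, 'm) module \<Rightarrow> int \<Rightarrow> (nat set \<Rightarrow> ('m \<times> 'r) set) set" where
  "cech_cocycles R bs M i =
     kernel (cech_cochains R bs M i) (cech_cochains R bs M (i + 1)) (cech_diff R bs M i)"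

definition cech_coboundaries ::
  "('r, 'c) ring_scheme \<Rightarrow> 'r list \<Rightarrow> ('r, 'm) module \<Rightarrow> int \<Rightarrow> (nat set \<Rightarrow> ('m \<times> 'r) set) set" where
  "cech_coboundaries R bs M i = cech_diff R bs M (i - 1) ` carrier (cech_cochains R bs M (i - 1))"

definition local_cohomology ::
  "('r, 'c) ring_scheme \<Rightarrow> 'r list \<Rightarrow> ('r, 'm) module \<Rightarrow> int \<Rightarrow> (nat set \<Rightarrow> ('m \<times> 'r) set) set monoid" where
  "local_cohomology R bs M i =
     (cech_cochains R bs M i)\<lparr>carrier := cech_cocycles R bs M i\<rparr> Mod cech_coboundaries R bs M i"

definition loc_grading ::
  "('r, 'c) ring_scheme \<Rightarrow> ('d \<Rightarrow> 'r set) \<Rightarrow> 'r set \<Rightarrow> ('r, 'm) module \<Rightarrow> ('d::plus \<Rightarrow> 'm set) \<Rightarrow>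
   'd \<Rightarrow> ('m \<times> 'r) set set" where
  "loc_grading R gR U M gM \<nu> = {mfrac R U M m u | m u \<delta>. u \<in> U \<inter> gR \<delta> \<and> m \<in> gM (\<nu> + \<delta>)}"

text \<open>The piece of degree \<^term>\<open>\<nu>\<close> of local cohomology, for a ring graded by \<^term>\<open>gR\<close>, a module
  graded by \<^term>\<open>gM\<close> and homogeneous \<^term>\<open>bs\<close>: the classes of the homogeneous cocycles of degree
  \<^term>\<open>\<nu>\<close>.\<close>

definition local_cohomology_piece ::
  "('r, 'c) ring_scheme \<Rightarrow> ('d \<Rightarrow> 'r set) \<Rightarrow> 'r list \<Rightarrow> ('r, 'm) module \<Rightarrow> ('d::plus \<Rightarrow> 'm set) \<Rightarrow>
   int \<Rightarrow> 'd \<Rightarrow> (nat set \<Rightarrow> ('m \<times> 'r) set) set set" where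
  "local_cohomology_piece R gR bs M gM i \<nu> =
     {cech_coboundaries R bs M i #>\<^bsub>cech_cochains R bs M i\<^esub> c | c.
        c \<in> cech_cocycles R bs M i \<and>
        (\<forall>A\<in>cech_index bs i. c A \<in> loc_grading R gR (monomials_on R bs A) M gM \<nu>)}"

definition regular_sequence :: "('a, 'c) ring_scheme \<Rightarrow> 'a list \<Rightarrow> bool" where
  "regular_sequence A rs \<longleftrightarrow> set rs \<subseteq> carrier A \<and> Idl\<^bsub>A\<^esub> (set rs) \<noteq> carrier A \<and>
     (\<forall>i<length rs. \<forall>x\<in>carrier A.
        rs ! i \<otimes>\<^bsub>A\<^esub> x \<in> Idl\<^bsub>A\<^esub> (set (take i rs)) \<longrightarrow> x \<in> Idl\<^bsub>A\<^esub> (set (take i rs)))"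


section \<open>The polynomial rings\<close>

datatype svar = S0 | S1 | T0 | T1

text \<open>A linear order on the variables is what makes the library prove that the polynomial ring is
  an integral domain; the choice of the order plays no role.\<close>

instantiation svar :: linorder
begin
definition less_eq_svar :: "svar \<Rightarrow> svar \<Rightarrow> bool" where
  "less_eq_svar a b \<longleftrightarrow>
     case_svar 0 1 2 (3::nat) a \<le> case_svar 0 1 2 (3::nat) b"
definition less_svar :: "svar \<Rightarrow> svar \<Rightarrow> bool" where
  "less_svar a b \<longleftrightarrow>
     case_svar 0 1 2 (3::nat) a < case_svar 0 1 2 (3::nat) b"
instance
  by standard (auto simp: less_eq_svar_def less_svar_def split: svar.splits)
end

lemma UNIV_svar: "UNIV = {S0, S1, T0, T1}"
  using svar.exhaust by blast

instance svar :: finite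
  by standard (simp add: UNIV_svar)

type_synonym ('v, 'a) mpoly = "('v \<Rightarrow>\<^sub>0 nat) \<Rightarrow>\<^sub>0 'a"

text \<open>The rings \<open>S = k[s\<^sub>0,s\<^sub>1,t\<^sub>0,t\<^sub>1]\<close>, \<open>R = k[x\<^sub>0,\<dots>,x\<^sub>3]\<close> and \<open>S[x\<^sub>0,\<dots>,x\<^sub>3]\<close>. The indices
  \<open>0,1,2,3\<close> of the variables of \<open>R\<close> are the elements of the numeral type \<^typ>\<open>4\<close>.\<close>

type_synonym 'k S_poly = "(svar, 'k) mpoly"
type_synonym 'k R_poly = "(4, 'k) mpoly"
type_synonym 'k Sx_poly = "(4, 'k S_poly) mpoly"

definition const :: "'a::zero \<Rightarrow> ('v, 'a) mpoly" where
  "const c = Poly_Mapping.single 0 c"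

definition var :: "'v \<Rightarrow> ('v, 'a::zero_neq_one) mpoly" where
  "var v = Poly_Mapping.single (Poly_Mapping.single v 1) 1"

text \<open>Evaluation of a polynomial over \<open>k\<close> at polynomials over \<open>k\<close>.\<close>

definition subst :: "('v::finite \<Rightarrow> ('w, 'k::comm_ring_1) mpoly) \<Rightarrow> ('v, 'k) mpoly \<Rightarrow> ('w, 'k) mpoly" where
  "subst g F = (\<Sum>e\<in>Poly_Mapping.keys F.
     const (Poly_Mapping.lookup F e) * (\<Prod>v\<in>UNIV. g v ^ Poly_Mapping.lookup e v))"

definition R_to_Sx :: "'k::field R_poly \<Rightarrow> 'k Sx_poly" where
  "R_to_Sx = Poly_Mapping.map const"

definition bidegree :: "(svar \<Rightarrow>\<^sub>0 nat) \<Rightarrow> int \<times> int" where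
  "bidegree e = (int (Poly_Mapping.lookup e S0 + Poly_Mapping.lookup e S1),
                 int (Poly_Mapping.lookup e T0 + Poly_Mapping.lookup e T1))"

definition S_piece :: "int \<times> int \<Rightarrow> 'k::field S_poly set" where
  "S_piece \<nu> = {F. \<forall>e\<in>Poly_Mapping.keys F. bidegree e = \<nu>}"

definition R_piece :: "nat \<Rightarrow> 'k::field R_poly set" where
  "R_piece n = {F. \<forall>e\<in>Poly_Mapping.keys F. (\<Sum>i\<in>UNIV. Poly_Mapping.lookup e i) = n}"

definition Sx_piece :: "int \<times> int \<Rightarrow> 'k::field Sx_poly set" where
  "Sx_piece \<nu> = {F. \<forall>e. Poly_Mapping.lookup F e \<in> S_piece \<nu>}"


section \<open>Points of \<open>\<P>\<^sup>1 \<times> \<P>\<^sup>1\<close> and \<open>\<P>\<^sup>3\<close>\<close>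

definition irrelevant_ideal :: "'k::field S_poly set" where
  "irrelevant_ideal =
     (Idl\<^bsub>univ_ring\<^esub> {var S0, var S1}) \<cdot>\<^bsub>univ_ring\<^esub> (Idl\<^bsub>univ_ring\<^esub> {var T0, var T1})"

definition bihomogeneous_ideal :: "'k::field S_poly set \<Rightarrow> bool" where
  "bihomogeneous_ideal P \<longleftrightarrow> P = Idl\<^bsub>univ_ring\<^esub> (P \<inter> (\<Union>\<nu>. S_piece \<nu>))"

definition homogeneous_ideal :: "'k::field R_poly set \<Rightarrow> bool" where
  "homogeneous_ideal Q \<longleftrightarrow> Q = Idl\<^bsub>univ_ring\<^esub> (Q \<inter> (\<Union>n. R_piece n))"

text \<open>Points are points of the schemes, so that the field \<open>k\<close> need not be algebraically closed.\<close>

definition P1P1 :: "'k::field S_poly set set" where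
  "P1P1 = {P. primeideal P univ_ring \<and> bihomogeneous_ideal P \<and> \<not> irrelevant_ideal \<subseteq> P}"

definition P3 :: "'k::field R_poly set set" where
  "P3 = {Q. primeideal Q univ_ring \<and> homogeneous_ideal Q \<and> \<not> range var \<subseteq> Q}"

definition P3_closed :: "'k::field R_poly set set \<Rightarrow> bool" where
  "P3_closed Z \<longleftrightarrow> (\<exists>E. (\<forall>F\<in>E. \<exists>n. F \<in> R_piece n) \<and> Z = {Q\<in>P3. E \<subseteq> Q})"

definition P3_closure :: "'k::field R_poly set set \<Rightarrow> 'k R_poly set set" where
  "P3_closure X = \<Inter>{Z. P3_closed Z \<and> X \<subseteq> Z}"

definition P3_irreducible_closed :: "'k::field R_poly set set \<Rightarrow> bool" where
  "P3_irreducible_closed Z \<longleftrightarrow> P3_closed Z \<and> Z \<noteq> {} \<and>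
     (\<forall>Z1 Z2. P3_closed Z1 \<and> P3_closed Z2 \<and> Z = Z1 \<union> Z2 \<longrightarrow> Z = Z1 \<or> Z = Z2)"

text \<open>The closed set \<^term>\<open>X\<close> has Krull dimension \<^term>\<open>n\<close>.\<close>

definition P3_has_dim :: "'k::field R_poly set set \<Rightarrow> nat \<Rightarrow> bool" where
  "P3_has_dim X n \<longleftrightarrow>
     (let chains = {C. chain\<^sub>\<subseteq> C \<and> finite C \<and> (\<forall>Z\<in>C. P3_irreducible_closed Z \<and> Z \<subseteq> X)}
      in (\<exists>C\<in>chains. card C = n + 1) \<and> (\<forall>C\<in>chains. card C \<le> n + 1))"


section \<open>The rational map\<close>

text \<open>The rational map given by \<^term>\<open>f\<close> on points where it is defined by \<^term>\<open>f\<close>: a form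
  \<^term>\<open>F\<close> vanishes at the image of \<^term>\<open>P\<close> iff \<open>F(f\<^sub>0,\<dots>,f\<^sub>3)\<close> vanishes at \<^term>\<open>P\<close>.\<close>

definition base_ideal :: "(4 \<Rightarrow> 'k::field S_poly) \<Rightarrow> 'k S_poly set" where
  "base_ideal f = Idl\<^bsub>univ_ring\<^esub> (range f)"

definition base_locus :: "(4 \<Rightarrow> 'k::field S_poly) \<Rightarrow> 'k S_poly set set" where
  "base_locus f = {P\<in>P1P1. base_ideal f \<subseteq> P}"

definition map_point :: "(4 \<Rightarrow> 'k::field S_poly) \<Rightarrow> 'k S_poly set \<Rightarrow> 'k R_poly set" where
  "map_point f P = Idl\<^bsub>univ_ring\<^esub> {F. (\<exists>n. F \<in> R_piece n) \<and> subst f F \<in> P}"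

definition image_closure :: "(4 \<Rightarrow> 'k::field S_poly) \<Rightarrow> 'k R_poly set set" where
  "image_closure f = P3_closure (map_point f ` (P1P1 - base_locus f))"

text \<open>The map given by \<^term>\<open>f\<close> is birational onto the closure of its image: it has an inverse
  rational map, given by two pairs \<open>g\<^sub>S\<^sub>0 : g\<^sub>S\<^sub>1\<close> and \<open>g\<^sub>T\<^sub>0 : g\<^sub>T\<^sub>1\<close> of forms of equal degree on
  the closure of the image, whose ideal is \<^term>\<open>\<Inter>(image_closure f)\<close>. In each of the last two groups
  of conditions, the first part says that the composite is a rational map and the second that it is
  the identity.\<close>

definition birational_onto_image :: "(4 \<Rightarrow> 'k::field S_poly) \<Rightarrow> bool" where
  "birational_onto_image f \<longleftrightarrow>
     (let J = \<Inter>(image_closure f) in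
      \<exists>(g :: svar \<Rightarrow> 'k R_poly) m n.
        g S0 \<in> R_piece m \<and> g S1 \<in> R_piece m \<and> \<not> {g S0, g S1} \<subseteq> J \<and>
        g T0 \<in> R_piece n \<and> g T1 \<in> R_piece n \<and> \<not> {g T0, g T1} \<subseteq> J \<and>
        (\<not> {subst f (g S0), subst f (g S1)} \<subseteq> {0} \<and>
         \<not> {subst f (g T0), subst f (g T1)} \<subseteq> {0} \<and>
         subst f (g S0) * var S1 = subst f (g S1) * var S0 \<and>
         subst f (g T0) * var T1 = subst f (g T1) * var T0) \<and>
        (\<not> range (\<lambda>i. subst g (f i)) \<subseteq> J \<and>
         (\<forall>i j. subst g (f i) * var j - subst g (f j) * var i \<in> J)))"

text \<open>The local ring of \<open>\<P>\<^sup>1 \<times> \<P>\<^sup>1\<close> at the point \<^term>\<open>P\<close>, inside the fraction field of \<open>S\<close>, and the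
  stalk there of the ideal sheaf of \<open>V(I)\<close>.\<close>

definition local_ring :: "'k::field S_poly set \<Rightarrow> 'k S_poly fract ring" where
  "local_ring P = univ_ring\<lparr>carrier := {Fract a b | a b \<delta>. a \<in> S_piece \<delta> \<and> b \<in> S_piece \<delta> - P}\<rparr>"

definition local_ideal :: "'k::field S_poly set \<Rightarrow> 'k S_poly set \<Rightarrow> 'k S_poly fract set" where
  "local_ideal I P = {Fract a b | a b \<delta>. a \<in> I \<inter> S_piece \<delta> \<and> b \<in> S_piece \<delta> - P}"

definition base_locus_lci :: "(4 \<Rightarrow> 'k::field S_poly) \<Rightarrow> bool" where
  "base_locus_lci f \<longleftrightarrow> (\<forall>P\<in>base_locus f. \<exists>rs.
     regular_sequence (local_ring P) rs \<and>
     local_ideal (base_ideal f) P = Idl\<^bsub>local_ring P\<^esub> (set rs))"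


section \<open>The symmetric algebra and its local cohomology\<close>

definition sym_ideal :: "(4 \<Rightarrow> 'k::field S_poly) \<Rightarrow> 'k Sx_poly set" where
  "sym_ideal f = Idl\<^bsub>univ_ring\<^esub>
     {\<Sum>i\<in>UNIV. const (g i) * var i | g. (\<Sum>i\<in>UNIV. g i * f i) = 0}"

definition Sym :: "(4 \<Rightarrow> 'k::field S_poly) \<Rightarrow> 'k Sx_poly set ring" where
  "Sym f = univ_ring Quot sym_ideal f"

definition Sym_proj :: "(4 \<Rightarrow> 'k::field S_poly) \<Rightarrow> 'k Sx_poly \<Rightarrow> 'k Sx_poly set" where
  "Sym_proj f F = sym_ideal f +>\<^bsub>univ_ring\<^esub> F"

definition Sym_S :: "(4 \<Rightarrow> 'k::field S_poly) \<Rightarrow> ('k S_poly, 'k Sx_poly set) module" where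
  "Sym_S f = module_via (Sym_proj f \<circ> const) (Sym f)"

definition Sym_R :: "(4 \<Rightarrow> 'k::field S_poly) \<Rightarrow> ('k R_poly, 'k Sx_poly set) module" where
  "Sym_R f = module_via (Sym_proj f \<circ> R_to_Sx) (Sym f)"

definition Sym_piece :: "(4 \<Rightarrow> 'k::field S_poly) \<Rightarrow> int \<times> int \<Rightarrow> 'k Sx_poly set set" where
  "Sym_piece f \<nu> = Sym_proj f ` Sx_piece \<nu>"

text \<open>The tensor product \<open>S\<^sub>I \<otimes>\<^sub>R \<kappa>(p)\<close> as a bigraded \<open>S\<close>-module.\<close>

type_synonym 'k Sym_fibre_elem =
  "('k Sx_poly set \<times> ('k R_poly \<times> 'k R_poly) set set \<Rightarrow>\<^sub>0 int) set"

definition Sym_fibre ::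
  "(4 \<Rightarrow> 'k::field S_poly) \<Rightarrow> 'k R_poly set \<Rightarrow> ('k S_poly, 'k Sym_fibre_elem) module" where
  "Sym_fibre f p = tensor_module univ_ring (smult (Sym_S f)) (Sym_R f) (residue_field univ_ring p)"

definition Sym_fibre_piece ::
  "(4 \<Rightarrow> 'k::field S_poly) \<Rightarrow> 'k R_poly set \<Rightarrow> int \<times> int \<Rightarrow> 'k Sym_fibre_elem set" where
  "Sym_fibre_piece f p = tensor_grading univ_ring (Sym_R f) (residue_field univ_ring p) (Sym_piece f)"

definition B_gens :: "'k::field S_poly list" where
  "B_gens = [var S0 * var T0, var S0 * var T1, var S1 * var T0, var S1 * var T1]"

lemma irrelevant_ideal_eq: "irrelevant_ideal = Idl\<^bsub>univ_ring\<^esub> (set B_gens)"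
proof -
  let ?U = "univ_ring :: 'a S_poly ring"
  let ?K = "Idl\<^bsub>?U\<^esub> (set B_gens)"
  interpret cring ?U by (rule cring_univ_ring)
  have ops: "x \<otimes>\<^bsub>?U\<^esub> y = x * y" "x \<oplus>\<^bsub>?U\<^esub> y = x + y" "\<zero>\<^bsub>?U\<^esub> = 0" "carrier ?U = UNIV" for x y
    by (simp_all add: univ_ring_def)
  have K: "ideal ?K ?U" by (rule genideal_ideal) (simp add: ops)
  have sub: "set B_gens \<subseteq> ?K" by (rule genideal_self) (simp add: ops)
  have Kadd: "a + b \<in> ?K" and Kmul: "r * a \<in> ?K" if "a \<in> ?K" "b \<in> ?K" for a b r
    using additive_subgroup.a_closed[OF ideal.axioms(1)[OF K], of a b]
      ideal.I_l_closed[OF K, of a r] that by (auto simp: ops)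
  have K0: "0 \<in> ?K" using additive_subgroup.zero_closed[OF ideal.axioms(1)[OF K]] by (simp add: ops)
  have gens: "var a * var b \<in> ?K" if "a \<in> {S0, S1}" "b \<in> {T0, T1}" for a b
    using that sub by (auto simp: B_gens_def)
  have IT: "ideal {j. \<forall>a\<in>{S0, S1}. var a * j \<in> ?K} ?U"
    by (rule ideal_univ_ringI) (auto simp: K0 Kadd Kmul distrib_left mult.left_commute)
  have T: "Idl\<^bsub>?U\<^esub> {var T0, var T1} \<subseteq> {j. \<forall>a\<in>{S0, S1}. var a * j \<in> ?K}"
    by (rule genideal_minimal[OF IT]) (use gens in auto)
  have IS: "ideal {i. \<forall>j\<in>Idl\<^bsub>?U\<^esub> {var T0, var T1}. i * j \<in> ?K} ?U"
    by (rule ideal_univ_ringI) (auto simp: K0 Kadd Kmul distrib_right mult.assoc)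
  have S: "Idl\<^bsub>?U\<^esub> {var S0, var S1} \<subseteq> {i. \<forall>j\<in>Idl\<^bsub>?U\<^esub> {var T0, var T1}. i * j \<in> ?K}"
    by (rule genideal_minimal[OF IS]) (use T in auto)
  have I1: "ideal (Idl\<^bsub>?U\<^esub> {var S0, var S1}) ?U" and I2: "ideal (Idl\<^bsub>?U\<^esub> {var T0, var T1}) ?U"
    by (rule genideal_ideal; simp add: ops)+
  show ?thesis
  proof
    show "irrelevant_ideal \<subseteq> ?K"
    proof
      fix x assume "x \<in> (irrelevant_ideal :: 'a S_poly set)"
      then show "x \<in> ?K" unfolding irrelevant_ideal_def
        by (induct rule: ideal_prod.induct) (use S Kadd in \<open>auto simp: ops\<close>)
    qed
    have "{var S0, var S1} \<subseteq> Idl\<^bsub>?U\<^esub> {var S0, var S1}" "{var T0, var T1} \<subseteq> Idl\<^bsub>?U\<^esub> {var T0, var T1}"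
      by (rule genideal_self; simp add: ops)+
    then show "?K \<subseteq> irrelevant_ideal" unfolding irrelevant_ideal_def
      by (intro genideal_minimal ideal_prod_is_ideal I1 I2)
        (auto simp: B_gens_def ops(1)[symmetric] intro!: ideal_prod.prod)
  qed
qed

definition HB_Sym_fibre ::
  "(4 \<Rightarrow> 'k::field S_poly) \<Rightarrow> 'k R_poly set \<Rightarrow> int \<Rightarrow>
   (nat set \<Rightarrow> ('k Sym_fibre_elem \<times> 'k S_poly) set) set monoid" where
  "HB_Sym_fibre f p i = local_cohomology univ_ring B_gens (Sym_fibre f p) i"

definition HB_Sym_fibre_piece ::
  "(4 \<Rightarrow> 'k::field S_poly) \<Rightarrow> 'k R_poly set \<Rightarrow> int \<Rightarrow> int \<times> int \<Rightarrow>
   (nat set \<Rightarrow> ('k Sym_fibre_elem \<times> 'k S_poly) set) set set" where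
  "HB_Sym_fibre_piece f p i \<nu> =
     local_cohomology_piece univ_ring S_piece B_gens (Sym_fibre f p) (Sym_fibre_piece f p) i \<nu>"

definition degree_region :: "nat \<Rightarrow> nat \<Rightarrow> (int \<times> int) set" where
  "degree_region d1 d2 = {(n1, n2). n1 \<le> int d1 - 2 \<or> n2 \<le> int d2 - 2 \<or>
     (n1 \<le> 2 * int d1 - 2 \<and> n2 \<le> 2 * int d2 - 2)}"

end

theory Submission
  imports "HOL-Algebra.Algebraic_Closure_Type" "HOL-Computational_Algebra.Polynomial_Factorial" Defs
begin

text \<open>
  Let \<open>\<phi>\<close> be a ring homomorphism from \<open>R\<close> to an infinite field \<open>\<Omega>\<close> with kernel \<open>p\<close>, and write \<open>\<xi>\<^sub>i = \<phi>(x\<^sub>i)\<close>. After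
  base change to \<open>\<Omega>\<close> the fibre of the symmetric algebra becomes \<open>S\<^sub>\<Omega> / J\<close>, where \<open>J\<close> consists of the sums
  \<open>\<Sum> g\<^sub>i \<xi>\<^sub>i\<close> over the syzygies \<open>g\<close> of \<open>f\<close>; a linear retraction of \<open>\<Omega>\<close> onto the residue field of \<open>p\<close> carries
  the vanishing of Cech cohomology back to the fibre itself.

  If some \<open>\<xi>\<^sub>k\<close> is nonzero, \<open>J\<close> is the colon ideal of the \<open>u\<^sub>i = f\<^sub>i - (\<xi>\<^sub>i / \<xi>\<^sub>k) f\<^sub>k\<close> by \<open>f\<^sub>k\<close>. Cancelling common factors
  and taking a generic combination of the \<open>u\<^sub>i\<close>, one finds \<open>J = h \<cdot> ((g\<^sub>1, g\<^sub>2, g\<^sub>3) : f\<^sub>0)\<close> with \<open>g\<^sub>1, g\<^sub>2\<close> a regular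
  sequence of forms of the same bidegree. The Koszul complex bounds the cohomology of \<open>S / (g\<^sub>1, g\<^sub>2)\<close>. Since
  \<open>(g\<^sub>1, g\<^sub>2)\<close> has finite support, the quotients of ideals containing it have no cohomology in degrees at
  least 2, and the long exact sequences for \<open>(g\<^sub>1, g\<^sub>2) : g\<^sub>3\<close> and \<open>(g\<^sub>1, g\<^sub>2, g\<^sub>3)\<close> and for the second colon ideal
  transfer the bound to \<open>J\<close>.
\<close>

section \<open>The Cech complex in the Laurent ring\<close>

text \<open>The shape of the region comes from the polynomial ring S. Its Cech cohomology vanishes
  in all degrees once both coordinates of the bidegree are at least -1, and in degree 3 once one of
  them is. Let a be the bidegree of g1 and g2. The Koszul complex pairs the shifts 0, a, 2a of the
  bidegree with the degrees i, i+1, i+2. For i = 1 the shift 2a meets degree 3, where one coordinate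
  suffices: this is the alternative in the region. For i = 0 it meets degree 2 and constrains both
  coordinates, but the colon by f0 together with the factor h moves the question from bidegree \<nu>
  to \<nu> + a, where that bound is already implied.

  An infinite field is used for two generic choices: the combination of the u_i, and linear forms
  that miss the finite support. The large field is reached by adjoining the coordinates one by one,
  each time passing to the algebraic closure of a rational function field, so that its type does not
  depend on \<open>p\<close>. It has more elements than the residue field, whence the
  retraction.\<close>

type_synonym 'a laurent = "(svar \<Rightarrow>\<^sub>0 int) \<Rightarrow>\<^sub>0 'a"

abbreviation "lk \<equiv> Poly_Mapping.lookup"
abbreviation "keys \<equiv> Poly_Mapping.keys"
abbreviation "single \<equiv> Poly_Mapping.single"

section \<open>Restricting Laurent polynomials to a set of exponents\<close>

definition restr :: "('b \<Rightarrow> bool) \<Rightarrow> ('b \<Rightarrow>\<^sub>0 'a::comm_monoid_add) \<Rightarrow> ('b \<Rightarrow>\<^sub>0 'a)" where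
  "restr P x = Poly_Mapping.mapp (\<lambda>k v. v when P k) x"

lemma lookup_restr: "lk (restr P x) k = (lk x k when P k)"
  by (auto simp: restr_def lookup_mapp "when_def" in_keys_iff)

lemma restr_add: "restr P (x + y) = restr P x + restr P y"
  by (rule poly_mapping_eqI) (auto simp: lookup_restr lookup_add "when_def")

lemma restr_0 [simp]: "restr P 0 = 0"
  by (rule poly_mapping_eqI) (auto simp: lookup_restr "when_def")

lemma restr_uminus: "restr P (- x) = - restr P (x :: _ \<Rightarrow>\<^sub>0 _::ab_group_add)"
  by (rule poly_mapping_eqI) (auto simp: lookup_restr "when_def")

lemma restr_diff: "restr P (x - y) = restr P x - restr P (y :: _ \<Rightarrow>\<^sub>0 _::ab_group_add)"
  by (rule poly_mapping_eqI) (auto simp: lookup_restr lookup_minus "when_def")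

lemma restr_sum: "restr P (\<Sum>i\<in>I. f i) = (\<Sum>i\<in>I. restr P (f i))"
  by (induction I rule: infinite_finite_induct) (auto simp: restr_add)

lemma keys_restr: "keys (restr P x) = {k\<in>keys x. P k}"
  by (auto simp: in_keys_iff lookup_restr "when_def" split: if_splits)

lemma restr_id: "(\<And>k. k \<in> keys x \<Longrightarrow> P k) \<Longrightarrow> restr P x = x"
  by (rule poly_mapping_eqI) (auto simp: lookup_restr "when_def" in_keys_iff)

lemma restr_none: "(\<And>k. k \<in> keys x \<Longrightarrow> \<not> P k) \<Longrightarrow> restr P x = 0"
  by (rule poly_mapping_eqI) (auto simp: lookup_restr "when_def" in_keys_iff)

lemma restr_sgn: "restr P ((-1)^n * x) = (-1)^n * restr P (x :: 'a::field laurent)"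
  by (cases "even n") (auto simp: restr_uminus)

lemma pm_expand: "x = (\<Sum>k\<in>keys x. single k (lk x k))"
  by (rule poly_mapping_eqI)
    (auto simp: lookup_sum lookup_single "when_def" in_keys_iff sum.delta)

lemma pm_induct [case_names zero single add]:
  assumes "P 0" "\<And>k c. P (single k c)" "\<And>x y. P x \<Longrightarrow> P y \<Longrightarrow> P (x + y)"
  shows "P (x :: _ \<Rightarrow>\<^sub>0 _::comm_monoid_add)"
proof -
  have "P (\<Sum>k\<in>K. single k (lk x k))" if "finite K" for K
    using that by induction (auto intro: assms)
  then show ?thesis by (subst pm_expand) simp
qed

lemma lookup_single_mult:
  "lk (single k c * x) l = c * lk x (l - k)" for x :: "('v \<Rightarrow>\<^sub>0 int) \<Rightarrow>\<^sub>0 'a::comm_ring_1"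
proof (induction x rule: pm_induct)
  case (single k' c')
  show ?case by (auto simp: mult_single lookup_single "when_def")
qed (auto simp: distrib_left lookup_add)

section \<open>Polynomials and bihomogeneous Laurent polynomials\<close>

definition deg :: "(svar \<Rightarrow>\<^sub>0 int) \<Rightarrow> int \<times> int" where
  "deg k = (lk k S0 + lk k S1, lk k T0 + lk k T1)"

lemma deg_add: "deg (k + l) = deg k + deg l" and deg_0: "deg 0 = 0"
  by (auto simp: deg_def lookup_add lookup_minus zero_prod_def)

definition polys :: "'a::zero laurent set" where
  "polys = {x. \<forall>k\<in>keys x. \<forall>v. 0 \<le> lk k v}"

definition piece :: "int \<times> int \<Rightarrow> 'a::zero laurent set" where
  "piece \<nu> = {x. \<forall>k\<in>keys x. deg k = \<nu>}"

definition pr :: "int \<times> int \<Rightarrow> 'a::comm_monoid_add laurent \<Rightarrow> 'a laurent" where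
  "pr \<nu> = restr (\<lambda>k. deg k = \<nu>)"

lemma keys_addD: "k \<in> keys (x + y) \<Longrightarrow> k \<in> keys x \<or> k \<in> keys y"
  using Poly_Mapping.keys_add[of x y] by auto

lemma keys_multD: "k \<in> keys (x * y) \<Longrightarrow>
    \<exists>a b. a \<in> keys x \<and> b \<in> keys y \<and> k = a + b"
  using keys_mult[of x y] by blast

lemma keys_uminus [simp]: "keys (- x) = keys (x :: _ \<Rightarrow>\<^sub>0 'a::ab_group_add)"
  by (auto simp: in_keys_iff)

lemma polys_0 [simp]: "0 \<in> polys" and polys_1 [simp]: "(1 :: 'a::comm_ring_1 laurent) \<in> polys"
  by (auto simp: polys_def)

lemma polys_add: "x \<in> polys \<Longrightarrow> y \<in> polys \<Longrightarrow> x + y \<in> polys"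
  unfolding polys_def using keys_addD[of _ x y] by blast

lemma polys_uminus: "(x :: 'a::comm_ring_1 laurent) \<in> polys \<Longrightarrow> - x \<in> polys"
  by (auto simp: polys_def)

lemma polys_diff: "(x :: 'a::comm_ring_1 laurent) \<in> polys \<Longrightarrow> y \<in> polys \<Longrightarrow> x - y \<in> polys"
  using polys_add[of x "-y"] polys_uminus[of y] by simp

lemma polys_mult: "(x :: 'a::comm_ring_1 laurent) \<in> polys \<Longrightarrow> y \<in> polys \<Longrightarrow> x * y \<in> polys"
  unfolding polys_def using keys_multD[of _ x y] by (fastforce simp: lookup_add)

lemma polys_sum: "(\<And>i. i \<in> I \<Longrightarrow> f i \<in> polys) \<Longrightarrow> (\<Sum>i\<in>I. f i) \<in> polys"
  by (induction I rule: infinite_finite_induct) (auto intro: polys_add)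

lemma polys_power: "(x :: 'a::comm_ring_1 laurent) \<in> polys \<Longrightarrow> x ^ n \<in> polys"
  by (induction n) (auto intro: polys_mult)

lemma polys_prod: "(\<And>i. i \<in> I \<Longrightarrow> f i \<in> polys) \<Longrightarrow> (\<Prod>i\<in>I. (f i :: 'a::comm_ring_1 laurent)) \<in> polys"
  by (induction I rule: infinite_finite_induct) (auto intro: polys_mult)

lemma polys_restr: "x \<in> polys \<Longrightarrow> restr P x \<in> polys"
  by (auto simp: polys_def keys_restr)

lemma polys_single: "(\<And>v. 0 \<le> lk k v) \<Longrightarrow> single k c \<in> polys"
  by (auto simp: polys_def split: if_splits)

lemma polys_minus1 [simp]: "(- 1 :: 'a::comm_ring_1 laurent) \<in> polys"
  using polys_uminus[OF polys_1] .

lemma polys_sgn: "((-1)^n :: 'a::comm_ring_1 laurent) \<in> polys"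
  by (rule polys_power) simp

lemma piece_0 [simp]: "0 \<in> piece \<nu>" and piece_1 [simp]: "(1 :: 'a::comm_ring_1 laurent) \<in> piece 0"
  by (auto simp: piece_def deg_0)

lemma piece_add: "x \<in> piece \<nu> \<Longrightarrow> y \<in> piece \<nu> \<Longrightarrow> x + y \<in> piece \<nu>"
  unfolding piece_def using keys_addD[of _ x y] by blast

lemma piece_uminus: "(x :: 'a::comm_ring_1 laurent) \<in> piece \<nu> \<Longrightarrow> - x \<in> piece \<nu>"
  by (auto simp: piece_def)

lemma piece_diff: "(x :: 'a::comm_ring_1 laurent) \<in> piece \<nu> \<Longrightarrow> y \<in> piece \<nu> \<Longrightarrow> x - y \<in> piece \<nu>"
  using piece_add[of x \<nu> "-y"] piece_uminus[of y] by simp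

lemma piece_mult: "(x :: 'a::comm_ring_1 laurent) \<in> piece \<mu> \<Longrightarrow> y \<in> piece \<nu> \<Longrightarrow> x * y \<in> piece (\<mu> + \<nu>)"
  unfolding piece_def using keys_multD[of _ x y] by (fastforce simp: deg_add)

lemma piece_sum: "(\<And>i. i \<in> I \<Longrightarrow> f i \<in> piece \<nu>) \<Longrightarrow> (\<Sum>i\<in>I. f i) \<in> piece \<nu>"
  by (induction I rule: infinite_finite_induct) (auto intro: piece_add)

lemma piece_sgn: "((-1)^n :: 'a::comm_ring_1 laurent) \<in> piece 0"
  by (cases "even n") (auto intro: piece_uminus)

lemma piece_sgn_mult: "(x :: 'a::comm_ring_1 laurent) \<in> piece \<nu> \<Longrightarrow> (-1)^n * x \<in> piece \<nu>"
  using piece_mult[OF piece_sgn, of x \<nu> n] by simp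

lemma piece_single: "deg k = \<nu> \<Longrightarrow> single k c \<in> piece \<nu>"
  by (auto simp: piece_def split: if_splits)

lemma piece_pr: "pr \<nu> x \<in> piece \<nu>"
  by (auto simp: piece_def pr_def keys_restr)

lemma piece_restr: "x \<in> piece \<nu> \<Longrightarrow> restr P x \<in> piece \<nu>"
  by (auto simp: piece_def keys_restr)

lemma pr_piece: "x \<in> piece \<nu> \<Longrightarrow> pr \<nu> x = x"
  unfolding pr_def by (rule restr_id) (auto simp: piece_def)

lemma pr_piece_other: "x \<in> piece \<mu> \<Longrightarrow> \<mu> \<noteq> \<nu> \<Longrightarrow> pr \<nu> x = 0"
  unfolding pr_def by (rule restr_none) (auto simp: piece_def)

text \<open>A form moves each bihomogeneous component to a single other one. This is what allows a
  bidegree to be imposed after an ungraded construction.\<close>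

lemma pr_mult: "(x :: 'a::comm_ring_1 laurent) \<in> piece \<mu> \<Longrightarrow> pr \<nu> (x * y) = x * pr (\<nu> - \<mu>) y"
proof (induction y rule: pm_induct)
  case (single k c)
  show ?case
  proof (cases "deg k = \<nu> - \<mu>")
    case True
    then have s: "single k c \<in> piece (\<nu> - \<mu>)" by (rule piece_single)
    show ?thesis using piece_mult[OF single s] by (simp add: pr_piece s)
  next
    case False
    have s: "single k c \<in> piece (deg k)" by (simp add: piece_single)
    have "\<mu> + deg k \<noteq> \<nu>" using False by auto
    then show ?thesis using piece_mult[OF single s] pr_piece_other[OF s False]
      by (simp add: pr_piece_other)
  qed
qed (auto simp: pr_def restr_add distrib_left)

lemma pr_sgn: "pr \<nu> ((-1)^n * x) = (-1)^n * pr \<nu> (x :: 'a::comm_ring_1 laurent)"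
  using pr_mult[OF piece_sgn, of \<nu> n x] by simp

section \<open>Generators of the irrelevant ideal, and localizations inside the Laurent ring\<close>

definition lvar :: "svar \<Rightarrow> 'a::comm_ring_1 laurent" where
  "lvar v = single (single v 1) 1"

definition C :: "'a \<Rightarrow> 'a::zero laurent" where
  "C c = single 0 c"

lemma polys_lvar [simp]: "lvar v \<in> polys"
  by (auto simp: lvar_def lookup_single "when_def" intro!: polys_single)

lemma polys_C [simp]: "C c \<in> polys"
  by (auto simp: C_def intro!: polys_single)

lemma piece_C [simp]: "C c \<in> piece 0"
  by (auto simp: C_def deg_0 intro!: piece_single)

lemma C_simps: "C 0 = 0" "C (1 :: 'a::comm_ring_1) = 1" "C (a + b :: 'a) = C a + C b"
  "C (a * b :: 'a) = C a * C b" "C (- a :: 'a) = - C a" "C (a - b :: 'a) = C a - C b"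
  by (auto simp: C_def single_add mult_single single_uminus single_diff)

text \<open>The order agrees with \<open>B_gens\<close>: the high bit of \<open>j\<close> selects
  the s-variable, the low bit the t-variable.\<close>

definition bgen :: "nat \<Rightarrow> 'a::comm_ring_1 laurent" where
  "bgen j = lvar (if j < 2 then S0 else S1) * lvar (if even j then T0 else T1)"

definition bprod :: "nat set \<Rightarrow> 'a::comm_ring_1 laurent" where
  "bprod A = (\<Prod>j\<in>A. bgen j)"

lemma lvar_unit: "lvar v * single (- single v 1) 1 = (1 :: 'a::comm_ring_1 laurent)"
  by (simp add: lvar_def mult_single)

lemma bgen_polys [simp]: "bgen j \<in> polys"
  by (auto simp: bgen_def intro: polys_mult)

lemma bprod_polys [simp]: "bprod A \<in> polys"
  by (auto simp: bprod_def intro: polys_prod)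

lemma lvar_piece: "lvar S0 \<in> piece (1, 0)" "lvar S1 \<in> piece (1, 0)" "lvar T0 \<in> piece (0, 1)" "lvar T1 \<in> piece (0, 1)"
  by (auto simp: lvar_def deg_def lookup_single intro!: piece_single)

lemma bgen_piece: "bgen j \<in> piece (1, 1)"
proof -
  have "lvar (if j < 2 then S0 else S1) \<in> piece (1, 0)" "lvar (if even j then T0 else T1) \<in> piece (0, 1)"
    using lvar_piece by auto
  from piece_mult[OF this] show ?thesis by (simp add: bgen_def)
qed

lemma bprod_piece: "finite A \<Longrightarrow> bprod A \<in> piece (int (card A), int (card A))"
proof (induction A rule: finite_induct)
  case (insert j A)
  show ?case using piece_mult[OF bgen_piece insert(3), of j] insert(1,2)
    by (simp add: bprod_def)
qed (use piece_1 in \<open>auto simp: zero_prod_def bprod_def\<close>)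

lemma bprod_power_piece: "finite A \<Longrightarrow> bprod A ^ n \<in> piece (int (n * card A), int (n * card A))"
proof (induction n)
  case (Suc n)
  show ?case using piece_mult[OF bprod_piece Suc(1)] Suc(2) by (simp add: add.commute)
qed (use piece_1 in \<open>auto simp: zero_prod_def\<close>)

lemma bprod_subset: "finite A' \<Longrightarrow> A \<subseteq> A' \<Longrightarrow> bprod A' = bprod A * bprod (A' - A)"
  unfolding bprod_def by (metis mult.commute prod.subset_diff)

text \<open>Monomials are units in the Laurent ring, so the localization is a subset of it, with
  powers of \<open>bprod A\<close> as denominators, and the restriction maps become
  inclusions.\<close>

definition loc :: "'a::comm_ring_1 laurent set \<Rightarrow> nat set \<Rightarrow> 'a laurent set" where
  "loc M A = {x. \<exists>n. bprod A ^ n * x \<in> M}"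

text \<open>Exactly the ideals of the polynomial ring, seen inside the Laurent ring.\<close>

definition submod :: "'a::comm_ring_1 laurent set \<Rightarrow> bool" where
  "submod M \<longleftrightarrow> M \<subseteq> polys \<and> 0 \<in> M \<and> (\<forall>x\<in>M. \<forall>y\<in>M. x + y \<in> M) \<and> (\<forall>s\<in>polys. \<forall>x\<in>M. s * x \<in> M)"

definition homog :: "'a::comm_ring_1 laurent set \<Rightarrow> bool" where
  "homog M \<longleftrightarrow> (\<forall>x\<in>M. \<forall>\<nu>. pr \<nu> x \<in> M)"

lemma submodD:
  assumes "submod M"
  shows "x \<in> M \<Longrightarrow> x \<in> polys" "0 \<in> M" "x \<in> M \<Longrightarrow> y \<in> M \<Longrightarrow> x + y \<in> M"
    "s \<in> polys \<Longrightarrow> x \<in> M \<Longrightarrow> s * x \<in> M" "x \<in> M \<Longrightarrow> - x \<in> M" "x \<in> M \<Longrightarrow> y \<in> M \<Longrightarrow> x - y \<in> M"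
proof -
  show mul: "s * x \<in> M" if "s \<in> polys" "x \<in> M" for s x using assms that by (auto simp: submod_def)
  show um: "- x \<in> M" if "x \<in> M" for x using mul[of "-1" x] that by simp
  show add: "x + y \<in> M" if "x \<in> M" "y \<in> M" for x y using assms that by (auto simp: submod_def)
  show "x - y \<in> M" if "x \<in> M" "y \<in> M" using add[OF that(1) um[OF that(2)]] by simp
qed (use assms in \<open>auto simp: submod_def\<close>)

lemma submod_polys [simp]: "submod polys" and submod_0 [simp]: "submod {0}"
  and homog_polys [simp]: "homog polys" and homog_0 [simp]: "homog {0}"
  by (auto simp: submod_def homog_def pr_def intro: polys_add polys_mult polys_restr)

lemma locI: "bprod A ^ n * x \<in> M \<Longrightarrow> x \<in> loc M A"
  by (auto simp: loc_def)

lemma loc_super: "submod M \<Longrightarrow> x \<in> M \<Longrightarrow> x \<in> loc M A"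
  by (rule locI[of _ 0]) simp

lemma loc_up:
  assumes "submod M" "bprod A ^ n * x \<in> M" "n \<le> m"
  shows "bprod A ^ m * x \<in> M"
proof -
  have "bprod A ^ m * x = bprod A ^ (m - n) * (bprod A ^ n * x)"
    using assms(3) by (simp add: power_add[symmetric] mult.assoc[symmetric])
  then show ?thesis using submodD(4)[OF assms(1) polys_power[OF bprod_polys] assms(2)] by simp
qed

lemma loc_0 [simp]: "submod M \<Longrightarrow> 0 \<in> loc M A"
  by (auto simp: loc_def submodD)

lemma loc_add:
  assumes "submod M" "x \<in> loc M A" "y \<in> loc M A"
  shows "x + y \<in> loc M A"
proof -
  obtain n m where "bprod A ^ n * x \<in> M" "bprod A ^ m * y \<in> M" using assms by (auto simp: loc_def)
  then have "bprod A ^ (max n m) * (x + y) \<in> M"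
    using assms(1) by (auto simp: distrib_left intro!: submodD(3) intro: loc_up)
  then show ?thesis by (rule locI)
qed

lemma loc_mult:
  assumes "submod M" "s \<in> loc polys A" "x \<in> loc M A"
  shows "s * x \<in> loc M A"
proof -
  obtain n m where "bprod A ^ n * s \<in> polys" "bprod A ^ m * x \<in> M" using assms by (auto simp: loc_def)
  then have "(bprod A ^ n * s) * (bprod A ^ m * x) \<in> M" by (rule submodD(4)[OF assms(1)])
  then have "bprod A ^ (n + m) * (s * x) \<in> M" by (simp add: power_add algebra_simps)
  then show ?thesis by (rule locI)
qed

lemma loc_mult_polys: "submod M \<Longrightarrow> s \<in> polys \<Longrightarrow> x \<in> loc M A \<Longrightarrow> s * x \<in> loc M A"
  by (rule loc_mult) (auto intro: loc_super)

lemma loc_uminus: "submod M \<Longrightarrow> x \<in> loc M A \<Longrightarrow> - x \<in> loc M A"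
  using loc_mult_polys[of M "-1" x A] by simp

lemma loc_diff: "submod M \<Longrightarrow> x \<in> loc M A \<Longrightarrow> y \<in> loc M A \<Longrightarrow> x - y \<in> loc M A"
  using loc_add[of M x A "-y"] loc_uminus[of M y A] by simp

lemma loc_sgn: "submod M \<Longrightarrow> x \<in> loc M A \<Longrightarrow> (-1)^n * x \<in> loc M A"
  by (rule loc_mult_polys) (auto intro: polys_sgn)

lemma loc_sum: "submod M \<Longrightarrow> (\<And>i. i \<in> I \<Longrightarrow> f i \<in> loc M A) \<Longrightarrow> (\<Sum>i\<in>I. f i) \<in> loc M A"
  by (induction I rule: infinite_finite_induct) (auto intro: loc_add)

lemma loc_mono: "M \<subseteq> N \<Longrightarrow> x \<in> loc M A \<Longrightarrow> x \<in> loc N A"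
  by (auto simp: loc_def)

lemma loc_subset:
  assumes "submod M" "finite A'" "A \<subseteq> A'" "x \<in> loc M A"
  shows "x \<in> loc M A'"
proof -
  obtain n where n: "bprod A ^ n * x \<in> M" using assms by (auto simp: loc_def)
  have "bprod A' ^ n * x = bprod (A' - A) ^ n * (bprod A ^ n * x)"
    by (simp add: bprod_subset[OF assms(2,3)] power_mult_distrib mult_ac)
  also have "\<dots> \<in> M" by (rule submodD(4)[OF assms(1) _ n]) (auto intro: polys_power)
  finally show ?thesis by (rule locI)
qed

lemma loc_empty: "submod M \<Longrightarrow> loc M {} = M"
  by (auto simp: loc_def bprod_def)

lemma loc_pr:
  assumes "homog M" "finite A" "x \<in> loc M A"
  shows "pr \<nu> x \<in> loc M A"
proof -
  obtain n where n: "bprod A ^ n * x \<in> M" using assms by (auto simp: loc_def)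
  define \<mu> where "\<mu> = (int (n * card A), int (n * card A))"
  have "bprod A ^ n * pr \<nu> x = pr (\<nu> + \<mu>) (bprod A ^ n * x)"
    using pr_mult[OF bprod_power_piece[OF assms(2)], of "\<nu> + \<mu>" n x] by (simp add: \<mu>_def)
  also have "\<dots> \<in> M" using assms(1) n unfolding homog_def by blast
  finally show ?thesis by (rule locI)
qed

text \<open>A high power of \<open>bgen j\<close> absorbs the part of the denominator that
  \<open>j\<close> contributes. All larger powers work too, so that finitely many such statements
  can share one exponent.\<close>

lemma loc_insert_power:
  assumes "submod M" "finite A" "x \<in> loc M (insert j A)"
  shows "\<exists>n. \<forall>m\<ge>n. bgen j ^ m * x \<in> loc M A"
proof (cases "j \<in> A")
  case True
  then show ?thesis using assms
    by (auto simp: insert_absorb intro!: loc_mult_polys polys_power)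
next
  case False
  obtain n where n: "bprod (insert j A) ^ n * x \<in> M" using assms by (auto simp: loc_def)
  have "bgen j ^ m * x \<in> loc M A" if "m \<ge> n" for m
  proof (rule locI[of _ n])
    have "bgen j ^ m = (bgen j ^ n * bgen j ^ (m - n) :: 'a laurent)"
      using that by (simp add: power_add[symmetric])
    then have "bprod A ^ n * (bgen j ^ m * x) = bgen j ^ (m - n) * (bprod (insert j A) ^ n * x)"
      using False assms(2) by (simp add: bprod_def power_mult_distrib mult_ac)
    also have "\<dots> \<in> M" by (rule submodD(4)[OF assms(1) _ n]) (auto intro: polys_power)
    finally show "bprod A ^ n * (bgen j ^ m * x) \<in> M" .
  qed
  then show ?thesis by blast
qed

section \<open>The Cech differential and its contracting homotopy\<close>

definition idx :: "int \<Rightarrow> nat set set" where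
  "idx i = {A. A \<subseteq> {..<4} \<and> int (card A) = i}"

lemma idx_finite: "A \<in> idx i \<Longrightarrow> finite A"
  by (auto simp: idx_def dest: finite_subset)

lemma idx_remove: "A \<in> idx (i + 1) \<Longrightarrow> j \<in> A \<Longrightarrow> A - {j} \<in> idx i"
  using idx_finite[of A "i + 1"] card_Suc_Diff1[of A j] by (auto simp: idx_def)

lemma idx_insert: "A \<in> idx i \<Longrightarrow> j \<notin> A \<Longrightarrow> j < 4 \<Longrightarrow> insert j A \<in> idx (i + 1)"
  using idx_finite[of A i] by (auto simp: idx_def)

text \<open>As restriction maps are inclusions, only the signs of the Cech differential are
  left.\<close>

definition cd :: "(nat set \<Rightarrow> 'a::comm_ring_1 laurent) \<Rightarrow> nat set \<Rightarrow> 'a laurent" where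
  "cd x A = (\<Sum>j\<in>A. (-1) ^ card {l\<in>A. l < j} * x (A - {j}))"

text \<open>The cone construction with vertex \<open>e\<close>. It takes no account of denominators:
  whether its values lie in the localization at \<open>A\<close>, rather than at
  \<open>insert e A\<close>, has to be checked at each use.\<close>

definition ch :: "nat \<Rightarrow> (nat set \<Rightarrow> 'a::comm_ring_1 laurent) \<Rightarrow> nat set \<Rightarrow> 'a laurent" where
  "ch e x A = (if e \<in> A then 0 else (-1) ^ card {l\<in>insert e A. l < e} * x (insert e A))"

lemma sgn_cancel: "(-1) ^ n * ((-1) ^ n * y) = (y :: 'a::comm_ring_1)"
  by (metis mult.assoc mult.left_neutral left_minus_one_mult_self)

text \<open>A full simplex contracts to its vertex \<open>e\<close>. If \<open>e\<close> lies in
  \<open>A\<close>, only the face opposite to \<open>e\<close> contributes; otherwise all terms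
  cancel in pairs except the one that removes \<open>e\<close> again.\<close>

lemma homotopy:
  assumes "finite A"
  shows "cd (ch e x) A + ch e (cd x) A = (x A :: 'a::comm_ring_1 laurent)"
proof (cases "e \<in> A")
  case True
  have "cd (ch e x) A = (\<Sum>j\<in>A. if j = e then x A else 0)"
    unfolding cd_def
  proof (rule sum.cong)
    fix j assume j: "j \<in> A"
    show "(-1) ^ card {l\<in>A. l < j} * ch e x (A - {j}) = (if j = e then x A else 0)"
      using True by (auto simp: ch_def insert_absorb sgn_cancel)
  qed simp
  then show ?thesis using True assms by (simp add: ch_def)
next
  case False
  let ?B = "insert e A"
  \<comment> \<open>Passing between the two orders of removing \<open>j\<close> and inserting
    \<open>e\<close> changes exactly one of the two counts by one, depending on which of
    \<open>j\<close> and \<open>e\<close> is smaller. Hence the sign.\<close>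
  have sg: "(-1) ^ card {l\<in>A. l < j} * ((-1) ^ card {l\<in>insert e (A - {j}). l < e} * y)
      = - ((-1) ^ card {l\<in>?B. l < e} * ((-1) ^ card {l\<in>?B. l < j} * (y :: 'a laurent)))"
    if j: "j \<in> A" for j y
  proof (cases "j < e")
    case True
    have "{l\<in>?B. l < e} = insert j {l\<in>insert e (A - {j}). l < e}" using True j by auto
    then have "card {l\<in>?B. l < e} = Suc (card {l\<in>insert e (A - {j}). l < e})"
      using assms by auto
    moreover have "{l\<in>?B. l < j} = {l\<in>A. l < j}" using True by auto
    ultimately show ?thesis by (simp add: mult_ac)
  next
    case F: False
    then have "e < j" using j False by (metis linorder_neqE_nat)
    then have "{l\<in>?B. l < j} = insert e {l\<in>A. l < j}" by auto
    then have "card {l\<in>?B. l < j} = Suc (card {l\<in>A. l < j})" using assms False by auto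
    moreover have "{l\<in>?B. l < e} = {l\<in>insert e (A - {j}). l < e}" using F by auto
    ultimately show ?thesis by (simp add: mult_ac)
  qed
  have "cd (ch e x) A = (\<Sum>j\<in>A. - ((-1) ^ card {l\<in>?B. l < e} * ((-1) ^ card {l\<in>?B. l < j} * x (?B - {j}))))"
    unfolding cd_def
  proof (rule sum.cong)
    fix j assume j: "j \<in> A"
    then have "insert e (A - {j}) = ?B - {j}" using False by auto
    then show "(-1) ^ card {l\<in>A. l < j} * ch e x (A - {j}) =
        - ((-1) ^ card {l\<in>?B. l < e} * ((-1) ^ card {l\<in>?B. l < j} * x (?B - {j})))"
      using sg[OF j] False j by (simp add: ch_def)
  qed simp
  moreover have "ch e (cd x) A = (-1) ^ card {l\<in>?B. l < e} *
      ((-1) ^ card {l\<in>?B. l < e} * x (?B - {e}) + (\<Sum>j\<in>A. (-1) ^ card {l\<in>?B. l < j} * x (?B - {j})))"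
    using False assms by (simp add: ch_def cd_def)
  moreover have "?B - {e} = A" using False by auto
  ultimately show ?thesis
    by (simp only: distrib_left sgn_cancel sum_distrib_left sum_negf) simp
qed

lemma cd_cong: "(\<And>j. j \<in> A \<Longrightarrow> x (A - {j}) = y (A - {j})) \<Longrightarrow> cd x A = cd y A"
  by (auto simp: cd_def intro!: sum.cong)

lemma cd_add: "cd (\<lambda>A. x A + y A) A = cd x A + cd y A"
  by (simp add: cd_def distrib_left sum.distrib)

lemma cd_diff: "cd (\<lambda>A. x A - y A) A = cd x A - cd y A"
  by (simp add: cd_def right_diff_distrib sum_subtractf)

lemma cd_mult: "cd (\<lambda>A. s * x A) A = s * cd x A"
  by (simp add: cd_def sum_distrib_left mult_ac)

lemma cd_zero [simp]: "cd (\<lambda>A. 0) A = 0"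
  by (simp add: cd_def)

lemma cd_pr: "cd (\<lambda>A. pr \<nu> (x A)) A = pr \<nu> (cd x A)"
  by (simp add: cd_def pr_def restr_sum pr_sgn[unfolded pr_def])

text \<open>Two uses of the homotopy formula turn \<open>cd (cd x) A\<close> into the same
  expression for \<open>ch e x\<close> on \<open>A - {e}\<close>, so an induction on the size of
  \<open>A\<close> replaces the usual rearrangement of a double sum.\<close>

lemma cd_cd: "finite A \<Longrightarrow> cd (cd x) A = 0"
proof (induction "card A" arbitrary: A x)
  case 0
  then show ?case by (simp add: cd_def)
next
  case (Suc n)
  then obtain e where e: "e \<in> A" by (metis card_eq_0_iff ex_in_conv nat.distinct(1))
  let ?A = "A - {e}"
  have fin: "finite ?A" and ins: "insert e ?A = A" using Suc e by auto
  have c: "n = card ?A" using Suc e by simp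
  define s :: "'a laurent" where "s = (-1) ^ card {l\<in>A. l < e}"
  have "ch e (cd (cd x)) ?A = cd x ?A - cd (ch e (cd x)) ?A"
    using homotopy[OF fin, of e "cd x"] by (simp add: algebra_simps)
  also have "cd (ch e (cd x)) ?A = cd (\<lambda>B. x B - cd (ch e x) B) ?A"
  proof (rule cd_cong)
    fix j assume "j \<in> ?A"
    show "ch e (cd x) (?A - {j}) = x (?A - {j}) - cd (ch e x) (?A - {j})"
      using homotopy[of "?A - {j}" e x] fin by (simp add: algebra_simps)
  qed
  also have "\<dots> = cd x ?A - cd (cd (ch e x)) ?A" by (rule cd_diff)
  finally have "ch e (cd (cd x)) ?A = 0" using Suc(1)[OF c fin, of "ch e x"] by simp
  then have "s * cd (cd x) A = 0" unfolding ch_def s_def ins by simp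
  then show ?case using sgn_cancel[of "card {l\<in>A. l < e}" "cd (cd x) A"] by (simp add: s_def)
qed

text \<open>The cohomology in degree \<^term>\<open>i\<close> and bidegree \<^term>\<open>\<nu>\<close> of the Cech complex of \<open>M / N\<close> is zero. Cochains are
  represented by Laurent polynomials, so that no localization has to be constructed.\<close>

definition cvanish :: "'a::comm_ring_1 laurent set \<Rightarrow> 'a laurent set \<Rightarrow> int \<times> int \<Rightarrow> int \<Rightarrow> bool" where
  "cvanish M N \<nu> i \<longleftrightarrow> (\<forall>c. (\<forall>A\<in>idx i. c A \<in> loc M A \<inter> piece \<nu>) \<longrightarrow> (\<forall>A\<in>idx (i + 1). cd c A \<in> loc N A) \<longrightarrow>
     (\<exists>b. (\<forall>A\<in>idx (i - 1). b A \<in> loc M A \<inter> piece \<nu>) \<and> (\<forall>A\<in>idx i. c A - cd b A \<in> loc N A)))"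

lemma cd_loc:
  assumes "submod M" "\<forall>A\<in>idx i. x A \<in> loc M A" "A \<in> idx (i + 1)"
  shows "cd x A \<in> loc M A"
  unfolding cd_def
proof (intro loc_sum[OF assms(1)] loc_sgn[OF assms(1)])
  fix j assume j: "j \<in> A"
  show "x (A - {j}) \<in> loc M A"
    using loc_subset[OF assms(1) idx_finite[OF assms(3)], of "A - {j}"] assms(2) idx_remove[OF assms(3) j]
    by auto
qed

lemma cd_piece: "\<forall>A\<in>idx i. x A \<in> piece \<nu> \<Longrightarrow> A \<in> idx (i + 1) \<Longrightarrow> cd x A \<in> piece \<nu>"
  unfolding cd_def by (intro piece_sum piece_sgn_mult) (auto dest: idx_remove)

section \<open>Signs of exponents in the localizations of the polynomial ring\<close>

definition gexp :: "nat \<Rightarrow> svar \<Rightarrow>\<^sub>0 int" where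
  "gexp j = single (if j < 2 then S0 else S1) 1 + single (if even j then T0 else T1) 1"

text \<open>The variables that become invertible over \<open>A\<close>.\<close>

definition gsupp :: "nat set \<Rightarrow> svar set" where
  "gsupp A = (\<Union>j\<in>A. {if j < 2 then S0 else S1, if even j then T0 else T1})"

lemma bgen_single: "bgen j = single (gexp j) 1"
  by (simp add: bgen_def lvar_def mult_single gexp_def)

lemma single_prod: "(\<Prod>j\<in>A. single (g j) (1::'a::comm_ring_1)) = single (\<Sum>j\<in>A. g j) 1"
  by (induction A rule: infinite_finite_induct) (auto simp: mult_single single_one)

lemma bprod_power_single:
  "bprod A ^ n = single (\<Sum>i<n. \<Sum>j\<in>A. gexp j) (1::'a::comm_ring_1)"
proof -
  have "bprod A ^ n = (\<Prod>i<n. bprod A)" by simp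
  also have "\<dots> = (\<Prod>i<n. single (\<Sum>j\<in>A. gexp j) 1)"
    by (simp add: bprod_def bgen_single single_prod)
  also have "\<dots> = single (\<Sum>i<n. \<Sum>j\<in>A. gexp j) 1" by (simp only: single_prod)
  finally show ?thesis .
qed

lemma lookup_gexp: "0 \<le> lk (gexp j) v" "lk (gexp j) v = 0 \<longleftrightarrow> v \<notin> gsupp {j}"
  by (auto simp: gexp_def gsupp_def lookup_add lookup_single "when_def")

lemma lookup_sum_gexp:
  assumes "finite A"
  shows "v \<in> gsupp A \<Longrightarrow> 1 \<le> lk (\<Sum>j\<in>A. gexp j) v" "v \<notin> gsupp A \<Longrightarrow> lk (\<Sum>j\<in>A. gexp j) v = 0"
proof -
  assume "v \<in> gsupp A"
  then obtain j where j: "j \<in> A" "v \<in> gsupp {j}" by (auto simp: gsupp_def)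
  have "lk (gexp j) v \<noteq> 0" "0 \<le> lk (gexp j) v" using j lookup_gexp by auto
  then have "1 \<le> lk (gexp j) v" by simp
  also have "\<dots> \<le> (\<Sum>j\<in>A. lk (gexp j) v)"
    using assms j by (intro member_le_sum) (auto simp: lookup_gexp)
  finally show "1 \<le> lk (\<Sum>j\<in>A. gexp j) v" by (simp add: lookup_sum)
next
  assume "v \<notin> gsupp A"
  then show "lk (\<Sum>j\<in>A. gexp j) v = 0"
    by (auto simp: lookup_sum lookup_gexp gsupp_def intro!: sum.neutral)
qed

lemma keys_single_mult:
  "keys (single k 1 * x) = (+) k ` keys (x :: 'a::comm_ring_1 laurent)"
proof -
  have "l \<in> keys (single k 1 * x) \<longleftrightarrow> l - k \<in> keys x" for l
    by (simp add: in_keys_iff lookup_single_mult)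
  moreover have "l \<in> (+) k ` K \<longleftrightarrow> l - k \<in> K" for l K
    by (auto intro!: image_eqI[of _ _ "l - k"])
  ultimately show ?thesis by blast
qed

text \<open>Powers of \<open>bprod A\<close> raise the exponents of the variables in
  \<open>gsupp A\<close> without bound and leave all other exponents alone.\<close>

lemma loc_polys_iff:
  assumes "finite A"
  shows "x \<in> loc polys A \<longleftrightarrow> (\<forall>k\<in>keys (x :: 'a::comm_ring_1 laurent). \<forall>v. lk k v < 0 \<longrightarrow> v \<in> gsupp A)"
proof -
  define g where "g = (\<Sum>j\<in>A. gexp j)"
  have pw: "bprod A ^ n * x \<in> polys \<longleftrightarrow> (\<forall>k\<in>keys x. \<forall>v. 0 \<le> int n * lk g v + lk k v)" for n
    by (simp add: bprod_power_single g_def[symmetric] polys_def keys_single_mult lookup_add lookup_sum)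
  note g = lookup_sum_gexp[OF assms, folded g_def]
  show ?thesis
  proof
    assume "x \<in> loc polys A"
    then obtain n where n: "bprod A ^ n * x \<in> polys" by (auto simp: loc_def)
    show "\<forall>k\<in>keys x. \<forall>v. lk k v < 0 \<longrightarrow> v \<in> gsupp A"
    proof (intro ballI allI impI)
      fix k v assume "k \<in> keys x" "lk k v < 0"
      then show "v \<in> gsupp A" using n[unfolded pw] g(2)[of v] by (metis add_0 mult_zero_right not_le)
    qed
  next
    assume *: "\<forall>k\<in>keys x. \<forall>v. lk k v < 0 \<longrightarrow> v \<in> gsupp A"
    \<comment> \<open>The sum of all negative parts of exponents, which bounds each of them.\<close>
    define n where "n = (\<Sum>k\<in>keys x. \<Sum>v\<in>UNIV. nat (- lk k v))"
    have "0 \<le> int n * lk g v + lk k v" if k: "k \<in> keys x" for k v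
    proof (cases "lk k v < 0")
      case True
      have "nat (- lk k v) \<le> (\<Sum>v\<in>UNIV. nat (- lk k v))"
        by (rule member_le_sum) auto
      also have "\<dots> \<le> n" unfolding n_def using k by (intro member_le_sum) auto
      finally have "- lk k v \<le> int n" by simp
      moreover have "1 \<le> lk g v" using * k True g(1) by blast
      ultimately show ?thesis using mult_left_mono[of 1 "lk g v" "int n"] by simp
    next
      case False
      have "0 \<le> lk g v" using g[of v] by (cases "v \<in> gsupp A") auto
      then show ?thesis using False by simp
    qed
    then show "x \<in> loc polys A" by (intro locI[of _ n]) (simp add: pw)
  qed
qed

section \<open>Vanishing for the polynomial ring\<close>

lemma bgen_nz: "bgen j \<noteq> (0 :: 'a::field laurent)"
  by (simp add: bgen_single) (metis lookup_single_eq lookup_zero one_neq_zero)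

lemma bprod_nz: "bprod A \<noteq> (0 :: 'a::field laurent)"
  unfolding bprod_def by (cases "finite A") (auto simp: bgen_nz)

lemma loc_zero: "x \<in> loc {0} A \<longleftrightarrow> x = (0 :: 'a::field laurent)"
  using bprod_nz[of A] by (auto simp: loc_def)

lemma cd_restr: "cd (\<lambda>A. restr P (x A)) A = restr P (cd x A :: 'a::field laurent)"
  by (simp add: cd_def restr_sum restr_sgn)

text \<open>The index of a generator whose two variables have nonnegative exponents in
  \<open>k\<close>. It exists when both coordinates of the bidegree are at least -1, since two
  integers with sum at least -1 are not both negative.\<close>

definition far :: "(svar \<Rightarrow>\<^sub>0 int) \<Rightarrow> nat" where
  "far k = (if lk k S0 < 0 then 2 else 0) + (if lk k T0 < 0 then 1 else 0)"

lemma far_less: "far k < 4"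
  by (simp add: far_def)

lemma far_nonneg:
  assumes "deg k = (n1, n2)" "-1 \<le> n1" "-1 \<le> n2" "v \<in> gsupp {far k}"
  shows "0 \<le> lk k v"
  using assms by (auto simp: far_def gsupp_def deg_def split: if_splits)

text \<open>A cocycle splits according to the value of \<open>far\<close>. The parts are cocycles
  because \<open>cd\<close> acts exponent by exponent, and on each part the homotopy with vertex
  \<open>far\<close> respects the localizations.\<close>

lemma cvanish_polys:
  assumes "-1 \<le> n1" "-1 \<le> n2"
  shows "cvanish (polys :: 'a::field laurent set) {0} (n1, n2) i"
  unfolding cvanish_def
proof (intro allI impI)
  let ?S = "polys :: 'a laurent set" and ?\<nu> = "(n1, n2)"
  fix c :: "nat set \<Rightarrow> 'a laurent"
  assume c: "\<forall>A\<in>idx i. c A \<in> loc ?S A \<inter> piece ?\<nu>" and dc: "\<forall>A\<in>idx (i + 1). cd c A \<in> loc {0} A"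
  define q where "q e A = restr (\<lambda>k. far k = e) (c A)" for e A
  have csum: "c A = (\<Sum>e<4. q e A)" for A
  proof (rule poly_mapping_eqI)
    fix k
    have "(\<Sum>e<4. lk (q e A) k) = (\<Sum>e<4. if e = far k then lk (c A) k else 0)"
      by (rule sum.cong) (auto simp: q_def lookup_restr)
    also have "\<dots> = lk (c A) k" using far_less[of k] by simp
    finally show "lk (c A) k = lk (\<Sum>e<4. q e A) k" by (simp add: lookup_sum)
  qed
  define b where "b A = (\<Sum>e<4. ch e (q e) A)" for A
  have "b A \<in> loc ?S A \<inter> piece ?\<nu>" if A: "A \<in> idx (i - 1)" for A
  proof -
    have "ch e (q e) A \<in> loc ?S A \<inter> piece ?\<nu>" if e: "e < 4" for e
    proof (cases "e \<in> A")
      case False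
      then have A': "insert e A \<in> idx i" using idx_insert[OF A False e] by simp
      have cA: "c (insert e A) \<in> loc ?S (insert e A)" "c (insert e A) \<in> piece ?\<nu>" using c A' by auto
      have "q e (insert e A) \<in> loc ?S A"
        unfolding loc_polys_iff[OF idx_finite[OF A]]
      proof (intro ballI allI impI)
        fix k v assume k: "k \<in> keys (q e (insert e A))" and v: "lk k v < 0"
        then have k': "k \<in> keys (c (insert e A))" "far k = e" by (auto simp: q_def keys_restr)
        then have "v \<in> gsupp (insert e A)"
          using cA(1) v unfolding loc_polys_iff[OF idx_finite[OF A']] by blast
        moreover have "v \<notin> gsupp {e}"
          using far_nonneg[of k n1 n2 v] assms cA(2) k' v by (auto simp: piece_def)
        ultimately show "v \<in> gsupp A" by (auto simp: gsupp_def)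
      qed
      moreover have "q e (insert e A) \<in> piece ?\<nu>" unfolding q_def by (rule piece_restr) (rule cA)
      ultimately show ?thesis using False
        by (auto simp: ch_def intro: loc_sgn piece_sgn_mult)
    qed (simp add: ch_def)
    then show ?thesis unfolding b_def by (auto intro!: loc_sum piece_sum)
  qed
  moreover have "c A - cd b A \<in> loc {0} A" if A: "A \<in> idx i" for A
  proof -
    have "ch e (cd (q e)) A = 0" if e: "e < 4" for e
    proof (cases "e \<in> A")
      case False
      have "cd (q e) (insert e A) = restr (\<lambda>k. far k = e) (cd c (insert e A))"
        unfolding q_def by (rule cd_restr)
      also have "cd c (insert e A) = 0" using dc idx_insert[OF A False e] loc_zero by blast
      finally show ?thesis by (simp add: ch_def)
    qed (simp add: ch_def)
    then have "cd (ch e (q e)) A = q e A" if "e < 4" for e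
      using homotopy[OF idx_finite[OF A], of e "q e"] that by simp
    moreover have "cd b A = (\<Sum>e<4. cd (ch e (q e)) A)"
      unfolding b_def cd_def by (simp add: sum_distrib_left) (rule sum.swap)
    ultimately have "cd b A = c A" by (simp add: csum)
    then show ?thesis by simp
  qed
  ultimately show "\<exists>b. (\<forall>A\<in>idx (i - 1). b A \<in> loc ?S A \<inter> piece ?\<nu>) \<and> (\<forall>A\<in>idx i. c A - cd b A \<in> loc {0} A)"
    by blast
qed

lemma cd_3:
  fixes y :: "nat set \<Rightarrow> 'a::comm_ring_1 laurent"
  assumes "a < b" "b < (c::nat)"
  shows "cd y {a, b, c} = y {b, c} - y {a, c} + y {a, b}"
proof -
  have "{l \<in> {a, b, c}. l < a} = {}" "{l \<in> {a, b, c}. l < b} = {a}" "{l \<in> {a, b, c}. l < c} = {a, b}"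
    using assms by auto
  moreover have "{a, b, c} - {a} = {b, c}" "{a, b, c} - {b} = {a, c}" "{a, b, c} - {c} = {a, b}"
    using assms by auto
  moreover have "(\<Sum>j\<in>{a, b, c}. g j) = g a + g b + g c" for g :: "nat \<Rightarrow> 'a laurent"
    using assms by simp
  moreover have "card {a, b} = 2" using assms by simp
  ultimately show ?thesis unfolding cd_def by (simp only:) simp
qed

lemma cd_4:
  fixes y :: "nat set \<Rightarrow> 'a::comm_ring_1 laurent"
  shows "cd y {0, 1, 2, 3} = y {1, 2, 3} - y {0, 2, 3} + y {0, 1, 3} - y {0, 1, 2}"
proof -
  have "{l \<in> {0, 1, 2, 3}. l < (0::nat)} = {}" "{l \<in> {0, 1, 2, 3}. l < (1::nat)} = {0}"
    "{l \<in> {0, 1, 2, 3}. l < (2::nat)} = {0, 1}" "{l \<in> {0, 1, 2, 3}. l < (3::nat)} = {0, 1, 2}"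
    by auto
  moreover have "{0, 1, 2, 3} - {0} = {1, 2, 3::nat}" "{0, 1, 2, 3} - {1} = {0, 2, 3::nat}"
    "{0, 1, 2, 3} - {2} = {0, 1, 3::nat}" "{0, 1, 2, 3} - {3} = {0, 1, 2::nat}"
    by auto
  moreover have "(\<Sum>j\<in>{0, 1, 2, 3}. g j) = g 0 + g 1 + g 2 + g 3" for g :: "nat \<Rightarrow> 'a laurent"
    by simp
  moreover have "card {0::nat, 1} = 2" "card {0::nat, 1, 2} = 3" by auto
  ultimately show ?thesis unfolding cd_def by (simp only:) simp
qed

lemma lessThan_4: "{..<4} = {0, 1, 2, 3::nat}"
  by auto

lemma idx_3: "A \<in> idx 3 \<longleftrightarrow> A \<in> {{0, 1, 2}, {0, 1, 3}, {0, 2, 3}, {1, 2, 3}}"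
proof
  assume "A \<in> idx 3"
  then have sub: "A \<subseteq> {0, 1, 2, 3}" and card: "card A = 3" by (auto simp: idx_def lessThan_4)
  have "A = (if 0 \<in> A then {0} else {}) \<union> (if 1 \<in> A then {1} else {}) \<union>
      (if 2 \<in> A then {2} else {}) \<union> (if 3 \<in> A then {3} else {})" (is "_ = ?B")
    using sub by auto
  moreover have "card ?B = 3" using card calculation by simp
  then have "?B \<in> {{0, 1, 2}, {0, 1, 3}, {0, 2, 3}, {1, 2, 3}}"
    by (cases "0 \<in> A"; cases "1 \<in> A"; cases "2 \<in> A"; cases "3 \<in> A") (simp_all add: insert_commute)
  ultimately show "A \<in> {{0, 1, 2}, {0, 1, 3}, {0, 2, 3}, {1, 2, 3}}" by simp
qed (auto simp: idx_def)

lemma idx_2: "A \<in> idx 2 \<longleftrightarrow> A \<in> {{0, 1}, {0, 2}, {0, 3}, {1, 2}, {1, 3}, {2, 3}}"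
proof
  assume "A \<in> idx 2"
  then have sub: "A \<subseteq> {0, 1, 2, 3}" and card: "card A = 2" by (auto simp: idx_def lessThan_4)
  have "A = (if 0 \<in> A then {0} else {}) \<union> (if 1 \<in> A then {1} else {}) \<union>
      (if 2 \<in> A then {2} else {}) \<union> (if 3 \<in> A then {3} else {})" (is "_ = ?B")
    using sub by auto
  moreover have "card ?B = 2" using card calculation by simp
  then have "?B \<in> {{0, 1}, {0, 2}, {0, 3}, {1, 2}, {1, 3}, {2, 3}}"
    by (cases "0 \<in> A"; cases "1 \<in> A"; cases "2 \<in> A"; cases "3 \<in> A") (simp_all add: insert_commute)
  ultimately show "A \<in> {{0, 1}, {0, 2}, {0, 3}, {1, 2}, {1, 3}, {2, 3}}" by simp
qed (auto simp: idx_def)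

lemma gsupp_pairs:
  "gsupp {0, 1} = - {S1}" "gsupp {2, 3} = - {S0}" "gsupp {0, 2} = - {T1}" "gsupp {1, 3} = - {T0}"
  "gsupp {0, 3} = UNIV" "gsupp {1, 2} = UNIV"
  using UNIV_svar by (auto simp: gsupp_def)

text \<open>The cocycle condition equates \<open>c {0, 2, 3} - c {0, 1, 3}\<close> with
  \<open>c {1, 2, 3} - c {0, 1, 2}\<close>; call this \<open>z\<close>. The pairs
  \<open>{0, 3}\<close> and \<open>{1, 2}\<close> invert all variables and impose nothing. If the
  first coordinate is at least -1, each exponent has a nonnegative entry at \<open>S0\<close> or
  \<open>S1\<close>, so \<open>z\<close> splits into a part allowed on \<open>{0, 1}\<close> and one
  allowed on \<open>{2, 3}\<close>. The pairs \<open>{0, 2}\<close> and \<open>{1, 3}\<close> serve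
  in the same way for the second coordinate.\<close>

lemma cvanish_polys_3:
  assumes "-1 \<le> n1 \<or> -1 \<le> n2"
  shows "cvanish (polys :: 'a::field laurent set) {0} (n1, n2) 3"
  unfolding cvanish_def
proof (intro allI impI)
  let ?S = "polys :: 'a laurent set" and ?\<nu> = "(n1, n2)"
  fix c :: "nat set \<Rightarrow> 'a laurent"
  note One_nat_def [simp del]
  assume c: "\<forall>A\<in>idx 3. c A \<in> loc ?S A \<inter> piece ?\<nu>" and dc: "\<forall>A\<in>idx (3 + 1). cd c A \<in> loc {0} A"
  have "{0, 1, 2, 3} \<in> idx (3 + 1)" by (auto simp: idx_def)
  then have rel: "c {1, 2, 3} - c {0, 2, 3} + c {0, 1, 3} - c {0, 1, 2} = 0"
    using dc cd_4[of c] loc_zero by metis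
  define z where "z = c {0, 2, 3} - c {0, 1, 3}"
  have cp: "c A \<in> piece ?\<nu>" if "A \<in> idx 3" for A using c that by auto
  have z: "z \<in> piece ?\<nu>" unfolding z_def by (intro piece_diff cp) (auto simp: idx_3)
  show "\<exists>b. (\<forall>A\<in>idx (3 - 1). b A \<in> loc ?S A \<inter> piece ?\<nu>) \<and> (\<forall>A\<in>idx 3. c A - cd b A \<in> loc {0} A)"
  proof (cases "-1 \<le> n1")
    case True
    define z0 where "z0 = restr (\<lambda>k. 0 \<le> lk k S1) z"
    have z0: "z0 \<in> piece ?\<nu>" unfolding z0_def by (rule piece_restr) (rule z)
    have l01: "- z0 \<in> loc ?S {0, 1}"
      by (auto simp: loc_polys_iff gsupp_pairs z0_def keys_restr)
    have zz: "z - z0 = restr (\<lambda>k. \<not> 0 \<le> lk k S1) z"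
      by (rule poly_mapping_eqI) (auto simp: z0_def lookup_restr lookup_minus "when_def")
    have l23: "z - z0 \<in> loc ?S {2, 3}"
      using z True by (auto simp: loc_polys_iff gsupp_pairs zz keys_restr piece_def deg_def)
    \<comment> \<open>With value 0 on \<open>{0, 2}\<close> and \<open>{1, 3}\<close> the four
      equations \<open>cd b = c\<close> force \<open>b {2, 3} - b {0, 1} = z\<close>. The splitting
      of \<open>z\<close> solves this, and the values on \<open>{1, 2}\<close> and
      \<open>{0, 3}\<close> follow.\<close>
    define b where "b A = (if A = {0, 1} then - z0 else if A = {2, 3} then z - z0
      else if A = {1, 2} then c {0, 1, 2} + z0 else if A = {0, 3} then - z0 - c {0, 1, 3} else 0)" for A :: "nat set"
    have bv: "b {0, 1} = - z0" "b {2, 3} = z - z0" "b {1, 2} = c {0, 1, 2} + z0"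
      "b {0, 3} = - z0 - c {0, 1, 3}" "b {0, 2} = 0" "b {1, 3} = 0"
      by (auto simp: b_def doubleton_eq_iff)
    have e03: "- z0 - c {0, 1, 3} \<in> piece ?\<nu>"
      by (intro piece_diff piece_uminus z z0 cp) (simp add: idx_3)
    have "b A \<in> loc ?S A \<inter> piece ?\<nu>" if "A \<in> idx (3 - 1)" for A
    proof -
      have "A \<in> idx 2" using that by simp
      then show ?thesis unfolding idx_2 using l01 l23 z z0 e03 cp[of "{0,1,2}"] cp[of "{0,1,3}"]
        by (auto simp: bv idx_3 loc_polys_iff gsupp_pairs(5,6) intro: piece_uminus piece_diff piece_add)
    qed
    moreover have "c A - cd b A \<in> loc {0} A" if "A \<in> idx 3" for A
      using that rel unfolding idx_3 loc_zero
      by (auto simp: cd_3 bv z_def algebra_simps)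
    ultimately show ?thesis by blast
  next
    case False
    then have n2: "-1 \<le> n2" using assms by simp
    define z0 where "z0 = restr (\<lambda>k. 0 \<le> lk k T1) z"
    have z0: "z0 \<in> piece ?\<nu>" unfolding z0_def by (rule piece_restr) (rule z)
    have l02: "z0 \<in> loc ?S {0, 2}"
      by (auto simp: loc_polys_iff gsupp_pairs z0_def keys_restr)
    have zz: "z0 - z = - restr (\<lambda>k. \<not> 0 \<le> lk k T1) z"
      by (rule poly_mapping_eqI) (auto simp: z0_def lookup_restr lookup_minus "when_def")
    have l13: "z0 - z \<in> loc ?S {1, 3}"
      using z n2 by (auto simp: loc_polys_iff gsupp_pairs zz keys_restr piece_def deg_def)
    define b where "b A = (if A = {0, 2} then z0 else if A = {1, 3} then z0 - z
      else if A = {1, 2} then c {0, 1, 2} + z0 else if A = {0, 3} then z0 - z - c {0, 1, 3} else 0)" for A :: "nat set"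
    have bv: "b {0, 2} = z0" "b {1, 3} = z0 - z" "b {1, 2} = c {0, 1, 2} + z0"
      "b {0, 3} = z0 - z - c {0, 1, 3}" "b {0, 1} = 0" "b {2, 3} = 0"
      by (auto simp: b_def doubleton_eq_iff)
    have e03: "z0 - z - c {0, 1, 3} \<in> piece ?\<nu>"
      by (intro piece_diff piece_uminus z z0 cp) (simp add: idx_3)
    have "b A \<in> loc ?S A \<inter> piece ?\<nu>" if "A \<in> idx (3 - 1)" for A
    proof -
      have "A \<in> idx 2" using that by simp
      then show ?thesis unfolding idx_2 using l02 l13 z z0 e03 cp[of "{0,1,2}"] cp[of "{0,1,3}"]
        by (auto simp: bv idx_3 loc_polys_iff gsupp_pairs(5,6) intro: piece_uminus piece_diff piece_add)
    qed
    moreover have "c A - cd b A \<in> loc {0} A" if "A \<in> idx 3" for A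
      using that rel unfolding idx_3 loc_zero
      by (auto simp: cd_3 bv z_def algebra_simps)
    ultimately show ?thesis by blast
  qed
qed

section \<open>Quotients by two forms\<close>

lemma cvanishE:
  assumes "cvanish M N \<nu> i" "\<And>A. A \<in> idx i \<Longrightarrow> c A \<in> loc M A" "\<And>A. A \<in> idx i \<Longrightarrow> c A \<in> piece \<nu>"
    "\<And>A. A \<in> idx (i + 1) \<Longrightarrow> cd c A \<in> loc N A"
  obtains b where "\<And>A. A \<in> idx (i - 1) \<Longrightarrow> b A \<in> loc M A" "\<And>A. A \<in> idx (i - 1) \<Longrightarrow> b A \<in> piece \<nu>"
    "\<And>A. A \<in> idx i \<Longrightarrow> c A - cd b A \<in> loc N A"
proof -
  have "\<forall>A\<in>idx i. c A \<in> loc M A \<inter> piece \<nu>" "\<forall>A\<in>idx (i + 1). cd c A \<in> loc N A" using assms(2-4) by auto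
  then obtain b where "\<forall>A\<in>idx (i - 1). b A \<in> loc M A \<inter> piece \<nu>" "\<forall>A\<in>idx i. c A - cd b A \<in> loc N A"
    using assms(1) unfolding cvanish_def by blast
  then show thesis by (intro that[of b]) auto
qed

lemma cvanishI:
  assumes "\<And>c. (\<And>A. A \<in> idx i \<Longrightarrow> c A \<in> loc M A) \<Longrightarrow> (\<And>A. A \<in> idx i \<Longrightarrow> c A \<in> piece \<nu>) \<Longrightarrow>
    (\<And>A. A \<in> idx (i + 1) \<Longrightarrow> cd c A \<in> loc N A) \<Longrightarrow>
    \<exists>b. (\<forall>A\<in>idx (i - 1). b A \<in> loc M A \<and> b A \<in> piece \<nu>) \<and> (\<forall>A\<in>idx i. c A - cd b A \<in> loc N A)"
  shows "cvanish M N \<nu> i"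
  unfolding cvanish_def
proof (intro allI impI)
  fix c assume c: "\<forall>A\<in>idx i. c A \<in> loc M A \<inter> piece \<nu>" "\<forall>A\<in>idx (i + 1). cd c A \<in> loc N A"
  have "\<exists>b. (\<forall>A\<in>idx (i - 1). b A \<in> loc M A \<and> b A \<in> piece \<nu>) \<and> (\<forall>A\<in>idx i. c A - cd b A \<in> loc N A)"
    by (rule assms) (use c in auto)
  then show "\<exists>b. (\<forall>A\<in>idx (i - 1). b A \<in> loc M A \<inter> piece \<nu>) \<and> (\<forall>A\<in>idx i. c A - cd b A \<in> loc N A)"
    by auto
qed

lemma cd_loc':
  "submod M \<Longrightarrow> (\<And>A. A \<in> idx (i - 1) \<Longrightarrow> x A \<in> loc M A) \<Longrightarrow> A \<in> idx i \<Longrightarrow> cd x A \<in> loc M A"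
  using cd_loc[of M "i - 1" x A] by auto

lemma cd_piece':
  "(\<And>A. A \<in> idx (i - 1) \<Longrightarrow> x A \<in> piece \<nu>) \<Longrightarrow> A \<in> idx i \<Longrightarrow> cd x A \<in> piece \<nu>"
  using cd_piece[of "i - 1" x \<nu> A] by auto

section \<open>Regular pairs, colon ideals and their localizations\<close>

lemma unit_cancel: "b * u = 1 \<Longrightarrow> u * (b * x) = (x :: 'a::comm_ring_1)"
  by (metis mult.assoc mult.commute mult_1_left)

lemma bprod_inverse:
  assumes "finite A"
  obtains u :: "'a::comm_ring_1 laurent" where "u \<in> loc polys A" "bprod A ^ n * u = 1"
proof -
  define k where "k = (\<Sum>i<n. \<Sum>j\<in>A. gexp j)"
  have "bprod A ^ n * single (- k) (1::'a) = 1"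
    by (simp add: bprod_power_single k_def mult_single)
  moreover from this have "single (- k) (1::'a) \<in> loc polys A" by (intro locI[of _ n]) simp
  ultimately show ?thesis using that by blast
qed

lemma bgen_inverse:
  assumes "finite A" "j \<in> A"
  obtains u :: "'a::comm_ring_1 laurent" where "u \<in> loc polys A" "bgen j * u = 1"
proof -
  obtain u :: "'a laurent" where u: "u \<in> loc polys {j}" "bprod {j} ^ 1 * u = 1" using bprod_inverse[of "{j}" 1] by auto
  then show ?thesis using that[of u] loc_subset[OF submod_polys assms(1), of "{j}" u] assms
    by (auto simp: bprod_def)
qed

text \<open>A regular sequence of length two, except that the ideal is allowed to be the unit ideal.
  A pair with no common zero is thus covered as well.\<close>

definition regular_pair :: "'a::comm_ring_1 laurent \<Rightarrow> 'a laurent \<Rightarrow> bool" where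
  "regular_pair g1 g2 \<longleftrightarrow> g1 \<noteq> 0 \<and> (\<forall>a\<in>polys. \<forall>b\<in>polys. g1 * a = g2 * b \<longrightarrow> (\<exists>z\<in>polys. b = g1 * z))"

definition ideal2 :: "'a::comm_ring_1 laurent \<Rightarrow> 'a laurent \<Rightarrow> 'a laurent set" where
  "ideal2 g1 g2 = {g1 * x + g2 * y | x y. x \<in> polys \<and> y \<in> polys}"

definition colon :: "'a::comm_ring_1 laurent set \<Rightarrow> 'a laurent \<Rightarrow> 'a laurent set" where
  "colon M g = {q\<in>polys. g * q \<in> M}"

definition adjoin :: "'a::comm_ring_1 laurent set \<Rightarrow> 'a laurent \<Rightarrow> 'a laurent set" where
  "adjoin M g = {p + g * z | p z. p \<in> M \<and> z \<in> polys}"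

lemma submod_ideal2: "g1 \<in> polys \<Longrightarrow> g2 \<in> polys \<Longrightarrow> submod (ideal2 g1 g2)"
  unfolding submod_def
proof (intro conjI ballI)
  assume g: "g1 \<in> polys" "g2 \<in> polys"
  show "ideal2 g1 g2 \<subseteq> polys" using g by (auto simp: ideal2_def intro: polys_add polys_mult)
  show "0 \<in> ideal2 g1 g2" unfolding ideal2_def by (force intro: exI[of _ 0])
  show "x + y \<in> ideal2 g1 g2" if xy: "x \<in> ideal2 g1 g2" "y \<in> ideal2 g1 g2" for x y
  proof -
    obtain a b a' b' where "x = g1 * a + g2 * b" "y = g1 * a' + g2 * b'" and p: "a \<in> polys" "b \<in> polys" "a' \<in> polys" "b' \<in> polys"
      using xy by (auto simp: ideal2_def)
    then have "x + y = g1 * (a + a') + g2 * (b + b')" by (simp add: algebra_simps)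
    then show ?thesis using p polys_add unfolding ideal2_def by blast
  qed
  show "s * x \<in> ideal2 g1 g2" if sx: "s \<in> polys" "x \<in> ideal2 g1 g2" for s x
  proof -
    obtain a b where "x = g1 * a + g2 * b" and p: "a \<in> polys" "b \<in> polys"
      using sx by (auto simp: ideal2_def)
    then have "s * x = g1 * (s * a) + g2 * (s * b)" by (simp add: algebra_simps)
    then show ?thesis using p sx polys_mult unfolding ideal2_def by blast
  qed
qed

lemma ideal2_gens: "g1 \<in> ideal2 g1 g2" "g2 \<in> ideal2 g1 g2"
proof -
  have "g1 = g1 * 1 + g2 * 0" "g2 = g1 * 0 + g2 * 1" by auto
  then show "g1 \<in> ideal2 g1 g2" "g2 \<in> ideal2 g1 g2" using polys_0 polys_1 unfolding ideal2_def by blast+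
qed

lemma submod_colon: "submod M \<Longrightarrow> submod (colon M g)"
  unfolding submod_def[of "colon M g"]
  by (auto simp: colon_def distrib_left mult.left_commute[of g] intro: polys_add polys_mult dest: submodD)

lemma submod_adjoin:
  assumes "submod M" "g \<in> polys"
  shows "submod (adjoin M g)"
  unfolding submod_def
proof (intro conjI ballI)
  show "adjoin M g \<subseteq> polys" using assms by (auto simp: adjoin_def intro!: polys_add polys_mult dest: submodD)
  show "0 \<in> adjoin M g" using submodD(2)[OF assms(1)] by (force simp: adjoin_def intro!: exI[of _ 0])
  show "x + y \<in> adjoin M g" if xy: "x \<in> adjoin M g" "y \<in> adjoin M g" for x y
  proof -
    obtain a b a' b' where "x = a + g * b" "y = a' + g * b'" and p: "a \<in> M" "b \<in> polys" "a' \<in> M" "b' \<in> polys"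
      using xy by (auto simp: adjoin_def)
    then have "x + y = (a + a') + g * (b + b')" by (simp add: algebra_simps)
    then show ?thesis using p polys_add submodD(3)[OF assms(1)] unfolding adjoin_def by blast
  qed
  show "s * x \<in> adjoin M g" if sx: "s \<in> polys" "x \<in> adjoin M g" for s x
  proof -
    obtain a b where "x = a + g * b" and p: "a \<in> M" "b \<in> polys"
      using sx by (auto simp: adjoin_def)
    then have "s * x = (s * a) + g * (s * b)" by (simp add: algebra_simps)
    then show ?thesis using p sx polys_mult submodD(4)[OF assms(1)] unfolding adjoin_def by blast
  qed
qed

lemma pr_add: "pr \<nu> (x + y) = pr \<nu> x + pr \<nu> y"
  by (simp add: pr_def restr_add)

lemma pr_minus: "pr \<nu> (x - y) = pr \<nu> x - pr \<nu> (y :: 'a::ab_group_add laurent)"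
  by (simp add: pr_def restr_diff)

lemma pr_polys: "x \<in> polys \<Longrightarrow> pr \<nu> x \<in> polys"
  by (simp add: pr_def polys_restr)

lemma homog_ideal2: "g1 \<in> piece a \<Longrightarrow> g2 \<in> piece b \<Longrightarrow> homog (ideal2 g1 g2)"
  unfolding homog_def
proof (intro ballI allI)
  fix x \<nu> assume g: "g1 \<in> piece a" "g2 \<in> piece b" and "x \<in> ideal2 g1 g2"
  then obtain s t where st: "x = g1 * s + g2 * t" "s \<in> polys" "t \<in> polys" by (auto simp: ideal2_def)
  have "pr \<nu> x = g1 * pr (\<nu> - a) s + g2 * pr (\<nu> - b) t"
    by (simp add: st pr_add pr_mult[OF g(1)] pr_mult[OF g(2)])
  then show "pr \<nu> x \<in> ideal2 g1 g2" using st pr_polys unfolding ideal2_def by blast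
qed

lemma homog_colon: "g \<in> piece a \<Longrightarrow> homog M \<Longrightarrow> homog (colon M g)"
proof -
  assume g: "g \<in> piece a" and M: "homog M"
  have "g * pr \<nu> q \<in> M" if "g * q \<in> M" for q \<nu>
  proof -
    have "pr (\<nu> + a) (g * q) \<in> M" using M that unfolding homog_def by blast
    then show ?thesis by (simp add: pr_mult[OF g])
  qed
  then show "homog (colon M g)" using pr_polys unfolding homog_def colon_def by blast
qed

lemma homog_adjoin: "g \<in> piece a \<Longrightarrow> homog M \<Longrightarrow> homog (adjoin M g)"
  unfolding homog_def[of "adjoin M g"]
proof (intro ballI allI)
  fix x \<nu> assume g: "g \<in> piece a" "homog M" and "x \<in> adjoin M g"
  then obtain s t where st: "x = s + g * t" "s \<in> M" "t \<in> polys" by (auto simp: adjoin_def)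
  have "pr \<nu> x = pr \<nu> s + g * pr (\<nu> - a) t" by (simp add: st pr_add pr_mult[OF g(1)])
  moreover have "pr \<nu> s \<in> M" using g(2) st(2) unfolding homog_def by blast
  ultimately show "pr \<nu> x \<in> adjoin M g" using pr_polys[OF st(3)] unfolding adjoin_def by blast
qed

text \<open>Multiplying by the inverse of the denominator gives some coefficients; projecting the
  equation to bidegree \<open>\<nu>\<close> makes them homogeneous. One shift serves both since the
  two forms have the same bidegree.\<close>

lemma loc_ideal2E:
  assumes "finite A" "g1 \<in> piece a" "g2 \<in> piece a" "x \<in> loc (ideal2 g1 g2) A" "x \<in> piece \<nu>"
  obtains p q where "p \<in> loc polys A" "q \<in> loc polys A" "p \<in> piece (\<nu> - a)" "q \<in> piece (\<nu> - a)"
    "x = g1 * p + g2 * q"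
proof -
  obtain n where "bprod A ^ n * x \<in> ideal2 g1 g2" using assms(4) by (auto simp: loc_def)
  then obtain s t where st: "s \<in> polys" "t \<in> polys" "bprod A ^ n * x = g1 * s + g2 * t"
    by (auto simp: ideal2_def)
  obtain u :: "'a laurent" where u: "u \<in> loc polys A" "bprod A ^ n * u = 1" using bprod_inverse[OF assms(1)] by blast
  have "x = u * (bprod A ^ n * x)" using u(2) by (simp only: unit_cancel)
  also have "\<dots> = g1 * (s * u) + g2 * (t * u)" unfolding st(3) by (simp add: algebra_simps)
  finally have "pr \<nu> x = g1 * pr (\<nu> - a) (s * u) + g2 * pr (\<nu> - a) (t * u)"
    by (simp add: pr_add pr_mult[OF assms(2)] pr_mult[OF assms(3)])
  then have "x = g1 * pr (\<nu> - a) (s * u) + g2 * pr (\<nu> - a) (t * u)"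
    using assms(5) by (simp add: pr_piece)
  moreover have "pr (\<nu> - a) (s * u) \<in> loc polys A" "pr (\<nu> - a) (t * u) \<in> loc polys A"
    using st u assms(1) by (auto intro!: loc_pr loc_mult_polys)
  ultimately show ?thesis using that piece_pr by blast
qed

lemma loc_adjoinE:
  assumes "finite A" "g \<in> piece a" "homog M" "x \<in> loc (adjoin M g) A" "x \<in> piece \<nu>"
  obtains p z where "p \<in> loc M A" "z \<in> loc polys A" "z \<in> piece (\<nu> - a)" "x = p + g * z"
proof -
  obtain n where "bprod A ^ n * x \<in> adjoin M g" using assms(4) by (auto simp: loc_def)
  then obtain s t where st: "s \<in> M" "t \<in> polys" "bprod A ^ n * x = s + g * t"
    by (auto simp: adjoin_def)
  obtain u :: "'a laurent" where u: "u \<in> loc polys A" "bprod A ^ n * u = 1" using bprod_inverse[OF assms(1)] by blast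
  have "x = u * (bprod A ^ n * x)" using u(2) by (simp only: unit_cancel)
  also have "\<dots> = s * u + g * (t * u)" unfolding st(3) by (simp add: algebra_simps)
  finally have "pr \<nu> x = pr \<nu> (s * u) + g * pr (\<nu> - a) (t * u)"
    by (simp add: pr_add pr_mult[OF assms(2)])
  then have "x = pr \<nu> (s * u) + g * pr (\<nu> - a) (t * u)"
    using assms(5) by (simp add: pr_piece)
  moreover have "bprod A ^ n * (s * u) = s" using u(2) by (simp add: mult.left_commute)
  then have "s * u \<in> loc M A" using st(1) by (intro locI[of _ n]) simp
  then have "pr \<nu> (s * u) \<in> loc M A" using assms by (intro loc_pr)
  moreover have "pr (\<nu> - a) (t * u) \<in> loc polys A"
    using st u assms(1) by (auto intro!: loc_pr loc_mult_polys)
  ultimately show ?thesis using that piece_pr by blast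
qed

lemma loc_colon:
  assumes "submod M" "y \<in> loc polys A" "g * y \<in> loc M A"
  shows "y \<in> loc (colon M g) A"
proof -
  obtain n m where nm: "bprod A ^ n * y \<in> polys" "bprod A ^ m * (g * y) \<in> M"
    using assms by (auto simp: loc_def)
  have "bprod A ^ max n m * y \<in> polys" "bprod A ^ max n m * (g * y) \<in> M"
    using loc_up[OF submod_polys nm(1)] loc_up[OF assms(1) nm(2)] by auto
  then show ?thesis by (intro locI[of _ "max n m"]) (auto simp: colon_def mult.left_commute)
qed

lemma loc_colonD: "y \<in> loc (colon M g) A \<Longrightarrow> g * y \<in> loc M A"
  by (auto simp: loc_def colon_def mult.left_commute)

text \<open>Clear denominators, divide in the polynomial ring, and restore the denominator through
  its inverse in the localization.\<close>

lemma loc_regular: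
  fixes g1 :: "'a::field laurent"
  assumes reg: "regular_pair g1 g2" and "finite A" "p \<in> loc polys A" "q \<in> loc polys A" "g1 * p + g2 * q = 0"
  shows "\<exists>z\<in>loc polys A. q = g1 * z \<and> p = - (g2 * z)"
proof -
  obtain n m where "bprod A ^ n * p \<in> polys" "bprod A ^ m * q \<in> polys" using assms by (auto simp: loc_def)
  then have p: "bprod A ^ max n m * p \<in> polys" and q: "bprod A ^ max n m * q \<in> polys"
    using loc_up[OF submod_polys] by (meson max.cobounded1 max.cobounded2)+
  let ?u = "bprod A ^ max n m :: 'a laurent"
  have "g1 * (?u * p) = g2 * - (?u * q)"
  proof -
    have "g1 * (?u * p) + g2 * (?u * q) = ?u * (g1 * p + g2 * q)" by (simp add: algebra_simps)
    then show ?thesis using assms(5) by (simp add: add_eq_0_iff2)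
  qed
  then obtain z where z: "z \<in> polys" "- (?u * q) = g1 * z"
    using reg p polys_uminus[OF q] unfolding regular_pair_def by blast
  obtain v :: "'a laurent" where v: "v \<in> loc polys A" "?u * v = 1" using bprod_inverse[OF assms(2)] by blast
  define y where "y = - (z * v)"
  have "q = v * (?u * q)" using v(2) by (simp only: unit_cancel)
  also have "?u * q = - (g1 * z)" using z(2) by (metis minus_minus)
  finally have qy: "q = g1 * y" by (simp add: y_def mult_ac)
  have "g1 * (p + g2 * y) = 0" using assms(5) qy by (simp add: algebra_simps)
  then have "p = - (g2 * y)" using reg by (simp add: regular_pair_def add_eq_0_iff2)
  moreover have "y \<in> loc polys A" unfolding y_def
    by (intro loc_uminus loc_mult_polys submod_polys z v)
  ultimately show ?thesis using qy by blast
qed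

lemma piece_cancel:
  fixes g :: "'a::field laurent"
  assumes "g \<noteq> 0" "g \<in> piece a" "g * z \<in> piece b"
  shows "z \<in> piece (b - a)"
proof -
  have "g * pr (b - a) z = g * z" using pr_mult[OF assms(2), of b z] pr_piece[OF assms(3)] by metis
  then have "pr (b - a) z = z" using assms(1) by simp
  then show ?thesis by (metis piece_pr)
qed

text \<open>A chase through the resolution of S/(g1, g2) by S, two copies of S(-a) and S(-2a).
  Lifting a cocycle produces coefficients \<open>p\<close>, \<open>q\<close> one degree higher,
  whose differentials are a multiple \<open>z\<close> of the Koszul syzygy two degrees higher; the
  three vanishing hypotheses then correct \<open>z\<close>, the pair, and the cochain in
  turn.\<close>

lemma cvanish_koszul:
  fixes g1 :: "'a::field laurent"
  assumes g: "g1 \<in> polys" "g2 \<in> polys" "g1 \<in> piece a" "g2 \<in> piece a" and reg: "regular_pair g1 g2"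
    and v0: "cvanish (polys :: 'a laurent set) {0} \<nu> i"
    and v1: "cvanish (polys :: 'a laurent set) {0} (\<nu> - a) (i + 1)"
    and v2: "cvanish (polys :: 'a laurent set) {0} (\<nu> - a - a) (i + 2)"
  shows "cvanish polys (ideal2 g1 g2) \<nu> i"
proof (rule cvanishI)
  let ?S = "polys :: 'a laurent set" and ?P = "ideal2 g1 g2"
  have g1: "g1 \<noteq> 0" using reg by (simp add: regular_pair_def)
  have i2: "i + 1 + 1 = i + 2" "i + 2 + 1 = i + 3" "i + 1 - 1 = i" "i + 2 - 1 = i + 1" by auto
  fix c :: "nat set \<Rightarrow> 'a laurent"
  assume c: "\<And>A. A \<in> idx i \<Longrightarrow> c A \<in> loc ?S A" "\<And>A. A \<in> idx i \<Longrightarrow> c A \<in> piece \<nu>"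
    and dc: "\<And>A. A \<in> idx (i + 1) \<Longrightarrow> cd c A \<in> loc ?P A"
  have dcp: "cd c A \<in> piece \<nu>" if "A \<in> idx (i + 1)" for A using cd_piece[of i c \<nu> A] c that by auto
  have "\<forall>A\<in>idx (i + 1). \<exists>p q. p \<in> loc ?S A \<and> q \<in> loc ?S A \<and> p \<in> piece (\<nu> - a) \<and> q \<in> piece (\<nu> - a) \<and>
      cd c A = g1 * p + g2 * q"
    using loc_ideal2E[OF idx_finite g(3,4) dc dcp] by metis
  then obtain p q where pq: "\<And>A. A \<in> idx (i + 1) \<Longrightarrow> p A \<in> loc ?S A \<and> q A \<in> loc ?S A \<and>
      p A \<in> piece (\<nu> - a) \<and> q A \<in> piece (\<nu> - a) \<and> cd c A = g1 * p A + g2 * q A"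
    by metis
  have dpq: "cd p A \<in> loc ?S A" "cd q A \<in> loc ?S A" "cd q A \<in> piece (\<nu> - a)" if A: "A \<in> idx (i + 2)" for A
  proof -
    have A': "A \<in> idx (i + 1 + 1)" using A by (simp only: i2)
    show "cd p A \<in> loc ?S A" "cd q A \<in> loc ?S A" "cd q A \<in> piece (\<nu> - a)"
      using pq cd_loc[OF submod_polys _ A'] cd_piece[OF _ A'] by blast+
  qed
  have rel: "g1 * cd p A + g2 * cd q A = 0" if A: "A \<in> idx (i + 2)" for A
  proof -
    have "cd (cd c) A = cd (\<lambda>A. g1 * p A + g2 * q A) A"
      using A pq idx_remove[of A "i + 1"] by (intro cd_cong) (auto simp only: i2)
    then show ?thesis using cd_cd[OF idx_finite[OF A], of c] by (simp add: cd_add cd_mult)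
  qed
  have "\<forall>A\<in>idx (i + 2). \<exists>z\<in>loc ?S A. cd q A = g1 * z \<and> cd p A = - (g2 * z)"
    using loc_regular[OF reg idx_finite dpq(1,2) rel] by blast
  then obtain z where z: "\<And>A. A \<in> idx (i + 2) \<Longrightarrow> z A \<in> loc ?S A"
      "\<And>A. A \<in> idx (i + 2) \<Longrightarrow> cd q A = g1 * z A" "\<And>A. A \<in> idx (i + 2) \<Longrightarrow> cd p A = - (g2 * z A)"
    by metis
  have zp: "z A \<in> piece (\<nu> - a - a)" if A: "A \<in> idx (i + 2)" for A
    using piece_cancel[OF g1 g(3), of "z A" "\<nu> - a"] dpq(3)[OF A] z(2)[OF A] by simp
  have dz: "cd z A \<in> loc {0} A" if A: "A \<in> idx (i + 2 + 1)" for A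
  proof -
    have "cd (cd q) A = cd (\<lambda>A. g1 * z A) A"
      using A z idx_remove[of A "i + 2"] by (intro cd_cong) auto
    then show ?thesis using cd_cd[OF idx_finite[OF A], of q] g1 by (simp add: cd_mult loc_zero)
  qed
  obtain y where y: "\<And>A. A \<in> idx (i + 1) \<Longrightarrow> y A \<in> loc ?S A" "\<And>A. A \<in> idx (i + 1) \<Longrightarrow> y A \<in> piece (\<nu> - a - a)"
      "\<And>A. A \<in> idx (i + 2) \<Longrightarrow> z A - cd y A \<in> loc {0} A"
    using cvanishE[OF v2 z(1) zp dz] i2 by metis
  have gy: "g * y A \<in> piece (\<nu> - a)" if "g \<in> piece a" "A \<in> idx (i + 1)" for g A
    using piece_mult[OF that(1) y(2)[OF that(2)]] by simp
  have zy: "z A = cd y A" if "A \<in> idx (i + 2)" for A using y(3)[OF that] by (simp add: loc_zero)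
  \<comment> \<open>Adding \<open>y\<close> times the Koszul syzygy leaves
    \<open>g1 * p A + g2 * q A\<close> unchanged and turns both coefficients into cocycles.\<close>
  define q' where "q' A = q A - g1 * y A" for A
  define p' where "p' A = p A + g2 * y A" for A
  have q'1: "q' A \<in> loc ?S A" "q' A \<in> piece (\<nu> - a)" if "A \<in> idx (i + 1)" for A
    using that pq[OF that] y gy[OF g(3) that] g
    by (auto simp: q'_def intro!: loc_diff loc_mult_polys piece_diff)
  have p'1: "p' A \<in> loc ?S A" "p' A \<in> piece (\<nu> - a)" if "A \<in> idx (i + 1)" for A
    using that pq[OF that] y gy[OF g(4) that] g
    by (auto simp: p'_def intro!: loc_add loc_mult_polys piece_add)
  have q'2: "cd q' A \<in> loc {0} A" and p'2: "cd p' A \<in> loc {0} A" if "A \<in> idx (i + 1 + 1)" for A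
  proof -
    have A: "A \<in> idx (i + 2)" using that by (simp only: i2)
    show "cd q' A \<in> loc {0} A" using z(2)[OF A] zy[OF A]
      by (simp add: q'_def[abs_def] cd_diff cd_mult loc_zero)
    show "cd p' A \<in> loc {0} A" using z(3)[OF A] zy[OF A]
      by (simp add: p'_def[abs_def] cd_add cd_mult loc_zero)
  qed
  obtain s where s: "\<And>A. A \<in> idx i \<Longrightarrow> s A \<in> loc ?S A" "\<And>A. A \<in> idx i \<Longrightarrow> s A \<in> piece (\<nu> - a)"
      "\<And>A. A \<in> idx (i + 1) \<Longrightarrow> q' A - cd s A \<in> loc {0} A"
    using cvanishE[OF v1 q'1 q'2] i2 by metis
  obtain r where r: "\<And>A. A \<in> idx i \<Longrightarrow> r A \<in> loc ?S A" "\<And>A. A \<in> idx i \<Longrightarrow> r A \<in> piece (\<nu> - a)"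
      "\<And>A. A \<in> idx (i + 1) \<Longrightarrow> p' A - cd r A \<in> loc {0} A"
    using cvanishE[OF v1 p'1 p'2] i2 by metis
  \<comment> \<open>What is subtracted lies in the localized ideal, and the difference is a cocycle
    over S itself.\<close>
  define e where "e A = c A - (g1 * r A + g2 * s A)" for A
  have gs: "g * t \<in> piece \<nu>" if "g \<in> piece a" "t \<in> piece (\<nu> - a)" for g t :: "'a laurent"
    using piece_mult[OF that] by simp
  have "e A \<in> loc ?S A" "e A \<in> piece \<nu>" if "A \<in> idx i" for A
    using that c r s g gs by (auto simp: e_def intro!: loc_diff loc_add loc_mult_polys piece_diff piece_add)
  moreover have "cd e A \<in> loc {0} A" if A: "A \<in> idx (i + 1)" for A
  proof -
    have "cd r A = p' A" "cd s A = q' A" using r(3)[OF A] s(3)[OF A] by (simp_all add: loc_zero)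
    moreover have "cd e A = cd c A - (g1 * cd r A + g2 * cd s A)"
      by (simp add: e_def[abs_def] cd_diff cd_add cd_mult)
    moreover have "cd c A = g1 * p A + g2 * q A" using pq[OF A] by blast
    ultimately have "cd e A = g1 * p A + g2 * q A - (g1 * (p A + g2 * y A) + g2 * (q A - g1 * y A))"
      by (simp only: p'_def q'_def)
    then have "cd e A = 0" by (simp add: algebra_simps)
    then show ?thesis by (simp add: loc_zero)
  qed
  ultimately obtain b where b: "\<And>A. A \<in> idx (i - 1) \<Longrightarrow> b A \<in> loc ?S A" "\<And>A. A \<in> idx (i - 1) \<Longrightarrow> b A \<in> piece \<nu>"
      "\<And>A. A \<in> idx i \<Longrightarrow> e A - cd b A \<in> loc {0} A"
    using cvanishE[OF v0, of e] by metis
  have "c A - cd b A \<in> loc ?P A" if A: "A \<in> idx i" for A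
  proof -
    have "c A - cd b A = g1 * r A + g2 * s A" using b(3)[OF A] by (simp add: loc_zero e_def algebra_simps)
    moreover have "r A * g1 + s A * g2 \<in> loc ?P A"
      using submod_ideal2[OF g(1,2)] r(1)[OF A] s(1)[OF A]
      by (intro loc_add loc_mult[OF _ _ loc_super[OF _ ideal2_gens(1)]] loc_mult[OF _ _ loc_super[OF _ ideal2_gens(2)]])
    then have "g1 * r A + g2 * s A \<in> loc ?P A" by (simp add: mult.commute)
    ultimately show ?thesis by simp
  qed
  then show "\<exists>b. (\<forall>A\<in>idx (i - 1). b A \<in> loc ?S A \<and> b A \<in> piece \<nu>) \<and> (\<forall>A\<in>idx i. c A - cd b A \<in> loc ?P A)"
    using b by blast
qed

text \<open>The part of the long exact sequence of Q/P, M/P, M/Q in which the cohomology of M/Q sits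
  between that of M/P in degree \<open>i\<close> and that of Q/P in degree
  \<open>i + 1\<close>.\<close>

lemma cvanish_quotient:
  fixes M :: "'a::comm_ring_1 laurent set"
  assumes "submod P" "submod Q" "submod M" "P \<subseteq> Q" "Q \<subseteq> M" "cvanish M P \<nu> i" "cvanish Q P \<nu> (i + 1)"
  shows "cvanish M Q \<nu> i"
proof (rule cvanishI)
  fix c assume c: "\<And>A. A \<in> idx i \<Longrightarrow> c A \<in> loc M A" "\<And>A. A \<in> idx i \<Longrightarrow> c A \<in> piece \<nu>"
    and dc: "\<And>A. A \<in> idx (i + 1) \<Longrightarrow> cd c A \<in> loc Q A"
  have "cd c A \<in> piece \<nu>" if "A \<in> idx (i + 1)" for A using cd_piece[of i c \<nu> A] c that by auto
  moreover have "cd (cd c) A \<in> loc P A" if "A \<in> idx (i + 1 + 1)" for A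
    using cd_cd[OF idx_finite[OF that], of c] assms(1) by simp
  ultimately obtain e where "\<And>A. A \<in> idx (i + 1 - 1) \<Longrightarrow> e A \<in> loc Q A"
      "\<And>A. A \<in> idx (i + 1 - 1) \<Longrightarrow> e A \<in> piece \<nu>"
      "\<And>A. A \<in> idx (i + 1) \<Longrightarrow> cd c A - cd e A \<in> loc P A"
    using cvanishE[OF assms(7) dc] by blast
  then have e: "\<And>A. A \<in> idx i \<Longrightarrow> e A \<in> loc Q A" "\<And>A. A \<in> idx i \<Longrightarrow> e A \<in> piece \<nu>"
      "\<And>A. A \<in> idx (i + 1) \<Longrightarrow> cd c A - cd e A \<in> loc P A" by simp_all
  have "c A - e A \<in> loc M A" "c A - e A \<in> piece \<nu>" if "A \<in> idx i" for A
    using c(1,2)[OF that] e(1,2)[OF that] assms by (auto intro: loc_diff loc_mono[of Q M] piece_diff)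
  moreover have "cd (\<lambda>A. c A - e A) A \<in> loc P A" if "A \<in> idx (i + 1)" for A
    using e(3)[OF that] by (simp add: cd_diff)
  ultimately obtain b where b: "\<And>A. A \<in> idx (i - 1) \<Longrightarrow> b A \<in> loc M A" "\<And>A. A \<in> idx (i - 1) \<Longrightarrow> b A \<in> piece \<nu>"
      "\<And>A. A \<in> idx i \<Longrightarrow> c A - e A - cd b A \<in> loc P A"
    using cvanishE[OF assms(6), of "\<lambda>A. c A - e A"] by blast
  have "c A - cd b A \<in> loc Q A" if "A \<in> idx i" for A
    using loc_add[OF assms(2) loc_mono[OF assms(4) b(3)[OF that]] e(1)[OF that]] by simp
  then show "\<exists>b. (\<forall>A\<in>idx (i - 1). b A \<in> loc M A \<and> b A \<in> piece \<nu>) \<and> (\<forall>A\<in>idx i. c A - cd b A \<in> loc Q A)"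
    using b by blast
qed

section \<open>Torsion of cohomology classes, and finite support\<close>

lemma polys_of_nat [simp]: "(of_nat n :: 'a::comm_ring_1 laurent) \<in> polys"
  by (induction n) (auto intro: polys_add)

lemma submod_sum: "submod M \<Longrightarrow> (\<And>i. i \<in> I \<Longrightarrow> f i \<in> M) \<Longrightarrow> (\<Sum>i\<in>I. f i) \<in> M"
  by (induction I rule: infinite_finite_induct) (auto intro: submodD)

lemma radical_add:
  assumes "submod I" "x \<in> polys" "y \<in> polys" "x ^ m \<in> I" "y ^ n \<in> I"
  shows "(x + y) ^ (m + n) \<in> I"
proof -
  have "of_nat (m + n choose k) * x ^ k * y ^ (m + n - k) \<in> I" if "k \<le> m + n" for k
  proof (cases "m \<le> k")
    case True
    then have "x ^ k = x ^ (k - m) * x ^ m" by (simp add: power_add[symmetric])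
    then have "of_nat (m + n choose k) * x ^ k * y ^ (m + n - k) =
        (of_nat (m + n choose k) * x ^ (k - m) * y ^ (m + n - k)) * x ^ m" by (simp add: mult_ac)
    then show ?thesis using assms by (auto intro!: submodD(4) polys_mult polys_power)
  next
    case False
    then have "m + n - k = (m - k) + n" by simp
    then have "y ^ (m + n - k) = y ^ (m - k) * y ^ n" by (simp add: power_add)
    then have "of_nat (m + n choose k) * x ^ k * y ^ (m + n - k) =
        (of_nat (m + n choose k) * x ^ k * y ^ (m - k)) * y ^ n" by (simp add: mult_ac)
    then show ?thesis using assms by (auto intro!: submodD(4) polys_mult polys_power)
  qed
  then have "(\<Sum>k\<le>m + n. of_nat (m + n choose k) * x ^ k * y ^ (m + n - k)) \<in> I"
    by (intro submod_sum[OF assms(1)]) auto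
  then show ?thesis by (simp add: binomial_ring)
qed

lemma radical_sum:
  assumes "submod I" "finite K" "\<And>j. j \<in> K \<Longrightarrow> x j \<in> polys" "\<And>j. j \<in> K \<Longrightarrow> \<exists>n. x j ^ n \<in> I"
  shows "\<exists>n. (\<Sum>j\<in>K. x j) ^ n \<in> I"
  using assms(2-)
proof (induction K rule: finite_induct)
  case empty
  show ?case using submodD(2)[OF assms(1)] by (intro exI[of _ 1]) simp
next
  case (insert j K)
  obtain n where "x j ^ n \<in> I" using insert(5)[of j] by blast
  moreover obtain m where "(\<Sum>j\<in>K. x j) ^ m \<in> I" using insert(3-5) by blast
  ultimately have nm: "x j ^ n \<in> I" "(\<Sum>j\<in>K. x j) ^ m \<in> I" by auto
  have "(x j + (\<Sum>j\<in>K. x j)) ^ (n + m) \<in> I"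
    using insert(4) by (intro radical_add[OF assms(1) _ _ nm] polys_sum) auto
  then show ?case using insert(1,2) by auto
qed

text \<open>The classes of cohomology are torsion for each \<^term>\<open>bgen j\<close>, hence for \<^term>\<open>w\<close>, whereas \<^term>\<open>w\<close> is
  invertible modulo \<^term>\<open>P\<close> on every proper localization.\<close>

lemma cvanish_finite_support:
  fixes M :: "'a::comm_ring_1 laurent set"
  assumes M: "submod M" "homog M" and N: "submod N" "homog N" and P: "submod P" and sub: "P \<subseteq> N" "N \<subseteq> M"
    and wb: "w = (\<Sum>j<4. \<beta> j * bgen j)" "\<And>j. \<beta> j \<in> polys"
    and bw: "\<And>j. j < 4 \<Longrightarrow> \<exists>n. \<exists>\<alpha>\<in>polys. \<exists>\<pi>\<in>P. bgen j ^ n = w * \<alpha> + \<pi>"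
    and i: "2 \<le> i"
  shows "cvanish M N \<nu> i"
proof (rule cvanishI)
  have MS: "M \<subseteq> polys" using M(1) by (simp add: submod_def)
  have w: "w \<in> polys" unfolding wb by (auto intro!: polys_sum polys_mult wb)
  fix c assume c: "\<And>A. A \<in> idx i \<Longrightarrow> c A \<in> loc M A" "\<And>A. A \<in> idx i \<Longrightarrow> c A \<in> piece \<nu>"
    and dc: "\<And>A. A \<in> idx (i + 1) \<Longrightarrow> cd c A \<in> loc N A"
  \<comment> \<open>The annihilator of the class of \<open>c\<close>, where the bounding cochain may
    have any bidegree. Dropping the grading makes this an ideal; homogeneity is restored at the end
    by projection.\<close>
  define I where "I = {a\<in>polys. \<exists>b. (\<forall>A\<in>idx (i - 1). b A \<in> loc M A) \<and> (\<forall>A\<in>idx i. a * c A - cd b A \<in> loc N A)}"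
  have I: "submod I"
    unfolding submod_def
  proof (intro conjI ballI)
    show "0 \<in> I" using M(1) N(1) by (auto simp: I_def intro!: exI[of _ "\<lambda>_. 0"])
    fix x y assume "x \<in> I" "y \<in> I"
    then obtain b b' where x: "x \<in> polys" "\<forall>A\<in>idx (i - 1). b A \<in> loc M A" "\<forall>A\<in>idx i. x * c A - cd b A \<in> loc N A"
      and y: "y \<in> polys" "\<forall>A\<in>idx (i - 1). b' A \<in> loc M A" "\<forall>A\<in>idx i. y * c A - cd b' A \<in> loc N A"
      unfolding I_def by blast
    have "(x + y) * c A - cd (\<lambda>A. b A + b' A) A = (x * c A - cd b A) + (y * c A - cd b' A)" for A
      by (simp add: cd_add algebra_simps)
    then show "x + y \<in> I" unfolding I_def using x y M N
      by (auto intro!: exI[of _ "\<lambda>A. b A + b' A"] polys_add loc_add)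
  next
    fix s x :: "'a laurent" assume "x \<in> I" and s: "s \<in> polys"
    then obtain b where x: "x \<in> polys" "\<forall>A\<in>idx (i - 1). b A \<in> loc M A" "\<forall>A\<in>idx i. x * c A - cd b A \<in> loc N A"
      unfolding I_def by blast
    have "s * x * c A - cd (\<lambda>A. s * b A) A = s * (x * c A - cd b A)" for A
      by (simp add: cd_mult algebra_simps)
    then show "s * x \<in> I" unfolding I_def using x s M N
      by (auto intro!: exI[of _ "\<lambda>A. s * b A"] polys_mult loc_mult_polys)
  qed (auto simp: I_def)
  have fin: "finite (idx k)" for k by (rule finite_subset[of _ "Pow {..<4}"]) (auto simp: idx_def)
  have tors: "\<exists>n. bgen j ^ n \<in> I" if j: "j < 4" for j
  proof -
    have "\<exists>n. \<forall>m\<ge>n. bgen j ^ m * ch j x A \<in> loc K A"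
      if "submod K" "A \<in> idx k" "\<And>A. A \<in> idx (k + 1) \<Longrightarrow> x A \<in> loc K A" for K A k x
    proof (cases "j \<in> A")
      case False
      have "(-1) ^ card {l \<in> insert j A. l < j} * x (insert j A) \<in> loc K (insert j A)"
        using that idx_insert[OF that(2) False j] by (intro loc_sgn) auto
      from loc_insert_power[OF that(1) idx_finite[OF that(2)] this] show ?thesis
        using False by (simp add: ch_def)
    qed (use that in \<open>auto simp: ch_def\<close>)
    \<comment> \<open>There are finitely many index sets and each statement holds from some exponent
      on, so a single exponent serves them all.\<close>
    note ev = this[folded eventually_sequentially]
    have "eventually (\<lambda>m. \<forall>A\<in>idx (i - 1). bgen j ^ m * ch j c A \<in> loc M A) sequentially"
      using ev[OF M(1), of _ "i - 1" c] c fin by (intro eventually_ball_finite) auto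
    moreover have "eventually (\<lambda>m. \<forall>A\<in>idx i. bgen j ^ m * ch j (cd c) A \<in> loc N A) sequentially"
      using ev[OF N(1), of _ i "cd c"] dc fin by (intro eventually_ball_finite) auto
    ultimately have "eventually (\<lambda>m. (\<forall>A\<in>idx (i - 1). bgen j ^ m * ch j c A \<in> loc M A) \<and>
        (\<forall>A\<in>idx i. bgen j ^ m * ch j (cd c) A \<in> loc N A)) sequentially"
      by (rule eventually_conj)
    then obtain n where n: "\<forall>A\<in>idx (i - 1). bgen j ^ n * ch j c A \<in> loc M A"
        "\<forall>A\<in>idx i. bgen j ^ n * ch j (cd c) A \<in> loc N A"
      by (auto simp: eventually_sequentially)
    have "bgen j ^ n * c A - cd (\<lambda>A. bgen j ^ n * ch j c A) A = bgen j ^ n * ch j (cd c) A" if "A \<in> idx i" for A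
    proof -
      have "c A = cd (ch j c) A + ch j (cd c) A" using homotopy[OF idx_finite[OF that], of j c] by simp
      then have "bgen j ^ n * c A = bgen j ^ n * cd (ch j c) A + bgen j ^ n * ch j (cd c) A"
        by (metis distrib_left)
      then show ?thesis by (simp add: cd_mult)
    qed
    then have "bgen j ^ n \<in> I" unfolding I_def using n
      by (auto intro!: polys_power exI[of _ "\<lambda>A. bgen j ^ n * ch j c A"])
    then show ?thesis by blast
  qed
  have "\<exists>n. (\<Sum>j<4. \<beta> j * bgen j) ^ n \<in> I"
  proof (rule radical_sum[OF I])
    \<comment> \<open>Each summand of \<open>w\<close> is nilpotent modulo the annihilator, hence so
      is \<open>w\<close>.\<close>
    show "\<exists>n. (\<beta> j * bgen j) ^ n \<in> I" if "j \<in> {..<4}" for j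
      using tors[of j] that submodD(4)[OF I polys_power[OF wb(2)]] by (fastforce simp: power_mult_distrib)
  qed (auto intro: polys_mult wb)
  then obtain m where "w ^ m \<in> I" using wb by auto
  then obtain b where b: "\<forall>A\<in>idx (i - 1). b A \<in> loc M A" "\<forall>A\<in>idx i. w ^ m * c A - cd b A \<in> loc N A"
    unfolding I_def by blast
  have unit: "\<exists>\<alpha>\<in>loc polys A. \<exists>\<pi>\<in>loc P A. 1 = w ^ k * \<alpha> + \<pi>" if A: "A \<in> idx k'" "1 \<le> k'" for A k k'
  proof -
    have "A \<noteq> {}" using that by (auto simp: idx_def)
    moreover have "A \<subseteq> {..<4}" using A(1) by (auto simp: idx_def)
    ultimately obtain j where j: "j \<in> A" "j < 4" by fastforce
    note fA = idx_finite[OF A(1)]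
    obtain n \<alpha> \<pi> where *: "\<alpha> \<in> polys" "\<pi> \<in> P" "bgen j ^ n = w * \<alpha> + \<pi>" using bw[OF j(2)] by blast
    obtain u :: "'a laurent" where u: "u \<in> loc polys A" "bgen j * u = 1" using bgen_inverse[OF fA j(1)] by blast
    have un: "u ^ n \<in> loc polys A"
      by (induction n) (auto intro: loc_super loc_mult u)
    have "1 = bgen j ^ n * u ^ n" using u(2) by (metis power_mult_distrib power_one)
    then have one: "1 = w * (u ^ n * \<alpha>) + u ^ n * \<pi>" unfolding *(3) by (simp add: algebra_simps)
    have \<alpha>: "u ^ n * \<alpha> \<in> loc polys A" and \<pi>: "u ^ n * \<pi> \<in> loc P A"
      using loc_mult[OF submod_polys un loc_super[OF submod_polys *(1)]] loc_mult[OF P un loc_super[OF P *(2)]] by auto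
    then obtain x0 p0 where one: "1 = w * x0 + p0" and \<alpha>: "x0 \<in> loc polys A" and \<pi>: "p0 \<in> loc P A"
      using one by blast
    show ?thesis
    proof (induction k)
      case 0
      have "(1 :: 'a laurent) = w ^ 0 * 1 + 0" by simp
      then show ?case using loc_super[OF submod_polys polys_1] loc_0[OF P] by blast
    next
      case (Suc k)
      then obtain a p where ap: "a \<in> loc polys A" "p \<in> loc P A" "1 = w ^ k * a + p" by blast
      have "1 = (w * x0 + p0) * (w ^ k * a + p)"
        unfolding one[symmetric] ap(3)[symmetric] by simp
      also have "\<dots> = w ^ Suc k * (a * x0) + (w * x0 * p + (w ^ k * a + p) * p0)"
        by (simp add: algebra_simps)
      also have "(w ^ k * a + p) = 1" using ap(3) by simp
      finally have "1 = w ^ Suc k * (a * x0) + (w * x0 * p + 1 * p0)" .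
      moreover have "w * x0 * p + 1 * p0 \<in> loc P A"
        using ap \<alpha> \<pi> w unfolding mult_1 by (intro loc_add[OF P] loc_mult[OF P] loc_mult_polys[of polys]) auto
      moreover have "a * x0 \<in> loc polys A" using ap \<alpha> by (intro loc_mult[of polys]) auto
      ultimately show ?case by blast
    qed
  qed
  \<comment> \<open>Since \<open>2 \<le> i\<close>, every index set in \<open>idx (i - 1)\<close> is
    nonempty. So \<open>w ^ m\<close> is invertible modulo \<open>P\<close> there, and can be
    divided out of \<open>b\<close>.\<close>
  have "\<forall>A\<in>idx (i - 1). \<exists>b'. b' \<in> loc M A \<and> b A - w ^ m * b' \<in> loc N A"
  proof
    fix A assume A: "A \<in> idx (i - 1)"
    obtain \<alpha> \<pi> where ap: "\<alpha> \<in> loc polys A" "\<pi> \<in> loc P A" "1 = w ^ m * \<alpha> + \<pi>"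
      using unit[OF A, of m] i by auto
    have bA: "b A \<in> loc M A" using b A by blast
    have "b A = (w ^ m * \<alpha> + \<pi>) * b A" using ap(3) by simp
    then have "b A - w ^ m * (\<alpha> * b A) = b A * \<pi>" by (simp add: algebra_simps)
    moreover have "b A * \<pi> \<in> loc P A" using bA ap P MS by (intro loc_mult) (auto intro: loc_mono)
    ultimately show "\<exists>b'. b' \<in> loc M A \<and> b A - w ^ m * b' \<in> loc N A"
      using loc_mult[OF M(1) ap(1) bA] loc_mono[OF sub(1)] by metis
  qed
  then obtain b' where b': "\<And>A. A \<in> idx (i - 1) \<Longrightarrow> b' A \<in> loc M A"
      "\<And>A. A \<in> idx (i - 1) \<Longrightarrow> b A - w ^ m * b' A \<in> loc N A"
    by metis
  \<comment> \<open>Projection does not affect \<open>c\<close>, which already has bidegree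
    \<open>\<nu>\<close>, and it preserves the localizations of the homogeneous ideals.\<close>
  define b'' where "b'' A = pr \<nu> (b' A)" for A
  have "c A - cd b'' A \<in> loc N A" if A: "A \<in> idx i" for A
  proof -
    let ?x = "c A - cd b' A"
    have "cd (\<lambda>A. b A - w ^ m * b' A) A \<in> loc N A" by (rule cd_loc'[OF N(1) b'(2) A])
    then have "(w ^ m * c A - cd b A) + (cd b A - w ^ m * cd b' A) \<in> loc N A"
      using b(2) A by (intro loc_add[OF N(1)]) (auto simp: cd_diff cd_mult)
    then have wx: "w ^ m * ?x \<in> loc N A" by (simp add: algebra_simps)
    have xM: "?x \<in> loc polys A"
      using c(1)[OF A] cd_loc'[OF M(1) b'(1) A] loc_mono[OF MS] by (intro loc_diff) auto
    obtain \<alpha> \<pi> where ap: "\<alpha> \<in> loc polys A" "\<pi> \<in> loc P A" "1 = w ^ m * \<alpha> + \<pi>"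
      using unit[OF A, of m] i by auto
    have "?x = (w ^ m * \<alpha> + \<pi>) * ?x" using ap(3) by simp
    also have "\<dots> = \<alpha> * (w ^ m * ?x) + ?x * \<pi>" by (simp add: algebra_simps)
    also have "\<dots> \<in> loc N A"
      using loc_mult[OF N(1) ap(1) wx] loc_mono[OF sub(1) loc_mult[OF P xM ap(2)]] by (intro loc_add[OF N(1)])
    finally have "?x \<in> loc N A" .
    then have "pr \<nu> ?x \<in> loc N A" by (rule loc_pr[OF N(2) idx_finite[OF A]])
    then show ?thesis using c(2)[OF A] by (simp add: pr_minus pr_piece b''_def[abs_def] cd_pr)
  qed
  moreover have "b'' A \<in> loc M A" "b'' A \<in> piece \<nu>" if "A \<in> idx (i - 1)" for A
    using b'(1)[OF that] loc_pr[OF M(2) idx_finite[OF that]] by (auto simp: b''_def piece_pr)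
  ultimately show "\<exists>b. (\<forall>A\<in>idx (i - 1). b A \<in> loc M A \<and> b A \<in> piece \<nu>) \<and> (\<forall>A\<in>idx i. c A - cd b A \<in> loc N A)"
    by blast
qed

section \<open>Degree 0, colon ideals and scaling by a form\<close>

lemma idx_0: "idx 0 = {{}}"
  by (auto simp: idx_def dest: finite_subset)

lemma idx_1: "A \<in> idx 1 \<longleftrightarrow> (\<exists>j<4. A = {j})"
  by (auto simp: idx_def card_1_singleton_iff)

lemma idx_neg: "i < 0 \<Longrightarrow> idx i = {}"
  by (auto simp: idx_def)

lemma cvanish_neg: "i < 0 \<Longrightarrow> cvanish M N \<nu> i"
  by (simp add: cvanish_def idx_neg)

lemma cd_empty [simp]: "cd x {} = 0"
  by (simp add: cd_def)

lemma cd_single [simp]: "cd x {j} = x {}"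
proof -
  have "{l. l = j \<and> l < j} = {}" by auto
  then show ?thesis by (simp add: cd_def del: Collect_empty_eq)
qed

text \<open>Degree 0 has no coboundaries except zero, so vanishing there is saturation of
  \<open>N\<close> in \<open>M\<close> with respect to the irrelevant ideal, in bidegree
  \<open>\<nu>\<close>.\<close>

lemma cvanish_0_iff:
  assumes "submod M" "submod N"
  shows "cvanish M N \<nu> 0 \<longleftrightarrow> (\<forall>x\<in>M \<inter> piece \<nu>. (\<forall>j<4. x \<in> loc N {j}) \<longrightarrow> x \<in> N)"
proof
  assume v: "cvanish M N \<nu> 0"
  show "\<forall>x\<in>M \<inter> piece \<nu>. (\<forall>j<4. x \<in> loc N {j}) \<longrightarrow> x \<in> N"
  proof (intro ballI impI)
    fix x assume x: "x \<in> M \<inter> piece \<nu>" "\<forall>j<4. x \<in> loc N {j}"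
    have 1: "\<forall>A\<in>idx 0. x \<in> loc M A \<inter> piece \<nu>"
      using x assms by (auto simp: idx_0 loc_empty)
    have 2: "\<forall>A\<in>idx (0 + 1). cd (\<lambda>A. x) A \<in> loc N A"
      using x by (auto simp: idx_1)
    obtain b where "\<forall>A\<in>idx 0. x - cd b A \<in> loc N A"
      using v[unfolded cvanish_def, THEN spec, of "\<lambda>A. x"] 1 2 by blast
    then show "x \<in> N" using assms by (simp add: idx_0 loc_empty)
  qed
next
  assume *: "\<forall>x\<in>M \<inter> piece \<nu>. (\<forall>j<4. x \<in> loc N {j}) \<longrightarrow> x \<in> N"
  show "cvanish M N \<nu> 0"
  proof (rule cvanishI)
    fix c assume "\<And>A. A \<in> idx 0 \<Longrightarrow> c A \<in> loc M A" "\<And>A. A \<in> idx 0 \<Longrightarrow> c A \<in> piece \<nu>"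
      "\<And>A. A \<in> idx (0 + 1) \<Longrightarrow> cd c A \<in> loc N A"
    note c = this
    have "c {} \<in> M \<inter> piece \<nu>" using c(1,2)[of "{}"] assms by (simp add: idx_0 loc_empty)
    moreover have "c {} \<in> loc N {j}" if "j < 4" for j using c(3)[of "{j}"] that by (simp add: idx_1)
    ultimately have "c {} \<in> N" using * by blast
    then show "\<exists>b. (\<forall>A\<in>idx (0 - 1). b A \<in> loc M A \<and> b A \<in> piece \<nu>) \<and> (\<forall>A\<in>idx 0. c A - cd b A \<in> loc N A)"
      using assms by (auto simp: idx_0 idx_neg loc_empty)
  qed
qed

text \<open>Multiplication by \<open>g\<close> identifies S/(P : g), shifted by \<open>a\<close>,
  with the kernel of S/P -> S/(P, g). In the long exact sequence, degree 0 of the last quotient sits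
  between degree 0 of S/P and degree 1 of S/(P : g).\<close>

lemma cvanish_adjoin_0:
  fixes P :: "'a::comm_ring_1 laurent set"
  assumes P: "submod P" "homog P" and g: "g \<in> polys" "g \<in> piece a"
    and v0: "cvanish polys P \<nu> 0" and v1: "cvanish polys (colon P g) (\<nu> - a) 1"
  shows "cvanish polys (adjoin P g) \<nu> 0"
  unfolding cvanish_0_iff[OF submod_polys submod_adjoin[OF P(1) g(1)]]
proof (intro ballI impI)
  fix x assume x: "x \<in> polys \<inter> piece \<nu>" and xj: "\<forall>j<4. x \<in> loc (adjoin P g) {j}"
  have "\<forall>A\<in>idx 1. \<exists>p z. p \<in> loc P A \<and> z \<in> loc polys A \<and> z \<in> piece (\<nu> - a) \<and> x = p + g * z"
  proof
    fix A assume A: "A \<in> idx 1"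
    have "x \<in> loc (adjoin P g) A" using A xj by (auto simp: idx_1)
    then show "\<exists>p z. p \<in> loc P A \<and> z \<in> loc polys A \<and> z \<in> piece (\<nu> - a) \<and> x = p + g * z"
      using loc_adjoinE[OF idx_finite[OF A] g(2) P(2)] x by blast
  qed
  then obtain p z where pz: "\<And>A. A \<in> idx 1 \<Longrightarrow> p A \<in> loc P A" "\<And>A. A \<in> idx 1 \<Longrightarrow> z A \<in> loc polys A"
      "\<And>A. A \<in> idx 1 \<Longrightarrow> z A \<in> piece (\<nu> - a)" "\<And>A. A \<in> idx 1 \<Longrightarrow> x = p A + g * z A"
    by metis
  have "cd z A \<in> loc (colon P g) A" if A: "A \<in> idx (1 + 1)" for A
  proof (rule loc_colon[OF P(1)])
    show "cd z A \<in> loc polys A" using cd_loc[OF submod_polys _ A, of z] pz(2) by blast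
    have "g * cd z A = cd (\<lambda>A. g * z A) A" by (simp add: cd_mult)
    \<comment> \<open>On singletons the differential of a constant cochain is the constant. Written
      this way, \<open>x\<close> drops out by \<open>cd_cd\<close>.\<close>
    also have "\<dots> = cd (\<lambda>A. cd (\<lambda>_. x) A - p A) A"
    proof (rule cd_cong)
      fix j assume "j \<in> A"
      then have 1: "A - {j} \<in> idx 1" using idx_remove[OF A] by simp
      then obtain l where "A - {j} = {l}" unfolding idx_1 by blast
      then have "cd (\<lambda>_. x) (A - {j}) = x" by simp
      then show "g * z (A - {j}) = cd (\<lambda>_. x) (A - {j}) - p (A - {j})"
        using pz(4)[OF 1] by (simp add: algebra_simps)
    qed
    also have "\<dots> = - cd p A" by (simp add: cd_diff cd_cd idx_finite[OF A])
    also have "\<dots> \<in> loc P A" using cd_loc[OF P(1) _ A, of p] pz(1) P(1) by (intro loc_uminus) auto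
    finally show "g * cd z A \<in> loc P A" .
  qed
  then obtain b where b: "\<And>A. A \<in> idx (1 - 1) \<Longrightarrow> b A \<in> loc polys A" "\<And>A. A \<in> idx (1 - 1) \<Longrightarrow> b A \<in> piece (\<nu> - a)"
      "\<And>A. A \<in> idx 1 \<Longrightarrow> z A - cd b A \<in> loc (colon P g) A"
    using cvanishE[OF v1 pz(2,3)] by blast
  define y where "y = b {}"
  have y: "y \<in> polys" "y \<in> piece (\<nu> - a)" using b(1,2)[of "{}"] by (auto simp: y_def idx_0 loc_empty)
  have "x - g * y \<in> loc P {j}" if "j < 4" for j
  proof -
    have 1: "{j} \<in> idx 1" using that by (auto simp: idx_1)
    have "g * (z {j} - y) \<in> loc P {j}" using loc_colonD[OF b(3)[OF 1]] by (simp add: y_def)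
    then have "p {j} + g * (z {j} - y) \<in> loc P {j}" by (rule loc_add[OF P(1) pz(1)[OF 1]])
    moreover have "x - g * y = p {j} + g * (z {j} - y)" using pz(4)[OF 1] by (simp add: algebra_simps)
    ultimately show ?thesis by simp
  qed
  moreover have "x - g * y \<in> polys \<inter> piece \<nu>"
    using x y g piece_mult[OF g(2) y(2)] by (auto intro: polys_diff polys_mult piece_diff)
  ultimately have "x - g * y \<in> P" using v0 unfolding cvanish_0_iff[OF submod_polys P(1)] by blast
  then have "(x - g * y) + g * y \<in> adjoin P g" using y unfolding adjoin_def by blast
  then show "x \<in> adjoin P g" by simp
qed

text \<open>Multiplication by \<open>f\<close> embeds S/(M : f) into S/M with bidegrees raised by
  \<open>a\<close>, and degree 0 cohomology is left exact.\<close>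

lemma cvanish_colon_0:
  fixes M :: "'a::comm_ring_1 laurent set"
  assumes "submod M" "f \<in> polys" "f \<in> piece a" "cvanish polys M (\<nu> + a) 0"
  shows "cvanish polys (colon M f) \<nu> 0"
  unfolding cvanish_0_iff[OF submod_polys submod_colon[OF assms(1)]]
proof (intro ballI impI)
  fix q assume q: "q \<in> polys \<inter> piece \<nu>" "\<forall>j<4. q \<in> loc (colon M f) {j}"
  then have "f * q \<in> polys \<inter> piece (\<nu> + a)" using assms piece_mult[OF assms(3), of q \<nu>]
    by (auto intro: polys_mult simp: add.commute)
  moreover have "\<forall>j<4. f * q \<in> loc M {j}" using q loc_colonD by blast
  ultimately have "f * q \<in> M" using assms(4) unfolding cvanish_0_iff[OF submod_polys assms(1)] by blast
  then show "q \<in> colon M f" using q by (simp add: colon_def)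
qed

text \<open>As \<open>h\<close> is a nonzerodivisor, hQ is a copy of Q with bidegrees raised by
  \<open>a\<close>. The sequence of Q, S, S/Q gives vanishing for Q in degree \<open>i + 1\<close>
  and bidegree \<open>\<nu> - a\<close>; the sequence of hQ, S, S/hQ then gives the claim.\<close>

lemma cvanish_scale:
  fixes Q :: "'a::field laurent set"
  assumes Q: "submod Q" and h: "h \<noteq> 0" "h \<in> polys" "h \<in> piece a"
    and v: "cvanish polys Q (\<nu> - a) i" and w: "cvanish (polys :: 'a laurent set) {0} (\<nu> - a) (i + 1)"
    and u: "cvanish (polys :: 'a laurent set) {0} \<nu> i"
  shows "cvanish polys (times h ` Q) \<nu> i"
proof (rule cvanishI)
  let ?S = "polys :: 'a laurent set"
  fix c :: "nat set \<Rightarrow> 'a laurent"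
  assume c: "\<And>A. A \<in> idx i \<Longrightarrow> c A \<in> loc ?S A" "\<And>A. A \<in> idx i \<Longrightarrow> c A \<in> piece \<nu>"
    and dc: "\<And>A. A \<in> idx (i + 1) \<Longrightarrow> cd c A \<in> loc (times h ` Q) A"
  have QS: "Q \<subseteq> polys" using Q by (simp add: submod_def)
  have locQ: "\<exists>z. z \<in> loc Q A \<and> x = h * z" if fx: "finite A" "x \<in> loc (times h ` Q) A" for x A
  proof -
    obtain n q where n: "bprod A ^ n * x = h * q" "q \<in> Q" using fx(2) by (auto simp: loc_def)
    obtain t :: "'a laurent" where t: "t \<in> loc polys A" "bprod A ^ n * t = 1" using bprod_inverse[OF fx(1)] by blast
    have "x = t * (h * q)" using unit_cancel[OF t(2), of x] n(1) by simp
    then show ?thesis using t n Q loc_mult[OF Q t(1) loc_super[OF Q n(2)]] by (intro exI[of _ "t * q"]) (auto simp: mult_ac)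
  qed
  have locQ': "h * z \<in> loc (times h ` Q) A" if zQ: "z \<in> loc Q A" for z A
  proof -
    obtain n where "bprod A ^ n * z \<in> Q" using zQ by (auto simp: loc_def)
    then show ?thesis by (intro locI[of _ n]) (auto simp: mult.left_commute)
  qed
  have "\<forall>A\<in>idx (i + 1). \<exists>z. z \<in> loc Q A \<and> cd c A = h * z" using locQ idx_finite dc by blast
  then obtain z where z: "\<And>A. A \<in> idx (i + 1) \<Longrightarrow> z A \<in> loc Q A" "\<And>A. A \<in> idx (i + 1) \<Longrightarrow> cd c A = h * z A" by metis
  have zp: "z A \<in> piece (\<nu> - a)" if "A \<in> idx (i + 1)" for A
    using piece_cancel[OF h(1,3), of "z A" \<nu>] cd_piece[of i c \<nu> A] c that z(2)[OF that] by auto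
  have zS: "z A \<in> loc ?S A" if "A \<in> idx (i + 1)" for A using loc_mono[OF QS z(1)[OF that]] .
  have "cd z A \<in> loc {0} A" if A: "A \<in> idx (i + 1 + 1)" for A
  proof -
    have "cd (cd c) A = cd (\<lambda>A. h * z A) A" using z(2) idx_remove[OF A] by (intro cd_cong) auto
    then show ?thesis using cd_cd[OF idx_finite[OF A], of c] h by (simp add: cd_mult loc_zero)
  qed
  then obtain y where "\<And>A. A \<in> idx (i + 1 - 1) \<Longrightarrow> y A \<in> loc ?S A"
      "\<And>A. A \<in> idx (i + 1 - 1) \<Longrightarrow> y A \<in> piece (\<nu> - a)" "\<And>A. A \<in> idx (i + 1) \<Longrightarrow> z A - cd y A \<in> loc {0} A"
    using cvanishE[OF w zS zp] by blast
  then have y: "\<And>A. A \<in> idx i \<Longrightarrow> y A \<in> loc ?S A" "\<And>A. A \<in> idx i \<Longrightarrow> y A \<in> piece (\<nu> - a)"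
      "\<And>A. A \<in> idx (i + 1) \<Longrightarrow> z A = cd y A" by (simp_all add: loc_zero)
  have "cd y A \<in> loc Q A" if "A \<in> idx (i + 1)" for A using z(1)[OF that] y(3)[OF that] by simp
  then obtain y' where y': "\<And>A. A \<in> idx (i - 1) \<Longrightarrow> y' A \<in> loc ?S A"
      "\<And>A. A \<in> idx (i - 1) \<Longrightarrow> y' A \<in> piece (\<nu> - a)" "\<And>A. A \<in> idx i \<Longrightarrow> y A - cd y' A \<in> loc Q A"
    using cvanishE[OF v y(1,2)] by blast
  \<comment> \<open>Subtracting a coboundary moves \<open>y\<close> into \<open>Q\<close> and keeps
    its differential \<open>z\<close>.\<close>
  define q where "q A = y A - cd y' A" for A
  have qQ: "q A \<in> loc Q A" and qp: "q A \<in> piece (\<nu> - a)" if "A \<in> idx i" for A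
    using y'(3)[OF that] y(2)[OF that] cd_piece'[OF y'(2) that] by (auto simp: q_def intro: piece_diff)
  have dq: "cd q A = z A" if "A \<in> idx (i + 1)" for A
    using y(3)[OF that] by (simp add: q_def[abs_def] cd_diff cd_cd idx_finite[OF that])
  have "c A - h * q A \<in> loc ?S A" if "A \<in> idx i" for A
    using c(1)[OF that] loc_mono[OF QS qQ[OF that]] h by (intro loc_diff loc_mult_polys) auto
  moreover have "c A - h * q A \<in> piece \<nu>" if "A \<in> idx i" for A
    using c(2)[OF that] piece_mult[OF h(3) qp[OF that]] by (auto intro: piece_diff)
  moreover have "cd (\<lambda>A. c A - h * q A) A \<in> loc {0} A" if "A \<in> idx (i + 1)" for A
    using z(2)[OF that] dq[OF that] by (simp add: cd_diff cd_mult loc_zero)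
  ultimately obtain b where b: "\<And>A. A \<in> idx (i - 1) \<Longrightarrow> b A \<in> loc ?S A" "\<And>A. A \<in> idx (i - 1) \<Longrightarrow> b A \<in> piece \<nu>"
      "\<And>A. A \<in> idx i \<Longrightarrow> c A - h * q A - cd b A \<in> loc {0} A"
    using cvanishE[OF u, of "\<lambda>A. c A - h * q A"] by blast
  have "c A - cd b A \<in> loc (times h ` Q) A" if "A \<in> idx i" for A
  proof -
    have "c A - cd b A = h * q A" using b(3)[OF that] by (simp add: loc_zero algebra_simps)
    then show ?thesis using locQ'[OF qQ[OF that]] by simp
  qed
  then show "\<exists>b. (\<forall>A\<in>idx (i - 1). b A \<in> loc ?S A \<and> b A \<in> piece \<nu>) \<and> (\<forall>A\<in>idx i. c A - cd b A \<in> loc (times h ` Q) A)"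
    using b by blast
qed

section \<open>Ideals with finite support\<close>

text \<open>The product of the parts of highest weight is the part of highest weight of the product;
  it is nonzero because the Laurent ring is a domain.\<close>

lemma top_weight:
  fixes x y :: "'a::field laurent" and \<omega> :: "(svar \<Rightarrow>\<^sub>0 int) \<Rightarrow> int"
  assumes \<omega>: "\<And>k l. \<omega> (k + l) = \<omega> k + \<omega> l" and nz: "x \<noteq> 0" "y \<noteq> 0"
  shows "\<exists>k\<in>keys (x * y). \<omega> k = Max (\<omega> ` keys x) + Max (\<omega> ` keys y)"
proof -
  define mx where "mx z = Max (\<omega> ` keys z)" for z :: "'a laurent"
  have le: "\<omega> k \<le> mx z" if "k \<in> keys z" for k z
    using that by (auto simp: mx_def)
  have ex: "\<exists>k\<in>keys z. \<omega> k = mx z" if "z \<noteq> 0" for z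
    using Max_in[of "\<omega> ` keys z"] that by (fastforce simp: mx_def)
  define t where "t z = restr (\<lambda>k. \<omega> k = mx z) z" for z
  have t: "t z \<noteq> 0" if nz: "z \<noteq> 0" for z
  proof -
    obtain k where "k \<in> keys z" "\<omega> k = mx z" using ex[OF nz] by blast
    then have "k \<in> keys (t z)" by (simp add: t_def keys_restr)
    then show ?thesis by auto
  qed
  define n where "n = mx x + mx y"
  have rest: "restr (\<lambda>k. \<omega> k = n) ((x - t x) * y) = 0" "restr (\<lambda>k. \<omega> k = n) (t x * (y - t y)) = 0"
    "restr (\<lambda>k. \<omega> k = n) (t x * t y) = t x * t y"
  proof -
    have less: "\<omega> k < mx z" if "k \<in> keys (z - t z)" for k z
    proof -
      have "lk (z - t z) k \<noteq> 0" using that by (simp add: in_keys_iff)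
      then have "lk z k \<noteq> 0" "\<omega> k \<noteq> mx z" by (auto simp: t_def lookup_minus lookup_restr "when_def" split: if_splits)
      then show ?thesis using le[of k z] by (simp add: in_keys_iff)
    qed
    have eq: "\<omega> k = mx z" "k \<in> keys z" if "k \<in> keys (t z)" for k z
      using that by (auto simp: t_def keys_restr)
    show "restr (\<lambda>k. \<omega> k = n) ((x - t x) * y) = 0"
    proof (rule restr_none)
      fix k assume "k \<in> keys ((x - t x) * y)"
      then obtain a b where "a \<in> keys (x - t x)" "b \<in> keys y" "k = a + b"
        using keys_multD by blast
      then show "\<omega> k \<noteq> n" using less[of a x] le[of b y] by (auto simp: n_def \<omega>)
    qed
    show "restr (\<lambda>k. \<omega> k = n) (t x * (y - t y)) = 0"
    proof (rule restr_none)
      fix k assume "k \<in> keys (t x * (y - t y))"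
      then obtain a b where "a \<in> keys (t x)" "b \<in> keys (y - t y)" "k = a + b"
        using keys_multD by blast
      then show "\<omega> k \<noteq> n" using eq[of a x] less[of b y] by (auto simp: n_def \<omega>)
    qed
    show "restr (\<lambda>k. \<omega> k = n) (t x * t y) = t x * t y"
    proof (rule restr_id)
      fix k assume "k \<in> keys (t x * t y)"
      then obtain a b where "a \<in> keys (t x)" "b \<in> keys (t y)" "k = a + b"
        using keys_multD by blast
      then show "\<omega> k = n" using eq[of a x] eq[of b y] by (auto simp: n_def \<omega>)
    qed
  qed
  have "x * y = (x - t x) * y + t x * (y - t y) + t x * t y" by (simp add: algebra_simps)
  then have "restr (\<lambda>k. \<omega> k = n) (x * y) = t x * t y" by (simp add: restr_add rest)
  moreover have "t x * t y \<noteq> 0" using t nz by simp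
  ultimately have "keys (restr (\<lambda>k. \<omega> k = n) (x * y)) \<noteq> {}" by auto
  then show ?thesis by (auto simp: keys_restr n_def mx_def)
qed

text \<open>Highest weights add up, and so do lowest weights, by \<open>top_weight\<close> for the
  negated weight. A product of constant weight therefore leaves no spread in either factor.\<close>

lemma weight_const_factors:
  fixes x y :: "'a::field laurent"
  assumes \<omega>: "\<And>k l. \<omega> (k + l) = \<omega> k + (\<omega> l :: int)" and nz: "x \<noteq> 0" "y \<noteq> 0"
    and c: "\<And>k. k \<in> keys (x * y) \<Longrightarrow> \<omega> k = n"
  shows "\<exists>m. \<forall>k\<in>keys x. \<omega> k = m"
proof -
  let ?K = "keys x" and ?L = "keys y"
  have e1: "Max (\<omega> ` ?K) + Max (\<omega> ` ?L) = n"
    using top_weight[of \<omega> x y, OF \<omega> nz] c by metis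
  have e2: "Max ((\<lambda>k. - \<omega> k) ` ?K) + Max ((\<lambda>k. - \<omega> k) ` ?L) = - n"
    using top_weight[of "\<lambda>k. - \<omega> k" x y, OF _ nz] \<omega> c by (metis minus_add_distrib)
  obtain l where l: "l \<in> ?L" using nz by fastforce
  have "\<omega> l \<le> Max (\<omega> ` ?L)" "- \<omega> l \<le> Max ((\<lambda>k. - \<omega> k) ` ?L)" using l by auto
  moreover have "\<omega> k \<le> Max (\<omega> ` ?K)" "- \<omega> k \<le> Max ((\<lambda>k. - \<omega> k) ` ?K)" if "k \<in> ?K" for k
    using that by auto
  ultimately have "\<forall>k\<in>?K. \<omega> k = Max (\<omega> ` ?K)"
    using e1 e2 by (intro ballI) (smt (verit))
  then show ?thesis by blast
qed

lemma piece_factor: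
  fixes x y :: "'a::field laurent"
  assumes "x * y \<in> piece \<nu>" "x \<noteq> 0" "y \<noteq> 0"
  shows "\<exists>\<mu>. x \<in> piece \<mu>"
proof -
  have "\<exists>m. \<forall>k\<in>keys x. fst (deg k) = m"
  proof (rule weight_const_factors[where \<omega> = "\<lambda>k. fst (deg k)" and n = "fst \<nu>", OF _ assms(2,3)])
    show "fst (deg k) = fst \<nu>" if "k \<in> keys (x * y)" for k
      using assms(1) that by (simp add: piece_def)
  qed (simp add: deg_add)
  moreover have "\<exists>m. \<forall>k\<in>keys x. snd (deg k) = m"
  proof (rule weight_const_factors[where \<omega> = "\<lambda>k. snd (deg k)" and n = "snd \<nu>", OF _ assms(2,3)])
    show "snd (deg k) = snd \<nu>" if "k \<in> keys (x * y)" for k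
      using assms(1) that by (simp add: piece_def)
  qed (simp add: deg_add)
  ultimately obtain m n where "\<forall>k\<in>keys x. fst (deg k) = m" "\<forall>k\<in>keys x. snd (deg k) = n"
    by blast
  then have "x \<in> piece (m, n)" by (auto simp: piece_def prod_eq_iff)
  then show ?thesis by blast
qed

lemma piece_unique: "(x :: 'a::comm_monoid_add laurent) \<noteq> 0 \<Longrightarrow> x \<in> piece \<mu> \<Longrightarrow> x \<in> piece \<nu> \<Longrightarrow> \<mu> = \<nu>"
  using pr_piece[of x \<nu>] pr_piece_other[of x \<mu> \<nu>] by auto

lemma piece_nonneg:
  assumes "x \<noteq> 0" "x \<in> piece (n1, n2)" "x \<in> polys"
  shows "0 \<le> n1" "0 \<le> n2"
proof -
  obtain k where "k \<in> keys x" using assms(1) by fastforce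
  then have "deg k = (n1, n2)" "\<And>v. 0 \<le> lk k v" using assms(2,3) by (auto simp: piece_def polys_def)
  then show "0 \<le> n1" "0 \<le> n2" by (auto simp: deg_def intro: add_nonneg_nonneg)
qed

section \<open>Linear dependence over a domain, and elimination of a pair of variables\<close>

lemma linear_dependence:
  fixes v :: "'i \<Rightarrow> 't \<Rightarrow> 'r::idom"
  assumes D: "0 \<in> D" "1 \<in> D" "\<And>x y. x \<in> D \<Longrightarrow> y \<in> D \<Longrightarrow> x + y \<in> D" "\<And>x y. x \<in> D \<Longrightarrow> y \<in> D \<Longrightarrow> x * y \<in> D"
      "\<And>x. x \<in> D \<Longrightarrow> - x \<in> D"
    and "finite T" "finite I" "card T < card I" "\<And>i t. i \<in> I \<Longrightarrow> t \<in> T \<Longrightarrow> v i t \<in> D"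
  shows "\<exists>c. (\<forall>i. c i \<in> D) \<and> (\<exists>i\<in>I. c i \<noteq> 0) \<and> (\<forall>t\<in>T. (\<Sum>i\<in>I. c i * v i t) = 0)"
  using assms(6-)
proof (induction T arbitrary: I v rule: finite_induct)
  case empty
  then obtain i where "i \<in> I" by fastforce
  then show ?case using D(1,2) by (intro exI[of _ "\<lambda>_. 1"]) auto
next
  case (insert t T)
  show ?case
  proof (cases "\<forall>i\<in>I. v i t = 0")
    case True
    have "\<exists>c. (\<forall>i. c i \<in> D) \<and> (\<exists>i\<in>I. c i \<noteq> 0) \<and> (\<forall>t\<in>T. (\<Sum>i\<in>I. c i * v i t) = 0)"
      using insert.prems insert.hyps by (intro insert.IH) auto
    then show ?thesis using True by fastforce
  next
    case False
    then obtain j where j: "j \<in> I" "v j t \<noteq> 0" by blast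
    let ?J = "I - {j}"
    \<comment> \<open>Fraction-free elimination of the coordinate \<open>t\<close> with pivot
      \<open>v j t\<close>: only ring operations occur, so that everything stays in the subring
      \<open>D\<close>.\<close>
    define u where "u i s = v j t * v i s - v i t * v j s" for i s
    have "u i s \<in> D" if "i \<in> ?J" "s \<in> T" for i s
      using insert.prems(3) that j(1) D by (simp add: u_def diff_conv_add_uminus del: add_uminus_conv_diff)
    moreover have "card T < card ?J" using insert.prems(1,2) insert.hyps j(1) by simp
    ultimately obtain c where c: "\<forall>i. c i \<in> D" "\<exists>i\<in>?J. c i \<noteq> 0" "\<forall>s\<in>T. (\<Sum>i\<in>?J. c i * u i s) = 0"
      using insert.IH[of ?J u] insert.prems(1) by blast
    \<comment> \<open>The coefficient of the pivot vector is the one that cancels the coordinate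
      \<open>t\<close> of the others, after scaling these by the pivot.\<close>
    define c' where "c' i = (if i = j then - (\<Sum>l\<in>?J. c l * v l t) else if i \<in> I then c i * v j t else 0)" for i
    have sumD: "(\<Sum>l\<in>?J. c l * v l t) \<in> D"
    proof -
      have "finite K \<Longrightarrow> K \<subseteq> ?J \<Longrightarrow> (\<Sum>l\<in>K. c l * v l t) \<in> D" for K
        by (induction K rule: finite_induct) (use D c insert.prems(3) in auto)
      then show ?thesis using insert.prems(1) by simp
    qed
    have "\<forall>i. c' i \<in> D" using sumD c insert.prems(3) j D by (auto simp: c'_def)
    moreover have "\<exists>i\<in>I. c' i \<noteq> 0" using c(2) j by (auto simp: c'_def)
    moreover have "(\<Sum>i\<in>I. c' i * v i s) = 0" if s: "s \<in> insert t T" for s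
    proof -
      have "(\<Sum>i\<in>I. c' i * v i s) = c' j * v j s + (\<Sum>i\<in>?J. c' i * v i s)"
        by (rule sum.remove) (use insert.prems(1) j in auto)
      also have "(\<Sum>i\<in>?J. c' i * v i s) = (\<Sum>i\<in>?J. c i * v j t * v i s)"
        by (rule sum.cong) (auto simp: c'_def)
      also have "c' j * v j s + \<dots> = (\<Sum>i\<in>?J. c i * u i s)"
        by (simp add: c'_def u_def sum_distrib_right sum_distrib_left right_diff_distrib sum_subtractf mult_ac)
      also have "\<dots> = 0" using c(3) s by (cases "s = t") (auto simp: u_def mult.commute)
      finally show ?thesis .
    qed
    ultimately show ?thesis by blast
  qed
qed

text \<open>The letters \<open>p\<close> and \<open>q\<close> stand for the s- and t-variables in
  either order, so that one argument serves both factors of the product of lines. Everything is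
  viewed over the ring \<open>D\<close> of polynomials in \<open>p0\<close>,
  \<open>p1\<close>.\<close>

locale two_pairs =
  fixes p0 p1 q0 q1 :: svar
  assumes distinct: "distinct [p0, p1, q0, q1]" and all: "UNIV = {p0, p1, q0, q1}"
begin

definition D :: "'a::field laurent set" where
  "D = {x\<in>polys. \<forall>k\<in>keys x. lk k q0 = 0 \<and> lk k q1 = 0}"

definition wt :: "(svar \<Rightarrow>\<^sub>0 int) \<Rightarrow> int" where
  "wt k = lk k q0 + lk k q1"

lemma wt_add: "wt (k + l) = wt k + wt l"
  by (simp add: wt_def lookup_add)

lemma D_ring: "0 \<in> D" "1 \<in> D" "x \<in> D \<Longrightarrow> y \<in> D \<Longrightarrow> x + y \<in> D" "x \<in> D \<Longrightarrow> y \<in> D \<Longrightarrow> x * y \<in> D"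
  "x \<in> D \<Longrightarrow> - x \<in> D"
proof -
  show "x + y \<in> D" if "x \<in> D" "y \<in> D"
    using that keys_addD[of _ x y] by (auto simp: D_def intro: polys_add)
  show "x * y \<in> D" if xy: "x \<in> D" "y \<in> D"
  proof -
    have "lk k q0 = 0 \<and> lk k q1 = 0" if "k \<in> keys (x * y)" for k
      using keys_multD[OF that] xy by (auto simp: D_def lookup_add)
    then show ?thesis using xy by (auto simp: D_def intro: polys_mult)
  qed
qed (auto simp: D_def intro: polys_uminus)

lemma X_power: "lvar v ^ n = single (single v (int n)) (1::'a::comm_ring_1)"
  by (induction n) (auto simp: lvar_def mult_single single_add[symmetric])

lemma wt_expand:
  fixes g :: "'a::field laurent"
  assumes "g \<in> polys" "\<And>k. k \<in> keys g \<Longrightarrow> wt k = int n"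
  shows "\<exists>c. (\<forall>\<tau>. c \<tau> \<in> D) \<and> g = (\<Sum>\<tau>\<le>n. c \<tau> * (lvar q0 ^ \<tau> * lvar q1 ^ (n - \<tau>)))"
proof -
  define Q where "Q g \<longleftrightarrow> (\<exists>c. (\<forall>\<tau>. c \<tau> \<in> D) \<and> g = (\<Sum>\<tau>\<le>n. c \<tau> * (lvar q0 ^ \<tau> * lvar q1 ^ (n - \<tau>))))" for g :: "'a laurent"
  have Q0: "Q 0" unfolding Q_def using D_ring by (intro exI[of _ "\<lambda>_. 0"]) auto
  have Qadd: "Q (x + y)" if xy: "Q x" "Q y" for x y
  proof -
    obtain c c' where "\<forall>\<tau>. c \<tau> \<in> D" "x = (\<Sum>\<tau>\<le>n. c \<tau> * (lvar q0 ^ \<tau> * lvar q1 ^ (n - \<tau>)))"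
      "\<forall>\<tau>. c' \<tau> \<in> D" "y = (\<Sum>\<tau>\<le>n. c' \<tau> * (lvar q0 ^ \<tau> * lvar q1 ^ (n - \<tau>)))"
      using xy unfolding Q_def by blast
    then show ?thesis unfolding Q_def using D_ring(3)
      by (intro exI[of _ "\<lambda>\<tau>. c \<tau> + c' \<tau>"]) (auto simp: distrib_right sum.distrib)
  qed
  have Qs: "Q (single k (lk g k))" if k: "k \<in> keys g" for k
  proof -
    define \<tau> where "\<tau> = nat (lk k q0)"
    have nn: "0 \<le> lk k v" for v using assms(1) k by (auto simp: polys_def)
    have w: "lk k q0 + lk k q1 = int n" using assms(2)[OF k] by (simp add: wt_def)
    have t: "int \<tau> = lk k q0" "\<tau> \<le> n" "int (n - \<tau>) = lk k q1" using nn[of q0] nn[of q1] w by (auto simp: \<tau>_def)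
    define l where "l = k - single q0 (int \<tau>) - single q1 (int (n - \<tau>))"
    have "single l (lk g k) \<in> D"
      using nn distinct t unfolding D_def
      by (auto simp: l_def lookup_minus lookup_single "when_def" intro!: polys_single split: if_splits)
    moreover have "single k (lk g k) = single l (lk g k) * (lvar q0 ^ \<tau> * lvar q1 ^ (n - \<tau>))"
      by (simp add: X_power mult_single l_def)
    moreover have "(\<Sum>\<tau>'\<le>n. (if \<tau>' = \<tau> then single l (lk g k) else 0) * (lvar q0 ^ \<tau>' * lvar q1 ^ (n - \<tau>')))
        = single l (lk g k) * (lvar q0 ^ \<tau> * lvar q1 ^ (n - \<tau>))"
      using t(2) by (simp add: if_distrib[of "\<lambda>x. x * _"] cong: if_cong)
    ultimately show ?thesis unfolding Q_def using D_ring(1)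
      by (intro exI[of _ "\<lambda>\<tau>'. if \<tau>' = \<tau> then single l (lk g k) else 0"]) auto
  qed
  have "Q (\<Sum>k\<in>K. single k (lk g k))" if "finite K" "K \<subseteq> keys g" for K
    using that by (induction K rule: finite_induct) (auto intro: Q0 Qadd Qs)
  then have "Q g" by (subst pm_expand) simp
  then show ?thesis by (simp add: Q_def)
qed

text \<open>Coefficients in \<open>D\<close> do not involve \<open>q0\<close>, so the exponent of
  \<open>q0\<close> separates the summands.\<close>

lemma wt_independent:
  fixes c :: "nat \<Rightarrow> 'a::field laurent"
  assumes "\<And>i. c i \<in> D" "(\<Sum>i<n. c i * (lvar q0 ^ i * lvar q1 ^ (n - 1 - i))) = 0" "j < n"
  shows "c j = 0"
proof -
  let ?m = "\<lambda>i. lvar q0 ^ i * lvar q1 ^ (n - 1 - i) :: 'a laurent"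
  have m: "?m i = single (single q0 (int i) + single q1 (int (n - 1 - i))) 1" for i
    by (simp add: X_power mult_single)
  have keys: "lk k q0 = int i" if k: "k \<in> keys (c i * ?m i)" for k i
  proof -
    obtain a b where "a \<in> keys (c i)" "b \<in> keys (?m i)" "k = a + b"
      using keys_multD[OF k] by blast
    moreover from this have "b = single q0 (int i) + single q1 (int (n - 1 - i))"
      unfolding m by simp
    ultimately show ?thesis using assms(1)[of i] distinct
      by (auto simp: D_def lookup_add lookup_single "when_def")
  qed
  have "restr (\<lambda>k. lk k q0 = int j) (c i * ?m i) = (if i = j then c j * ?m j else 0)" for i
    using keys by (auto intro!: restr_id restr_none)
  then have "restr (\<lambda>k. lk k q0 = int j) (\<Sum>i<n. c i * ?m i) = c j * ?m j"
    using assms(3) by (simp add: restr_sum)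
  then have "c j * ?m j = 0" using assms(2) by simp
  moreover have "?m j \<noteq> 0" unfolding m by (metis lookup_single_eq lookup_zero one_neq_zero)
  ultimately show ?thesis using mult_eq_0_iff by blast
qed

text \<open>The dimension count behind the resultant. Weight \<open>2 * n - 1\<close> has
  \<open>2 * n\<close> monomials in \<open>q0\<close>, \<open>q1\<close>, while the multiples of
  \<open>g1\<close> and \<open>g2\<close> by the \<open>n\<close> monomials of weight
  \<open>n - 1\<close>, together with a power of \<open>qe\<close>, are \<open>2 * n + 1\<close>
  elements. In a linear relation over \<open>D\<close> the coefficient of the power of
  \<open>qe\<close> is the desired \<open>r\<close>.\<close>

lemma eliminate:
  fixes g1 g2 :: "'a::field laurent"
  assumes g: "g1 \<in> polys" "g2 \<in> polys" and wt: "\<And>k. k \<in> keys g1 \<Longrightarrow> wt k = int n"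
      "\<And>k. k \<in> keys g2 \<Longrightarrow> wt k = int n"
    and reg: "regular_pair g1 g2" and qe: "qe \<in> {q0, q1}"
  shows "\<exists>r\<in>D. r \<noteq> 0 \<and> (\<exists>m. r * lvar qe ^ m \<in> ideal2 g1 g2)"
proof (cases "n = 0")
  \<comment> \<open>In weight 0 the form \<open>g1\<close> lies in \<open>D\<close> and serves as
    \<open>r\<close>; the count below needs the multipliers of weight \<open>n - 1\<close>.\<close>
  case True
  have "g1 \<in> D"
  proof -
    have "lk k q0 = 0 \<and> lk k q1 = 0" if k: "k \<in> keys g1" for k
    proof -
      have "0 \<le> lk k q0" "0 \<le> lk k q1" using g(1) k by (auto simp: polys_def)
      then show ?thesis using wt(1)[OF k] True by (simp add: wt_def)
    qed
    then show ?thesis using g(1) by (auto simp: D_def)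
  qed
  moreover have "g1 * lvar qe ^ 0 \<in> ideal2 g1 g2" using ideal2_gens by simp
  moreover have "g1 \<noteq> 0" using reg by (simp add: regular_pair_def)
  ultimately show ?thesis by blast
next
  case False
  let ?m = "\<lambda>i. lvar q0 ^ i * lvar q1 ^ (n - 1 - i) :: 'a laurent"
  define v where "v i = (if i < n then g1 * ?m i else if i < 2 * n then g2 * ?m (i - n) else lvar qe ^ (2 * n - 1))" for i
  have mp: "?m i \<in> polys" for i by (intro polys_mult polys_power polys_lvar)
  have mw: "wt k = int (n - 1)" if "k \<in> keys (?m i)" "i < n" for k i
  proof -
    have "k = single q0 (int i) + single q1 (int (n - 1 - i))"
      using that(1) unfolding X_power mult_single by simp
    then show ?thesis using that(2) distinct by (auto simp: wt_def lookup_add lookup_single "when_def")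
  qed
  have gm: "wt k = int (2 * n - 1)" if w: "\<forall>k\<in>keys g. wt k = int n" and i: "i < n"
      and k: "k \<in> keys (g * ?m i)" for g :: "'a laurent" and i k
  proof -
    obtain a b where "a \<in> keys g" "b \<in> keys (?m i)" "k = a + b"
      using keys_multD[OF k] by blast
    then have "wt k = int n + int (n - 1)" using w mw[of b i] i by (simp add: wt_add)
    then show ?thesis using False by simp
  qed
  have "\<exists>c. (\<forall>\<tau>. c \<tau> \<in> D) \<and> v i = (\<Sum>\<tau>\<le>2 * n - 1. c \<tau> * (lvar q0 ^ \<tau> * lvar q1 ^ (2 * n - 1 - \<tau>)))" if "i \<le> 2 * n" for i
  proof (rule wt_expand)
    show "v i \<in> polys" using g mp by (auto simp: v_def intro!: polys_mult polys_power)
    fix k assume k: "k \<in> keys (v i)"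
    consider "i < n" | "n \<le> i" "i < 2 * n" | "2 * n \<le> i" by linarith
    then show "wt k = int (2 * n - 1)"
    proof cases
      case 1
      then have "k \<in> keys (g1 * ?m i)" using k by (simp add: v_def)
      then show ?thesis using gm[of g1 i k] wt(1) 1 by blast
    next
      case 2
      then have *: "k \<in> keys (g2 * ?m (i - n))" using k by (simp add: v_def)
      have "i - n < n" using 2 by simp
      then show ?thesis using * gm[of g2 "i - n" k] wt(2) by blast
    next
      case 3
      then have "k \<in> keys (lvar qe ^ (2 * n - 1) :: 'a laurent)" using k by (simp add: v_def)
      then show ?thesis using qe distinct
        by (auto simp: X_power wt_def lookup_single "when_def" split: if_splits)
    qed
  qed
  then have "\<forall>i\<in>{..2 * n}. \<exists>c. (\<forall>\<tau>. c \<tau> \<in> D) \<and> v i = (\<Sum>\<tau>\<le>2 * n - 1. c \<tau> * (lvar q0 ^ \<tau> * lvar q1 ^ (2 * n - 1 - \<tau>)))"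
    by auto
  from bchoice[OF this] obtain V where
    V: "\<forall>i\<in>{..2 * n}. (\<forall>\<tau>. V i \<tau> \<in> D) \<and> v i = (\<Sum>\<tau>\<le>2 * n - 1. V i \<tau> * (lvar q0 ^ \<tau> * lvar q1 ^ (2 * n - 1 - \<tau>)))"
    by blast
  have "\<exists>c. (\<forall>i. c i \<in> D) \<and> (\<exists>i\<in>{..2 * n}. c i \<noteq> 0) \<and> (\<forall>t\<in>{..2 * n - 1}. (\<Sum>i\<in>{..2 * n}. c i * V i t) = 0)"
    by (rule linear_dependence[OF D_ring]) (use False V in auto)
  then obtain c where c: "\<And>i. c i \<in> D" "\<exists>i\<le>2 * n. c i \<noteq> 0" "\<And>t. t \<le> 2 * n - 1 \<Longrightarrow> (\<Sum>i\<le>2 * n. c i * V i t) = 0"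
    by (auto simp only: atMost_iff Bex_def Ball_def)
  have cp: "c i \<in> polys" for i using c(1)[of i] by (simp add: D_def)
  have "(\<Sum>i\<le>2 * n. c i * v i) = (\<Sum>i\<le>2 * n. \<Sum>\<tau>\<le>2 * n - 1. c i * V i \<tau> * (lvar q0 ^ \<tau> * lvar q1 ^ (2 * n - 1 - \<tau>)))"
  proof (rule sum.cong)
    fix i assume "i \<in> {..2 * n}"
    then have "v i = (\<Sum>\<tau>\<le>2 * n - 1. V i \<tau> * (lvar q0 ^ \<tau> * lvar q1 ^ (2 * n - 1 - \<tau>)))" using V by blast
    then show "c i * v i = (\<Sum>\<tau>\<le>2 * n - 1. c i * V i \<tau> * (lvar q0 ^ \<tau> * lvar q1 ^ (2 * n - 1 - \<tau>)))"
      by (simp only: sum_distrib_left mult.assoc)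
  qed simp
  also have "\<dots> = (\<Sum>\<tau>\<le>2 * n - 1. \<Sum>i\<le>2 * n. c i * V i \<tau> * (lvar q0 ^ \<tau> * lvar q1 ^ (2 * n - 1 - \<tau>)))"
    by (rule sum.swap)
  also have "\<dots> = (\<Sum>\<tau>\<le>2 * n - 1. (\<Sum>i\<le>2 * n. c i * V i \<tau>) * (lvar q0 ^ \<tau> * lvar q1 ^ (2 * n - 1 - \<tau>)))"
    by (simp only: sum_distrib_right)
  also have "\<dots> = 0" using c(3) by simp
  finally have rel: "(\<Sum>i\<le>2 * n. c i * v i) = 0" .
  define A1 where "A1 = (\<Sum>i<n. c i * ?m i)"
  define A2 where "A2 = (\<Sum>i<n. c (n + i) * ?m i)"
  have "(\<Sum>i\<le>2 * n. c i * v i) = (\<Sum>i<2 * n. c i * v i) + c (2 * n) * v (2 * n)"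
    by (simp add: lessThan_Suc_atMost[symmetric])
  also have "(\<Sum>i<2 * n. c i * v i) = (\<Sum>i<n. c i * v i) + (\<Sum>i<n. c (n + i) * v (n + i))"
    using sum.atLeastLessThan_concat[of 0 n "2 * n" "\<lambda>i. c i * v i"] sum.shift_bounds_nat_ivl[of "\<lambda>i. c i * v i" 0 n n]
    by (simp add: atLeast0LessThan mult_2 add.commute)
  also have "(\<Sum>i<n. c i * v i) = g1 * A1" by (simp add: A1_def v_def sum_distrib_left mult_ac)
  also have "(\<Sum>i<n. c (n + i) * v (n + i)) = g2 * A2" by (simp add: A2_def v_def sum_distrib_left mult_ac)
  finally have rel': "g1 * A1 + g2 * A2 + c (2 * n) * lvar qe ^ (2 * n - 1) = 0" using rel by (simp add: v_def)
  have Ap: "A1 \<in> polys" "A2 \<in> polys" unfolding A1_def A2_def by (intro polys_sum polys_mult cp mp)+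
  \<comment> \<open>Otherwise regularity makes \<open>A2\<close> a multiple of \<open>g1\<close>.
    Its weight \<open>n - 1\<close> is below that of \<open>g1\<close>, so \<open>A2\<close> and
    then \<open>A1\<close> vanish, and independence of the monomials kills all coefficients.\<close>
  have "c (2 * n) \<noteq> 0"
  proof
    assume 0: "c (2 * n) = 0"
    then have "g1 * - A1 = g2 * A2" using rel' by (simp add: add_eq_0_iff2 minus_equation_iff)
    then obtain z where z: "z \<in> polys" "A2 = g1 * z"
      using reg Ap polys_uminus[OF Ap(1)] unfolding regular_pair_def by blast
    have g1: "g1 \<noteq> 0" using reg by (simp add: regular_pair_def)
    have "z = 0"
    proof (rule ccontr)
      assume nz: "z \<noteq> 0"
      obtain k where k: "k \<in> keys (g1 * z)" "wt k = Max (wt ` keys g1) + Max (wt ` keys z)"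
        using top_weight[OF wt_add g1 nz] by blast
      have "wt ` keys g1 = {int n}"
      proof -
        have "wt ` keys g1 = (\<lambda>_. int n) ` keys g1"
          by (rule image_cong) (use wt(1) in auto)
        moreover have "keys g1 \<noteq> {}" using g1 by simp
        ultimately show ?thesis by (simp add: image_constant_conv)
      qed
      moreover have "0 \<le> Max (wt ` keys z)"
      proof -
        obtain l where l: "l \<in> keys z" using nz by fastforce
        then have "0 \<le> wt l" using z(1) by (auto simp: polys_def wt_def)
        also have "wt l \<le> Max (wt ` keys z)" using l by auto
        finally show ?thesis .
      qed
      ultimately have "int n \<le> wt k" using k(2) by simp
      moreover have "wt k = int (n - 1)"
      proof -
        have "k \<in> (\<Union>i\<in>{..<n}. keys (c (n + i) * ?m i))"
        proof (rule ccontr)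
          assume "k \<notin> (\<Union>i\<in>{..<n}. keys (c (n + i) * ?m i))"
          then have "lk A2 k = 0" unfolding A2_def lookup_sum by (intro sum.neutral) (auto simp: in_keys_iff)
          then show False using k(1) z(2) by (simp add: in_keys_iff)
        qed
        then obtain i where i: "i < n" "k \<in> keys (c (n + i) * ?m i)" by auto
        obtain a b where "a \<in> keys (c (n + i))" "b \<in> keys (?m i)" "k = a + b"
          using keys_multD[OF i(2)] by blast
        then show ?thesis using c(1)[of "n + i"] mw[of b i] i(1) by (auto simp: wt_add D_def) (simp add: wt_def)
      qed
      ultimately show False using False by simp
    qed
    then have A2: "A2 = 0" using z by simp
    then have A1: "A1 = 0" using rel' 0 g1 by simp
    have c1: "c i = 0" if "i < n" for i using wt_independent[of c n i] c(1) A1 that by (simp add: A1_def)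
    have c2: "c (n + i) = 0" if "i < n" for i
      using wt_independent[of "\<lambda>i. c (n + i)" n i] c(1) A2 that by (simp add: A2_def)
    have "c i = 0" if i: "i \<le> 2 * n" for i
    proof -
      consider "i < n" | "n \<le> i" "i < 2 * n" | "i = 2 * n" using i by linarith
      then show ?thesis using c1 0 c2[of "i - n"] by cases auto
    qed
    then show False using c(2) by blast
  qed
  moreover have "c (2 * n) * lvar qe ^ (2 * n - 1) \<in> ideal2 g1 g2"
  proof -
    have "c (2 * n) * lvar qe ^ (2 * n - 1) = - (g1 * A1 + g2 * A2)"
      using rel' by (metis add.commute eq_neg_iff_add_eq_0)
    also have "\<dots> = g1 * (- A1) + g2 * (- A2)" by simp
    finally show ?thesis using polys_uminus[OF Ap(1)] polys_uminus[OF Ap(2)] unfolding ideal2_def by blast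
  qed
  ultimately show ?thesis using c(1) by blast
qed

end

lemma power_lvar_piece: "lvar v ^ n \<in> piece (deg (single v (int n)))"
  by (simp add: two_pairs.X_power[of S0 S1 T0 T1] two_pairs_def UNIV_svar piece_single)

context two_pairs
begin

text \<open>Modulo the linear form, \<open>lvar p1\<close> equals \<open>C c * lvar p0\<close>, and
  a binary form of degree \<open>N\<close> becomes its dehomogenized value at \<open>c\<close> times
  \<open>lvar p0 ^ N\<close>. The dehomogenization \<open>q\<close> is nonzero because the exponent
  of \<open>p1\<close> determines the term.\<close>

lemma linear_form_mod:
  fixes r :: "'a::field laurent"
  assumes "r \<in> D" "\<And>k. k \<in> keys r \<Longrightarrow> lk k p0 + lk k p1 = int N" "r \<noteq> 0"
  shows "\<exists>q. q \<noteq> 0 \<and> (\<forall>c. \<exists>\<alpha>\<in>polys. r = C (poly q c) * lvar p0 ^ N + (lvar p1 - C c * lvar p0) * \<alpha>)"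
proof -
  let ?j = "\<lambda>k. nat (lk k p1)"
  define q where "q = (\<Sum>k\<in>keys r. monom (lk r k) (?j k))"
  have nn: "0 \<le> lk k p0" "0 \<le> lk k p1" "lk k q0 = 0" "lk k q1 = 0" if "k \<in> keys r" for k
    using assms(1) that by (auto simp: D_def polys_def)
  have kform: "k = single p0 (int (N - ?j k)) + single p1 (int (?j k))" "?j k \<le> N"
    if k: "k \<in> keys r" for k
  proof -
    show "?j k \<le> N" using nn[OF k] assms(2)[OF k] by simp
    show "k = single p0 (int (N - ?j k)) + single p1 (int (?j k))"
    proof (rule poly_mapping_eqI)
      fix v
      have "v \<in> {p0, p1, q0, q1}" using all by blast
      then show "lk k v = lk (single p0 (int (N - ?j k)) + single p1 (int (?j k))) v"
        using nn[OF k] assms(2)[OF k] distinct by (auto simp: lookup_add lookup_single "when_def")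
    qed
  qed
  obtain k0 where k0: "k0 \<in> keys r" using assms(3) by fastforce
  have "coeff q (?j k0) = (\<Sum>k\<in>keys r. if k = k0 then lk r k else 0)"
    unfolding q_def coeff_sum coeff_monom
  proof (rule sum.cong)
    fix k assume k: "k \<in> keys r"
    have "?j k = ?j k0 \<longleftrightarrow> k = k0" using kform(1)[OF k] kform(1)[OF k0] by metis
    then show "(if ?j k = ?j k0 then lk r k else 0) = (if k = k0 then lk r k else 0)" by simp
  qed simp
  also have "\<dots> = lk r k0" using k0 by simp
  finally have "q \<noteq> 0" using k0 by (auto simp: in_keys_iff)
  moreover have "\<exists>\<alpha>\<in>polys. r = C (poly q c) * lvar p0 ^ N + (lvar p1 - C c * lvar p0) * \<alpha>" for c
  proof -
    let ?l = "lvar p1 - C c * lvar p0 :: 'a laurent"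
    have "\<exists>\<alpha>\<in>polys. single k (lk r k) = C (lk r k * c ^ ?j k) * lvar p0 ^ N + ?l * \<alpha>"
      if k: "k \<in> keys r" for k
    proof -
      let ?y = "C c * lvar p0 :: 'a laurent"
      define s where "s = (\<Sum>i<?j k. lvar p1 ^ i * ?y ^ (?j k - Suc i))"
      have sp: "s \<in> polys" unfolding s_def by (intro polys_sum polys_mult polys_power polys_lvar polys_C)
      have eq: "lvar p1 ^ ?j k = ?y ^ ?j k + ?l * s"
        using power_diff_sumr2[of "lvar p1" "?j k" ?y] unfolding s_def by (simp add: mult.commute diff_eq_eq add.commute)
      have Cp: "C c ^ n = C (c ^ n)" for n by (induction n) (auto simp: C_simps)
      have "single k (lk r k) = C (lk r k) * (lvar p0 ^ (N - ?j k) * lvar p1 ^ ?j k)"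
        by (subst kform(1)[OF k]) (simp add: X_power mult_single C_def)
      also have "\<dots> = C (lk r k) * (lvar p0 ^ (N - ?j k) * ?y ^ ?j k) + ?l * (C (lk r k) * lvar p0 ^ (N - ?j k) * s)"
        unfolding eq by (simp add: algebra_simps)
      also have "lvar p0 ^ (N - ?j k) * ?y ^ ?j k = C (c ^ ?j k) * lvar p0 ^ N"
        using kform(2)[OF k] by (simp add: power_mult_distrib Cp mult.left_commute power_add[symmetric])
      also have "C (lk r k) * (C (c ^ ?j k) * lvar p0 ^ N) = C (lk r k * c ^ ?j k) * lvar p0 ^ N"
        by (simp add: C_simps mult.assoc)
      finally show ?thesis using sp by (intro bexI[of _ "C (lk r k) * lvar p0 ^ (N - ?j k) * s"] polys_mult polys_power) auto
    qed
    then obtain \<alpha> where \<alpha>: "\<And>k. k \<in> keys r \<Longrightarrow> \<alpha> k \<in> polys"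
        "\<And>k. k \<in> keys r \<Longrightarrow> single k (lk r k) = C (lk r k * c ^ ?j k) * lvar p0 ^ N + ?l * \<alpha> k"
      by metis
    have Csum: "C (sum g K) = (\<Sum>k\<in>K. C (g k))" for g :: "(svar \<Rightarrow>\<^sub>0 int) \<Rightarrow> 'a" and K
      by (induction K rule: infinite_finite_induct) (auto simp: C_simps)
    have "r = (\<Sum>k\<in>keys r. single k (lk r k))" by (rule pm_expand)
    also have "\<dots> = (\<Sum>k\<in>keys r. C (lk r k * c ^ ?j k) * lvar p0 ^ N + ?l * \<alpha> k)"
      by (rule sum.cong) (use \<alpha>(2) in auto)
    also have "\<dots> = (\<Sum>k\<in>keys r. C (lk r k * c ^ ?j k)) * lvar p0 ^ N + ?l * (\<Sum>k\<in>keys r. \<alpha> k)"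
      by (simp only: sum.distrib sum_distrib_left sum_distrib_right)
    also have "(\<Sum>k\<in>keys r. C (lk r k * c ^ ?j k)) = C (poly q c)"
      by (simp add: q_def poly_sum poly_monom Csum)
    finally show ?thesis using polys_sum[of "keys r" \<alpha>] \<alpha>(1) by blast
  qed
  ultimately show ?thesis by blast
qed

text \<open>The elements found by \<open>eliminate\<close> confine the projection of the zeros of
  (g1, g2) to the finitely many zeros of binary forms in \<open>p0\<close>, \<open>p1\<close>. A
  linear form that avoids these shares no zero with the pair, which shows algebraically as powers of
  all products \<open>lvar u * lvar e\<close> in the enlarged ideal.\<close>

lemma generic_linear_form:
  fixes g1 g2 :: "'a::field laurent"
  assumes g: "g1 \<in> polys" "g2 \<in> polys" "g1 \<in> piece a" "g2 \<in> piece a"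
    and wt: "\<And>k. deg k = a \<Longrightarrow> wt k = int n"
    and reg: "regular_pair g1 g2" and inf: "infinite (UNIV :: 'a set)"
  shows "\<exists>c. \<forall>u\<in>{p0, p1}. \<forall>e\<in>{q0, q1}. \<exists>M. (lvar u * lvar e) ^ M \<in> adjoin (ideal2 g1 g2) (lvar p1 - C c * lvar p0)"
proof -
  let ?P = "ideal2 g1 g2"
  have P: "submod ?P" "homog ?P" using submod_ideal2[OF g(1,2)] homog_ideal2[OF g(3,4)] by auto
  have "\<exists>q N m. q \<noteq> 0 \<and> (\<forall>c. \<exists>\<alpha>\<in>polys. (C (poly q c) * lvar p0 ^ N + (lvar p1 - C c * lvar p0) * \<alpha>) * lvar e ^ m \<in> ?P)"
    if e: "e \<in> {q0, q1}" for e
  proof -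
    have "wt k = int n" if "k \<in> keys g1" for k using wt g(3) that by (auto simp: piece_def)
    moreover have "wt k = int n" if "k \<in> keys g2" for k using wt g(4) that by (auto simp: piece_def)
    ultimately obtain r m where r: "r \<in> D" "r \<noteq> 0" "r * lvar e ^ m \<in> ?P"
      using eliminate[OF g(1,2) _ _ reg e, of n] by blast
    obtain k where k: "k \<in> keys r" using r(2) by fastforce
    \<comment> \<open>A bihomogeneous component of \<open>r\<close> works as well because the ideal
      is homogeneous. It is a binary form, as \<open>linear_form_mod\<close> requires.\<close>
    define s where "s = pr (deg k) r"
    have s: "s \<in> D" using r(1) polys_restr[of r "\<lambda>l. deg l = deg k"] by (auto simp: D_def s_def pr_def keys_restr)
    have "k \<in> keys s" using k by (simp add: s_def pr_def keys_restr)
    then have s0: "s \<noteq> 0" by auto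
    have sP: "s * lvar e ^ m \<in> ?P"
    proof -
      define \<kappa> where "\<kappa> = deg (single e (int m))"
      have "pr (deg k + \<kappa>) (lvar e ^ m * r) = lvar e ^ m * s"
        using pr_mult[of "lvar e ^ m :: 'a laurent" \<kappa> "deg k + \<kappa>" r] power_lvar_piece[of e m] by (simp add: s_def \<kappa>_def)
      moreover have "lvar e ^ m * r \<in> ?P" using r(3) by (simp add: mult.commute)
      then have "pr (deg k + \<kappa>) (lvar e ^ m * r) \<in> ?P" using P(2) unfolding homog_def by blast
      ultimately show ?thesis by (simp add: mult.commute)
    qed
    have tot: "lk l p0 + lk l p1 = fst (deg l) + snd (deg l)" if l: "l \<in> keys s" for l
    proof -
      have "(\<Sum>v\<in>{S0, S1, T0, T1}. lk l v) = (\<Sum>v\<in>{p0, p1, q0, q1}. lk l v)"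
        using all UNIV_svar by simp
      then show ?thesis using distinct s l by (auto simp: D_def deg_def)
    qed
    define N where "N = nat (fst (deg k) + snd (deg k))"
    have N: "lk l p0 + lk l p1 = int N" if l: "l \<in> keys s" for l
    proof -
      have "deg l = deg k" using l by (auto simp: s_def pr_def keys_restr)
      moreover have "0 \<le> lk l p0 + lk l p1" using s l by (auto simp: D_def polys_def)
      ultimately show ?thesis using tot[OF l] by (simp add: N_def)
    qed
    show ?thesis using linear_form_mod[OF s N s0] sP by metis
  qed
  from this[of q0] this[of q1] obtain q N m q' N' m' where
    q: "q \<noteq> 0" "\<forall>c. \<exists>\<alpha>\<in>polys. (C (poly q c) * lvar p0 ^ N + (lvar p1 - C c * lvar p0) * \<alpha>) * lvar q0 ^ m \<in> ?P" and
    q': "q' \<noteq> 0" "\<forall>c. \<exists>\<alpha>\<in>polys. (C (poly q' c) * lvar p0 ^ N' + (lvar p1 - C c * lvar p0) * \<alpha>) * lvar q1 ^ m' \<in> ?P"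
    by blast
  \<comment> \<open>One polynomial comes from each of \<open>q0\<close> and \<open>q1\<close>; a
    value that is a root of neither exists in an infinite field.\<close>
  have "finite ({c. poly q c = 0} \<union> {c. poly q' c = 0})" using q q' poly_roots_finite by blast
  then obtain c where c: "poly q c \<noteq> 0" "poly q' c \<noteq> 0" using inf ex_new_if_finite by blast
  let ?l = "lvar p1 - C c * lvar p0 :: 'a laurent"
  have lS: "?l \<in> polys" by (intro polys_diff polys_mult) auto
  let ?E = "adjoin ?P ?l"
  have E: "submod ?E" using submod_adjoin[OF P(1) lS] .
  have lE: "?l * z \<in> ?E" if "z \<in> polys" for z
  proof -
    have "?l * z = 0 + ?l * z" by simp
    then show ?thesis using that submodD(2)[OF P(1)] unfolding adjoin_def by blast
  qed
  have PE: "z \<in> ?E" if "z \<in> ?P" for z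
  proof -
    have "z = z + ?l * 0" by simp
    then show ?thesis using that polys_0 unfolding adjoin_def by blast
  qed
  have fin: "\<exists>M. (lvar u * lvar e) ^ M \<in> ?E"
    if b: "b \<noteq> 0" and al: "\<alpha> \<in> polys" "(C b * lvar p0 ^ N + ?l * \<alpha>) * lvar e ^ m \<in> ?P" and u: "u \<in> {p0, p1}"
    for b \<alpha> N e m u
  proof -
    have "(C b * lvar p0 ^ N + ?l * \<alpha>) * lvar e ^ m - ?l * (\<alpha> * lvar e ^ m) \<in> ?E"
      using al by (intro submodD(6)[OF E] PE lE polys_mult polys_power) auto
    then have "C b * (lvar p0 ^ N * lvar e ^ m) \<in> ?E" by (simp add: algebra_simps)
    then have "C (inverse b) * (C b * (lvar p0 ^ N * lvar e ^ m)) \<in> ?E" by (rule submodD(4)[OF E polys_C])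
    moreover have "C (inverse b) * C b = 1" using b by (simp add: C_simps(4)[symmetric] C_simps(2))
    ultimately have 0: "lvar p0 ^ N * lvar e ^ m \<in> ?E" by (metis mult.assoc mult_1)
    have "lvar u ^ N * lvar e ^ m \<in> ?E"
    proof (cases "u = p0")
      case False
      then have u: "u = p1" using u by simp
      define s where "s = (\<Sum>i<N. lvar p1 ^ i * (C c * lvar p0) ^ (N - Suc i) :: 'a laurent)"
      have sp: "s \<in> polys" unfolding s_def by (intro polys_sum polys_mult polys_power polys_lvar polys_C)
      have eq: "lvar p1 ^ N = (C c * lvar p0) ^ N + ?l * s"
        using power_diff_sumr2[of "lvar p1" N "C c * lvar p0"] unfolding s_def by (simp add: mult.commute diff_eq_eq add.commute)
      have "lvar u ^ N * lvar e ^ m = ((C c * lvar p0) ^ N + ?l * s) * lvar e ^ m"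
        unfolding u by (simp only: eq)
      also have "\<dots> = C c ^ N * (lvar p0 ^ N * lvar e ^ m) + ?l * (s * lvar e ^ m)"
        by (simp add: algebra_simps power_mult_distrib)
      also have "\<dots> \<in> ?E"
        using sp by (intro submodD(3)[OF E submodD(4)[OF E _ 0]] lE polys_mult polys_power) auto
      finally show ?thesis .
    qed (use 0 in simp)
    then have "(lvar u ^ m * lvar e ^ N) * (lvar u ^ N * lvar e ^ m) \<in> ?E"
      by (rule submodD(4)[OF E, rotated]) (intro polys_mult polys_power polys_lvar)
    then have "(lvar u * lvar e) ^ (N + m) \<in> ?E" by (simp add: power_mult_distrib power_add mult_ac)
    then show ?thesis by blast
  qed
  obtain \<alpha> where \<alpha>: "\<alpha> \<in> polys" "(C (poly q c) * lvar p0 ^ N + ?l * \<alpha>) * lvar q0 ^ m \<in> ?P" using q(2) by blast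
  obtain \<alpha>' where \<alpha>': "\<alpha>' \<in> polys" "(C (poly q' c) * lvar p0 ^ N' + ?l * \<alpha>') * lvar q1 ^ m' \<in> ?P" using q'(2) by blast
  have "\<exists>M. (lvar u * lvar e) ^ M \<in> ?E" if u: "u \<in> {p0, p1}" and e: "e \<in> {q0, q1}" for u e
    using fin[OF c(1) \<alpha> u] fin[OF c(2) \<alpha>' u] e by blast
  then show ?thesis by blast
qed

end

lemma bgen_cases: "j < 4 \<Longrightarrow> \<exists>u\<in>{S0, S1}. \<exists>e\<in>{T0, T1}. bgen j = lvar u * lvar e"
  by (auto simp: bgen_def)

text \<open>Take for \<open>w\<close> the product of two linear forms, one for each factor of the
  product of lines, that miss the support. It has bidegree (1, 1), hence is a combination of the
  generators, and powers of each generator lie in the ideal enlarged by either linear form;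
  multiplying two such powers gives one in the ideal enlarged by \<open>w\<close>.\<close>

lemma finite_support_form:
  fixes g1 g2 :: "'a::field laurent"
  assumes g: "g1 \<in> polys" "g2 \<in> polys" "g1 \<in> piece a" "g2 \<in> piece a"
    and reg: "regular_pair g1 g2" and inf: "infinite (UNIV :: 'a set)"
  shows "\<exists>w \<beta>. w = (\<Sum>j<4. \<beta> j * bgen j) \<and> (\<forall>j. \<beta> j \<in> polys) \<and>
     (\<forall>j<4. \<exists>n. \<exists>\<alpha>\<in>polys. \<exists>\<pi>\<in>ideal2 g1 g2. bgen j ^ n = w * \<alpha> + \<pi>)"
proof -
  let ?P = "ideal2 g1 g2"
  have P: "submod ?P" using submod_ideal2[OF g(1,2)] .
  obtain a1 a2 where a: "a = (a1, a2)" by (cases a)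
  have "g1 \<noteq> 0" using reg by (simp add: regular_pair_def)
  then have nn: "0 \<le> a1" "0 \<le> a2" using piece_nonneg[of g1 a1 a2] g a by auto
  interpret ST: two_pairs S0 S1 T0 T1 by unfold_locales (auto simp: UNIV_svar)
  interpret TS: two_pairs T0 T1 S0 S1 by unfold_locales (auto simp: UNIV_svar)
  have "\<exists>c. \<forall>u\<in>{S0, S1}. \<forall>e\<in>{T0, T1}. \<exists>M. (lvar u * lvar e) ^ M \<in> adjoin ?P (lvar S1 - C c * lvar S0)"
    by (rule ST.generic_linear_form[OF g _ reg inf, of "nat a2"]) (use nn in \<open>auto simp: ST.wt_def deg_def a\<close>)
  then obtain c where c: "\<And>u e. u \<in> {S0, S1} \<Longrightarrow> e \<in> {T0, T1} \<Longrightarrow> \<exists>M. (lvar u * lvar e) ^ M \<in> adjoin ?P (lvar S1 - C c * lvar S0)"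
    by blast
  have "\<exists>c. \<forall>u\<in>{T0, T1}. \<forall>e\<in>{S0, S1}. \<exists>M. (lvar u * lvar e) ^ M \<in> adjoin ?P (lvar T1 - C c * lvar T0)"
    by (rule TS.generic_linear_form[OF g _ reg inf, of "nat a1"]) (use nn in \<open>auto simp: TS.wt_def deg_def a\<close>)
  then obtain c' where c': "\<And>u e. u \<in> {T0, T1} \<Longrightarrow> e \<in> {S0, S1} \<Longrightarrow> \<exists>M. (lvar u * lvar e) ^ M \<in> adjoin ?P (lvar T1 - C c' * lvar T0)"
    by blast
  let ?l = "lvar S1 - C c * lvar S0 :: 'a laurent" and ?l' = "lvar T1 - C c' * lvar T0 :: 'a laurent"
  \<comment> \<open>The coefficients of the expanded product of the two linear forms, in the order
    of \<open>bgen\<close>.\<close>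
  define \<beta> where "\<beta> j = (if j = 3 then 1 else if j = 2 then - C c' else if j = 1 then - C c else C c * C c' :: 'a laurent)" for j :: nat
  have "?l * ?l' = (\<Sum>j<4. \<beta> j * bgen j)"
  proof -
    have "{..<4} = {0, 1, 2, 3::nat}" by auto
    then have "(\<Sum>j<4. \<beta> j * bgen j) = \<beta> 0 * bgen 0 + \<beta> 1 * bgen 1 + \<beta> 2 * bgen 2 + \<beta> 3 * bgen 3" by simp
    then show ?thesis by (simp add: \<beta>_def bgen_def algebra_simps)
  qed
  moreover have "\<forall>j. \<beta> j \<in> polys" by (auto simp: \<beta>_def intro: polys_uminus polys_mult)
  moreover have "\<exists>n. \<exists>\<alpha>\<in>polys. \<exists>\<pi>\<in>?P. bgen j ^ n = ?l * ?l' * \<alpha> + \<pi>" if j: "j < 4" for j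
  proof -
    obtain u e where ue: "u \<in> {S0, S1}" "e \<in> {T0, T1}" "bgen j = (lvar u * lvar e :: 'a laurent)" using bgen_cases[OF j] by blast
    obtain M where "bgen j ^ M \<in> adjoin ?P ?l" using c[OF ue(1,2)] ue(3) by auto
    then obtain \<pi> \<alpha> where 1: "\<pi> \<in> ?P" "\<alpha> \<in> polys" "bgen j ^ M = \<pi> + ?l * \<alpha>" by (auto simp: adjoin_def)
    obtain M' where "bgen j ^ M' \<in> adjoin ?P ?l'" using c'[OF ue(2,1)] ue(3) by (auto simp: mult.commute)
    then obtain \<pi>' \<alpha>' where 2: "\<pi>' \<in> ?P" "\<alpha>' \<in> polys" "bgen j ^ M' = \<pi>' + ?l' * \<alpha>'" by (auto simp: adjoin_def)
    have "bgen j ^ (M + M') = (\<pi> + ?l * \<alpha>) * (\<pi>' + ?l' * \<alpha>')" by (simp only: power_add 1 2)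
    also have "\<dots> = ?l * ?l' * (\<alpha> * \<alpha>') + ((\<pi>' + ?l' * \<alpha>') * \<pi> + (?l * \<alpha>) * \<pi>')"
      by (simp add: algebra_simps)
    finally have "bgen j ^ (M + M') = ?l * ?l' * (\<alpha> * \<alpha>') + ((\<pi>' + ?l' * \<alpha>') * \<pi> + (?l * \<alpha>) * \<pi>')" .
    moreover have "(\<pi>' + ?l' * \<alpha>') * \<pi> + (?l * \<alpha>) * \<pi>' \<in> ?P"
      using 1 2 submodD(1)[OF P 2(1)]
      by (intro submodD(3)[OF P submodD(4)[OF P _ 1(1)] submodD(4)[OF P _ 2(1)]] polys_add polys_mult polys_diff) auto
    moreover have "\<alpha> * \<alpha>' \<in> polys" using 1 2 by (intro polys_mult)
    ultimately show ?thesis by blast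
  qed
  ultimately show ?thesis by blast
qed

text \<open>Here \<open>c * h\<close> is the gcd of the three \<open>u\<close>, and \<open>c\<close>
  its gcd with \<open>f\<close>. For a prime dividing \<open>v1\<close> at most one \<open>x\<close>
  is bad: with two, the prime would divide \<open>v3\<close>, hence \<open>v2\<close>, against the
  coprimality of the triple. There are finitely many such primes, so some \<open>x\<close> is good
  for all of them.\<close>

lemma common_factors:
  fixes u1 u2 u3 f :: "'b::{factorial_ring_gcd,semiring_gcd_mult_normalize}" and \<gamma> :: "'c \<Rightarrow> 'b"
  assumes u1: "u1 \<noteq> 0" and inf: "infinite (UNIV :: 'c set)" and unit: "\<And>x y. x \<noteq> y \<Longrightarrow> \<gamma> x - \<gamma> y dvd 1"
  shows "\<exists>c h v1 v2 v3 f' x. u1 = c * h * v1 \<and> u2 = c * h * v2 \<and> u3 = c * h * v3 \<and> f = c * f' \<and>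
    coprime h f' \<and> coprime v1 (v2 + \<gamma> x * v3)"
proof -
  define g where "g = gcd u1 (gcd u2 u3)"
  have g0: "g \<noteq> 0" using u1 by (simp add: g_def)
  have "g dvd u1" unfolding g_def by (rule gcd_dvd1)
  moreover have "g dvd u2" unfolding g_def by (rule dvd_trans[OF gcd_dvd2 gcd_dvd1])
  moreover have "g dvd u3" unfolding g_def by (rule dvd_trans[OF gcd_dvd2 gcd_dvd2])
  ultimately obtain v1 v2 v3 where v: "u1 = g * v1" "u2 = g * v2" "u3 = g * v3" by (auto simp: dvd_def)
  have one: "d dvd 1" if "d dvd v1" "d dvd v2" "d dvd v3" for d
  proof -
    have "g * d dvd gcd u1 (gcd u2 u3)" using that by (intro gcd_greatest) (simp_all add: v mult_dvd_mono)
    then have "g * d dvd g" by (simp only: g_def)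
    then show ?thesis using g0 by simp
  qed
  have v1: "v1 \<noteq> 0" using u1 v by auto
  have "gcd g f \<noteq> 0" using g0 by simp
  then obtain h f' where hf: "g = h * gcd g f" "f = f' * gcd g f" "coprime h f'"
    using gcd_coprime_exists by blast
  define bad where "bad q = {x. q dvd v2 + \<gamma> x * v3}" for q
  have "finite (bad q)" if q: "prime q" "q dvd v1" for q
  proof -
    have "x = y" if "x \<in> bad q" "y \<in> bad q" for x y
    proof (rule ccontr)
      assume "x \<noteq> y"
      then obtain t where t: "1 = (\<gamma> x - \<gamma> y) * t" using unit by (auto simp: dvd_def)
      have "q dvd (v2 + \<gamma> x * v3) - (v2 + \<gamma> y * v3)" using that by (intro dvd_diff) (auto simp: bad_def)
      then have "q dvd (\<gamma> x - \<gamma> y) * v3" by (simp add: algebra_simps)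
      then have "q dvd ((\<gamma> x - \<gamma> y) * v3) * t" by (rule dvd_mult2)
      then have "q dvd ((\<gamma> x - \<gamma> y) * t) * v3" by (simp only: mult_ac)
      then have q3: "q dvd v3" using t by simp
      then have "q dvd (v2 + \<gamma> x * v3) - \<gamma> x * v3" using that by (intro dvd_diff) (auto simp: bad_def)
      then have "q dvd v2" by simp
      then show False using one q q3 not_prime_unit by blast
    qed
    then have "bad q = {} \<or> (\<exists>x. bad q = {x})" by blast
    then show ?thesis by auto
  qed
  then have "finite (\<Union>q\<in>{q. prime q \<and> q dvd v1}. bad q)"
    using finite_prime_divisors[OF v1] by (intro finite_UN_I) auto
  then obtain x where x: "x \<notin> (\<Union>q\<in>{q. prime q \<and> q dvd v1}. bad q)" using inf ex_new_if_finite by blast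
  have "coprime v1 (v2 + \<gamma> x * v3)"
  proof (rule coprimeI)
    fix d assume d: "d dvd v1" "d dvd v2 + \<gamma> x * v3"
    show "is_unit d"
    proof (rule ccontr)
      assume "\<not> is_unit d"
      moreover have "d \<noteq> 0" using d(1) v1 by auto
      ultimately obtain q where "q dvd d" "prime q" using prime_divisor_exists by blast
      then show False using d x by (auto simp: bad_def dest: dvd_trans)
    qed
  qed
  moreover have "u1 = gcd g f * h * v1" "u2 = gcd g f * h * v2" "u3 = gcd g f * h * v3" "f = gcd g f * f'"
    using v hf by (metis mult.commute)+
  ultimately show ?thesis using hf(3) by blast
qed

section \<open>Iterated univariate polynomials as a model of the polynomial ring\<close>

definition ring_hom_on :: "('a::comm_ring_1 \<Rightarrow> 'b::comm_ring_1) \<Rightarrow> bool" where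
  "ring_hom_on h \<longleftrightarrow> h 1 = 1 \<and> (\<forall>a b. h (a + b) = h a + h b) \<and> (\<forall>a b. h (a * b) = h a * h b)"

lemma ring_hom_onD:
  assumes "ring_hom_on h"
  shows "h 0 = 0" "h 1 = 1" "h (a + b) = h a + h b" "h (a * b) = h a * h b" "h (- a) = - h a" "h (a - b) = h a - h b"
proof -
  show a: "h (a + b) = h a + h b" for a b using assms by (simp add: ring_hom_on_def)
  show 0: "h 0 = 0" using a[of 0 0] by simp
  show m: "h (- a) = - h a" for a using a[of a "- a"] 0 by (simp add: add_eq_0_iff2)
  show "h (a - b) = h a - h b" using a[of a "- b"] m by simp
qed (use assms in \<open>auto simp: ring_hom_on_def\<close>)

definition eval_poly :: "('a::comm_ring_1 \<Rightarrow> 'b::comm_ring_1) \<Rightarrow> 'b \<Rightarrow> 'a poly \<Rightarrow> 'b" where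
  "eval_poly h t p = poly (map_poly h p) t"

lemma eval_poly_0 [simp]: "eval_poly h t 0 = 0"
  by (simp add: eval_poly_def)

lemma eval_poly_pCons: "ring_hom_on h \<Longrightarrow> eval_poly h t (pCons a p) = h a + t * eval_poly h t p"
  by (simp add: eval_poly_def map_poly_pCons ring_hom_onD)

lemma ring_hom_eval_poly:
  assumes h: "ring_hom_on h"
  shows "ring_hom_on (eval_poly h t)"
proof -
  note [simp] = eval_poly_pCons[OF h] ring_hom_onD[OF h]
  have add: "eval_poly h t (p + q) = eval_poly h t p + eval_poly h t q" for p q
    by (induction p q rule: poly_induct2) (simp_all add: algebra_simps)
  have smult: "eval_poly h t (smult a p) = h a * eval_poly h t p" for a p
    by (induction p) (simp_all add: algebra_simps)
  have mult: "eval_poly h t (p * q) = eval_poly h t p * eval_poly h t q" for p q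
    by (induction p) (simp_all add: add smult algebra_simps)
  have "eval_poly h t 1 = 1" unfolding one_pCons by simp
  then show ?thesis using add mult by (simp add: ring_hom_on_def)
qed

lemma eval_poly_const: "ring_hom_on h \<Longrightarrow> eval_poly h t [:a:] = h a"
  by (simp add: eval_poly_pCons)

lemma eval_poly_X: "ring_hom_on h \<Longrightarrow> eval_poly h t [:0, 1:] = t"
  by (simp add: eval_poly_pCons ring_hom_onD)

lemma ring_hom_C: "ring_hom_on C"
  by (simp add: ring_hom_on_def C_simps)

definition supported :: "svar set \<Rightarrow> 'a::comm_ring_1 laurent set" where
  "supported V = {x\<in>polys. \<forall>k\<in>keys x. \<forall>v. v \<notin> V \<longrightarrow> lk k v = 0}"

lemma supported_eval:
  assumes h: "ring_hom_on h" and s: "\<And>a. h a \<in> supported V"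
  shows "eval_poly h (lvar v) p \<in> supported (insert v V)"
proof (induction p)
  case 0
  show ?case by (simp add: supported_def)
next
  case (pCons a p)
  have "lk k u = 0" if k: "k \<in> keys (lvar v * eval_poly h (lvar v) p)" and u: "u \<notin> insert v V" for k u
  proof -
    obtain l m where "l \<in> keys (lvar v :: 'b laurent)" "m \<in> keys (eval_poly h (lvar v) p)" "k = l + m"
      using keys_multD[OF k] by blast
    then show ?thesis using pCons(2) u
      by (auto simp: lvar_def lookup_add lookup_single supported_def split: if_splits)
  qed
  moreover have "lk k u = 0" if "k \<in> keys (h a)" "u \<notin> insert v V" for k u
    using s[of a] that by (auto simp: supported_def)
  ultimately have "lk k u = 0" if "k \<in> keys (h a + lvar v * eval_poly h (lvar v) p)" "u \<notin> insert v V" for k u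
    using keys_addD[OF that(1)] that(2) by blast
  moreover have "h a + lvar v * eval_poly h (lvar v) p \<in> polys"
    using s[of a] pCons(2) by (auto simp: supported_def intro!: polys_add polys_mult)
  ultimately show ?case unfolding eval_poly_pCons[OF h] by (auto simp: supported_def)
qed

text \<open>The image of the constant coefficient is the part free of \<open>v\<close>, since all
  other terms carry a positive power of \<open>v\<close>. Restriction separates it, and the variable
  can then be cancelled from the rest.\<close>

lemma inj_eval:
  fixes h :: "'a::comm_ring_1 \<Rightarrow> 'b::field laurent"
  assumes h: "ring_hom_on h" and s: "\<And>a. h a \<in> supported V" and v: "v \<notin> V" and inj: "\<And>a. h a = 0 \<Longrightarrow> a = 0"
  shows "eval_poly h (lvar v) p = 0 \<Longrightarrow> p = 0"
proof (induction p)
  case (pCons a p)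
  let ?y = "eval_poly h (lvar v) p"
  have 0: "h a + lvar v * ?y = 0" using pCons.prems by (simp add: eval_poly_pCons[OF h])
  have "lk k v \<noteq> 0" if k: "k \<in> keys (lvar v * ?y)" for k
  proof -
    obtain l m where "l \<in> keys (lvar v :: 'b laurent)" "m \<in> keys ?y" "k = l + m"
      using keys_multD[OF k] by blast
    then have "lk k v = 1 + lk m v" "0 \<le> lk m v" using supported_eval[OF h s, of v p]
      by (auto simp: lvar_def lookup_add supported_def polys_def split: if_splits)
    then show ?thesis by simp
  qed
  then have "restr (\<lambda>k. lk k v = 0) (lvar v * ?y) = 0" by (intro restr_none)
  moreover have "restr (\<lambda>k. lk k v = 0) (h a) = h a" using s[of a] v by (intro restr_id) (auto simp: supported_def)
  ultimately have "h a = restr (\<lambda>k. lk k v = 0) (h a + lvar v * ?y)" by (simp add: restr_add)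
  then have ha: "h a = 0" using 0 by simp
  moreover have "lvar v \<noteq> (0 :: 'b laurent)" using lvar_unit[of v] by (metis mult_zero_left zero_neq_one)
  ultimately have "?y = 0" using 0 by simp
  then show ?case using pCons.IH inj[OF ha] by simp
qed simp

text \<open>An isomorphism onto \<open>polys\<close>, through which gcds and prime factors of
  iterated polynomials are carried to polynomials inside the Laurent ring.\<close>

definition nest :: "'a::comm_ring_1 poly poly poly poly \<Rightarrow> 'a laurent" where
  "nest = eval_poly (eval_poly (eval_poly (eval_poly C (lvar S0)) (lvar S1)) (lvar T0)) (lvar T1)"

lemma ring_hom_nest: "ring_hom_on nest"
  unfolding nest_def by (intro ring_hom_eval_poly ring_hom_C)

lemma nest_levels:
  fixes dummy :: "'a::field itself"
  shows "\<And>p :: 'a poly poly poly poly. nest p \<in> polys" "\<And>p :: 'a poly poly poly poly. nest p = 0 \<Longrightarrow> p = 0"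
proof -
  let ?h1 = "eval_poly C (lvar S0) :: 'a poly \<Rightarrow> 'a laurent"
  let ?h2 = "eval_poly ?h1 (lvar S1)" let ?h3 = "eval_poly ?h2 (lvar T0)"
  have h: "ring_hom_on ?h1" "ring_hom_on ?h2" "ring_hom_on ?h3" by (intro ring_hom_eval_poly ring_hom_C)+
  have s0: "C a \<in> supported {}" for a :: 'a by (auto simp: supported_def C_def split: if_splits intro!: polys_single)
  have i0: "C a = 0 \<Longrightarrow> a = 0" for a :: 'a by (metis C_def lookup_single_eq lookup_zero)
  note s1 = supported_eval[OF ring_hom_C s0, of S0] and i1 = inj_eval[OF ring_hom_C s0 _ i0, of S0]
  note s2 = supported_eval[OF h(1) s1, of S1] and i2 = inj_eval[OF h(1) s1 _ i1, of S1]
  note s3 = supported_eval[OF h(2) s2, of T0] and i3 = inj_eval[OF h(2) s2 _ i2, of T0]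
  note s4 = supported_eval[OF h(3) s3, of T1] and i4 = inj_eval[OF h(3) s3 _ i3, of T1]
  show "nest p \<in> polys" for p :: "'a poly poly poly poly"
    using s4[of p] by (simp add: nest_def supported_def)
  show "nest p = 0 \<Longrightarrow> p = 0" for p :: "'a poly poly poly poly"
    using i4[of p] by (simp add: nest_def)
qed

lemma nest_surj:
  fixes x :: "'a::field laurent"
  assumes "x \<in> polys"
  shows "\<exists>p. nest p = x"
proof -
  note hom = ring_hom_onD[OF ring_hom_nest]
  let ?h1 = "eval_poly C (lvar S0) :: 'a poly \<Rightarrow> 'a laurent"
  let ?h2 = "eval_poly ?h1 (lvar S1)" let ?h3 = "eval_poly ?h2 (lvar T0)"
  have h: "ring_hom_on ?h1" "ring_hom_on ?h2" "ring_hom_on ?h3" by (intro ring_hom_eval_poly ring_hom_C)+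
  note ev = eval_poly_const[OF ring_hom_C] eval_poly_const[OF h(1)] eval_poly_const[OF h(2)] eval_poly_const[OF h(3)]
    eval_poly_X[OF ring_hom_C] eval_poly_X[OF h(1)] eval_poly_X[OF h(2)] eval_poly_X[OF h(3)]
  let ?R = "range (nest :: 'a poly poly poly poly \<Rightarrow> _)"
  have RC: "C a \<in> ?R" for a
    by (rule range_eqI[of _ _ "[:[:[:[:a:]:]:]:]"]) (simp add: nest_def ev)
  have "lvar S0 \<in> ?R" by (rule range_eqI[of _ _ "[:[:[:[:0, 1:]:]:]:]"]) (simp add: nest_def ev)
  moreover have "lvar S1 \<in> ?R" by (rule range_eqI[of _ _ "[:[:[:0, 1:]:]:]"]) (simp add: nest_def ev)
  moreover have "lvar T0 \<in> ?R" by (rule range_eqI[of _ _ "[:[:0, 1:]:]"]) (simp add: nest_def ev)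
  moreover have "lvar T1 \<in> ?R" by (rule range_eqI[of _ _ "[:0, 1:]"]) (simp add: nest_def ev)
  ultimately have RX: "lvar v \<in> ?R" for v by (cases v) auto
  have Radd: "a + b \<in> ?R" if "a \<in> ?R" "b \<in> ?R" for a b using that by (auto simp: hom(3)[symmetric])
  have Rmul: "a * b \<in> ?R" if "a \<in> ?R" "b \<in> ?R" for a b using that by (auto simp: hom(4)[symmetric])
  have R1: "1 \<in> ?R" by (rule range_eqI[of _ _ 1]) (simp add: hom)
  have R0: "0 \<in> ?R" by (rule range_eqI[of _ _ 0]) (simp add: hom)
  have Rpow: "a ^ n \<in> ?R" if "a \<in> ?R" for a n using that by (induction n) (auto intro: R1 Rmul)
  have mono: "single k c \<in> ?R" if k: "\<And>v. 0 \<le> lk k v" for k c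
  proof -
    have "lvar v ^ n = (single (single v (int n)) 1 :: 'a laurent)" for v n
      by (simp add: two_pairs.X_power[of S0 S1 T0 T1] two_pairs_def UNIV_svar)
    note Xp = this
    have "k = single S0 (lk k S0) + single S1 (lk k S1) +
        single T0 (lk k T0) + single T1 (lk k T1)"
    proof (rule poly_mapping_eqI)
      fix v show "lk k v = lk (single S0 (lk k S0) + single S1 (lk k S1) +
        single T0 (lk k T0) + single T1 (lk k T1)) v"
        by (cases v) (auto simp: lookup_add lookup_single)
    qed
    then have "single k c = C c * (lvar S0 ^ nat (lk k S0) * lvar S1 ^ nat (lk k S1) *
        lvar T0 ^ nat (lk k T0) * lvar T1 ^ nat (lk k T1))"
      using k by (simp add: Xp mult_single C_def)
    also have "\<dots> \<in> ?R" by (intro Rmul RC Rpow RX)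
    finally show ?thesis .
  qed
  have "(\<Sum>k\<in>K. single k (lk x k)) \<in> ?R" if "finite K" "K \<subseteq> keys x" for K
    using that assms by (induction K rule: finite_induct) (auto intro!: R0 Radd mono simp: polys_def)
  then have "x \<in> ?R" by (subst pm_expand) simp
  then show ?thesis by auto
qed

text \<open>\<open>common_factors\<close> applied to the preimages under \<open>nest\<close>, with
  constants as the shifts: differences of distinct constants are units. Coprimality returns as a
  cancellation property for elements of \<open>polys\<close>.\<close>

lemma factor_forms:
  fixes u1 u2 u3 f :: "'a::{field,factorial_ring_gcd,semiring_gcd_mult_normalize} laurent"
  assumes u1: "u1 \<noteq> 0" and p: "u1 \<in> polys" "u2 \<in> polys" "u3 \<in> polys" "f \<in> polys"
    and inf: "infinite (UNIV :: 'a set)"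
  obtains c h v1 v2 v3 f' x where "u1 = c * h * v1" "u2 = c * h * v2" "u3 = c * h * v3" "f = c * f'"
    "c \<in> polys" "h \<in> polys" "v1 \<in> polys" "v2 \<in> polys" "v3 \<in> polys" "f' \<in> polys"
    "\<And>a b. a \<in> polys \<Longrightarrow> b \<in> polys \<Longrightarrow> h * a = f' * b \<Longrightarrow> \<exists>z\<in>polys. b = h * z"
    "regular_pair v1 (v2 + C x * v3)"
proof -
  note hom = ring_hom_onD[OF ring_hom_nest]
  obtain U1 U2 U3 F where U: "nest U1 = u1" "nest U2 = u2" "nest U3 = u3" "nest F = f"
    using nest_surj p by metis
  have "U1 \<noteq> 0" using u1 U hom(1) by auto
  moreover have "([:[:[:[:x:]:]:]:] - [:[:[:[:y:]:]:]:] :: 'a poly poly poly poly) dvd 1" if "x \<noteq> y" for x y :: 'a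
  proof -
    have "([:[:[:[:x:]:]:]:] - [:[:[:[:y:]:]:]:]) * [:[:[:[:inverse (x - y):]:]:]:] = (1 :: 'a poly poly poly poly)"
      using that by (simp add: one_pCons)
    then show ?thesis by (metis dvd_triv_left)
  qed
  ultimately obtain c h v1 v2 v3 f' and x :: 'a where
    eq: "U1 = c * h * v1" "U2 = c * h * v2" "U3 = c * h * v3" "F = c * f'"
    and cop: "coprime h f'" "coprime v1 (v2 + [:[:[:[:x:]:]:]:] * v3)"
    using common_factors[of U1 "\<lambda>x. [:[:[:[:x:]:]:]:]" U2 U3 F, OF _ inf] by blast
  have nx: "nest [:[:[:[:x:]:]:]:] = C x"
    unfolding nest_def by (simp add: eval_poly_const ring_hom_eval_poly ring_hom_C)
  have inj: "nest a = nest b \<Longrightarrow> a = b" for a b :: "'a poly poly poly poly"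
    using nest_levels(2)[of "a - b"] by (simp add: hom)
  have cancel: "\<exists>z\<in>polys. b = nest h * z" if c: "coprime h g" and ab: "a \<in> polys" "b \<in> polys" "nest h * a = nest g * b"
    for h g :: "'a poly poly poly poly" and a b
  proof -
    obtain A B where AB: "nest A = a" "nest B = b" using nest_surj ab by metis
    have "nest (h * A) = nest (g * B)" using ab(3) AB by (simp add: hom)
    then have "h * A = g * B" by (rule inj)
    then have "h dvd g * B" by (metis dvd_triv_left)
    then have "h dvd B" using c by (simp add: coprime_dvd_mult_right_iff)
    then obtain Z where "B = h * Z" by (auto simp: dvd_def)
    then show ?thesis using AB nest_levels(1) hom(4) by metis
  qed
  show ?thesis
  proof (rule that[of "nest c" "nest h" "nest v1" "nest v2" "nest v3" "nest f'" x])
    show "u1 = nest c * nest h * nest v1" "u2 = nest c * nest h * nest v2" "u3 = nest c * nest h * nest v3"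
      "f = nest c * nest f'" using U eq by (auto simp: hom)
    show "\<exists>z\<in>polys. b = nest h * z" if "a \<in> polys" "b \<in> polys" "nest h * a = nest f' * b" for a b
      using cancel[OF cop(1) that] .
    have "u1 = nest c * nest h * nest v1" using U eq by (auto simp: hom)
    then have "nest v1 \<noteq> 0" using u1 by auto
    moreover have "nest v2 + C x * nest v3 = nest (v2 + [:[:[:[:x:]:]:]:] * v3)" by (simp only: hom nx)
    ultimately show "regular_pair (nest v1) (nest v2 + C x * nest v3)"
      using cancel[OF cop(2)] unfolding regular_pair_def by metis
  qed (auto intro: nest_levels)
qed

text \<open>All ideals here contain P = (v1, v2), which has finite support, so their quotients have
  cohomology only in degrees 0 and 1. Degree 1 of S/Q' is covered by degree 1 of S/P; degree 0 goes
  through both colon ideals down to S/P.\<close>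

lemma cvanish_linked:
  fixes v1 v2 v3 f h :: "'a::field laurent"
  assumes p: "v1 \<in> polys" "v2 \<in> polys" "v3 \<in> polys" "f \<in> polys" "h \<in> polys" and h0: "h \<noteq> 0"
    and pc: "v1 \<in> piece (a1, a2)" "v2 \<in> piece (a1, a2)" "v3 \<in> piece (a1, a2)" "f \<in> piece (b1 + a1, b2 + a2)" "h \<in> piece (b1, b2)"
    and nn: "0 \<le> a1" "0 \<le> a2" "0 \<le> b1" "0 \<le> b2"
    and reg: "regular_pair v1 v2" and inf: "infinite (UNIV :: 'a set)"
    and n: "a1 + b1 - 1 \<le> n1" "a2 + b2 - 1 \<le> n2" "2 * a1 + 2 * b1 - 1 \<le> n1 \<or> 2 * a2 + 2 * b2 - 1 \<le> n2"
  shows "cvanish polys (times h ` colon (adjoin (ideal2 v1 v2) v3) f) (n1, n2) i"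
proof -
  let ?a = "(a1, a2)" and ?b = "(b1, b2)" and ?\<nu> = "(n1, n2)" and ?S = "polys :: 'a laurent set"
  let ?P = "ideal2 v1 v2" let ?I = "adjoin ?P v3" let ?Q = "colon ?P v3" let ?Q' = "colon ?I f"
  have P: "submod ?P" "homog ?P" using submod_ideal2 homog_ideal2 p pc by blast+
  have I: "submod ?I" "homog ?I" using submod_adjoin homog_adjoin P p pc by blast+
  have Q: "submod ?Q" "homog ?Q" using submod_colon homog_colon P pc by blast+
  have Q': "submod ?Q'" "homog ?Q'" using submod_colon homog_colon I pc by blast+
  have PQ: "?P \<subseteq> ?Q" using submodD[OF P(1)] p by (auto simp: colon_def)
  have PI: "?P \<subseteq> ?I"
  proof
    fix z assume "z \<in> ?P"
    moreover have "z = z + v3 * 0" by simp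
    ultimately show "z \<in> ?I" using polys_0 unfolding adjoin_def by blast
  qed
  have PQ': "?P \<subseteq> ?Q'" using PI submodD[OF I(1)] submodD(1)[OF P(1)] p by (auto simp: colon_def)
  have QS: "?Q \<subseteq> ?S" "?Q' \<subseteq> ?S" by (auto simp: colon_def)
  obtain w \<beta> where w: "w = (\<Sum>j<4. \<beta> j * bgen j)" "\<And>j. \<beta> j \<in> ?S"
      "\<And>j. j < 4 \<Longrightarrow> \<exists>n. \<exists>\<alpha>\<in>polys. \<exists>\<pi>\<in>?P. bgen j ^ n = w * \<alpha> + \<pi>"
    using finite_support_form[OF p(1,2) pc(1,2) reg inf] by blast
  note high = cvanish_finite_support[OF _ _ _ _ P(1) _ _ w]
  have S: "cvanish ?S {0} (m1, m2) j" if "-1 \<le> m1" "-1 \<le> m2" for m1 m2 j using cvanish_polys[OF that] .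
  have S3: "cvanish ?S {0} (m1, m2) 3" if "-1 \<le> m1 \<or> -1 \<le> m2" for m1 m2 using cvanish_polys_3[OF that] .
  \<comment> \<open>The alternative is the condition for degree 3 of S in the bidegree shifted by
    twice \<open>a\<close>.\<close>
  have PS1: "cvanish ?S ?P (m1, m2) 1" if "a1 - 1 \<le> m1" "a2 - 1 \<le> m2" "2 * a1 - 1 \<le> m1 \<or> 2 * a2 - 1 \<le> m2" for m1 m2
  proof (rule cvanish_koszul[OF p(1,2) pc(1,2) reg])
    show "cvanish ?S {0} (m1, m2) 1" using that nn by (intro S) auto
    show "cvanish ?S {0} ((m1, m2) - ?a) (1 + 1)" using that nn by (auto intro!: S)
    have "cvanish ?S {0} (m1 - a1 - a1, m2 - a2 - a2) 3" using that nn by (intro S3) auto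
    then show "cvanish ?S {0} ((m1, m2) - ?a - ?a) (1 + 2)" by simp
  qed
  have PS0: "cvanish ?S ?P (m1, m2) 0" if "2 * a1 - 1 \<le> m1" "2 * a2 - 1 \<le> m2" for m1 m2
    using that nn by (intro cvanish_koszul[OF p(1,2) pc(1,2) reg]) (auto intro!: S)
  have "cvanish ?S ?Q ?\<nu> 1"
    by (rule cvanish_quotient[OF P(1) Q(1) submod_polys PQ QS(1) PS1])
      (use n nn Q P PQ in \<open>auto intro!: high\<close>)
  \<comment> \<open>At \<open>\<nu> + a\<close> the two bounds of \<open>PS0\<close> follow from
    \<open>a1 + b1 - 1 \<le> n1\<close> and \<open>a2 + b2 - 1 \<le> n2\<close>.\<close>
  then have "cvanish ?S ?I (?\<nu> + ?a) 0"
    using n nn by (intro cvanish_adjoin_0[OF P p(3) pc(3)]) (auto intro!: PS0)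
  \<comment> \<open>The form \<open>f\<close> has bidegree \<open>a + b\<close>, so the colon ideal
    in bidegree \<open>\<nu> - b\<close> leads to exactly \<open>\<nu> + a\<close>.\<close>
  then have I0: "cvanish ?S ?I (?\<nu> - ?b + (b1 + a1, b2 + a2)) 0" by simp
  have "cvanish ?S ?Q' (?\<nu> - ?b) i"
  proof -
    consider "i < 0" | "i = 0" | "i = 1" | "2 \<le> i" by linarith
    then show ?thesis
    proof cases
      case 1
      then show ?thesis by (rule cvanish_neg)
    next
      case 2
      then show ?thesis using cvanish_colon_0[OF I(1) p(4) pc(4) I0] by simp
    next
      case 3
      have "cvanish ?S ?Q' (n1 - b1, n2 - b2) 1"
        by (rule cvanish_quotient[OF P(1) Q'(1) submod_polys PQ' QS(2) PS1])
          (use n nn Q' P PQ' in \<open>auto intro!: high\<close>)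
      then show ?thesis using 3 by simp
    next
      case 4
      then show ?thesis using Q' PQ' QS by (intro high) auto
    qed
  qed
  then show ?thesis
    using n nn by (intro cvanish_scale[OF Q'(1) h0 p(5) pc(5)]) (auto intro!: S)
qed

section \<open>The ideal of syzygies\<close>

text \<open>The defining relations of the symmetric algebra, specialized at x_i =
  \<open>\<xi> i\<close>.\<close>

definition syz_ideal :: "('i::finite \<Rightarrow> 'a::comm_ring_1 laurent) \<Rightarrow> ('i \<Rightarrow> 'a) \<Rightarrow> 'a laurent set" where
  "syz_ideal f \<xi> = {\<Sum>i\<in>UNIV. g i * C (\<xi> i) | g. (\<forall>i. g i \<in> polys) \<and> (\<Sum>i\<in>UNIV. g i * f i) = 0}"

lemma cvanish_self: "submod M \<Longrightarrow> cvanish M M \<nu> i"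
  by (auto simp: cvanish_def intro!: exI[of _ "\<lambda>_. 0"])

text \<open>Rewriting a syzygy in terms of the \<open>u i\<close> leaves \<open>f k\<close> with the
  coefficient \<open>\<Sum>i. g i * \<xi> i / \<xi> k\<close>, which is the specialized relation up
  to the constant \<open>\<xi> k\<close>. Conversely the coefficients other than \<open>g k\<close>
  are free, and \<open>g k\<close> adjusts this value.\<close>

lemma syz_ideal_colon:
  fixes f :: "'i::finite \<Rightarrow> 'a::field laurent"
  assumes k: "\<xi> k \<noteq> 0" and f: "\<And>i. f i \<in> polys"
  defines "u \<equiv> \<lambda>i. f i - C (\<xi> i / \<xi> k) * f k"
  shows "syz_ideal f \<xi> = {q\<in>polys. \<exists>a. (\<forall>i. a i \<in> polys) \<and> f k * q = (\<Sum>i\<in>UNIV - {k}. a i * u i)}"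
proof -
  let ?K = "UNIV - {k}" and ?\<eta> = "\<lambda>i. C (\<xi> i / \<xi> k) :: 'a laurent"
  have split: "sum F UNIV = F k + sum F ?K" for F :: "'i \<Rightarrow> 'a laurent" by (simp add: sum.remove)
  have Ck: "C (\<xi> k) * C (inverse (\<xi> k)) = 1" using k by (simp add: C_simps(2,4)[symmetric])
  have C\<xi>: "(\<Sum>i\<in>UNIV. g i * C (\<xi> i)) = C (\<xi> k) * (\<Sum>i\<in>UNIV. g i * ?\<eta> i)" for g
  proof -
    have "g i * C (\<xi> i) = C (\<xi> k) * (g i * ?\<eta> i)" for i
    proof -
      have "C (\<xi> i) = C (\<xi> k) * ?\<eta> i" using k by (simp add: C_simps(4)[symmetric])
      then show ?thesis by (simp only: mult.left_commute)
    qed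
    then show ?thesis by (simp only: sum_distrib_left)
  qed
  have \<eta>k: "?\<eta> k = 1" using k by (simp add: C_simps)
  have id: "(\<Sum>i\<in>UNIV. g i * f i) = (\<Sum>i\<in>?K. g i * u i) + (\<Sum>i\<in>UNIV. g i * ?\<eta> i) * f k" for g
  proof -
    have "(\<Sum>i\<in>UNIV. g i * f i) = (\<Sum>i\<in>UNIV. g i * u i + g i * ?\<eta> i * f k)"
      by (simp add: u_def algebra_simps)
    also have "\<dots> = (\<Sum>i\<in>UNIV. g i * u i) + (\<Sum>i\<in>UNIV. g i * ?\<eta> i) * f k"
      by (simp add: sum.distrib sum_distrib_right)
    also have "(\<Sum>i\<in>UNIV. g i * u i) = (\<Sum>i\<in>?K. g i * u i)"
      unfolding split[of "\<lambda>i. g i * u i"] using \<eta>k by (simp add: u_def)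
    finally show ?thesis .
  qed
  show ?thesis
  proof (intro subset_antisym subsetI)
    fix q assume "q \<in> syz_ideal f \<xi>"
    then obtain g where g: "\<And>i. g i \<in> polys" "(\<Sum>i\<in>UNIV. g i * f i) = 0" "q = (\<Sum>i\<in>UNIV. g i * C (\<xi> i))"
      by (auto simp: syz_ideal_def)
    define q' where "q' = (\<Sum>i\<in>UNIV. g i * ?\<eta> i)"
    have q: "q = C (\<xi> k) * q'" unfolding g(3) q'_def by (rule C\<xi>)
    have "q' * f k = - (\<Sum>i\<in>?K. g i * u i)" using id[of g] g(2) by (simp add: q'_def add_eq_0_iff)
    moreover have "f k * q = C (\<xi> k) * (q' * f k)" unfolding q by (simp only: mult_ac)
    ultimately have "f k * q = (\<Sum>i\<in>?K. - (C (\<xi> k) * g i) * u i)"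
      by (simp add: mult.assoc sum_distrib_left sum_negf)
    moreover have "q \<in> polys" unfolding g(3) by (intro polys_sum polys_mult polys_C g(1))
    moreover have "\<forall>i. - (C (\<xi> k) * g i) \<in> polys" by (intro allI polys_uminus polys_mult polys_C g(1))
    ultimately show "q \<in> {q\<in>polys. \<exists>a. (\<forall>i. a i \<in> polys) \<and> f k * q = (\<Sum>i\<in>?K. a i * u i)}"
      by (intro CollectI conjI exI[of _ "\<lambda>i. - (C (\<xi> k) * g i)"])
  next
    fix q assume "q \<in> {q\<in>polys. \<exists>a. (\<forall>i. a i \<in> polys) \<and> f k * q = (\<Sum>i\<in>?K. a i * u i)}"
    then obtain a where a: "q \<in> polys" "\<And>i. a i \<in> polys" "f k * q = (\<Sum>i\<in>?K. a i * u i)" by blast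
    let ?c = "C (inverse (\<xi> k)) :: 'a laurent"
    \<comment> \<open>The entry at \<open>k\<close> is solved from the condition that the weighted
      sum of all entries be \<open>q\<close> divided by \<open>\<xi> k\<close>.\<close>
    define g where "g i = (if i = k then ?c * q + (\<Sum>i\<in>?K. ?c * a i * ?\<eta> i) else - (?c * a i))" for i
    have gp: "\<forall>i. g i \<in> polys"
    proof
      fix i
      have "?c * q + (\<Sum>i\<in>?K. ?c * a i * ?\<eta> i) \<in> polys"
        by (intro polys_add polys_mult polys_sum polys_C a(1,2))
      moreover have "- (?c * a i) \<in> polys" by (intro polys_uminus polys_mult polys_C a(2))
      ultimately show "g i \<in> polys" by (simp add: g_def)
    qed
    have s: "(\<Sum>i\<in>UNIV. g i * ?\<eta> i) = ?c * q"
      unfolding split[of "\<lambda>i. g i * ?\<eta> i"] \<eta>k by (simp add: g_def sum_negf)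
    have "(\<Sum>i\<in>?K. g i * u i) = - (?c * (\<Sum>i\<in>?K. a i * u i))"
      by (simp add: g_def sum_negf sum_distrib_left mult.assoc)
    then have "(\<Sum>i\<in>UNIV. g i * f i) = 0" unfolding id s a(3)[symmetric] by (simp add: mult_ac)
    moreover have "(\<Sum>i\<in>UNIV. g i * C (\<xi> i)) = q" unfolding C\<xi> s using Ck by (simp add: mult.assoc[symmetric])
    ultimately show "q \<in> syz_ideal f \<xi>" using gp unfolding syz_ideal_def by blast
  qed
qed

text \<open>After cancelling \<open>c\<close>, membership of \<open>q\<close> reads
  \<open>f' * q = h * s\<close> with \<open>s\<close> in (v1, v2, v3). Since \<open>h\<close> is
  coprime to \<open>f'\<close>, it divides \<open>q\<close>, and the quotient lies in the colon of
  (v1, v2, v3) by \<open>f'\<close>: this is the situation of \<open>cvanish_linked\<close>.\<close>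

theorem cvanish_syz_ideal:
  fixes f :: "4 \<Rightarrow> 'a::{field,factorial_ring_gcd,semiring_gcd_mult_normalize} laurent"
  assumes inf: "infinite (UNIV :: 'a set)" and f: "\<And>i. f i \<in> polys" "\<And>i. f i \<in> piece (d1, d2)"
    and d: "0 \<le> d1" "0 \<le> d2"
    and n: "d1 - 1 \<le> n1" "d2 - 1 \<le> n2" "2 * d1 - 1 \<le> n1 \<or> 2 * d2 - 1 \<le> n2"
  shows "cvanish polys (syz_ideal f \<xi>) (n1, n2) i"
proof (cases "\<forall>k. \<xi> k = 0")
  \<comment> \<open>At the origin every specialized relation is zero, and only the cohomology of S
    itself is left.\<close>
  case True
  have "(0 :: 'a laurent) = (\<Sum>i\<in>(UNIV :: 4 set). 0 * C (\<xi> i))" by simp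
  then have "syz_ideal f \<xi> = {0}" using True
    by (auto simp: syz_ideal_def C_simps intro!: exI[of _ "\<lambda>_. 0"])
  then show ?thesis using cvanish_polys[of n1 n2 i] n d by simp
next
  case False
  then obtain k where k: "\<xi> k \<noteq> 0" by blast
  define u where "u i = f i - C (\<xi> i / \<xi> k) * f k" for i
  have up: "u i \<in> polys" for i using f by (auto simp: u_def intro!: polys_diff polys_mult)
  have upc: "u i \<in> piece (d1, d2)" for i
    using piece_mult[OF piece_C f(2), of "\<xi> i / \<xi> k" k] f(2) by (auto simp: u_def intro!: piece_diff)
  have J: "syz_ideal f \<xi> = {q\<in>polys. \<exists>a. (\<forall>i. a i \<in> polys) \<and> f k * q = (\<Sum>i\<in>UNIV - {k}. a i * u i)}"
    unfolding u_def by (rule syz_ideal_colon[of \<xi> k f, OF k f(1)])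
  show ?thesis
  proof (cases "\<forall>i\<in>UNIV - {k}. u i = 0")
    \<comment> \<open>All \<open>f i\<close> are constant multiples of \<open>f k\<close>, so that
      no form is available to start the factorization.\<close>
    case True
    then have s0: "(\<Sum>i\<in>UNIV - {k}. a i * u i) = 0" for a by (intro sum.neutral) auto
    have "\<exists>a :: 4 \<Rightarrow> 'a laurent. \<forall>i. a i \<in> polys" by (intro exI[of _ "\<lambda>_. 0"]) simp
    then have J': "syz_ideal f \<xi> = {q\<in>polys. f k * q = 0}" unfolding J s0 by auto
    show ?thesis
    proof (cases "f k = 0")
      case True
      then have "syz_ideal f \<xi> = polys" using J' by simp
      then show ?thesis by (simp only: cvanish_self[OF submod_polys])
    next
      case False
      then have "syz_ideal f \<xi> = {0}" unfolding J' by auto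
      then show ?thesis using cvanish_polys[of n1 n2 i] n d by simp
    qed
  next
    case False
    then obtain i1 where i1: "i1 \<noteq> k" "u i1 \<noteq> 0" by blast
    have "card (UNIV - {k, i1}) = 2" using i1(1) by (simp add: card_Diff_subset)
    then obtain i2 i3 where i23: "UNIV - {k, i1} = {i2, i3}" "i2 \<noteq> i3" by (auto simp: card_2_iff)
    then have K: "UNIV - {k} = {i1, i2, i3}" "i1 \<noteq> i2" "i1 \<noteq> i3" using i1(1) by auto
    obtain c h v1 v2 v3 f' x where eq: "u i1 = c * h * v1" "u i2 = c * h * v2" "u i3 = c * h * v3" "f k = c * f'"
      and p: "c \<in> polys" "h \<in> polys" "v1 \<in> polys" "v2 \<in> polys" "v3 \<in> polys" "f' \<in> polys"
      and cop: "\<And>a b. a \<in> polys \<Longrightarrow> b \<in> polys \<Longrightarrow> h * a = f' * b \<Longrightarrow> \<exists>z\<in>polys. b = h * z"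
      and reg: "regular_pair v1 (v2 + C x * v3)"
      by (rule factor_forms[OF i1(2) up[of i1] up[of i2] up[of i3] f(1)[of k] inf]) (rule that)
    have nz: "c \<noteq> 0" "h \<noteq> 0" "v1 \<noteq> 0" using i1(2) eq(1) by auto
    have "c * (h * v1) \<in> piece (d1, d2)" "h * (c * v1) \<in> piece (d1, d2)" "v1 * (c * h) \<in> piece (d1, d2)"
      using upc[of i1] eq(1) by (simp_all add: mult_ac)
    then obtain \<epsilon> b a where pc0: "c \<in> piece \<epsilon>" "h \<in> piece b" "v1 \<in> piece a"
      using piece_factor nz by (metis mult_eq_0_iff)
    have "u i1 \<in> piece (\<epsilon> + b + a)" unfolding eq(1) by (intro piece_mult pc0)
    then have sum: "\<epsilon> + b + a = (d1, d2)" using piece_unique[OF i1(2)] upc by blast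
    obtain e1 e2 b1 b2 a1 a2 where ab: "\<epsilon> = (e1, e2)" "b = (b1, b2)" "a = (a1, a2)"
      by (metis prod.exhaust)
    note pc = pc0[unfolded ab]
    have deg: "d1 = e1 + b1 + a1" "d2 = e2 + b2 + a2" using sum by (auto simp: ab)
    have nn: "0 \<le> e1" "0 \<le> e2" "0 \<le> b1" "0 \<le> b2" "0 \<le> a1" "0 \<le> a2"
      using piece_nonneg[OF nz(1) pc(1) p(1)] piece_nonneg[OF nz(2) pc(2) p(2)] piece_nonneg[OF nz(3) pc(3) p(3)] by auto
    have chp: "c * h \<in> piece (e1 + b1, e2 + b2)" using piece_mult[OF pc(1,2)] by simp
    have ch: "c * h \<noteq> 0" using nz by simp
    have v: "v2 \<in> piece (a1, a2)" "v3 \<in> piece (a1, a2)"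
      using piece_cancel[OF ch chp, of v2 "(d1, d2)"] piece_cancel[OF ch chp, of v3 "(d1, d2)"]
        upc[of i2] upc[of i3] by (simp_all add: eq deg)
    have f': "f' \<in> piece (b1 + a1, b2 + a2)"
      using piece_cancel[OF nz(1) pc(1), of f' "(d1, d2)"] f(2)[of k] by (simp add: eq(4) deg)
    have "C x * v3 \<in> piece (a1, a2)" using piece_mult[OF piece_C v(2), of x] by simp
    then have w: "v2 + C x * v3 \<in> polys" "v2 + C x * v3 \<in> piece (a1, a2)"
      using piece_add[OF v(1)] polys_add[OF p(4) polys_mult[OF polys_C p(5)]] by auto
    let ?I = "adjoin (ideal2 v1 (v2 + C x * v3)) v3"
    \<comment> \<open>Once \<open>v3\<close> is adjoined, the generic multiple of it added to
      \<open>v2\<close> is invisible: the ideal is (v1, v2, v3).\<close>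
    have I: "s \<in> ?I \<longleftrightarrow> (\<exists>x1\<in>polys. \<exists>x2\<in>polys. \<exists>x3\<in>polys. s = x1 * v1 + x2 * v2 + x3 * v3)" for s
    proof
      assume "s \<in> ?I"
      then obtain y1 y2 y3 where y: "y1 \<in> polys" "y2 \<in> polys" "y3 \<in> polys" "s = v1 * y1 + (v2 + C x * v3) * y2 + v3 * y3"
        by (auto simp: adjoin_def ideal2_def)
      have "s = y1 * v1 + y2 * v2 + (C x * y2 + y3) * v3" unfolding y(4) by (simp add: algebra_simps)
      moreover have "C x * y2 + y3 \<in> polys" by (intro polys_add polys_mult polys_C y)
      ultimately show "\<exists>x1\<in>polys. \<exists>x2\<in>polys. \<exists>x3\<in>polys. s = x1 * v1 + x2 * v2 + x3 * v3" using y by blast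
    next
      assume "\<exists>x1\<in>polys. \<exists>x2\<in>polys. \<exists>x3\<in>polys. s = x1 * v1 + x2 * v2 + x3 * v3"
      then obtain y1 y2 y3 where y: "y1 \<in> polys" "y2 \<in> polys" "y3 \<in> polys" "s = y1 * v1 + y2 * v2 + y3 * v3" by blast
      have "s = (v1 * y1 + (v2 + C x * v3) * y2) + v3 * (y3 - C x * y2)" unfolding y(4) by (simp add: algebra_simps)
      moreover have "y3 - C x * y2 \<in> polys" by (intro polys_diff polys_mult polys_C y)
      moreover have "v1 * y1 + (v2 + C x * v3) * y2 \<in> ideal2 v1 (v2 + C x * v3)" using y unfolding ideal2_def by blast
      ultimately show "s \<in> ?I" unfolding adjoin_def by blast
    qed
    have Ipolys: "s \<in> polys" if "s \<in> ?I" for s using that p unfolding I by (auto intro!: polys_add polys_mult)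
    have sumK: "(\<Sum>i\<in>UNIV - {k}. a i * u i) = c * (h * (a i1 * v1 + a i2 * v2 + a i3 * v3))" for a
      unfolding K(1) using K(2,3) i23(2) by (simp add: eq algebra_simps)
    have "syz_ideal f \<xi> = times h ` colon ?I f'"
    proof (intro subset_antisym subsetI)
      fix q assume "q \<in> syz_ideal f \<xi>"
      then obtain a where a: "q \<in> polys" "\<And>i. a i \<in> polys" "f k * q = c * (h * (a i1 * v1 + a i2 * v2 + a i3 * v3))"
        unfolding J sumK by blast
      define s where "s = a i1 * v1 + a i2 * v2 + a i3 * v3"
      have sI: "s \<in> ?I" unfolding I s_def using a(2) by blast
      have "c * (f' * q) = c * (h * s)" using a(3) by (simp add: eq(4) s_def mult.assoc)
      then have hs: "h * s = f' * q" using nz(1) by simp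
      then obtain z where z: "z \<in> polys" "q = h * z" using cop[OF Ipolys[OF sI] a(1)] by blast
      have "h * s = h * (f' * z)" using hs z(2) by (simp add: mult.left_commute)
      then have "s = f' * z" using nz(2) by simp
      then show "q \<in> times h ` colon ?I f'" using sI z by (auto simp: colon_def)
    next
      fix q assume "q \<in> times h ` colon ?I f'"
      then obtain z where z: "z \<in> polys" "f' * z \<in> ?I" "q = h * z" by (auto simp: colon_def)
      then obtain y1 y2 y3 where y: "y1 \<in> polys" "y2 \<in> polys" "y3 \<in> polys" "f' * z = y1 * v1 + y2 * v2 + y3 * v3"
        unfolding I by blast
      define a where "a i = (if i = i1 then y1 else if i = i2 then y2 else y3)" for i
      have "(\<Sum>i\<in>UNIV - {k}. a i * u i) = c * (h * (f' * z))"
        unfolding sumK y(4) using K(2,3) i23(2) by (simp add: a_def)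
      also have "\<dots> = f k * q" by (simp add: eq(4) z(3) mult_ac)
      finally have "f k * q = (\<Sum>i\<in>UNIV - {k}. a i * u i)" by simp
      moreover have "\<forall>i. a i \<in> polys" using y by (simp add: a_def)
      moreover have "q \<in> polys" unfolding z(3) using z p by (intro polys_mult)
      ultimately show "q \<in> syz_ideal f \<xi>" unfolding J by blast
    qed
    moreover have "cvanish polys (times h ` colon ?I f') (n1, n2) i"
      by (rule cvanish_linked[OF p(3) w(1) p(5,6,2) nz(2) pc(3) w(2) v(2) f' pc(2) nn(5,6,3,4) reg inf])
        (use n nn deg in auto)
    ultimately show ?thesis by simp
  qed
qed

section \<open>Embedding a prime quotient into a field\<close>

definition prime_set :: "'a::comm_ring_1 set \<Rightarrow> bool" where
  "prime_set P \<longleftrightarrow> 0 \<in> P \<and> 1 \<notin> P \<and> (\<forall>a\<in>P. \<forall>b\<in>P. a + b \<in> P) \<and> (\<forall>a. \<forall>b\<in>P. a * b \<in> P) \<and>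
     (\<forall>a b. a * b \<in> P \<longrightarrow> a \<in> P \<or> b \<in> P)"

lemma prime_setD:
  assumes "prime_set P"
  shows "0 \<in> P" "1 \<notin> P" "a \<in> P \<Longrightarrow> b \<in> P \<Longrightarrow> a + b \<in> P" "b \<in> P \<Longrightarrow> a * b \<in> P"
    "a * b \<in> P \<Longrightarrow> a \<in> P \<or> b \<in> P" "a \<in> P \<Longrightarrow> b \<in> P \<Longrightarrow> a - b \<in> P" "a \<in> P \<Longrightarrow> - a \<in> P"
proof -
  show mult: "a * b \<in> P" if "b \<in> P" for a b using assms that by (simp add: prime_set_def)
  show add: "a + b \<in> P" if "a \<in> P" "b \<in> P" for a b using assms that by (simp add: prime_set_def)
  show um: "- a \<in> P" if "a \<in> P" for a using mult[OF that, of "-1"] by simp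
  show "a - b \<in> P" if "a \<in> P" "b \<in> P" using add[OF that(1) um[OF that(2)]] by simp
qed (use assms in \<open>auto simp: prime_set_def\<close>)

lemma prime_set_vimage:
  assumes h: "ring_hom_on h" and P: "prime_set P"
  shows "prime_set {a. h a \<in> P}"
  unfolding prime_set_def using prime_setD(1-4)[OF P] prime_setD(5)[OF P]
  by (auto simp: ring_hom_onD[OF h])

lemma ring_hom_const_poly: "ring_hom_on (\<lambda>a. [:a:])"
  by (simp add: ring_hom_on_def one_pCons)

lemma ring_hom_comp: "ring_hom_on f \<Longrightarrow> ring_hom_on g \<Longrightarrow> ring_hom_on (\<lambda>x. f (g x))"
  by (simp add: ring_hom_on_def)

lemma map_poly_eval: "ring_hom_on h \<Longrightarrow> map_poly h p = eval_poly (\<lambda>a. [:h a:]) [:0, 1:] p"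
  by (induction p) (simp_all add: eval_poly_pCons ring_hom_comp[OF ring_hom_const_poly] map_poly_pCons ring_hom_onD)

lemma ring_hom_map_poly:
  assumes "ring_hom_on h"
  shows "ring_hom_on (map_poly h)"
proof -
  have "map_poly h = eval_poly (\<lambda>a. [:h a:]) [:0, 1:]" by (rule ext, rule map_poly_eval[OF assms])
  then show ?thesis using ring_hom_eval_poly[OF ring_hom_comp[OF ring_hom_const_poly assms]] by simp
qed

lemma eval_poly_comp:
  "ring_hom_on f \<Longrightarrow> ring_hom_on g \<Longrightarrow> eval_poly (\<lambda>a. f (g a)) t p = eval_poly f t (map_poly g p)"
  by (induction p) (simp_all add: eval_poly_pCons ring_hom_comp map_poly_pCons ring_hom_onD)

text \<open>If \<^term>\<open>\<phi>\<close> has kernel the contraction of \<^term>\<open>P\<close>, then the variable is sent to a root of the image of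
  minimal degree of an element of \<^term>\<open>P\<close>, or to a new transcendental if there is none.\<close>

lemma extend_prime_embedding:
  fixes \<phi> :: "'d::comm_ring_1 \<Rightarrow> 'e::field"
  assumes \<phi>: "ring_hom_on \<phi>" and P: "prime_set P" and ker: "\<And>a. \<phi> a = 0 \<longleftrightarrow> [:a:] \<in> P"
  shows "\<exists>\<Phi> :: 'd poly \<Rightarrow> 'e poly fract alg_closure. ring_hom_on \<Phi> \<and> (\<forall>F. \<Phi> F = 0 \<longleftrightarrow> F \<in> P)"
proof -
  note [simp] = prime_setD(1)[OF P]
  define m where "m = map_poly \<phi>"
  have m: "ring_hom_on m" unfolding m_def by (rule ring_hom_map_poly[OF \<phi>])
  note mhom = ring_hom_onD[OF m]
  have coeff_m: "Polynomial.coeff (m F) i = \<phi> (Polynomial.coeff F i)" for F i by (simp add: m_def coeff_map_poly ring_hom_onD[OF \<phi>])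
  have degm: "Polynomial.degree (m F) \<le> Polynomial.degree F" for F by (rule degree_le) (auto simp: coeff_m coeff_eq_0 ring_hom_onD[OF \<phi>])
  have monomP: "Polynomial.monom a n \<in> P" if "\<phi> a = 0" for a n
  proof -
    have "Polynomial.monom 1 n * [:a:] \<in> P" using that by (intro prime_setD(4)[OF P]) (simp add: ker)
    then show ?thesis by (simp add: smult_monom mult.commute[of "Polynomial.monom 1 n"])
  qed
  have sumP: "(\<Sum>i\<in>I. F i) \<in> P" if "\<And>i. i \<in> I \<Longrightarrow> F i \<in> P" for I :: "nat set" and F
    using that by (induction I rule: infinite_finite_induct) (auto intro: prime_setD(3)[OF P])
  have m0: "F \<in> P" if "m F = 0" for F
  proof -
    have "\<phi> (Polynomial.coeff F i) = 0" for i using that coeff_m[of F i] by simp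
    then have "(\<Sum>i\<le>Polynomial.degree F. Polynomial.monom (Polynomial.coeff F i) i) \<in> P" by (intro sumP monomP)
    then show ?thesis by (simp add: poly_as_sum_of_monoms)
  qed
  \<comment> \<open>Dropping the coefficients above the degree of the image changes \<open>F\<close>
    by an element of \<open>P\<close>. Afterwards the leading coefficient has nonzero image, as
    division needs.\<close>
  have normal: "\<exists>G. m G = m F \<and> Polynomial.degree G = Polynomial.degree (m F) \<and> F - G \<in> P" for F
  proof -
    define G where "G = (\<Sum>i\<le>Polynomial.degree (m F). Polynomial.monom (Polynomial.coeff F i) i)"
    have cG: "Polynomial.coeff G i = (if i \<le> Polynomial.degree (m F) then Polynomial.coeff F i else 0)" for i
      by (simp add: G_def coeff_sum if_distrib cong: if_cong)
    have mG: "m G = m F"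
    proof (rule poly_eqI)
      fix i
      show "Polynomial.coeff (m G) i = Polynomial.coeff (m F) i"
      proof (cases "i \<le> Polynomial.degree (m F)")
        case False
        then have "Polynomial.coeff (m F) i = 0" by (simp add: coeff_eq_0)
        then show ?thesis using False by (simp add: coeff_m[of G] cG ring_hom_onD[OF \<phi>])
      qed (simp add: coeff_m cG)
    qed
    have "Polynomial.degree G \<le> Polynomial.degree (m F)" unfolding G_def
      by (intro degree_sum_le) (auto intro: order.trans[OF degree_monom_le])
    then have "Polynomial.degree G = Polynomial.degree (m F)" using degm[of G] mG by simp
    moreover have "F - G \<in> P" using mG by (intro m0) (simp add: mhom)
    ultimately show ?thesis using mG by blast
  qed
  \<comment> \<open>Pseudo-division costs a power of the leading coefficient of \<open>G\<close>,
    whose image under \<open>\<phi>\<close> is nonzero by the condition on the degrees.\<close>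
  have divide: "\<exists>a Q R. \<phi> a \<noteq> 0 \<and> Polynomial.smult a F = G * Q + R \<and> (R = 0 \<or> Polynomial.degree R < Polynomial.degree G)"
    if G: "m G \<noteq> 0" "Polynomial.degree G = Polynomial.degree (m G)" for F G
  proof -
    obtain Q R where QR: "pseudo_divmod F G = (Q, R)" by (meson surj_pair)
    have "G \<noteq> 0" using G(1) mhom(1) by auto
    note pd = pseudo_divmod[OF this QR]
    have lc: "\<phi> (Polynomial.coeff G (Polynomial.degree G)) \<noteq> 0" using G coeff_m[of G "Polynomial.degree G"] by (metis leading_coeff_0_iff)
    have "\<phi> (x ^ n) = \<phi> x ^ n" for x n by (induction n) (simp_all add: ring_hom_onD[OF \<phi>])
    then have "\<phi> (Polynomial.coeff G (Polynomial.degree G) ^ n) \<noteq> 0" for n using lc by simp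
    then show ?thesis using pd by blast
  qed
  have smultP: "Polynomial.smult a F \<in> P \<longleftrightarrow> F \<in> P" if "\<phi> a \<noteq> 0" for a F
    using prime_setD(5)[OF P, of "[:a:]" F] prime_setD(4)[OF P, of F "[:a:]"] that by (auto simp: ker)
  define \<iota> :: "'e \<Rightarrow> 'e poly fract alg_closure" where "\<iota> e = to_ac (to_fract [:e:])" for e
  have \<iota>: "ring_hom_on \<iota>" unfolding \<iota>_def ring_hom_on_def
    by (simp add: one_pCons[symmetric] to_fract_add[symmetric] to_fract_mult[symmetric] to_ac_add[symmetric] to_ac_mult[symmetric]
        del: to_fract_add to_fract_mult to_ac_add to_ac_mult)
  have \<iota>0: "\<iota> e = 0 \<Longrightarrow> e = 0" for e by (simp add: \<iota>_def)
  show ?thesis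
  proof (cases "\<forall>F\<in>P. m F = 0")
    case True
    define \<Phi> :: "'d poly \<Rightarrow> 'e poly fract alg_closure" where "\<Phi> F = to_ac (to_fract (m F))" for F
    have "ring_hom_on \<Phi>" by (simp add: ring_hom_on_def \<Phi>_def mhom)
    moreover have "\<Phi> F = 0 \<longleftrightarrow> F \<in> P" for F using True m0 by (auto simp: \<Phi>_def)
    ultimately show ?thesis by blast
  next
    case False
    then have ex: "\<exists>n F. F \<in> P \<and> m F \<noteq> 0 \<and> Polynomial.degree (m F) = n" by blast
    define n0 where "n0 = (LEAST n. \<exists>F. F \<in> P \<and> m F \<noteq> 0 \<and> Polynomial.degree (m F) = n)"
    obtain F1 where F1: "F1 \<in> P" "m F1 \<noteq> 0" "Polynomial.degree (m F1) = n0" using LeastI_ex[OF ex] unfolding n0_def by blast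
    have least: "n0 \<le> Polynomial.degree (m F)" if "F \<in> P" "m F \<noteq> 0" for F
      unfolding n0_def by (rule Least_le) (use that in blast)
    obtain F0 where F0': "m F0 = m F1" "Polynomial.degree F0 = Polynomial.degree (m F1)" "F1 - F0 \<in> P" using normal by blast
    have F0: "F0 \<in> P" "m F0 \<noteq> 0" "Polynomial.degree (m F0) = n0" "Polynomial.degree F0 = Polynomial.degree (m F0)"
    proof -
      have "F1 - (F1 - F0) \<in> P" by (rule prime_setD(6)[OF P F1(1) F0'(3)])
      then show "F0 \<in> P" by simp
    qed (use F0' F1 in simp_all)
    have pos: "0 < n0"
    proof (rule ccontr)
      assume "\<not> 0 < n0"
      then have "Polynomial.degree F0 = 0" using F0 by simp
      then obtain a where a: "F0 = [:a:]" by (metis degree_eq_zeroE)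
      then have "\<phi> a = 0" using F0(1) ker by simp
      then show False using F0(2) a by (simp add: m_def map_poly_pCons ring_hom_onD[OF \<phi>])
    qed
    have "Polynomial.degree (map_poly \<iota> (m F0)) = n0"
      using F0(3) \<iota>0 by (subst degree_map_poly) auto
    then obtain \<omega> where \<omega>: "poly (map_poly \<iota> (m F0)) \<omega> = 0"
      using alg_closed_imp_poly_has_root[of "map_poly \<iota> (m F0)"] pos by auto
    define \<Phi> where "\<Phi> = eval_poly (\<lambda>a. \<iota> (\<phi> a)) \<omega>"
    have \<Phi>: "ring_hom_on \<Phi>" unfolding \<Phi>_def by (rule ring_hom_eval_poly[OF ring_hom_comp[OF \<iota> \<phi>]])
    note Phom = ring_hom_onD[OF \<Phi>]
    have \<Phi>m: "\<Phi> F = eval_poly \<iota> \<omega> (m F)" for F unfolding \<Phi>_def m_def by (rule eval_poly_comp[OF \<iota> \<phi>])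
    have \<Phi>0: "\<Phi> F = 0" if "m F = 0" for F using that by (simp add: \<Phi>m)
    have \<Phi>F0: "\<Phi> F0 = 0" using \<omega> by (simp add: \<Phi>m eval_poly_def)
    have \<Phi>c: "\<Phi> [:a:] = \<iota> (\<phi> a)" for a unfolding \<Phi>_def by (rule eval_poly_const[OF ring_hom_comp[OF \<iota> \<phi>]])
    have \<Phi>s: "\<Phi> (Polynomial.smult a F) = \<iota> (\<phi> a) * \<Phi> F" for a F
      using Phom(4)[of "[:a:]" F] by (simp add: \<Phi>c)
    have low: "m R = 0" if "R \<in> P" "R = 0 \<or> Polynomial.degree R < n0" for R
      using least[OF that(1)] degm[of R] that(2) mhom(1) by fastforce
    have PK: "\<Phi> F = 0" if F: "F \<in> P" for F
    proof -
      obtain a Q R where aQR: "\<phi> a \<noteq> 0" "Polynomial.smult a F = F0 * Q + R" "R = 0 \<or> Polynomial.degree R < Polynomial.degree F0"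
        using divide[OF F0(2,4), of F] by blast
      have "R = Polynomial.smult a F - Q * F0" using aQR(2) by (simp add: mult.commute)
      also have "\<dots> \<in> P" using F F0(1) smultP[OF aQR(1)] by (intro prime_setD(6)[OF P] prime_setD(4)[OF P]) auto
      finally have "m R = 0" using aQR(3) F0 by (intro low) auto
      then have "\<iota> (\<phi> a) * \<Phi> F = 0" using \<Phi>s[of a F] aQR(2) \<Phi>F0 \<Phi>0 by (simp add: Phom)
      then show ?thesis using aQR(1) \<iota>0 by auto
    qed
    \<comment> \<open>A counterexample \<open>G\<close> of least degree has degree below
      \<open>n0\<close>. Dividing \<open>F0\<close> by it leaves a remainder in \<open>P\<close>, so
      the quotient \<open>Q\<close> lies in \<open>P\<close> by primality. As \<open>Q\<close>
      cannot have degree below \<open>n0\<close>, \<open>G\<close> is constant, and then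
      \<open>ker\<close> puts it into \<open>P\<close>.\<close>
    have KP: "F \<in> P" if F: "\<Phi> F = 0" for F
    proof (rule ccontr)
      assume "F \<notin> P"
      then have ex: "\<exists>n F. \<Phi> F = 0 \<and> F \<notin> P \<and> Polynomial.degree (m F) = n" using F by blast
      define k where "k = (LEAST n. \<exists>F. \<Phi> F = 0 \<and> F \<notin> P \<and> Polynomial.degree (m F) = n)"
      obtain G1 where G1: "\<Phi> G1 = 0" "G1 \<notin> P" "Polynomial.degree (m G1) = k" using LeastI_ex[OF ex] unfolding k_def by blast
      have leastk: "k \<le> Polynomial.degree (m F)" if "\<Phi> F = 0" "F \<notin> P" for F
        unfolding k_def by (rule Least_le) (use that in blast)
      obtain G where G': "m G = m G1" "Polynomial.degree G = Polynomial.degree (m G1)" "G1 - G \<in> P" using normal by blast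
      have GP: "G \<notin> P" using prime_setD(3)[OF P G'(3), of G] G1(2) by auto
      have \<Phi>G: "\<Phi> G = 0" using G1(1) by (simp add: \<Phi>m G'(1))
      have mG: "m G \<noteq> 0" using GP m0 by blast
      have dG: "Polynomial.degree G = k" "Polynomial.degree (m G) = k" "Polynomial.degree G = Polynomial.degree (m G)" using G' G1 by auto
      have "k < n0"
      proof (rule ccontr)
        assume k: "\<not> k < n0"
        obtain a Q R where aQR: "\<phi> a \<noteq> 0" "Polynomial.smult a G = F0 * Q + R" "R = 0 \<or> Polynomial.degree R < Polynomial.degree F0"
          using divide[OF F0(2,4), of G] by blast
        have "\<Phi> R = 0" using \<Phi>s[of a G] aQR(2) \<Phi>G \<Phi>F0 by (simp add: Phom)
        moreover have "R \<notin> P"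
        proof
          assume "R \<in> P"
          then have "Polynomial.smult a G \<in> P" unfolding aQR(2) mult.commute[of F0]
            using F0(1) by (intro prime_setD(3,4)[OF P])
          then show False using smultP[OF aQR(1)] GP by blast
        qed
        ultimately have "k \<le> Polynomial.degree (m R)" by (rule leastk)
        moreover have "R \<noteq> 0" using \<open>R \<notin> P\<close> by auto
        ultimately show False using k aQR(3) degm[of R] F0 by auto
      qed
      obtain a Q R where aQR: "\<phi> a \<noteq> 0" "Polynomial.smult a F0 = G * Q + R" "R = 0 \<or> Polynomial.degree R < Polynomial.degree G"
        using divide[OF mG dG(3), of F0] by blast
      have "\<Phi> R = 0" using \<Phi>s[of a F0] aQR(2) \<Phi>G \<Phi>F0 by (simp add: Phom)
      then have RP: "R \<in> P" using leastk[of R] aQR(3) degm[of R] dG by fastforce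
      have mR: "m R = 0" using RP aQR(3) dG \<open>k < n0\<close> by (intro low) auto
      have "G * Q = Polynomial.smult a F0 - R" using aQR(2) by simp
      also have "\<dots> \<in> P" using F0(1) smultP[OF aQR(1)] RP by (intro prime_setD(6)[OF P]) auto
      finally have QP: "Q \<in> P" using prime_setD(5)[OF P] GP by blast
      have "m (Polynomial.smult a F0) = m G * m Q" using aQR(2) mR by (simp add: mhom)
      moreover have "m (Polynomial.smult a F0) = Polynomial.smult (\<phi> a) (m F0)"
        by (rule poly_eqI) (simp add: coeff_m ring_hom_onD[OF \<phi>])
      ultimately have eq: "Polynomial.smult (\<phi> a) (m F0) = m G * m Q" by simp
      then have mQ: "m Q \<noteq> 0" using aQR(1) F0(2) by auto
      have "n0 = Polynomial.degree (m G) + Polynomial.degree (m Q)"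
        using arg_cong[OF eq, of Polynomial.degree] aQR(1) F0(3) degree_mult_eq[OF mG mQ] by simp
      then have "Polynomial.degree G = 0" using least[OF QP mQ] dG by simp
      then obtain b where b: "G = [:b:]" by (metis degree_eq_zeroE)
      then have "\<phi> b = 0" using \<Phi>G \<Phi>c \<iota>0 by simp
      then show False using GP b ker by simp
    qed
    show ?thesis using \<Phi> PK KP by blast
  qed
qed

section \<open>Iterated polynomials for R, and the field containing its residue field\<close>

definition nest_eval :: "('v \<Rightarrow> ('w, 'k::comm_ring_1) mpoly) \<Rightarrow> 'v \<Rightarrow> 'v \<Rightarrow> 'v \<Rightarrow> 'v \<Rightarrow>
    'k poly poly poly poly \<Rightarrow> ('w, 'k) mpoly" where
  "nest_eval g a b c d = eval_poly (eval_poly (eval_poly (eval_poly const (g a)) (g b)) (g c)) (g d)"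

lemma const_simps: "const 0 = 0" "const (1::'k::comm_ring_1) = 1" "const (a + b :: 'k) = const a + const b"
  "const (a * b :: 'k) = const a * const b"
  by (auto simp: const_def single_add mult_single)

lemma ring_hom_const: "ring_hom_on (const :: 'k::comm_ring_1 \<Rightarrow> ('v, 'k) mpoly)"
  by (simp add: ring_hom_on_def const_simps)

lemma var_power: "var v ^ n = single (single v n) (1::'k::comm_ring_1)"
  by (induction n) (auto simp: var_def mult_single single_add[symmetric])

lemma single_eq_prod:
  fixes e :: "'v::finite \<Rightarrow>\<^sub>0 nat"
  shows "single e c = const (c::'k::comm_ring_1) * (\<Prod>v\<in>UNIV. var v ^ lk e v)"
proof -
  have "(\<Prod>v\<in>V. single (single v (lk e v)) (1::'k))
      = single (\<Sum>v\<in>V. single v (lk e v)) 1" if "finite V" for V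
    using that by (induction V rule: finite_induct) (auto simp: mult_single)
  moreover have "(\<Sum>v\<in>UNIV. single v (lk e v)) = e"
    by (rule poly_mapping_eqI) (simp add: lookup_sum lookup_single "when_def")
  ultimately show ?thesis by (simp add: var_power const_def mult_single)
qed

lemma UNIV_4: "(UNIV :: 4 set) = {0, 1, 2, 3}"
proof -
  have "card {0, 1, 2, 3 :: 4} = CARD(4)" by simp
  then show ?thesis by (metis card_subset_eq finite top_greatest)
qed

lemma nest_eval_surj: "\<exists>G. nest_eval var 0 1 2 3 G = (F :: 'k::comm_ring_1 R_poly)"
proof -
  let ?h1 = "eval_poly const (var 0) :: 'k poly \<Rightarrow> 'k R_poly"
  let ?h2 = "eval_poly ?h1 (var 1)" let ?h3 = "eval_poly ?h2 (var 2)"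
  let ?n = "nest_eval var 0 1 2 3 :: 'k poly poly poly poly \<Rightarrow> 'k R_poly"
  have h: "ring_hom_on ?h1" "ring_hom_on ?h2" "ring_hom_on ?h3" by (intro ring_hom_eval_poly ring_hom_const)+
  have "ring_hom_on ?n" unfolding nest_eval_def by (intro ring_hom_eval_poly ring_hom_const)
  note hom = ring_hom_onD[OF this]
  note ev = eval_poly_const[OF ring_hom_const] eval_poly_const[OF h(1)] eval_poly_const[OF h(2)] eval_poly_const[OF h(3)]
    eval_poly_X[OF ring_hom_const] eval_poly_X[OF h(1)] eval_poly_X[OF h(2)] eval_poly_X[OF h(3)]
  let ?R = "range ?n"
  have RC: "const a \<in> ?R" for a
    by (rule range_eqI[of _ _ "[:[:[:[:a:]:]:]:]"]) (simp add: nest_eval_def ev)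
  have "var 0 \<in> ?R" by (rule range_eqI[of _ _ "[:[:[:[:0, 1:]:]:]:]"]) (simp add: nest_eval_def ev)
  have "var 1 \<in> ?R" by (rule range_eqI[of _ _ "[:[:[:0, 1:]:]:]"]) (simp add: nest_eval_def ev)
  have "var 2 \<in> ?R" by (rule range_eqI[of _ _ "[:[:0, 1:]:]"]) (simp add: nest_eval_def ev)
  have "var 3 \<in> ?R" by (rule range_eqI[of _ _ "[:0, 1:]"]) (simp add: nest_eval_def ev)
  have RX: "var v \<in> ?R" for v
  proof -
    have "v \<in> {0, 1, 2, 3}" using UNIV_4 by blast
    then show ?thesis using \<open>var 0 \<in> ?R\<close> \<open>var 1 \<in> ?R\<close> \<open>var 2 \<in> ?R\<close> \<open>var 3 \<in> ?R\<close> by auto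
  qed
  have Radd: "a + b \<in> ?R" if "a \<in> ?R" "b \<in> ?R" for a b using that by (auto simp: hom(3)[symmetric])
  have Rmul: "a * b \<in> ?R" if "a \<in> ?R" "b \<in> ?R" for a b using that by (auto simp: hom(4)[symmetric])
  have R1: "1 \<in> ?R" by (rule range_eqI[of _ _ 1]) (simp add: hom)
  have R0: "0 \<in> ?R" by (rule range_eqI[of _ _ 0]) (simp add: hom)
  have Rpow: "a ^ n \<in> ?R" if "a \<in> ?R" for a n using that by (induction n) (auto intro: R1 Rmul)
  have Rprod: "(\<Prod>v\<in>V. var v ^ lk e v) \<in> ?R" for V e
    by (induction V rule: infinite_finite_induct) (auto intro: R1 Rmul Rpow RX)
  have "F \<in> ?R"
  proof (induction F rule: pm_induct)
    case (single k c)
    show ?case unfolding single_eq_prod by (intro Rmul RC Rprod)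
  qed (auto intro: R0 Radd)
  then show ?thesis by auto
qed

text \<open>Room for one further generator of a field extension: the rational function field
  supplies a transcendental element, its closure supplies roots.\<close>

type_synonym 'e adj = "'e poly fract alg_closure"

lemma infinite_adj: "infinite (UNIV :: 'e::field adj set)"
proof -
  have "inj (\<lambda>n. to_ac (to_fract (Polynomial.monom (1::'e) n)))"
    by (rule injI) (simp add: monom_eq_iff')
  then have "infinite (range (\<lambda>n. to_ac (to_fract (Polynomial.monom (1::'e) n))))" by (rule range_inj_infinite)
  then show ?thesis using infinite_super[OF subset_UNIV] by blast
qed

text \<open>One extension step for each variable, along the contractions of \<open>p\<close> to
  polynomial rings in fewer variables. The induction starts at the base field, where the contraction
  of a prime ideal is zero.\<close>

lemma prime_embedding:
  fixes p :: "'k::field R_poly set"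
  assumes "primeideal p univ_ring"
  shows "\<exists>\<phi> :: 'k R_poly \<Rightarrow> 'k adj adj adj adj. ring_hom_on \<phi> \<and> (\<forall>F. \<phi> F = 0 \<longleftrightarrow> F \<in> p)"
proof -
  interpret p: primeideal p univ_ring by (rule assms)
  have p: "prime_set p"
    unfolding prime_set_def
  proof (intro conjI ballI allI impI)
    show "0 \<in> p" using additive_subgroup.zero_closed[OF p.additive_subgroup_axioms] by (simp add: univ_ring_def)
    show "1 \<notin> p" using p.one_imp_carrier p.I_notcarr by (auto simp: univ_ring_def)
    show "a + b \<in> p" if "a \<in> p" "b \<in> p" for a b using additive_subgroup.a_closed[OF p.additive_subgroup_axioms that] by (simp add: univ_ring_def)
    show "a * b \<in> p" if "b \<in> p" for a b using p.I_l_closed[OF that, of a] by (simp add: univ_ring_def)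
    show "a \<in> p \<or> b \<in> p" if "a * b \<in> p" for a b using p.I_prime[of a b] that by (simp add: univ_ring_def)
  qed
  define n :: "'k poly poly poly poly \<Rightarrow> 'k R_poly" where "n = nest_eval var 0 1 2 3"
  have n: "ring_hom_on n" unfolding n_def nest_eval_def by (intro ring_hom_eval_poly ring_hom_const)
  define P4 where "P4 = {G. n G \<in> p}"
  define P3 where "P3 = {a. [:a:] \<in> P4}"
  define P2 where "P2 = {a. [:a:] \<in> P3}"
  define P1 where "P1 = {a. [:a:] \<in> P2}"
  have P4: "prime_set P4" unfolding P4_def by (rule prime_set_vimage[OF n p])
  have P3: "prime_set P3" unfolding P3_def by (rule prime_set_vimage[OF ring_hom_const_poly P4])
  have P2: "prime_set P2" unfolding P2_def by (rule prime_set_vimage[OF ring_hom_const_poly P3])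
  have P1: "prime_set P1" unfolding P1_def by (rule prime_set_vimage[OF ring_hom_const_poly P2])
  have id: "ring_hom_on (\<lambda>a::'k. a)" by (simp add: ring_hom_on_def)
  have ker0: "a = 0 \<longleftrightarrow> [:a:] \<in> P1" for a :: 'k
  proof
    assume a: "[:a:] \<in> P1"
    show "a = 0"
    proof (rule ccontr)
      assume "a \<noteq> 0"
      then have "[:inverse a:] * [:a:] = 1" by (simp add: one_pCons)
      then show False using prime_setD(4)[OF P1 a, of "[:inverse a:]"] prime_setD(2)[OF P1] by simp
    qed
  qed (use prime_setD(1)[OF P1] in auto)
  obtain \<phi>1 :: "'k poly \<Rightarrow> 'k adj" where f1: "ring_hom_on \<phi>1" "\<forall>F. \<phi>1 F = 0 \<longleftrightarrow> F \<in> P1"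
    using extend_prime_embedding[OF id P1 ker0] by blast
  obtain \<phi>2 :: "'k poly poly \<Rightarrow> 'k adj adj" where f2: "ring_hom_on \<phi>2" "\<forall>F. \<phi>2 F = 0 \<longleftrightarrow> F \<in> P2"
    using extend_prime_embedding[OF f1(1) P2] f1(2) by (auto simp: P1_def)
  obtain \<phi>3 :: "'k poly poly poly \<Rightarrow> 'k adj adj adj" where f3: "ring_hom_on \<phi>3" "\<forall>F. \<phi>3 F = 0 \<longleftrightarrow> F \<in> P3"
    using extend_prime_embedding[OF f2(1) P3] f2(2) by (auto simp: P2_def)
  obtain \<phi>4 :: "'k poly poly poly poly \<Rightarrow> 'k adj adj adj adj" where f4: "ring_hom_on \<phi>4" "\<forall>F. \<phi>4 F = 0 \<longleftrightarrow> F \<in> P4"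
    using extend_prime_embedding[OF f3(1) P4] f3(2) by (auto simp: P3_def)
  \<comment> \<open>Any preimage will do: two preimages differ by an element of the kernel of
    \<open>n\<close>, hence of \<open>P4\<close>, which \<open>\<phi>4\<close> sends to
    zero.\<close>
  define s where "s F = (SOME G. n G = F)" for F
  have s: "n (s F) = F" for F unfolding s_def by (rule someI_ex) (simp add: n_def nest_eval_surj)
  note nh = ring_hom_onD[OF n] and fh = ring_hom_onD[OF f4(1)]
  have same: "\<phi>4 G = \<phi>4 H" if "n G = n H" for G H
  proof -
    have "n (G - H) = 0" using that by (simp add: nh)
    then have "G - H \<in> P4" using prime_setD(1)[OF p] by (simp add: P4_def)
    then have "\<phi>4 (G - H) = 0" using f4(2) by blast
    then show ?thesis by (simp add: fh)
  qed
  define \<phi> where "\<phi> F = \<phi>4 (s F)" for F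
  have "\<phi> 1 = 1" using same[of "s 1" 1] by (simp add: \<phi>_def s nh fh)
  moreover have "\<phi> (F + G) = \<phi> F + \<phi> G" for F G
    using same[of "s (F + G)" "s F + s G"] by (simp add: \<phi>_def s nh fh)
  moreover have "\<phi> (F * G) = \<phi> F * \<phi> G" for F G
    using same[of "s (F * G)" "s F * s G"] by (simp add: \<phi>_def s nh fh)
  ultimately have "ring_hom_on \<phi>" by (simp add: ring_hom_on_def)
  moreover have "\<phi> F = 0 \<longleftrightarrow> F \<in> p" for F using f4(2) s by (simp add: \<phi>_def P4_def)
  ultimately show ?thesis by blast
qed

section \<open>Local cohomology through a Laurent model\<close>

lemma univ_ring_simps [simp]:
  "carrier univ_ring = UNIV" "x \<otimes>\<^bsub>univ_ring\<^esub> y = x * y" "x \<oplus>\<^bsub>univ_ring\<^esub> y = x + y"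
  "\<one>\<^bsub>univ_ring\<^esub> = 1" "\<zero>\<^bsub>univ_ring\<^esub> = 0"
  by (simp_all add: univ_ring_def)

lemma univ_ring_pow [simp]: "(x :: 'a::comm_ring_1) [^]\<^bsub>univ_ring\<^esub> (n::nat) = x ^ n"
proof -
  interpret cring "univ_ring :: 'a ring" by (rule cring_univ_ring)
  show ?thesis by (induction n) (simp_all add: mult.commute)
qed

lemma univ_ring_finprod:
  "finite A \<Longrightarrow> finprod (univ_ring :: 'a::comm_ring_1 ring) f A = (\<Prod>j\<in>A. f j)"
proof -
  interpret cring "univ_ring :: 'a ring" by (rule cring_univ_ring)
  show "finite A \<Longrightarrow> finprod univ_ring f A = (\<Prod>j\<in>A. f j)"
    by (induction A rule: finite_induct) simp_all
qed

lemma cech_index_B_gens: "cech_index B_gens i = idx i"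
  by (simp add: cech_index_def idx_def B_gens_def numeral_eq_Suc)

text \<open>Operations on classes of fractions are written as unions over representatives; such a
  union collapses once its members do not depend on the representative.\<close>

lemma UN_pair_const:
  assumes "\<And>a b. (a, b) \<in> S \<Longrightarrow> f a b = T" "S \<noteq> {}"
  shows "(\<Union>(a, b)\<in>S. f a b) = T"
proof -
  have "(\<Union>(a, b)\<in>S. f a b) = (\<Union>p\<in>S. T)"
    by (rule SUP_cong) (use assms(1) in \<open>auto split: prod.splits\<close>)
  then show ?thesis using assms(2) by simp
qed

text \<open>The map \<^term>\<open>\<rho>\<close> plays the role of the projection to \<open>polys / J\<close>, but its kernel may be larger than \<^term>\<open>J\<close>
  outside \<^term>\<open>SK\<close>. As \<^term>\<open>SK\<close> still maps onto the graded pieces, homogeneous cocycles lift to cocycles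
  modulo \<^term>\<open>J\<close>, and only the element that they are the coboundary of leaves \<^term>\<open>SK\<close>.\<close>

locale cech_model =
  fixes M :: "('k::field S_poly, 'm) module" and \<rho> :: "'a::field laurent \<Rightarrow> 'm" and \<epsilon> :: "'k S_poly \<Rightarrow> 'a laurent"
    and SK J :: "'a laurent set" and gM :: "int \<times> int \<Rightarrow> 'm set"
  assumes eps: "ring_hom_on \<epsilon>" "\<And>a. \<epsilon> a \<in> polys" "\<And>j. j < 4 \<Longrightarrow> \<epsilon> (B_gens ! j) = bgen j"
      "\<And>a \<delta>. a \<in> S_piece \<delta> \<Longrightarrow> \<epsilon> a \<in> piece \<delta>"
    and carM: "carrier M = \<rho> ` polys" and zeroM: "\<zero>\<^bsub>M\<^esub> = \<rho> 0"
    and addM: "\<And>x y. x \<in> polys \<Longrightarrow> y \<in> polys \<Longrightarrow> \<rho> x \<oplus>\<^bsub>M\<^esub> \<rho> y = \<rho> (x + y)"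
    and smultM: "\<And>a x. x \<in> polys \<Longrightarrow> a \<odot>\<^bsub>M\<^esub> \<rho> x = \<rho> (\<epsilon> a * x)"
    and SK: "SK \<subseteq> polys" "0 \<in> SK" "\<And>x y. x \<in> SK \<Longrightarrow> y \<in> SK \<Longrightarrow> x + y \<in> SK"
      "\<And>a x. x \<in> SK \<Longrightarrow> \<epsilon> a * x \<in> SK"
    and J: "submod J" "\<And>x. x \<in> J \<Longrightarrow> \<rho> x = \<rho> 0" "\<And>x. x \<in> SK \<Longrightarrow> \<rho> x = \<rho> 0 \<Longrightarrow> x \<in> J"
    and gM: "\<And>\<nu>. gM \<nu> = \<rho> ` (SK \<inter> piece \<nu>)"
begin

lemmas ehom = ring_hom_onD[OF eps(1)]

abbreviation "U \<equiv> monomials_on univ_ring (B_gens :: 'k S_poly list)"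

abbreviation "CL \<equiv> cech_loc univ_ring B_gens M"

lemma rho_eq_iff:
  assumes "x \<in> polys" "y \<in> polys"
  shows "\<rho> x = \<rho> y \<longleftrightarrow> \<rho> (x - y) = \<rho> 0"
proof
  assume eq: "\<rho> x = \<rho> y"
  have "\<rho> (x - y) = \<rho> x \<oplus>\<^bsub>M\<^esub> \<rho> (- y)" using addM[OF assms(1) polys_uminus[OF assms(2)]] by simp
  also have "\<dots> = \<rho> 0" using eq addM[OF assms(2) polys_uminus[OF assms(2)]] by simp
  finally show "\<rho> (x - y) = \<rho> 0" .
next
  assume eq: "\<rho> (x - y) = \<rho> 0"
  have "\<rho> x = \<rho> (x - y) \<oplus>\<^bsub>M\<^esub> \<rho> y" using addM[OF polys_diff[OF assms] assms(2)] by simp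
  also have "\<dots> = \<rho> y" using eq addM[OF polys_0 assms(2)] by simp
  finally show "\<rho> x = \<rho> y" .
qed

lemma rho_0_mult:
  assumes "x \<in> polys" "\<rho> x = \<rho> 0"
  shows "\<rho> (\<epsilon> a * x) = \<rho> 0"
  using smultM[OF assms(1), of a] smultM[OF polys_0, of a] assms(2) by simp

lemma rho_0_add: "x \<in> polys \<Longrightarrow> y \<in> polys \<Longrightarrow> \<rho> x = \<rho> 0 \<Longrightarrow> \<rho> y = \<rho> 0 \<Longrightarrow> \<rho> (x + y) = \<rho> 0"
  using addM[of x y] addM[of 0 0] by simp

section \<open>Monomial denominators and classes of fractions\<close>

lemma U_iff: "finite A \<Longrightarrow> u \<in> U A \<longleftrightarrow> (\<exists>e. u = (\<Prod>j\<in>A. (B_gens ! j) ^ e j))"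
  by (auto simp: monomials_on_def univ_ring_finprod)

lemma U_1: "finite A \<Longrightarrow> 1 \<in> U A"
  by (subst U_iff) (auto intro!: exI[of _ "\<lambda>_. 0"])

lemma U_mult:
  assumes "finite A" "u \<in> U A" "v \<in> U A"
  shows "u * v \<in> U A"
proof -
  obtain e e' where "u = (\<Prod>j\<in>A. (B_gens ! j) ^ e j)" "v = (\<Prod>j\<in>A. (B_gens ! j) ^ e' j)"
    using assms by (auto simp: U_iff)
  then have "u * v = (\<Prod>j\<in>A. (B_gens ! j) ^ (e j + e' j))" by (simp add: power_add prod.distrib)
  then show ?thesis using assms(1) by (auto simp: U_iff)
qed

lemma U_mono:
  assumes "finite A'" "A \<subseteq> A'" "u \<in> U A"
  shows "u \<in> U A'"
proof -
  obtain e where e: "u = (\<Prod>j\<in>A. (B_gens ! j) ^ e j)"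
    using assms finite_subset[OF assms(2,1)] by (auto simp: U_iff)
  have "u = (\<Prod>j\<in>A'. (B_gens ! j) ^ (if j \<in> A then e j else 0))"
    unfolding e by (rule prod.mono_neutral_cong_left) (use assms in auto)
  then show ?thesis unfolding U_iff[OF assms(1)]
    by (rule exI[of _ "\<lambda>j. if j \<in> A then e j else 0"])
qed

lemma eps_prod: "\<epsilon> (\<Prod>j\<in>A. g j) = (\<Prod>j\<in>A. \<epsilon> (g j))"
  by (induction A rule: infinite_finite_induct) (simp_all add: ehom)

lemma eps_power: "\<epsilon> (a ^ n) = \<epsilon> a ^ n"
  by (induction n) (simp_all add: ehom)

lemma bprod_U:
  assumes "A \<subseteq> {..<4}"
  shows "\<exists>u\<in>U A. \<epsilon> u = bprod A ^ n"
proof -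
  have fin: "finite A" using assms finite_subset by blast
  have "\<epsilon> (\<Prod>j\<in>A. (B_gens ! j) ^ n) = (\<Prod>j\<in>A. bgen j ^ n)"
    unfolding eps_prod by (rule prod.cong) (use assms eps(3) in \<open>auto simp: eps_power\<close>)
  then have "\<epsilon> (\<Prod>j\<in>A. (B_gens ! j) ^ n) = bprod A ^ n" by (simp add: bprod_def prod_power_distrib)
  moreover have "(\<Prod>j\<in>A. (B_gens ! j) ^ n) \<in> U A" using fin by (auto simp: U_iff)
  ultimately show ?thesis by blast
qed

lemma U_divides:
  assumes "A \<subseteq> {..<4}" "u \<in> U A"
  shows "\<exists>v\<in>U A. \<exists>n. \<epsilon> v * \<epsilon> u = bprod A ^ n"
proof -
  have fin: "finite A" using assms finite_subset by blast
  obtain e where e: "u = (\<Prod>j\<in>A. (B_gens ! j) ^ e j)" using assms fin by (auto simp: U_iff)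
  define n where "n = (\<Sum>j\<in>A. e j)"
  have le: "e j \<le> n" if "j \<in> A" for j unfolding n_def using fin that by (intro member_le_sum) auto
  define v :: "'k S_poly" where "v = (\<Prod>j\<in>A. (B_gens ! j) ^ (n - e j))"
  have "v * u = (\<Prod>j\<in>A. (B_gens ! j) ^ n)"
    unfolding v_def e prod.distrib[symmetric] by (rule prod.cong) (use le in \<open>auto simp: power_add[symmetric]\<close>)
  then have "\<epsilon> v * \<epsilon> u = (\<Prod>j\<in>A. \<epsilon> (B_gens ! j) ^ n)" by (simp add: ehom(4)[symmetric] eps_prod eps_power)
  also have "\<dots> = (\<Prod>j\<in>A. bgen j ^ n)" by (rule prod.cong) (use assms eps(3) in auto)
  also have "\<dots> = bprod A ^ n" by (simp add: bprod_def prod_power_distrib)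
  finally have "\<epsilon> v * \<epsilon> u = bprod A ^ n" .
  moreover have "v \<in> U A" using fin by (auto simp: U_iff v_def)
  ultimately show ?thesis by blast
qed

lemma loc_iff_U:
  assumes "submod N" "A \<subseteq> {..<4}"
  shows "x \<in> loc N A \<longleftrightarrow> (\<exists>u\<in>U A. \<epsilon> u * x \<in> N)"
proof
  assume "x \<in> loc N A"
  then obtain n where "bprod A ^ n * x \<in> N" by (auto simp: loc_def)
  then show "\<exists>u\<in>U A. \<epsilon> u * x \<in> N" using bprod_U[OF assms(2), of n] by metis
next
  assume "\<exists>u\<in>U A. \<epsilon> u * x \<in> N"
  then obtain u where u: "u \<in> U A" "\<epsilon> u * x \<in> N" by blast
  obtain v n where v: "\<epsilon> v * \<epsilon> u = bprod A ^ n" using U_divides[OF assms(2) u(1)] by blast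
  have "\<epsilon> v * (\<epsilon> u * x) \<in> N" using submodD(4)[OF assms(1) eps(2) u(2)] .
  then have "bprod A ^ n * x \<in> N" by (simp add: mult.assoc[symmetric] v)
  then show "x \<in> loc N A" by (rule locI)
qed

lemma U_inverse:
  assumes "A \<subseteq> {..<4}" "u \<in> U A"
  shows "\<exists>t\<in>loc polys A. \<epsilon> u * t = 1"
proof -
  have fin: "finite A" using assms finite_subset by blast
  obtain v n where v: "\<epsilon> v * \<epsilon> u = bprod A ^ n" using U_divides[OF assms] by blast
  obtain t :: "'a laurent" where t: "t \<in> loc polys A" "bprod A ^ n * t = 1" using bprod_inverse[OF fin] by blast
  have "\<epsilon> u * (\<epsilon> v * t) = 1" using t(2) by (simp add: v[symmetric] mult_ac)
  then show ?thesis using loc_mult_polys[OF submod_polys eps(2) t(1)] by blast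
qed

text \<open>The values that become zero in the localization of \<open>M\<close> at \<open>A\<close>.
  As \<open>\<rho>\<close> is linear only along \<open>\<epsilon>\<close>, this is closed under
  multiplication by elements \<open>\<epsilon> a\<close>, but need not be an ideal of
  \<open>polys\<close>.\<close>

definition Z :: "nat set \<Rightarrow> 'a laurent set" where
  "Z A = {x. \<exists>w\<in>U A. \<epsilon> w * x \<in> polys \<and> \<rho> (\<epsilon> w * x) = \<rho> 0}"

lemma Z_mult: "x \<in> Z A \<Longrightarrow> \<epsilon> a * x \<in> Z A"
proof -
  assume "x \<in> Z A"
  then obtain w where w: "w \<in> U A" "\<epsilon> w * x \<in> polys" "\<rho> (\<epsilon> w * x) = \<rho> 0" by (auto simp: Z_def)
  have "\<epsilon> w * (\<epsilon> a * x) = \<epsilon> a * (\<epsilon> w * x)" by (simp add: mult_ac)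
  moreover have "\<rho> (\<epsilon> a * (\<epsilon> w * x)) = \<rho> 0" "\<epsilon> a * (\<epsilon> w * x) \<in> polys"
    using rho_0_mult[OF w(2,3), of a] polys_mult[OF eps(2) w(2), of a] by auto
  ultimately have "\<epsilon> w * (\<epsilon> a * x) \<in> polys \<and> \<rho> (\<epsilon> w * (\<epsilon> a * x)) = \<rho> 0" by (simp only: simp_thms)
  then show "\<epsilon> a * x \<in> Z A" using w(1) unfolding Z_def by blast
qed

lemma Z_add:
  assumes "finite A" "x \<in> Z A" "y \<in> Z A"
  shows "x + y \<in> Z A"
proof -
  obtain w where w: "w \<in> U A" "\<epsilon> w * x \<in> polys" "\<rho> (\<epsilon> w * x) = \<rho> 0" using assms by (auto simp: Z_def)
  obtain v where v: "v \<in> U A" "\<epsilon> v * y \<in> polys" "\<rho> (\<epsilon> v * y) = \<rho> 0" using assms by (auto simp: Z_def)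
  have eq: "\<epsilon> (w * v) * (x + y) = \<epsilon> v * (\<epsilon> w * x) + \<epsilon> w * (\<epsilon> v * y)" by (simp add: ehom algebra_simps)
  have p: "\<epsilon> v * (\<epsilon> w * x) \<in> polys" "\<epsilon> w * (\<epsilon> v * y) \<in> polys" using w v eps(2) by (auto intro: polys_mult)
  have "\<rho> (\<epsilon> (w * v) * (x + y)) = \<rho> 0"
    unfolding eq using p rho_0_mult[OF w(2,3)] rho_0_mult[OF v(2,3)] by (intro rho_0_add)
  moreover have "\<epsilon> (w * v) * (x + y) \<in> polys" unfolding eq by (intro polys_add p)
  moreover have "w * v \<in> U A" using U_mult[OF assms(1) w(1) v(1)] .
  ultimately show ?thesis unfolding Z_def by blast
qed

lemma Z_uminus: "x \<in> Z A \<Longrightarrow> - x \<in> Z A"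
  using Z_mult[of x A "-1"] by (simp add: ehom)

lemma Z_cancel:
  assumes "finite A" "u \<in> U A" "\<epsilon> u * x \<in> Z A"
  shows "x \<in> Z A"
proof -
  obtain w where w: "w \<in> U A" "\<epsilon> w * (\<epsilon> u * x) \<in> polys" "\<rho> (\<epsilon> w * (\<epsilon> u * x)) = \<rho> 0" using assms by (auto simp: Z_def)
  have wu: "w * u \<in> U A" using U_mult[OF assms(1) w(1) assms(2)] .
  have "\<epsilon> (w * u) * x = \<epsilon> w * (\<epsilon> u * x)" by (simp add: ehom mult.assoc)
  then have "\<epsilon> (w * u) * x \<in> polys \<and> \<rho> (\<epsilon> (w * u) * x) = \<rho> 0" using w(2,3) by (simp only: simp_thms)
  then show ?thesis using wu unfolding Z_def by blast
qed

lemma Z_mono: "finite A' \<Longrightarrow> A \<subseteq> A' \<Longrightarrow> x \<in> Z A \<Longrightarrow> x \<in> Z A'"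
  using U_mono unfolding Z_def by blast

lemma Z_0: "finite A \<Longrightarrow> 0 \<in> Z A"
  using U_1 unfolding Z_def by force

lemma loc_J_Z:
  assumes "A \<subseteq> {..<4}" "x \<in> loc J A"
  shows "x \<in> Z A"
proof -
  obtain u where "u \<in> U A" "\<epsilon> u * x \<in> J" using assms loc_iff_U[OF J(1) assms(1)] by blast
  then show ?thesis unfolding Z_def using J(2) submodD(1)[OF J(1)] by blast
qed

abbreviation "rel A \<equiv> loc_rel univ_ring (U A) M"

lemma rel_iff:
  assumes A: "finite A" and g: "g \<in> polys" "h \<in> polys"
  shows "((\<rho> g, u), (\<rho> h, v)) \<in> rel A \<longleftrightarrow> u \<in> U A \<and> v \<in> U A \<and> \<epsilon> v * g - \<epsilon> u * h \<in> Z A"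
proof -
  have e: "\<epsilon> w * (\<epsilon> v * g) \<in> polys" "\<epsilon> w * (\<epsilon> u * h) \<in> polys" for w
    using g eps(2) by (auto intro!: polys_mult)
  have "w \<odot>\<^bsub>M\<^esub> (v \<odot>\<^bsub>M\<^esub> \<rho> g) = w \<odot>\<^bsub>M\<^esub> (u \<odot>\<^bsub>M\<^esub> \<rho> h) \<longleftrightarrow>
      \<rho> (\<epsilon> w * (\<epsilon> v * g - \<epsilon> u * h)) = \<rho> 0" for w
  proof -
    have "w \<odot>\<^bsub>M\<^esub> (v \<odot>\<^bsub>M\<^esub> \<rho> g) = \<rho> (\<epsilon> w * (\<epsilon> v * g))" "w \<odot>\<^bsub>M\<^esub> (u \<odot>\<^bsub>M\<^esub> \<rho> h) = \<rho> (\<epsilon> w * (\<epsilon> u * h))"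
      using g eps(2) by (simp_all add: smultM polys_mult)
    then show ?thesis using rho_eq_iff[OF e, of w w] by (simp add: right_diff_distrib)
  qed
  moreover have "\<epsilon> w * (\<epsilon> v * g - \<epsilon> u * h) \<in> polys" for w
    using g eps(2) by (auto intro!: polys_mult polys_diff)
  ultimately show ?thesis using g carM unfolding loc_rel_def Z_def by auto
qed

text \<open>The fractions of value \<open>x\<close>, as a class in the localization of
  \<open>M\<close>. Thus \<open>R A\<close> is the localized projection, defined on
  \<open>loc polys A\<close> and with kernel given by \<open>Z A\<close>.\<close>

definition R :: "nat set \<Rightarrow> 'a laurent \<Rightarrow> ('m \<times> 'k S_poly) set" where
  "R A x = {(\<rho> g, u) | g u. g \<in> polys \<and> u \<in> U A \<and> g - \<epsilon> u * x \<in> Z A}"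

lemma R_mem:
  assumes A: "finite A" and g: "g \<in> polys"
  shows "(\<rho> g, u) \<in> R A x \<longleftrightarrow> u \<in> U A \<and> g - \<epsilon> u * x \<in> Z A"
proof
  assume "(\<rho> g, u) \<in> R A x"
  then obtain g' where g': "\<rho> g = \<rho> g'" "g' \<in> polys" "u \<in> U A" "g' - \<epsilon> u * x \<in> Z A" by (auto simp: R_def)
  have "\<rho> (g - g') = \<rho> 0" using g'(1) rho_eq_iff[OF g g'(2)] by simp
  then have "g - g' \<in> Z A" unfolding Z_def using U_1[OF A] polys_diff[OF g g'(2)] by (auto intro!: bexI[of _ 1] simp: ehom)
  then have "(g - g') + (g' - \<epsilon> u * x) \<in> Z A" using g' by (intro Z_add[OF A])
  then show "u \<in> U A \<and> g - \<epsilon> u * x \<in> Z A" using g' by simp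
qed (use g in \<open>auto simp: R_def\<close>)

text \<open>Two fractions are equivalent exactly when their values agree modulo \<open>Z A\<close>,
  so a class can be named by a value.\<close>

lemma mfrac_R:
  assumes A: "finite A" and g: "g \<in> polys" and u: "u \<in> U A" and x: "\<epsilon> u * x - g \<in> Z A"
  shows "mfrac univ_ring (U A) M (\<rho> g) u = R A x"
proof -
  have x': "g - \<epsilon> u * x \<in> Z A" using Z_uminus[OF x] by simp
  have key: "((\<rho> g, u), (\<rho> h, v)) \<in> rel A \<longleftrightarrow> (\<rho> h, v) \<in> R A x" if h: "h \<in> polys" for h v
  proof -
    have "\<epsilon> v * g - \<epsilon> u * h \<in> Z A \<longleftrightarrow> h - \<epsilon> v * x \<in> Z A"
    proof
      assume 1: "\<epsilon> v * g - \<epsilon> u * h \<in> Z A"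
      have "\<epsilon> v * (g - \<epsilon> u * x) + - (\<epsilon> v * g - \<epsilon> u * h) \<in> Z A" by (intro Z_add[OF A] Z_mult x' Z_uminus 1)
      moreover have "\<epsilon> v * (g - \<epsilon> u * x) + - (\<epsilon> v * g - \<epsilon> u * h) = \<epsilon> u * (h - \<epsilon> v * x)" by (simp add: algebra_simps)
      ultimately show "h - \<epsilon> v * x \<in> Z A" using Z_cancel[OF A u] by simp
    next
      assume 1: "h - \<epsilon> v * x \<in> Z A"
      have "\<epsilon> v * (g - \<epsilon> u * x) + - (\<epsilon> u * (h - \<epsilon> v * x)) \<in> Z A" by (intro Z_add[OF A] Z_mult x' Z_uminus 1)
      moreover have "\<epsilon> v * (g - \<epsilon> u * x) + - (\<epsilon> u * (h - \<epsilon> v * x)) = \<epsilon> v * g - \<epsilon> u * h" by (simp add: algebra_simps)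
      ultimately show "\<epsilon> v * g - \<epsilon> u * h \<in> Z A" by simp
    qed
    then show ?thesis using u by (auto simp: rel_iff[OF A g h] R_mem[OF A h])
  qed
  have img: "\<exists>h\<in>polys. n = \<rho> h" if "((\<rho> g, u), (n, v)) \<in> rel A \<or> (n, v) \<in> R A x" for n v
    using that by (auto simp: loc_rel_def carM R_def)
  have "((\<rho> g, u), (n, v)) \<in> rel A \<longleftrightarrow> (n, v) \<in> R A x" for n v
    using key img by metis
  then show ?thesis unfolding mfrac_def by auto
qed

lemma R_nonempty:
  assumes "A \<subseteq> {..<4}" "x \<in> loc polys A"
  obtains g u where "g \<in> polys" "u \<in> U A" "g = \<epsilon> u * x" "(\<rho> g, u) \<in> R A x"
proof -
  have fin: "finite A" using assms finite_subset by blast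
  obtain u where "u \<in> U A" "\<epsilon> u * x \<in> polys" using assms loc_iff_U[OF submod_polys assms(1)] by blast
  then show ?thesis using that[of "\<epsilon> u * x" u] by (simp add: R_mem[OF fin] Z_0[OF fin])
qed

lemma R_eq_iff:
  assumes "A \<subseteq> {..<4}" "x \<in> loc polys A" "y \<in> loc polys A"
  shows "R A x = R A y \<longleftrightarrow> x - y \<in> Z A"
proof -
  have fin: "finite A" using assms finite_subset by blast
  show ?thesis
  proof
    assume eq: "R A x = R A y"
    obtain g u where gu: "g \<in> polys" "u \<in> U A" "g = \<epsilon> u * x" "(\<rho> g, u) \<in> R A x" using R_nonempty[OF assms(1,2)] by blast
    then have "\<epsilon> u * (x - y) \<in> Z A" using eq R_mem[OF fin gu(1), of u y] by (simp add: right_diff_distrib)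
    then show "x - y \<in> Z A" by (rule Z_cancel[OF fin gu(2)])
  next
    assume d: "x - y \<in> Z A"
    have "g - \<epsilon> u * x \<in> Z A \<longleftrightarrow> g - \<epsilon> u * y \<in> Z A" for g u
    proof
      assume "g - \<epsilon> u * x \<in> Z A"
      then have "(g - \<epsilon> u * x) + \<epsilon> u * (x - y) \<in> Z A" by (intro Z_add[OF fin] Z_mult d)
      then show "g - \<epsilon> u * y \<in> Z A" by (simp add: algebra_simps)
    next
      assume "g - \<epsilon> u * y \<in> Z A"
      then have "(g - \<epsilon> u * y) + - (\<epsilon> u * (x - y)) \<in> Z A" by (intro Z_add[OF fin] Z_uminus Z_mult d)
      then show "g - \<epsilon> u * x \<in> Z A" by (simp add: algebra_simps)
    qed
    then show "R A x = R A y" by (simp add: R_def)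
  qed
qed

lemma CL_carrier:
  assumes "A \<subseteq> {..<4}"
  shows "carrier (CL A) = R A ` loc polys A"
proof -
  have fin: "finite A" using assms finite_subset by blast
  have car: "carrier (CL A) = {mfrac univ_ring (U A) M m u | m u. m \<in> carrier M \<and> u \<in> U A}"
    by (auto simp: cech_loc_def localization_def quotient_def mfrac_def)
  show ?thesis
  proof (intro subset_antisym subsetI)
    fix Y assume "Y \<in> carrier (CL A)"
    then obtain g u where g: "g \<in> polys" "u \<in> U A" "Y = mfrac univ_ring (U A) M (\<rho> g) u" by (auto simp: car carM)
    obtain t where t: "t \<in> loc polys A" "\<epsilon> u * t = 1" using U_inverse[OF assms g(2)] by blast
    have "Y = R A (g * t)" unfolding g(3)
      by (rule mfrac_R[OF fin g(1,2)]) (use t(2) Z_0[OF fin] in \<open>simp add: mult.left_commute\<close>)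
    then show "Y \<in> R A ` loc polys A" using loc_mult_polys[OF submod_polys g(1) t(1)] by blast
  next
    fix Y assume "Y \<in> R A ` loc polys A"
    then obtain x where x: "x \<in> loc polys A" "Y = R A x" by blast
    obtain g u where gu: "g \<in> polys" "u \<in> U A" "g = \<epsilon> u * x" using R_nonempty[OF assms x(1)] by blast
    have "mfrac univ_ring (U A) M (\<rho> g) u = R A x" by (rule mfrac_R[OF fin gu(1,2)]) (use gu(3) Z_0[OF fin] in simp)
    then show "Y \<in> carrier (CL A)" using gu x by (auto simp: car carM)
  qed
qed

lemma CL_zero: "A \<subseteq> {..<4} \<Longrightarrow> \<zero>\<^bsub>CL A\<^esub> = R A 0"
proof -
  assume A: "A \<subseteq> {..<4}"
  then have fin: "finite A" using finite_subset by blast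
  show ?thesis unfolding cech_loc_def localization_def using mfrac_R[OF fin polys_0 U_1[OF fin], of 0] Z_0[OF fin]
    by (simp add: zeroM)
qed

lemma CL_add:
  assumes "A \<subseteq> {..<4}" "x \<in> loc polys A" "y \<in> loc polys A"
  shows "R A x \<oplus>\<^bsub>CL A\<^esub> R A y = R A (x + y)"
proof -
  have fin: "finite A" using assms finite_subset by blast
  have const: "mfrac univ_ring (U A) M (v \<odot>\<^bsub>M\<^esub> m \<oplus>\<^bsub>M\<^esub> u \<odot>\<^bsub>M\<^esub> n) (u * v) = R A (x + y)"
    if mu: "(m, u) \<in> R A x" and nv: "(n, v) \<in> R A y" for m u n v
  proof -
    obtain g where g: "m = \<rho> g" "g \<in> polys" "u \<in> U A" "g - \<epsilon> u * x \<in> Z A" using mu by (auto simp: R_def)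
    obtain h where h: "n = \<rho> h" "h \<in> polys" "v \<in> U A" "h - \<epsilon> v * y \<in> Z A" using nv by (auto simp: R_def)
    have p: "\<epsilon> v * g \<in> polys" "\<epsilon> u * h \<in> polys" using g h eps(2) by (auto intro: polys_mult)
    have e: "v \<odot>\<^bsub>M\<^esub> m \<oplus>\<^bsub>M\<^esub> u \<odot>\<^bsub>M\<^esub> n = \<rho> (\<epsilon> v * g + \<epsilon> u * h)"
      using g h p by (simp add: smultM addM)
    have "- (\<epsilon> v * (g - \<epsilon> u * x) + \<epsilon> u * (h - \<epsilon> v * y)) \<in> Z A" by (intro Z_uminus Z_add[OF fin] Z_mult g h)
    then have z: "\<epsilon> (u * v) * (x + y) - (\<epsilon> v * g + \<epsilon> u * h) \<in> Z A" by (simp add: ehom algebra_simps)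
    show ?thesis unfolding e using mfrac_R[OF fin polys_add[OF p] U_mult[OF fin g(3) h(3)] z] by simp
  qed
  obtain g u where 1: "(\<rho> g, u) \<in> R A x" using R_nonempty[OF assms(1,2)] by blast
  obtain h v where 2: "(\<rho> h, v) \<in> R A y" using R_nonempty[OF assms(1,3)] by blast
  have "(\<Union>(m, u)\<in>R A x. \<Union>(n, v)\<in>R A y. mfrac univ_ring (U A) M (v \<odot>\<^bsub>M\<^esub> m \<oplus>\<^bsub>M\<^esub> u \<odot>\<^bsub>M\<^esub> n) (u * v))
      = R A (x + y)"
    by (intro UN_pair_const const) (use 1 2 in auto)
  then show ?thesis by (simp add: cech_loc_def localization_def)
qed

lemma CL_res:
  assumes "A' \<subseteq> {..<4}" "A \<subseteq> A'" "x \<in> loc polys A"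
  shows "cech_res univ_ring B_gens M A' (R A x) = R A' x"
proof -
  have fin: "finite A'" using assms(1) finite_subset by blast
  have const: "mfrac univ_ring (U A') M m u = R A' x" if mu: "(m, u) \<in> R A x" for m u
  proof -
    obtain g where g: "m = \<rho> g" "g \<in> polys" "u \<in> U A" "g - \<epsilon> u * x \<in> Z A" using mu by (auto simp: R_def)
    have "\<epsilon> u * x - g \<in> Z A'" using Z_mono[OF fin assms(2) Z_uminus[OF g(4)]] by simp
    then show ?thesis unfolding g(1) by (intro mfrac_R[OF fin g(2) U_mono[OF fin assms(2) g(3)]])
  qed
  obtain g u where 1: "(\<rho> g, u) \<in> R A x" using R_nonempty[OF order_trans[OF assms(2,1)] assms(3)] by blast
  then show ?thesis unfolding cech_res_def by (intro UN_pair_const const) auto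
qed

lemma CL_group:
  assumes A: "A \<subseteq> {..<4}"
  shows "abelian_group (CL A)"
proof (rule abelian_groupI)
  note [simp] = CL_carrier[OF A] CL_zero[OF A]
  have add: "R A x \<oplus>\<^bsub>CL A\<^esub> R A y = R A (x + y)" "x + y \<in> loc polys A" if "x \<in> loc polys A" "y \<in> loc polys A" for x y
    using CL_add[OF A that] loc_add[OF submod_polys that] by auto
  show "P \<oplus>\<^bsub>CL A\<^esub> Y \<in> carrier (CL A)" if "P \<in> carrier (CL A)" "Y \<in> carrier (CL A)" for P Y
    using that add by auto
  show "\<zero>\<^bsub>CL A\<^esub> \<in> carrier (CL A)" using loc_0[OF submod_polys] by auto
  show "P \<oplus>\<^bsub>CL A\<^esub> Y \<oplus>\<^bsub>CL A\<^esub> W = P \<oplus>\<^bsub>CL A\<^esub> (Y \<oplus>\<^bsub>CL A\<^esub> W)"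
    if "P \<in> carrier (CL A)" "Y \<in> carrier (CL A)" "W \<in> carrier (CL A)" for P Y W
    using that by (auto simp: add add.assoc)
  show "P \<oplus>\<^bsub>CL A\<^esub> Y = Y \<oplus>\<^bsub>CL A\<^esub> P" if "P \<in> carrier (CL A)" "Y \<in> carrier (CL A)" for P Y
    using that by (auto simp: add add.commute)
  show "\<zero>\<^bsub>CL A\<^esub> \<oplus>\<^bsub>CL A\<^esub> P = P" if "P \<in> carrier (CL A)" for P
    using that loc_0[OF submod_polys] by (auto simp: add)
  show "\<exists>Y\<in>carrier (CL A). Y \<oplus>\<^bsub>CL A\<^esub> P = \<zero>\<^bsub>CL A\<^esub>" if P: "P \<in> carrier (CL A)" for P
  proof -
    obtain x where "x \<in> loc polys A" "P = R A x" using P by auto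
    then show ?thesis using loc_uminus[OF submod_polys, of x A] by (auto simp: add intro!: bexI[of _ "- x"])
  qed
qed

lemma CL_uminus:
  assumes A: "A \<subseteq> {..<4}" and x: "x \<in> loc polys A"
  shows "\<ominus>\<^bsub>CL A\<^esub> R A x = R A (- x)"
proof -
  interpret abelian_group "CL A" by (rule CL_group[OF A])
  have x': "- x \<in> loc polys A" using loc_uminus[OF submod_polys x] .
  show ?thesis
  proof (rule minus_equality)
    show "R A (- x) \<oplus>\<^bsub>CL A\<^esub> R A x = \<zero>\<^bsub>CL A\<^esub>" using CL_add[OF A x' x] CL_zero[OF A] by simp
  qed (use x x' CL_carrier[OF A] in auto)
qed

lemma CL_finsum:
  assumes A: "A \<subseteq> {..<4}" and "finite F" "\<And>j. j \<in> F \<Longrightarrow> x j \<in> loc polys A"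
  shows "finsum (CL A) (\<lambda>j. R A (x j)) F = R A (\<Sum>j\<in>F. x j)"
  using assms(2,3)
proof (induction F rule: finite_induct)
  case empty
  interpret abelian_group "CL A" by (rule CL_group[OF A])
  show ?case using CL_zero[OF A] by simp
next
  case (insert j F)
  interpret abelian_group "CL A" by (rule CL_group[OF A])
  have "finsum (CL A) (\<lambda>j. R A (x j)) (insert j F) = R A (x j) \<oplus>\<^bsub>CL A\<^esub> finsum (CL A) (\<lambda>j. R A (x j)) F"
    using insert CL_carrier[OF A] by (intro finsum_insert) auto
  also have "\<dots> = R A (x j) \<oplus>\<^bsub>CL A\<^esub> R A (\<Sum>j\<in>F. x j)" using insert by simp
  also have "\<dots> = R A (x j + (\<Sum>j\<in>F. x j))"
    using insert by (intro CL_add[OF A] loc_sum[OF submod_polys]) auto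
  finally show ?case using insert by simp
qed

section \<open>Cochains, coboundaries and homogeneous cocycles\<close>

abbreviation "CC \<equiv> cech_cochains univ_ring B_gens M"

definition Rc :: "int \<Rightarrow> (nat set \<Rightarrow> 'a laurent) \<Rightarrow> nat set \<Rightarrow> ('m \<times> 'k S_poly) set" where
  "Rc i x = (\<lambda>A\<in>idx i. R A (x A))"

lemma idx_sub: "A \<in> idx i \<Longrightarrow> A \<subseteq> {..<4}"
  by (simp add: idx_def)

lemma CC_carrier: "c \<in> carrier (CC i) \<longleftrightarrow> (\<exists>x. (\<forall>A\<in>idx i. x A \<in> loc polys A) \<and> c = Rc i x)"
proof
  assume "c \<in> carrier (CC i)"
  then have c: "c \<in> (\<Pi>\<^sub>E A\<in>idx i. carrier (CL A))"
    by (simp add: cech_cochains_def cech_index_B_gens)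
  then have "\<forall>A\<in>idx i. \<exists>x. x \<in> loc polys A \<and> c A = R A x"
    using CL_carrier[OF idx_sub] by (fastforce simp: PiE_iff)
  then obtain x where x: "\<forall>A\<in>idx i. x A \<in> loc polys A \<and> c A = R A (x A)" by metis
  then have "c = Rc i x" using c by (auto simp: Rc_def PiE_iff extensional_def fun_eq_iff)
  then show "\<exists>x. (\<forall>A\<in>idx i. x A \<in> loc polys A) \<and> c = Rc i x" using x by blast
next
  assume "\<exists>x. (\<forall>A\<in>idx i. x A \<in> loc polys A) \<and> c = Rc i x"
  then show "c \<in> carrier (CC i)"
    using CL_carrier[OF idx_sub] by (auto simp: cech_cochains_def cech_index_B_gens Rc_def)
qed

lemma CC_mult:
  assumes "\<forall>A\<in>idx i. x A \<in> loc polys A" "\<forall>A\<in>idx i. y A \<in> loc polys A"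
  shows "Rc i x \<otimes>\<^bsub>CC i\<^esub> Rc i y = Rc i (\<lambda>A. x A + y A)"
  using assms CL_add[OF idx_sub]
  by (auto simp: cech_cochains_def cech_index_B_gens Rc_def intro!: restrict_ext)

lemma CC_one: "\<one>\<^bsub>CC i\<^esub> = Rc i (\<lambda>A. 0)"
  using CL_zero[OF idx_sub] by (auto simp: cech_cochains_def cech_index_B_gens Rc_def intro!: restrict_ext)

lemma Rc_eq_iff:
  assumes "\<forall>A\<in>idx i. x A \<in> loc polys A" "\<forall>A\<in>idx i. y A \<in> loc polys A"
  shows "Rc i x = Rc i y \<longleftrightarrow> (\<forall>A\<in>idx i. x A - y A \<in> Z A)"
proof -
  have "Rc i x = Rc i y \<longleftrightarrow> (\<forall>A\<in>idx i. R A (x A) = R A (y A))"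
    by (auto simp: Rc_def restrict_def fun_eq_iff)
  moreover have "R A (x A) = R A (y A) \<longleftrightarrow> x A - y A \<in> Z A" if "A \<in> idx i" for A
    by (rule R_eq_iff[OF idx_sub[OF that]]) (use assms that in auto)
  ultimately show ?thesis by simp
qed

text \<open>\<open>R A\<close> respects sums and signs, and restriction keeps the value of a
  fraction, so the Cech differential of \<open>M\<close> becomes \<open>cd\<close> on
  values.\<close>

lemma CC_diff:
  assumes x: "\<forall>A\<in>idx i. x A \<in> loc polys A"
  shows "cech_diff univ_ring B_gens M i (Rc i x) = Rc (i + 1) (cd x)"
  unfolding cech_diff_def cech_index_B_gens Rc_def[of "i + 1"]
proof (rule restrict_ext)
  fix A assume A: "A \<in> idx (i + 1)"
  note sub = idx_sub[OF A] and fin = idx_finite[OF A]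
  have xl: "x (A - {j}) \<in> loc polys (A - {j})" "x (A - {j}) \<in> loc polys A" if j: "j \<in> A" for j
  proof -
    show "x (A - {j}) \<in> loc polys (A - {j})" using x idx_remove[OF A j] by blast
    then show "x (A - {j}) \<in> loc polys A" by (rule loc_subset[OF submod_polys fin Diff_subset])
  qed
  interpret abelian_group "CL A" by (rule CL_group[OF sub])
  have "(if even (card {l \<in> A. l < j}) then cech_res univ_ring B_gens M A (Rc i x (A - {j}))
      else \<ominus>\<^bsub>CL A\<^esub> cech_res univ_ring B_gens M A (Rc i x (A - {j})))
    = R A ((-1) ^ card {l \<in> A. l < j} * x (A - {j}))" if j: "j \<in> A" for j
  proof -
    have "Rc i x (A - {j}) = R (A - {j}) (x (A - {j}))" using idx_remove[OF A j] by (simp add: Rc_def)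
    then have "cech_res univ_ring B_gens M A (Rc i x (A - {j})) = R A (x (A - {j}))"
      using CL_res[OF sub Diff_subset xl(1)[OF j]] by simp
    then show ?thesis using CL_uminus[OF sub xl(2)[OF j]] by simp
  qed
  then have "finsum (CL A) (\<lambda>j. if even (card {l \<in> A. l < j}) then cech_res univ_ring B_gens M A (Rc i x (A - {j}))
      else \<ominus>\<^bsub>CL A\<^esub> cech_res univ_ring B_gens M A (Rc i x (A - {j}))) A
    = finsum (CL A) (\<lambda>j. R A ((-1) ^ card {l \<in> A. l < j} * x (A - {j}))) A"
    using CL_carrier[OF sub] loc_sgn[OF submod_polys xl(2)] by (intro finsum_cong') auto
  also have "\<dots> = R A (\<Sum>j\<in>A. (-1) ^ card {l \<in> A. l < j} * x (A - {j}))"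
    by (rule CL_finsum[OF sub fin]) (intro loc_sgn submod_polys xl)
  finally show "finsum (CL A) (\<lambda>j. if even (card {l \<in> A. l < j}) then cech_res univ_ring B_gens M A (Rc i x (A - {j}))
      else \<ominus>\<^bsub>CL A\<^esub> cech_res univ_ring B_gens M A (Rc i x (A - {j}))) A = R A (cd x A)"
    by (simp add: cd_def)
qed

lemma cob_eq: "cech_coboundaries univ_ring B_gens M i = {Rc i (cd y) | y. \<forall>A\<in>idx (i - 1). y A \<in> loc polys A}"
proof -
  have d: "cech_diff univ_ring B_gens M (i - 1) (Rc (i - 1) y) = Rc i (cd y)" if "\<forall>A\<in>idx (i - 1). y A \<in> loc polys A" for y
    using CC_diff[OF that] by simp
  show ?thesis
  proof (intro subset_antisym subsetI)
    fix c assume "c \<in> cech_coboundaries univ_ring B_gens M i"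
    then obtain b where b: "b \<in> carrier (CC (i - 1))" "c = cech_diff univ_ring B_gens M (i - 1) b"
      by (auto simp: cech_coboundaries_def)
    obtain y where y: "\<forall>A\<in>idx (i - 1). y A \<in> loc polys A" "b = Rc (i - 1) y" using b(1) CC_carrier by blast
    then show "c \<in> {Rc i (cd y) | y. \<forall>A\<in>idx (i - 1). y A \<in> loc polys A}" using b(2) d[OF y(1)] by blast
  next
    fix c assume "c \<in> {Rc i (cd y) | y. \<forall>A\<in>idx (i - 1). y A \<in> loc polys A}"
    then obtain y where y: "\<forall>A\<in>idx (i - 1). y A \<in> loc polys A" "c = Rc i (cd y)" by blast
    then have "Rc (i - 1) y \<in> carrier (CC (i - 1))" using CC_carrier by blast
    then show "c \<in> cech_coboundaries univ_ring B_gens M i"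
      unfolding cech_coboundaries_def using d[OF y(1)] y(2) by (metis imageI)
  qed
qed

lemma cob_coset:
  assumes c: "c \<in> cech_coboundaries univ_ring B_gens M i"
  shows "cech_coboundaries univ_ring B_gens M i #>\<^bsub>CC i\<^esub> c = cech_coboundaries univ_ring B_gens M i"
proof -
  have cdl: "\<forall>A\<in>idx i. cd y A \<in> loc polys A" if "\<forall>A\<in>idx (i - 1). y A \<in> loc polys A" for y
    using cd_loc'[OF submod_polys, of i y] that by blast
  obtain z where z: "c = Rc i (cd z)" "\<forall>A\<in>idx (i - 1). z A \<in> loc polys A" using c unfolding cob_eq by blast
  have add: "Rc i (cd y) \<otimes>\<^bsub>CC i\<^esub> c = Rc i (cd (\<lambda>A. y A + z A))" if "\<forall>A\<in>idx (i - 1). y A \<in> loc polys A" for y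
    unfolding z(1) using CC_mult[OF cdl[OF that] cdl[OF z(2)]] by (simp add: cd_add[abs_def])
  show ?thesis
  proof (intro subset_antisym subsetI)
    fix b assume "b \<in> cech_coboundaries univ_ring B_gens M i #>\<^bsub>CC i\<^esub> c"
    then obtain y where y: "\<forall>A\<in>idx (i - 1). y A \<in> loc polys A" "b = Rc i (cd y) \<otimes>\<^bsub>CC i\<^esub> c"
      unfolding r_coset_def cob_eq by blast
    moreover have "\<forall>A\<in>idx (i - 1). y A + z A \<in> loc polys A" using y z loc_add[OF submod_polys] by blast
    ultimately show "b \<in> cech_coboundaries univ_ring B_gens M i" unfolding cob_eq using add by blast
  next
    fix b assume "b \<in> cech_coboundaries univ_ring B_gens M i"
    then obtain y where y: "\<forall>A\<in>idx (i - 1). y A \<in> loc polys A" "b = Rc i (cd y)" unfolding cob_eq by blast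
    have y': "\<forall>A\<in>idx (i - 1). y A - z A \<in> loc polys A" using y z loc_diff[OF submod_polys] by blast
    have "b = Rc i (cd (\<lambda>A. y A - z A)) \<otimes>\<^bsub>CC i\<^esub> c" using add[OF y'] y by simp
    moreover have "Rc i (cd (\<lambda>A. y A - z A)) \<in> cech_coboundaries univ_ring B_gens M i"
      unfolding cob_eq by (rule CollectI, rule exI, rule conjI[OF refl y'])
    ultimately show "b \<in> cech_coboundaries univ_ring B_gens M i #>\<^bsub>CC i\<^esub> c"
      unfolding r_coset_def by (simp only: UN_iff singleton_iff) (rule bexI, rule refl)
  qed
qed

text \<open>The fractions with numerator in \<open>SK\<close>. On these a value that vanishes in the
  localization of \<open>M\<close> already lies in the localization of \<open>J\<close>.\<close>

definition locK :: "nat set \<Rightarrow> 'a laurent set" where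
  "locK A = {x. \<exists>u\<in>U A. \<epsilon> u * x \<in> SK}"

lemma locK_mono: "finite A' \<Longrightarrow> A \<subseteq> A' \<Longrightarrow> x \<in> locK A \<Longrightarrow> x \<in> locK A'"
  using U_mono unfolding locK_def by blast

lemma locK_mult: "x \<in> locK A \<Longrightarrow> \<epsilon> a * x \<in> locK A"
proof -
  assume "x \<in> locK A"
  then obtain u where u: "u \<in> U A" "\<epsilon> u * x \<in> SK" by (auto simp: locK_def)
  have "\<epsilon> u * (\<epsilon> a * x) = \<epsilon> a * (\<epsilon> u * x)" by (simp only: mult.left_commute)
  also have "\<dots> \<in> SK" by (rule SK(4)[OF u(2)])
  finally show "\<epsilon> a * x \<in> locK A" using u(1) unfolding locK_def by blast
qed

lemma locK_add:
  assumes "finite A" "x \<in> locK A" "y \<in> locK A"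
  shows "x + y \<in> locK A"
proof -
  obtain u v where uv: "u \<in> U A" "\<epsilon> u * x \<in> SK" "v \<in> U A" "\<epsilon> v * y \<in> SK" using assms by (auto simp: locK_def)
  have "\<epsilon> (u * v) * (x + y) = \<epsilon> v * (\<epsilon> u * x) + \<epsilon> u * (\<epsilon> v * y)" by (simp add: ehom algebra_simps)
  then have "\<epsilon> (u * v) * (x + y) \<in> SK" using SK(3,4) uv by simp
  then show ?thesis using U_mult[OF assms(1) uv(1,3)] unfolding locK_def by blast
qed

lemma locK_sum:
  assumes "finite A" "finite F" "\<And>j. j \<in> F \<Longrightarrow> x j \<in> locK A"
  shows "(\<Sum>j\<in>F. x j) \<in> locK A"
  using assms(2,3)
proof (induction F rule: finite_induct)
  case empty
  show ?case using U_1[OF assms(1)] SK(2) by (auto simp: locK_def)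
qed (auto intro: locK_add[OF assms(1)])

lemma locK_sgn: "x \<in> locK A \<Longrightarrow> (-1) ^ n * x \<in> locK A"
  using locK_mult[of x A "(-1) ^ n"] by (simp add: eps_power ehom)

lemma locK_Z_J:
  assumes "A \<subseteq> {..<4}" "x \<in> locK A" "x \<in> Z A"
  shows "x \<in> loc J A"
proof -
  have fin: "finite A" using assms finite_subset by blast
  obtain u where u: "u \<in> U A" "\<epsilon> u * x \<in> SK" using assms by (auto simp: locK_def)
  obtain w where w: "w \<in> U A" "\<epsilon> w * x \<in> polys" "\<rho> (\<epsilon> w * x) = \<rho> 0" using assms by (auto simp: Z_def)
  have "\<epsilon> (w * u) * x = \<epsilon> w * (\<epsilon> u * x)" by (simp add: ehom mult.assoc)
  then have 1: "\<epsilon> (w * u) * x \<in> SK" using SK(4)[OF u(2), of w] by (simp only:)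
  have "\<epsilon> (w * u) * x = \<epsilon> u * (\<epsilon> w * x)" by (simp add: ehom mult_ac)
  then have "\<rho> (\<epsilon> (w * u) * x) = \<rho> 0" using rho_0_mult[OF w(2,3), of u] by (simp only:)
  then have "\<epsilon> (w * u) * x \<in> J" by (rule J(3)[OF 1])
  then show ?thesis using loc_iff_U[OF J(1) assms(1)] U_mult[OF fin w(1) u(1)] by blast
qed

theorem local_cohomology_piece_trivial:
  assumes v: "cvanish polys J \<nu> i"
  shows "local_cohomology_piece univ_ring S_piece B_gens M gM i \<nu> = {\<one>\<^bsub>local_cohomology univ_ring B_gens M i\<^esub>}"
proof -
  let ?B = "cech_coboundaries univ_ring B_gens M i"
  have one: "\<one>\<^bsub>local_cohomology univ_ring B_gens M i\<^esub> = ?B" by (simp add: local_cohomology_def)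
  have JS: "J \<subseteq> polys" using J(1) by (simp add: submod_def)
  have inB: "c \<in> ?B" if c: "c \<in> cech_cocycles univ_ring B_gens M i"
    "\<forall>A\<in>idx i. c A \<in> loc_grading univ_ring S_piece (U A) M gM \<nu>" for c
  proof -
    have "\<forall>A\<in>idx i. \<exists>x. x \<in> loc polys A \<and> x \<in> piece \<nu> \<and> x \<in> locK A \<and> c A = R A x"
    proof
      fix A assume A: "A \<in> idx i"
      note sub = idx_sub[OF A] and fin = idx_finite[OF A]
      obtain m u \<delta> where mu: "u \<in> U A" "u \<in> S_piece \<delta>" "m \<in> gM (\<nu> + \<delta>)" "c A = mfrac univ_ring (U A) M m u"
        using c(2) A by (auto simp: loc_grading_def)
      obtain g where g: "m = \<rho> g" "g \<in> SK" "g \<in> piece (\<nu> + \<delta>)" using mu(3) by (auto simp: gM)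
      have gp: "g \<in> polys" using g SK by auto
      \<comment> \<open>The value of the fraction \<open>m/u\<close> is \<open>g * t\<close>. It is
        bihomogeneous of bidegree \<open>\<nu>\<close> because both \<open>g\<close> and the image
        of \<open>u\<close> are.\<close>
      obtain t where t: "t \<in> loc polys A" "\<epsilon> u * t = 1" using U_inverse[OF sub mu(1)] by blast
      have ug: "\<epsilon> u * (g * t) = g" using t(2) by (simp add: mult.left_commute)
      have "\<epsilon> u \<noteq> 0" using t(2) by auto
      then have "g * t \<in> piece \<nu>"
        using piece_cancel[of "\<epsilon> u" \<delta> "g * t" "\<nu> + \<delta>"] eps(4)[OF mu(2)] ug g(3) by simp
      moreover have "g * t \<in> loc polys A" by (rule loc_mult_polys[OF submod_polys gp t(1)])
      moreover have "g * t \<in> locK A" unfolding locK_def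
        by (rule CollectI, rule bexI[OF _ mu(1)]) (simp only: ug g(2))
      moreover have "c A = R A (g * t)" unfolding mu(4) g(1)
        by (rule mfrac_R[OF fin gp mu(1)]) (simp only: ug diff_self Z_0[OF fin])
      ultimately show "\<exists>x. x \<in> loc polys A \<and> x \<in> piece \<nu> \<and> x \<in> locK A \<and> c A = R A x" by blast
    qed
    then obtain x where x: "\<And>A. A \<in> idx i \<Longrightarrow> x A \<in> loc polys A" "\<And>A. A \<in> idx i \<Longrightarrow> x A \<in> piece \<nu>"
      "\<And>A. A \<in> idx i \<Longrightarrow> x A \<in> locK A" "\<And>A. A \<in> idx i \<Longrightarrow> c A = R A (x A)" by metis
    have car: "c \<in> carrier (CC i)" and dc: "cech_diff univ_ring B_gens M i c = \<one>\<^bsub>CC (i + 1)\<^esub>"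
      using c(1) by (auto simp: cech_cocycles_def kernel_def)
    have cx: "c = Rc i x"
    proof -
      obtain y where "c = Rc i y" using car CC_carrier by blast
      then have "c \<in> extensional (idx i)" by (simp add: Rc_def)
      then show ?thesis using x(4) by (auto simp: Rc_def extensional_def fun_eq_iff)
    qed
    have cdx: "\<forall>A\<in>idx (i + 1). cd x A \<in> loc polys A" using cd_loc[OF submod_polys, of i x] x(1) by blast
    have "Rc (i + 1) (cd x) = Rc (i + 1) (\<lambda>A. 0)" using dc CC_diff[of i x] x(1) by (simp add: cx CC_one)
    then have dxZ: "cd x A \<in> Z A" if "A \<in> idx (i + 1)" for A
      using Rc_eq_iff[OF cdx, of "\<lambda>A. 0"] that loc_0[OF submod_polys] by auto
    have dxJ: "cd x A \<in> loc J A" if A: "A \<in> idx (i + 1)" for A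
    proof (rule locK_Z_J[OF idx_sub[OF A] _ dxZ[OF A]])
      have "x (A - {j}) \<in> locK A" if "j \<in> A" for j
        by (rule locK_mono[OF idx_finite[OF A] Diff_subset x(3)[OF idx_remove[OF A that]]])
      then show "cd x A \<in> locK A" unfolding cd_def by (intro locK_sum locK_sgn idx_finite[OF A])
    qed
    obtain b where b: "\<And>A. A \<in> idx (i - 1) \<Longrightarrow> b A \<in> loc polys A" "\<And>A. A \<in> idx i \<Longrightarrow> x A - cd b A \<in> loc J A"
      using cvanishE[OF v x(1,2) dxJ] by metis
    have "\<forall>A\<in>idx i. cd b A \<in> loc polys A" using cd_loc'[OF submod_polys b(1)] by blast
    then have "Rc i x = Rc i (cd b)"
      using Rc_eq_iff[of i x "cd b"] x(1) loc_J_Z[OF idx_sub b(2)] by blast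
    then show ?thesis unfolding cx cob_eq using b(1) by blast
  qed
  have 0: "\<forall>A\<in>idx j. (0 :: 'a laurent) \<in> loc polys A" for j using loc_0[OF submod_polys] by blast
  have zero: "Rc i (\<lambda>A. 0) \<in> cech_cocycles univ_ring B_gens M i"
  proof -
    have "Rc i (\<lambda>A. 0) \<in> carrier (CC i)"
      unfolding CC_carrier by (rule exI[of _ "\<lambda>A. 0"]) (use 0 in blast)
    then show ?thesis using CC_diff[OF 0, of i] by (simp add: cech_cocycles_def kernel_def CC_one cd_zero[abs_def])
  qed
  \<comment> \<open>The trivial class has to occur in the graded piece: zero is the fraction 0/1,
    and the denominator 1 has bidegree 0.\<close>
  have zeroh: "\<forall>A\<in>idx i. Rc i (\<lambda>A. 0) A \<in> loc_grading univ_ring S_piece (U A) M gM \<nu>"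
  proof
    fix A assume A: "A \<in> idx i"
    have "1 \<in> S_piece 0" by (auto simp: S_piece_def bidegree_def zero_prod_def)
    moreover have "\<rho> 0 \<in> gM (\<nu> + 0)" unfolding gM using SK(2) by auto
    moreover have "Rc i (\<lambda>A. 0) A = mfrac univ_ring (U A) M (\<rho> 0) 1"
      using A mfrac_R[OF idx_finite[OF A] polys_0 U_1[OF idx_finite[OF A]], of 0] Z_0[OF idx_finite[OF A]] by (simp add: Rc_def)
    ultimately show "Rc i (\<lambda>A. 0) A \<in> loc_grading univ_ring S_piece (U A) M gM \<nu>"
      unfolding loc_grading_def using U_1[OF idx_finite[OF A]] by blast
  qed
  show ?thesis
    unfolding one local_cohomology_piece_def cech_index_B_gens
  proof (intro subset_antisym subsetI)
    fix Y assume "Y \<in> {?B #>\<^bsub>CC i\<^esub> c | c. c \<in> cech_cocycles univ_ring B_gens M i \<and>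
        (\<forall>A\<in>idx i. c A \<in> loc_grading univ_ring S_piece (U A) M gM \<nu>)}"
    then show "Y \<in> {?B}" using inB cob_coset by blast
  next
    fix Y assume "Y \<in> {?B}"
    moreover have "?B #>\<^bsub>CC i\<^esub> Rc i (\<lambda>A. 0) = ?B" using cob_coset[OF inB[OF zero zeroh]] .
    ultimately show "Y \<in> {?B #>\<^bsub>CC i\<^esub> c | c. c \<in> cech_cocycles univ_ring B_gens M i \<and>
        (\<forall>A\<in>idx i. c A \<in> loc_grading univ_ring S_piece (U A) M gM \<nu>)}"
      using zero zeroh by blast
  qed
qed

end

section \<open>The residue field\<close>

definition subfield_set :: "'a::field set \<Rightarrow> bool" where
  "subfield_set F \<longleftrightarrow> 1 \<in> F \<and> (\<forall>x\<in>F. \<forall>y\<in>F. x + y \<in> F \<and> x * y \<in> F \<and> x - y \<in> F) \<and> (\<forall>x\<in>F. inverse x \<in> F)"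

text \<open>Zorn's lemma gives a maximal subspace \<open>W\<close> over \<open>F\<close> that does
  not contain 1. Maximality makes it a complement of \<open>F\<close>, and the retraction is the
  projection along \<open>W\<close>.\<close>

lemma subfield_retraction:
  assumes F: "subfield_set F"
  shows "\<exists>\<pi> :: 'a::field \<Rightarrow> 'a. (\<forall>x. \<pi> x \<in> F) \<and> (\<forall>x y. \<pi> (x + y) = \<pi> x + \<pi> y) \<and>
    (\<forall>c\<in>F. \<forall>x. \<pi> (c * x) = c * \<pi> x) \<and> (\<forall>c\<in>F. \<pi> c = c)"
proof -
  have F1: "1 \<in> F" and Fadd: "\<And>x y. x \<in> F \<Longrightarrow> y \<in> F \<Longrightarrow> x + y \<in> F" and Fmul: "\<And>x y. x \<in> F \<Longrightarrow> y \<in> F \<Longrightarrow> x * y \<in> F"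
    and Fdiff: "\<And>x y. x \<in> F \<Longrightarrow> y \<in> F \<Longrightarrow> x - y \<in> F" and Finv: "\<And>x. x \<in> F \<Longrightarrow> inverse x \<in> F"
    using F by (auto simp: subfield_set_def)
  have F0: "0 \<in> F" using Fdiff[OF F1 F1] by simp
  define \<W> where "\<W> = {W. 0 \<in> W \<and> 1 \<notin> W \<and> (\<forall>x\<in>W. \<forall>y\<in>W. x + y \<in> W) \<and> (\<forall>c\<in>F. \<forall>x\<in>W. c * x \<in> W)}"
  have "\<exists>W\<in>\<W>. \<forall>V\<in>\<W>. W \<subseteq> V \<longrightarrow> V = W"
  proof (rule subset_Zorn_nonempty)
    show "\<W> \<noteq> {}" unfolding \<W>_def by (auto intro!: exI[of _ "{0}"])
    fix \<C> assume C: "\<C> \<noteq> {}" "subset.chain \<W> \<C>"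
    then have sub: "\<C> \<subseteq> \<W>" and tot: "\<And>A B. A \<in> \<C> \<Longrightarrow> B \<in> \<C> \<Longrightarrow> A \<subseteq> B \<or> B \<subseteq> A"
      by (auto simp: subset.chain_def)
    have "x + y \<in> \<Union>\<C>" if xy: "x \<in> \<Union>\<C>" "y \<in> \<Union>\<C>" for x y
    proof -
      obtain A B where AB: "A \<in> \<C>" "x \<in> A" "B \<in> \<C>" "y \<in> B" using xy by blast
      define V where "V = (if A \<subseteq> B then B else A)"
      have "V \<in> \<C>" "x \<in> V" "y \<in> V" using AB tot[OF AB(1,3)] by (auto simp: V_def)
      then show ?thesis using sub by (auto simp: \<W>_def)
    qed
    moreover have "c * x \<in> \<Union>\<C>" if cx: "c \<in> F" "x \<in> \<Union>\<C>" for c x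
    proof -
      obtain A where A: "A \<in> \<C>" "x \<in> A" using cx by blast
      then have "c * x \<in> A" using sub cx(1) by (auto simp: \<W>_def)
      then show ?thesis using A by blast
    qed
    moreover have "0 \<in> \<Union>\<C>" "1 \<notin> \<Union>\<C>" using C(1) sub by (auto simp: \<W>_def)
    ultimately show "\<Union>\<C> \<in> \<W>" unfolding \<W>_def by (intro CollectI conjI ballI)
  qed
  then obtain W where W: "W \<in> \<W>" and max: "\<And>V. V \<in> \<W> \<Longrightarrow> W \<subseteq> V \<Longrightarrow> V = W" by blast
  have W0: "0 \<in> W" and W1: "1 \<notin> W" and Wadd: "\<And>x y. x \<in> W \<Longrightarrow> y \<in> W \<Longrightarrow> x + y \<in> W"
    and Wmul: "\<And>c x. c \<in> F \<Longrightarrow> x \<in> W \<Longrightarrow> c * x \<in> W" using W by (auto simp: \<W>_def)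
  have Wdiff: "x - y \<in> W" if "x \<in> W" "y \<in> W" for x y
    using Wadd[OF that(1) Wmul[OF Fdiff[OF F0 F1] that(2)]] by simp
  have disj: "c = 0" if "c \<in> F" "c \<in> W" for c
    using Wmul[OF Finv[OF that(1)] that(2)] W1 by (cases "c = 0") auto
  have ex: "\<exists>c\<in>F. x - c \<in> W" for x
  proof (cases "x \<in> W")
    case True
    then show ?thesis using F0 by (intro bexI[of _ 0]) auto
  next
    case False
    \<comment> \<open>Enlarging \<open>W\<close> by \<open>x\<close> must produce 1 = w + c x with
      \<open>c\<close> nonzero. So \<open>x\<close> agrees with the inverse of \<open>c\<close>
      modulo \<open>W\<close>.\<close>
    define V where "V = {w + c * x | w c. w \<in> W \<and> c \<in> F}"
    have V0: "0 \<in> V" unfolding V_def using W0 F0 by force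
    have Vadd: "a + b \<in> V" if ab: "a \<in> V" "b \<in> V" for a b
    proof -
      obtain w c w' c' where wc: "w \<in> W" "c \<in> F" "w' \<in> W" "c' \<in> F" "a = w + c * x" "b = w' + c' * x"
        using ab unfolding V_def by blast
      have "a + b = (w + w') + (c + c') * x" by (simp add: wc algebra_simps)
      then show ?thesis unfolding V_def using wc Wadd Fadd by blast
    qed
    have Vmul: "d * a \<in> V" if ad: "a \<in> V" "d \<in> F" for a d
    proof -
      obtain w c where wc: "w \<in> W" "c \<in> F" "a = w + c * x" using ad unfolding V_def by blast
      have "d * a = d * w + (d * c) * x" by (simp add: wc algebra_simps)
      then show ?thesis unfolding V_def using wc ad Wmul Fmul by blast
    qed
    have xV: "x \<in> V"
    proof -
      have "x = 0 + 1 * x" by simp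
      then show ?thesis unfolding V_def using W0 F1 by blast
    qed
    have WV: "W \<subseteq> V"
    proof
      fix w assume "w \<in> W"
      moreover have "w = w + 0 * x" by simp
      ultimately show "w \<in> V" unfolding V_def using F0 by blast
    qed
    have "1 \<in> V"
    proof (rule ccontr)
      assume "1 \<notin> V"
      then have "V \<in> \<W>" using V0 Vadd Vmul by (auto simp: \<W>_def)
      then show False using max[OF _ WV] xV False by blast
    qed
    then obtain w c where wc: "w \<in> W" "c \<in> F" "1 = w + c * x" unfolding V_def by blast
    have c0: "c \<noteq> 0" using wc W1 by auto
    then have "x - inverse c = inverse c * (c * x - 1)" by (simp add: right_diff_distrib)
    also have "c * x - 1 = 0 - w" by (simp add: wc(3))
    also have "inverse c * (0 - w) \<in> W" by (intro Wmul Finv wc Wdiff W0)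
    finally show ?thesis using Finv[OF wc(2)] by blast
  qed
  define \<pi> where "\<pi> x = (SOME c. c \<in> F \<and> x - c \<in> W)" for x
  have p: "\<pi> x \<in> F" "x - \<pi> x \<in> W" for x
    using someI_ex[of "\<lambda>c. c \<in> F \<and> x - c \<in> W"] ex[of x] unfolding \<pi>_def by blast+
  have uniq: "\<pi> x = c" if "c \<in> F" "x - c \<in> W" for x c
  proof -
    have "c - \<pi> x = (x - \<pi> x) - (x - c)" by simp
    also have "\<dots> \<in> W" by (rule Wdiff[OF p(2) that(2)])
    finally have "c - \<pi> x \<in> W" .
    then have "c - \<pi> x = 0" by (intro disj Fdiff that(1) p(1))
    then show ?thesis by simp
  qed
  have "\<pi> (x + y) = \<pi> x + \<pi> y" for x y
  proof (rule uniq)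
    have "x + y - (\<pi> x + \<pi> y) = (x - \<pi> x) + (y - \<pi> y)" by simp
    also have "\<dots> \<in> W" by (rule Wadd[OF p(2) p(2)])
    finally show "x + y - (\<pi> x + \<pi> y) \<in> W" .
  qed (intro Fadd p)
  moreover have "\<pi> (c * x) = c * \<pi> x" if "c \<in> F" for c x
  proof (rule uniq)
    have "c * x - c * \<pi> x = c * (x - \<pi> x)" by (simp add: right_diff_distrib)
    also have "\<dots> \<in> W" by (rule Wmul[OF that p(2)])
    finally show "c * x - c * \<pi> x \<in> W" .
  qed (intro Fmul p that)
  moreover have "\<pi> c = c" if "c \<in> F" for c using that W0 by (intro uniq) auto
  ultimately show ?thesis using p(1) by blast
qed

locale prime_point =
  fixes p :: "'k::field R_poly set" and \<phi> :: "'k R_poly \<Rightarrow> 'a::field"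
  assumes \<phi>: "ring_hom_on \<phi>" and ker: "\<And>F. \<phi> F = 0 \<longleftrightarrow> F \<in> p"
begin

lemmas phom = ring_hom_onD[OF \<phi>]

text \<open>The copy of the residue field of \<open>p\<close> inside the large field.\<close>

definition K0 :: "'a set" where
  "K0 = {\<phi> r / \<phi> u | r u. u \<notin> p}"

lemma nz: "u \<notin> p \<Longrightarrow> \<phi> u \<noteq> 0"
  using ker by blast

lemma p_mult: "u \<notin> p \<Longrightarrow> v \<notin> p \<Longrightarrow> u * v \<notin> p"
  by (simp add: ker[symmetric] phom)

lemma one_notin: "1 \<notin> p"
  by (simp add: ker[symmetric] phom)

lemma K0I: "\<phi> r \<in> K0"
  unfolding K0_def by (rule CollectI, rule exI[of _ r], rule exI[of _ 1]) (simp add: phom one_notin)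

lemma K0_add: "x \<in> K0 \<Longrightarrow> y \<in> K0 \<Longrightarrow> x + y \<in> K0"
proof -
  assume "x \<in> K0" "y \<in> K0"
  then obtain r u s v where *: "u \<notin> p" "v \<notin> p" "x = \<phi> r / \<phi> u" "y = \<phi> s / \<phi> v" by (auto simp: K0_def)
  then have "x + y = \<phi> (r * v + s * u) / \<phi> (u * v)" using nz by (simp add: phom add_frac_eq)
  then show ?thesis unfolding K0_def using p_mult * by blast
qed

lemma K0_mult: "x \<in> K0 \<Longrightarrow> y \<in> K0 \<Longrightarrow> x * y \<in> K0"
proof -
  assume "x \<in> K0" "y \<in> K0"
  then obtain r u s v where *: "u \<notin> p" "v \<notin> p" "x = \<phi> r / \<phi> u" "y = \<phi> s / \<phi> v" by (auto simp: K0_def)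
  then have "x * y = \<phi> (r * s) / \<phi> (u * v)" by (simp add: phom)
  then show ?thesis unfolding K0_def using p_mult * by blast
qed

lemma K0_diff: "x \<in> K0 \<Longrightarrow> y \<in> K0 \<Longrightarrow> x - y \<in> K0"
  using K0_add[of x "- y"] K0_mult[of "\<phi> (-1)" y] K0I[of "-1"] by (simp add: phom)

lemma K0_0: "0 \<in> K0" and K0_1: "1 \<in> K0"
  using K0I[of 0] K0I[of 1] by (simp_all add: phom)

lemma subfield_K0: "subfield_set K0"
proof -
  have "inverse x \<in> K0" if x: "x \<in> K0" for x
  proof -
    obtain r u where *: "u \<notin> p" "x = \<phi> r / \<phi> u" using x by (auto simp: K0_def)
    show ?thesis
    proof (cases "r \<in> p")
      case True
      then have "x = 0" using * ker by simp
      then show ?thesis using K0_0 by simp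
    next
      case False
      then show ?thesis unfolding K0_def using * by (auto simp: inverse_eq_divide)
    qed
  qed
  then show ?thesis using K0_add K0_mult K0_diff K0_1 by (auto simp: subfield_set_def)
qed

definition ret :: "'a \<Rightarrow> 'a" where
  "ret = (SOME \<pi>. (\<forall>x. \<pi> x \<in> K0) \<and> (\<forall>x y. \<pi> (x + y) = \<pi> x + \<pi> y) \<and>
    (\<forall>c\<in>K0. \<forall>x. \<pi> (c * x) = c * \<pi> x) \<and> (\<forall>c\<in>K0. \<pi> c = c))"

lemma ret: "ret x \<in> K0" "ret (x + y) = ret x + ret y" "c \<in> K0 \<Longrightarrow> ret (c * x) = c * ret x" "c \<in> K0 \<Longrightarrow> ret c = c"
  using someI_ex[OF subfield_retraction[OF subfield_K0], folded ret_def] by blast+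

lemma ret_0 [simp]: "ret 0 = 0"
  using ret(4)[OF K0_0] .

section \<open>The localization at \<open>p\<close> and its residue field\<close>

abbreviation "LR \<equiv> localization univ_ring (- p) (module_via id univ_ring)"
abbreviation "fr \<equiv> mfrac univ_ring (- p) (module_via id univ_ring)"

text \<open>R is a domain and 0 lies in \<open>p\<close>, so the auxiliary factor \<open>w\<close>
  of the localization relation can be cancelled.\<close>

lemma fr_eq:
  assumes "u \<notin> p"
  shows "fr r u = {(n, v). v \<notin> p \<and> v * r = u * n}"
proof -
  have "0 \<in> p" by (simp add: ker[symmetric] phom)
  then have "w * (v * r) = w * (u * n) \<longleftrightarrow> v * r = u * n" if "w \<notin> p" for w v n using that by auto
  then show ?thesis using assms one_notin
    by (auto simp: mfrac_def loc_rel_def module_via_def)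
qed

lemma p_nz: "u \<notin> p \<Longrightarrow> u \<noteq> 0"
  using nz phom(1) by metis

lemma fr_eq_iff:
  assumes "u \<notin> p" "v \<notin> p"
  shows "fr r u = fr s v \<longleftrightarrow> v * r = u * s"
proof
  assume "fr r u = fr s v"
  moreover have "(s, v) \<in> fr s v" using assms by (simp add: fr_eq)
  ultimately have "(s, v) \<in> fr r u" by simp
  then show "v * r = u * s" using assms by (simp add: fr_eq)
next
  assume eq: "v * r = u * s"
  have "w * r = u * n \<longleftrightarrow> w * s = v * n" for w n
  proof -
    have "v * (w * r) = w * (v * r)" by (rule mult.left_commute)
    also have "\<dots> = w * (u * s)" by (simp only: eq)
    also have "\<dots> = u * (w * s)" by (rule mult.left_commute)
    finally have 1: "v * (w * r) = u * (w * s)" .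
    have "w * r = u * n \<longleftrightarrow> v * (w * r) = v * (u * n)" using p_nz[OF assms(2)] by simp
    also have "\<dots> \<longleftrightarrow> u * (w * s) = u * (v * n)" by (simp only: 1 mult.left_commute[of v u n])
    also have "\<dots> \<longleftrightarrow> w * s = v * n" using p_nz[OF assms(1)] by simp
    finally show ?thesis .
  qed
  then show "fr r u = fr s v" using assms by (simp add: fr_eq)
qed

lemma LR_carrier: "carrier LR = {fr r u | r u. u \<notin> p}"
  by (auto simp: localization_def quotient_def mfrac_def module_via_def)

lemma LR_add:
  assumes "u \<notin> p" "v \<notin> p"
  shows "fr r u \<oplus>\<^bsub>LR\<^esub> fr s v = fr (v * r + u * s) (u * v)"
proof -
  have "(\<Union>(m, u)\<in>fr r u. \<Union>(n, v)\<in>fr s v. fr (v * m + u * n) (u * v)) = fr (v * r + u * s) (u * v)"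
  proof (intro UN_pair_const)
    fix m u' n v' assume "(m, u') \<in> fr r u" "(n, v') \<in> fr s v"
    then have *: "u' \<notin> p" "u' * r = u * m" "v' \<notin> p" "v' * s = v * n" using assms by (auto simp: fr_eq)
    have "u * v * (v' * m + u' * n) = v * v' * (u * m) + u * u' * (v * n)" by (simp add: algebra_simps)
    also have "\<dots> = v * v' * (u' * r) + u * u' * (v' * s)" using * by simp
    also have "\<dots> = u' * v' * (v * r + u * s)" by (simp add: algebra_simps)
    finally show "fr (v' * m + u' * n) (u' * v') = fr (v * r + u * s) (u * v)"
      using * assms by (simp add: fr_eq_iff p_mult)
  qed (use assms in \<open>auto simp: fr_eq\<close>)
  then show ?thesis by (simp add: localization_def module_via_def)
qed

lemma LR_smult:
  assumes "u \<notin> p"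
  shows "t \<odot>\<^bsub>LR\<^esub> fr r u = fr (t * r) u"
proof -
  have "(\<Union>(m, u)\<in>fr r u. fr (t * m) u) = fr (t * r) u"
  proof (intro UN_pair_const)
    fix m u' assume "(m, u') \<in> fr r u"
    then have *: "u' \<notin> p" "u' * r = u * m" using assms by (auto simp: fr_eq)
    have "u * (t * m) = t * (u * m)" by (rule mult.left_commute)
    also have "\<dots> = t * (u' * r)" by (simp only: *)
    also have "\<dots> = u' * (t * r)" by (rule mult.left_commute)
    finally have "u * (t * m) = u' * (t * r)" .
    then show "fr (t * m) u' = fr (t * r) u" using * assms by (simp add: fr_eq_iff)
  qed (use assms in \<open>auto simp: fr_eq\<close>)
  then show ?thesis by (simp add: localization_def module_via_def)
qed

abbreviation "\<kappa> \<equiv> residue_field univ_ring p"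

text \<open>The residue class of value \<open>a\<close>, as a set of fractions; it is empty for
  values outside \<open>K0\<close>.\<close>

definition fib :: "'a \<Rightarrow> ('k R_poly \<times> 'k R_poly) set set" where
  "fib a = {fr r u | r u. u \<notin> p \<and> \<phi> r / \<phi> u = a}"

lemma fr_mem_fib: "u \<notin> p \<Longrightarrow> fr r u \<in> fib a \<longleftrightarrow> \<phi> r / \<phi> u = a"
proof
  assume u: "u \<notin> p" and "fr r u \<in> fib a"
  then obtain s v where *: "fr r u = fr s v" "v \<notin> p" "\<phi> s / \<phi> v = a" by (auto simp: fib_def)
  then have "v * r = u * s" using fr_eq_iff[OF u *(2)] by simp
  then have "\<phi> v * \<phi> r = \<phi> u * \<phi> s" by (metis phom(4))
  then show "\<phi> r / \<phi> u = a" using *(3) nz[OF u] nz[OF *(2)] by (simp add: field_simps)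
qed (auto simp: fib_def)

lemma coset_fib:
  assumes "u \<notin> p"
  shows "fib 0 +>\<^bsub>LR\<^esub> fr r u = fib (\<phi> r / \<phi> u)"
proof (intro subset_antisym subsetI)
  fix Y assume "Y \<in> fib 0 +>\<^bsub>LR\<^esub> fr r u"
  then obtain n v where nv: "v \<notin> p" "\<phi> n / \<phi> v = 0" "Y = fr n v \<oplus>\<^bsub>LR\<^esub> fr r u"
    by (auto simp: a_r_coset_def r_coset_def fib_def)
  have "Y = fr (u * n + v * r) (v * u)" using LR_add[OF nv(1) assms] nv(3) by simp
  moreover have "\<phi> (u * n + v * r) / \<phi> (v * u) = \<phi> r / \<phi> u" using nv nz[OF nv(1)] by (simp add: phom)
  ultimately show "Y \<in> fib (\<phi> r / \<phi> u)" unfolding fib_def using p_mult[OF nv(1) assms] by blast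
next
  fix Y assume "Y \<in> fib (\<phi> r / \<phi> u)"
  then obtain a b where ab: "b \<notin> p" "\<phi> a / \<phi> b = \<phi> r / \<phi> u" "Y = fr a b" by (auto simp: fib_def)
  let ?D = "fr (u * a - b * r) (b * u)"
  have bu: "b * u \<notin> p" by (rule p_mult[OF ab(1) assms])
  have "\<phi> (u * a - b * r) = 0" using ab(2) nz[OF ab(1)] nz[OF assms] by (simp add: phom field_simps)
  then have "?D \<in> fib 0" using bu by (simp add: fr_mem_fib)
  moreover have "?D \<oplus>\<^bsub>LR\<^esub> fr r u = Y"
    unfolding LR_add[OF bu assms] ab(3) using ab(1) assms bu p_mult
    by (subst fr_eq_iff) (auto simp: algebra_simps)
  ultimately show "Y \<in> fib 0 +>\<^bsub>LR\<^esub> fr r u" by (auto simp: a_r_coset_def r_coset_def)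
qed

lemma kappa_eq: "\<kappa> = quotient_module LR (fib 0)"
proof -
  have "{fr r u | r u. r \<in> p \<and> u \<in> - p} = fib 0"
    unfolding fib_def using nz ker by auto
  then show ?thesis by (simp add: residue_field_def Compl_eq_Diff_UNIV)
qed

lemma kappa_carrier: "carrier \<kappa> = fib ` K0"
proof -
  have "carrier \<kappa> = {fib 0 +>\<^bsub>LR\<^esub> Y | Y. Y \<in> carrier LR}"
    by (auto simp: kappa_eq quotient_module_def A_RCOSETS_def RCOSETS_def a_r_coset_def)
  also have "\<dots> = {fib (\<phi> r / \<phi> u) | r u. u \<notin> p}" unfolding LR_carrier using coset_fib by blast
  also have "\<dots> = fib ` K0" by (auto simp: K0_def)
  finally show ?thesis .
qed

lemma fib_inj: "a \<in> K0 \<Longrightarrow> fib a = fib b \<Longrightarrow> a = b"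
  by (auto simp: K0_def) (metis fr_mem_fib)

lemma kappa_add:
  assumes "a \<in> K0" "b \<in> K0"
  shows "fib a \<oplus>\<^bsub>\<kappa>\<^esub> fib b = fib (a + b)"
proof -
  obtain r u where ru: "u \<notin> p" "a = \<phi> r / \<phi> u" using assms(1) by (auto simp: K0_def)
  have sum: "\<phi> (v * m + w * n) / \<phi> (w * v) = \<phi> m / \<phi> w + \<phi> n / \<phi> v" if "w \<notin> p" "v \<notin> p" for m n w v
    using nz[OF that(1)] nz[OF that(2)] by (simp add: phom add_frac_eq mult.commute)
  have "set_add LR (fib a) (fib b) = fib (a + b)"
  proof (intro subset_antisym subsetI)
    fix Y assume "Y \<in> set_add LR (fib a) (fib b)"
    then obtain m w n v where *: "w \<notin> p" "v \<notin> p" "\<phi> m / \<phi> w = a" "\<phi> n / \<phi> v = b" "Y = fr m w \<oplus>\<^bsub>LR\<^esub> fr n v"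
      by (auto simp: set_add_def set_mult_def fib_def)
    then show "Y \<in> fib (a + b)" using sum[OF *(1,2), of m n] by (simp add: LR_add fr_mem_fib p_mult)
  next
    fix Y assume "Y \<in> fib (a + b)"
    then obtain s w where sw: "w \<notin> p" "\<phi> s / \<phi> w = a + b" "Y = fr s w" by (auto simp: fib_def)
    let ?D = "fr (u * s - w * r) (u * w)"
    have uw: "u * w \<notin> p" by (rule p_mult[OF ru(1) sw(1)])
    have "\<phi> (u * s - w * r) / \<phi> (u * w) = \<phi> s / \<phi> w - \<phi> r / \<phi> u"
      using nz[OF ru(1)] nz[OF sw(1)] by (simp add: phom field_simps)
    then have "?D \<in> fib b" using uw sw(2) ru(2) by (simp add: fr_mem_fib)
    moreover have "fr r u \<in> fib a" using ru by (simp add: fr_mem_fib)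
    moreover have "fr r u \<oplus>\<^bsub>LR\<^esub> ?D = Y"
      unfolding LR_add[OF ru(1) uw] sw(3) using ru(1) sw(1) uw p_mult
      by (subst fr_eq_iff) (auto simp: algebra_simps)
    ultimately show "Y \<in> set_add LR (fib a) (fib b)" by (auto simp: set_add_def set_mult_def)
  qed
  then show ?thesis by (simp add: kappa_eq quotient_module_def)
qed

lemma kappa_smult:
  assumes "a \<in> K0"
  shows "t \<odot>\<^bsub>\<kappa>\<^esub> fib a = fib (\<phi> t * a)"
proof -
  obtain r u where ru: "u \<notin> p" "a = \<phi> r / \<phi> u" using assms(1) by (auto simp: K0_def)
  have "(\<Union>Y\<in>fib a. fib 0 +>\<^bsub>LR\<^esub> (t \<odot>\<^bsub>LR\<^esub> Y)) = (\<Union>Y\<in>fib a. fib (\<phi> t * a))"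
  proof (rule SUP_cong)
    fix Y assume "Y \<in> fib a"
    then obtain m w where "w \<notin> p" "\<phi> m / \<phi> w = a" "Y = fr m w" by (auto simp: fib_def)
    then show "fib 0 +>\<^bsub>LR\<^esub> (t \<odot>\<^bsub>LR\<^esub> Y) = fib (\<phi> t * a)" by (auto simp: LR_smult coset_fib phom)
  qed simp
  moreover have "fr r u \<in> fib a" using ru by (simp add: fr_mem_fib)
  ultimately show ?thesis by (auto simp: kappa_eq quotient_module_def)
qed

end

section \<open>The fibre of the symmetric algebra\<close>

definition addgrp :: "'z::ab_group_add set \<Rightarrow> bool" where
  "addgrp K \<longleftrightarrow> 0 \<in> K \<and> (\<forall>x\<in>K. \<forall>y\<in>K. x - y \<in> K)"

lemma addgrpD:
  assumes "addgrp K"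
  shows "0 \<in> K" "x \<in> K \<Longrightarrow> y \<in> K \<Longrightarrow> x - y \<in> K" "x \<in> K \<Longrightarrow> - x \<in> K" "x \<in> K \<Longrightarrow> y \<in> K \<Longrightarrow> x + y \<in> K"
    "(\<And>i. i \<in> I \<Longrightarrow> g i \<in> K) \<Longrightarrow> sum g I \<in> K"
proof -
  show 0: "0 \<in> K" using assms by (simp add: addgrp_def)
  show diff: "x - y \<in> K" if "x \<in> K" "y \<in> K" for x y using assms that by (simp add: addgrp_def)
  show minus: "- x \<in> K" if "x \<in> K" for x using diff[OF 0 that] by simp
  show add: "x + y \<in> K" if "x \<in> K" "y \<in> K" for x y using diff[OF that(1) minus[OF that(2)]] by simp
  show "sum g I \<in> K" if "\<And>i. i \<in> I \<Longrightarrow> g i \<in> K"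
    using that by (induction I rule: infinite_finite_induct) (auto intro: 0 add)
qed

lemma addgrp_submod: "submod J \<Longrightarrow> addgrp J"
  using submodD[of J] by (auto simp: addgrp_def)

text \<open>The maps \<open>G k\<close> are often additive only modulo a subgroup. This is the case
  of pure tensors, which are additive modulo the tensor relations and not as formal sums.\<close>

definition lin :: "('i \<Rightarrow> 'c::zero \<Rightarrow> 'z::comm_monoid_add) \<Rightarrow> ('i \<Rightarrow>\<^sub>0 'c) \<Rightarrow> 'z" where
  "lin G x = (\<Sum>k\<in>keys x. G k (lk x k))"

lemma lin_0 [simp]: "lin G 0 = 0"
  by (simp add: lin_def)

lemma lin_mod_superset:
  fixes G :: "'i \<Rightarrow> 'c::comm_monoid_add \<Rightarrow> 'z::ab_group_add"
  assumes K: "addgrp K" and G: "\<And>k a b. G k (a + b) - G k a - G k b \<in> K"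
    and S: "finite S" "keys x \<subseteq> S"
  shows "(\<Sum>k\<in>S. G k (lk x k)) - lin G x \<in> K"
proof -
  have G0: "G k 0 \<in> K" for k using addgrpD(3)[OF K G[of k 0 0]] by simp
  have "(\<Sum>k\<in>S. G k (lk x k)) = (\<Sum>k\<in>S - keys x. G k (lk x k)) + lin G x"
    unfolding lin_def by (rule sum.subset_diff[OF S(2,1)])
  moreover have "(\<Sum>k\<in>S - keys x. G k (lk x k)) \<in> K"
    by (rule addgrpD(5)[OF K]) (use G0 in \<open>simp add: in_keys_iff\<close>)
  ultimately show ?thesis by simp
qed

lemma lin_mod_add:
  fixes G :: "'i \<Rightarrow> 'c::comm_monoid_add \<Rightarrow> 'z::ab_group_add"
  assumes K: "addgrp K" and G: "\<And>k a b. G k (a + b) - G k a - G k b \<in> K"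
  shows "lin G (x + y) - lin G x - lin G y \<in> K"
proof -
  let ?S = "keys x \<union> keys y"
  let ?s = "\<lambda>x. \<Sum>k\<in>?S. G k (lk x k)"
  have *: "?s z - lin G z \<in> K" if "keys z \<subseteq> ?S" for z
    by (rule lin_mod_superset[OF K G _ that]) simp
  have "?s (x + y) - ?s x - ?s y = (\<Sum>k\<in>?S. G k (lk x k + lk y k) - G k (lk x k) - G k (lk y k))"
    by (simp add: sum_subtractf lookup_add)
  also have "\<dots> \<in> K" by (rule addgrpD(5)[OF K G])
  finally have "?s (x + y) - ?s x - ?s y \<in> K" .
  then have "?s (x + y) - ?s x - ?s y - (?s (x + y) - lin G (x + y)) + (?s x - lin G x) + (?s y - lin G y) \<in> K"
    using Poly_Mapping.keys_add[of x y] by (intro addgrpD(4)[OF K] addgrpD(2)[OF K _ *] *) auto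
  then show ?thesis by (simp add: algebra_simps)
qed

lemma lin_mod_single:
  fixes G :: "'i \<Rightarrow> 'c::comm_monoid_add \<Rightarrow> 'z::ab_group_add"
  assumes K: "addgrp K" and G: "\<And>k a b. G k (a + b) - G k a - G k b \<in> K"
  shows "G k c - lin G (single k c) \<in> K"
proof -
  have "(\<Sum>l\<in>{k}. G l (lk (single k c) l)) - lin G (single k c) \<in> K"
    by (rule lin_mod_superset[OF K G]) simp_all
  then show ?thesis by simp
qed

lemma addgrp_zero: "addgrp {0}"
  by (simp add: addgrp_def)

lemma lin_add:
  fixes G :: "'i \<Rightarrow> 'c::comm_monoid_add \<Rightarrow> 'z::ab_group_add"
  assumes "\<And>k a b. G k (a + b) = G k a + G k b"
  shows "lin G (x + y) = lin G x + lin G y"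
  using lin_mod_add[OF addgrp_zero, of G x y] assms by (simp add: algebra_simps)

lemma lin_single:
  fixes G :: "'i \<Rightarrow> 'c::comm_monoid_add \<Rightarrow> 'z::ab_group_add"
  assumes "\<And>k a b. G k (a + b) = G k a + G k b"
  shows "lin G (single k c) = G k c"
  using lin_mod_single[OF addgrp_zero, of G k c] assms by simp

lemma ring_hom_lin:
  fixes h :: "'c::comm_ring_1 \<Rightarrow> 'b::comm_ring_1" and e :: "'i::comm_monoid_add \<Rightarrow> 'b"
  assumes h: "ring_hom_on h" and e: "e 0 = 1" "\<And>k l. e (k + l) = e k * e l"
  shows "ring_hom_on (lin (\<lambda>k a. h a * e k))"
proof -
  let ?e = "lin (\<lambda>k a. h a * e k)"
  have add: "?e (x + y) = ?e x + ?e y" for x y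
    by (rule lin_add) (simp add: ring_hom_onD[OF h] distrib_right)
  have sg: "?e (single k c) = h c * e k" for k c
    by (rule lin_single) (simp add: ring_hom_onD[OF h] distrib_right)
  have "?e (x * y) = ?e x * ?e y" for x y
  proof (induction x rule: pm_induct)
    case (single k c)
    show ?case
    proof (induction y rule: pm_induct)
      case (single l d)
      show ?case by (simp only: mult_single sg ring_hom_onD[OF h] e) (simp only: mult_ac)
    qed (simp_all add: distrib_left add)
  qed (simp_all add: distrib_right add)
  moreover have "?e 1 = 1" using sg[of 0 1] e(1) by (simp add: ring_hom_onD[OF h])
  ultimately show ?thesis using add by (simp add: ring_hom_on_def)
qed

section \<open>Extension of coefficients from the base field to the large field\<close>

definition intk :: "('v \<Rightarrow>\<^sub>0 nat) \<Rightarrow> ('v \<Rightarrow>\<^sub>0 int)" where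
  "intk = Poly_Mapping.map int"

definition natk :: "('v \<Rightarrow>\<^sub>0 int) \<Rightarrow> ('v \<Rightarrow>\<^sub>0 nat)" where
  "natk = Poly_Mapping.map nat"

lemma lookup_intk [simp]: "lk (intk k) v = int (lk k v)"
  by (simp add: intk_def Poly_Mapping.map.rep_eq "when_def")

lemma lookup_natk [simp]: "lk (natk k) v = nat (lk k v)"
  by (simp add: natk_def Poly_Mapping.map.rep_eq "when_def")

lemma intk_add: "intk (k + l) = intk k + intk l" and intk_0: "intk 0 = 0"
  by (rule poly_mapping_eqI, simp add: lookup_add)+

lemma natk_intk [simp]: "natk (intk k) = k"
  by (rule poly_mapping_eqI) simp

lemma intk_natk: "(\<And>v. 0 \<le> lk k v) \<Longrightarrow> intk (natk k) = k"
  by (rule poly_mapping_eqI) simp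

lemma natk_add: "(\<And>v. 0 \<le> lk l v) \<Longrightarrow> natk (intk k + l) = k + natk l"
  by (rule poly_mapping_eqI) (simp add: lookup_add nat_add_distrib)

definition base_change :: "('k::field \<Rightarrow> 'a::field) \<Rightarrow> 'k S_poly \<Rightarrow> 'a laurent" where
  "base_change h = lin (\<lambda>k a. C (h a) * single (intk k) 1)"

lemma C_single: "C c * single k d = single k (c * d :: 'a::comm_ring_1)"
  by (simp add: C_def mult_single)

lemma ring_hom_C': "ring_hom_on h \<Longrightarrow> ring_hom_on (\<lambda>a. C (h a))"
  by (simp add: ring_hom_on_def C_simps)

context
  fixes h :: "'k::field \<Rightarrow> 'a::field"
  assumes h: "ring_hom_on h"
begin

lemma ring_hom_base_change: "ring_hom_on (base_change h)"
  unfolding base_change_def by (rule ring_hom_lin[OF ring_hom_C'[OF h]]) (simp_all add: intk_0 intk_add mult_single)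

lemma base_change_single: "base_change h (single k c) = single (intk k) (h c)"
proof -
  have "base_change h (single k c) = C (h c) * single (intk k) 1"
    unfolding base_change_def by (rule lin_single) (simp add: ring_hom_onD[OF h] C_simps distrib_right)
  then show ?thesis by (simp add: C_single)
qed

lemma base_change_polys: "base_change h F \<in> polys"
  unfolding base_change_def lin_def by (auto simp: C_single intro!: polys_sum polys_single)

lemma base_change_piece: "F \<in> S_piece \<delta> \<Longrightarrow> base_change h F \<in> piece \<delta>"
  unfolding base_change_def lin_def
  by (auto simp: C_single S_piece_def bidegree_def deg_def intro!: piece_sum piece_single)

lemma base_change_B_gens: "j < 4 \<Longrightarrow> base_change h (B_gens ! j) = bgen j"
proof -
  have "base_change h (var v) = lvar v" for v
  proof -
    have "intk (single v (1::nat)) = single v 1"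
      by (rule poly_mapping_eqI) (simp add: lookup_single "when_def")
    then show ?thesis by (simp add: var_def lvar_def base_change_single ring_hom_onD[OF h])
  qed
  moreover assume "j < 4"
  then have "j \<in> {0, 1, 2, 3}" by auto
  ultimately show ?thesis by (auto simp: B_gens_def bgen_def ring_hom_onD[OF ring_hom_base_change])
qed

lemma lookup_base_change: "lk (base_change h F) (intk k) = h (lk F k)"
proof (induction F rule: pm_induct)
  case (single l c)
  have "intk l = intk k \<longleftrightarrow> l = k" by (metis natk_intk)
  then show ?case by (auto simp: base_change_single lookup_single "when_def" ring_hom_onD[OF h])
qed (simp_all add: ring_hom_onD[OF ring_hom_base_change] ring_hom_onD[OF h] lookup_add)

end

lemma submod_syz_ideal: "submod (syz_ideal f \<xi>)"
  unfolding submod_def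
proof (intro conjI ballI subsetI)
  fix x assume "x \<in> syz_ideal f \<xi>"
  then show "x \<in> polys" by (auto simp: syz_ideal_def intro!: polys_sum polys_mult)
next
  show "0 \<in> syz_ideal f \<xi>" unfolding syz_ideal_def by (auto intro!: exI[of _ "\<lambda>_. 0"])
next
  fix x y assume "x \<in> syz_ideal f \<xi>" "y \<in> syz_ideal f \<xi>"
  then obtain g g' where *: "\<forall>i. g i \<in> polys" "(\<Sum>i\<in>UNIV. g i * f i) = 0" "x = (\<Sum>i\<in>UNIV. g i * C (\<xi> i))"
    "\<forall>i. g' i \<in> polys" "(\<Sum>i\<in>UNIV. g' i * f i) = 0" "y = (\<Sum>i\<in>UNIV. g' i * C (\<xi> i))"
    unfolding syz_ideal_def by blast
  then show "x + y \<in> syz_ideal f \<xi>" unfolding syz_ideal_def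
    by (auto intro!: exI[of _ "\<lambda>i. g i + g' i"] polys_add simp: distrib_right sum.distrib)
next
  fix s x :: "'a laurent" assume "s \<in> polys" "x \<in> syz_ideal f \<xi>"
  then obtain g where *: "\<forall>i. g i \<in> polys" "(\<Sum>i\<in>UNIV. g i * f i) = 0" "x = (\<Sum>i\<in>UNIV. g i * C (\<xi> i))"
    unfolding syz_ideal_def by blast
  then have "(\<Sum>i\<in>UNIV. s * g i * f i) = 0" "s * x = (\<Sum>i\<in>UNIV. s * g i * C (\<xi> i))"
    by (simp_all add: mult.assoc sum_distrib_left[symmetric])
  then show "s * x \<in> syz_ideal f \<xi>" unfolding syz_ideal_def using \<open>s \<in> polys\<close> *(1)
    by (auto intro!: exI[of _ "\<lambda>i. s * g i"] polys_mult)
qed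

section \<open>The tensor product as classes of formal sums of pure tensors\<close>

locale sym_fibre = prime_point p \<phi> for p :: "'k::field R_poly set" and \<phi> :: "'k R_poly \<Rightarrow> 'a::field" +
  fixes f :: "4 \<Rightarrow> 'k S_poly"
begin

lemma sym_ideal: "ideal (sym_ideal f) univ_ring"
proof -
  interpret cring "univ_ring :: 'k Sx_poly ring" by (rule cring_univ_ring)
  show ?thesis unfolding sym_ideal_def by (rule genideal_ideal) simp
qed

lemma addgrp_sym_ideal: "addgrp (sym_ideal f)"
proof -
  interpret ideal "sym_ideal f" univ_ring by (rule sym_ideal)
  have "x - y \<in> sym_ideal f" if "x \<in> sym_ideal f" "y \<in> sym_ideal f" for x y
    using additive_subgroup.a_closed[OF additive_subgroup_axioms that(1) I_l_closed[OF that(2), of "- 1"]] by simp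
  then show ?thesis using additive_subgroup.zero_closed[OF additive_subgroup_axioms] by (auto simp: addgrp_def)
qed

lemma Sym_proj_eq: "Sym_proj f F = Sym_proj f G \<longleftrightarrow> F - G \<in> sym_ideal f"
proof -
  have coset: "Sym_proj f F = {h + F | h. h \<in> sym_ideal f}" for F
    by (auto simp: Sym_proj_def a_r_coset_def r_coset_def)
  note sub = addgrpD[OF addgrp_sym_ideal]
  show ?thesis
  proof
    assume "Sym_proj f F = Sym_proj f G"
    moreover have "0 + F \<in> Sym_proj f F" unfolding coset using sub(1) by blast
    ultimately show "F - G \<in> sym_ideal f" unfolding coset by auto
  next
    assume *: "F - G \<in> sym_ideal f"
    have "h + F \<in> Sym_proj f G" if "h \<in> sym_ideal f" for h
      unfolding coset using sub(4)[OF that *] by (intro CollectI exI[of _ "h + (F - G)"]) simp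
    moreover have "h + G \<in> Sym_proj f F" if "h \<in> sym_ideal f" for h
      unfolding coset using sub(2)[OF that *] by (intro CollectI exI[of _ "h - (F - G)"]) simp
    ultimately show "Sym_proj f F = Sym_proj f G" using coset by auto
  qed
qed

lemma Sym_add: "Sym_proj f F \<oplus>\<^bsub>Sym f\<^esub> Sym_proj f G = Sym_proj f (F + G)"
  and Sym_mult: "Sym_proj f F \<otimes>\<^bsub>Sym f\<^esub> Sym_proj f G = Sym_proj f (F * G)"
  using ring_hom_add[OF ideal.rcos_ring_hom[OF sym_ideal], of F G]
    ring_hom_mult[OF ideal.rcos_ring_hom[OF sym_ideal], of F G]
  by (simp_all add: Sym_def Sym_proj_def)

abbreviation "MR \<equiv> Sym_R f"

lemma MR_simps: "carrier MR = range (Sym_proj f)"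
  "Sym_proj f F \<oplus>\<^bsub>MR\<^esub> Sym_proj f G = Sym_proj f (F + G)"
  "r \<odot>\<^bsub>MR\<^esub> Sym_proj f F = Sym_proj f (R_to_Sx r * F)"
  "s \<odot>\<^bsub>Sym_S f\<^esub> Sym_proj f F = Sym_proj f (const s * F)"
proof -
  show "carrier MR = range (Sym_proj f)"
    by (auto simp: Sym_R_def module_via_def Sym_def FactRing_def A_RCOSETS_def RCOSETS_def Sym_proj_def a_r_coset_def)
qed (simp_all add: Sym_R_def Sym_S_def module_via_def Sym_add Sym_mult)

abbreviation "FA \<equiv> free_Abelian_group (carrier MR \<times> carrier \<kappa>)"

abbreviation "rel \<equiv> tensor_relations univ_ring MR \<kappa>"

abbreviation "Kk \<equiv> tensor_kernel univ_ring MR \<kappa>"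

definition tens :: "'k Sx_poly \<Rightarrow> 'a \<Rightarrow> ('k Sx_poly set \<times> ('k R_poly \<times> 'k R_poly) set set \<Rightarrow>\<^sub>0 int)" where
  "tens F a = frag_of (Sym_proj f F, fib a)"

text \<open>The tensor relations in terms of polynomial representatives on the left and values in
  \<open>K0\<close> on the right; the R-action on the right is multiplication by
  \<open>\<phi> r\<close>.\<close>

lemma rel_cases:
  assumes "z \<in> rel"
  obtains (left) F G a where "a \<in> K0" "z = tens (F + G) a - tens F a - tens G a"
  | (right) F a b where "a \<in> K0" "b \<in> K0" "z = tens F (a + b) - tens F a - tens F b"
  | (middle) r F a where "a \<in> K0" "z = tens (R_to_Sx r * F) a - tens F (\<phi> r * a)"
  using assms unfolding tensor_relations_def MR_simps(1) kappa_carrier tens_def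
  by (auto simp: MR_simps kappa_add kappa_smult)

lemma rel_intros:
  "a \<in> K0 \<Longrightarrow> tens (F + G) a - tens F a - tens G a \<in> rel"
  "a \<in> K0 \<Longrightarrow> b \<in> K0 \<Longrightarrow> tens F (a + b) - tens F a - tens F b \<in> rel"
  "a \<in> K0 \<Longrightarrow> tens (R_to_Sx r * F) a - tens F (\<phi> r * a) \<in> rel"
proof -
  assume a: "a \<in> K0"
  then have fa: "fib a \<in> carrier \<kappa>" by (simp add: kappa_carrier)
  have F: "Sym_proj f F \<in> carrier MR" for F by (simp add: MR_simps)
  show "tens (F + G) a - tens F a - tens G a \<in> rel"
    unfolding tensor_relations_def tens_def MR_simps(2)[symmetric] using fa F by blast
  show "tens (R_to_Sx r * F) a - tens F (\<phi> r * a) \<in> rel"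
    unfolding tensor_relations_def tens_def MR_simps(3)[symmetric] kappa_smult[OF a, symmetric] using fa F by force
  assume b: "b \<in> K0"
  then have fb: "fib b \<in> carrier \<kappa>" by (simp add: kappa_carrier)
  show "tens F (a + b) - tens F a - tens F b \<in> rel"
    unfolding tensor_relations_def tens_def kappa_add[OF a b, symmetric] using fa fb F by blast
qed

lemma tens_FA: "a \<in> K0 \<Longrightarrow> tens F a \<in> carrier FA"
  by (simp add: tens_def MR_simps kappa_carrier)

lemma addgrp_FA: "addgrp (carrier FA)"
  unfolding addgrp_def
proof (intro conjI ballI)
  fix x y assume "x \<in> carrier FA" "y \<in> carrier FA"
  then show "x - y \<in> carrier FA" using keys_diff[of x y] by (simp; blast)
qed simp

lemma rel_FA: "rel \<subseteq> carrier FA"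
proof
  fix z assume "z \<in> rel"
  then show "z \<in> carrier FA"
  proof (cases rule: rel_cases)
    case left
    show ?thesis unfolding left(2) by (intro addgrpD(2)[OF addgrp_FA] tens_FA left)
  next
    case right
    show ?thesis unfolding right(3) by (intro addgrpD(2)[OF addgrp_FA] tens_FA right K0_add)
  next
    case middle
    show ?thesis unfolding middle(2) by (intro addgrpD(2)[OF addgrp_FA] tens_FA middle K0_mult K0I)
  qed
qed

lemma inv_FA: "x \<in> carrier FA \<Longrightarrow> inv\<^bsub>FA\<^esub> x = - x"
  by (rule inv_free_Abelian_group) simp

lemma Kk_FA: "Kk \<subseteq> carrier FA"
  unfolding tensor_kernel_def by (rule group.generate_incl[OF group_free_Abelian_group rel_FA])

lemma rel_Kk: "z \<in> rel \<Longrightarrow> z \<in> Kk"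
  unfolding tensor_kernel_def by (rule generate.incl)

lemma addgrp_Kk: "addgrp Kk"
proof -
  have sub: "subgroup Kk FA"
    unfolding tensor_kernel_def by (rule group.generate_is_subgroup[OF group_free_Abelian_group rel_FA])
  have "x - y \<in> Kk" if "x \<in> Kk" "y \<in> Kk" for x y
    using subgroup.m_closed[OF sub that(1) subgroup.m_inv_closed[OF sub that(2)]] inv_FA[OF subsetD[OF Kk_FA that(2)]] by simp
  then show ?thesis using subgroup.one_closed[OF sub] by (simp add: addgrp_def)
qed

lemmas KD = addgrpD[OF addgrp_Kk]

lemma Kk_map:
  assumes h: "\<And>x y. h (x + y) = h x + h y" and L: "addgrp L" and r: "\<And>z. z \<in> rel \<Longrightarrow> h z \<in> L" and z: "z \<in> Kk"
  shows "h z \<in> L"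
proof -
  have h0: "h 0 = 0" using h[of 0 0] by simp
  have hu: "h (- x) = - h x" for x using h[of x "- x"] h0 by (simp add: eq_neg_iff_add_eq_0 add.commute)
  show ?thesis using z unfolding tensor_kernel_def
  proof (induction rule: generate.induct)
    case (inv x)
    then have "inv\<^bsub>FA\<^esub> x = - x" using rel_FA inv_FA by blast
    then show ?case using addgrpD(3)[OF L r[OF inv]] by (simp add: hu)
  qed (simp_all add: h0 h addgrpD[OF L] r)
qed

definition cls where "cls z = Kk #>\<^bsub>FA\<^esub> z"

lemma cls: "cls z = {h + z | h. h \<in> Kk}"
  by (auto simp: cls_def r_coset_def)

lemma cls_eq: "cls z = cls w \<longleftrightarrow> z - w \<in> Kk"
proof
  assume "cls z = cls w"
  moreover have "0 + z \<in> cls z" unfolding cls using KD(1) by blast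
  ultimately show "z - w \<in> Kk" unfolding cls by auto
next
  assume *: "z - w \<in> Kk"
  have "h + z \<in> cls w" if "h \<in> Kk" for h
    unfolding cls using KD(4)[OF that *] by (intro CollectI exI[of _ "h + (z - w)"]) simp
  moreover have "h + w \<in> cls z" if "h \<in> Kk" for h
    unfolding cls using KD(2)[OF that *] by (intro CollectI exI[of _ "h - (z - w)"]) simp
  ultimately show "cls z = cls w" using cls by auto
qed

definition act where "act s = frag_extend (\<lambda>(m, n). frag_of (s \<odot>\<^bsub>Sym_S f\<^esub> m, n))"

lemma act_simps: "act s (x + y) = act s x + act s y" "act s (x - y) = act s x - act s y" "act s 0 = 0"
  "act s (tens F a) = tens (const s * F) a"
  by (simp_all add: act_def tens_def frag_extend_add frag_extend_diff MR_simps)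

lemma act_Kk: "z \<in> Kk \<Longrightarrow> act s z \<in> Kk"
proof (rule Kk_map[OF act_simps(1) addgrp_Kk])
  fix z assume "z \<in> rel"
  then show "act s z \<in> Kk"
  proof (cases rule: rel_cases)
    case (left F G a)
    then show ?thesis by (simp add: act_simps distrib_left rel_Kk rel_intros)
  next
    case (right F a b)
    then show ?thesis by (simp add: act_simps rel_Kk rel_intros)
  next
    case (middle r F a)
    then show ?thesis by (simp add: act_simps mult.left_commute[of "const s"] rel_Kk rel_intros)
  qed
qed

abbreviation "SF \<equiv> Sym_fibre f p"

lemma SF_carrier: "carrier SF = cls ` carrier FA" and SF_zero: "\<zero>\<^bsub>SF\<^esub> = cls 0"
  and SF_add: "cls z \<oplus>\<^bsub>SF\<^esub> cls w = cls (z + w)"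
  and SF_smult: "s \<odot>\<^bsub>SF\<^esub> cls z = cls (act s z)"
proof -
  show "carrier SF = cls ` carrier FA"
    by (auto simp: Sym_fibre_def tensor_module_def Let_def FactGroup_def RCOSETS_def cls_def)
  have "cls 0 = Kk" by (auto simp: cls)
  then show "\<zero>\<^bsub>SF\<^esub> = cls 0" by (simp add: Sym_fibre_def tensor_module_def Let_def FactGroup_def)
  have "cls z <#>\<^bsub>FA\<^esub> cls w = cls (z + w)"
  proof (intro subset_antisym subsetI)
    fix x assume "x \<in> cls z <#>\<^bsub>FA\<^esub> cls w"
    then obtain h g where hg: "h \<in> Kk" "g \<in> Kk" "x = (h + z) + (g + w)" by (auto simp: cls set_mult_def)
    then have "x = (h + g) + (z + w)" by (simp add: ac_simps)
    then show "x \<in> cls (z + w)" unfolding cls using KD(4)[OF hg(1,2)] by blast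
  next
    fix x assume "x \<in> cls (z + w)"
    then obtain h where h: "h \<in> Kk" "x = h + (z + w)" by (auto simp: cls)
    then have "x = (h + z) + (0 + w)" by (simp add: ac_simps)
    moreover have "h + z \<in> cls z" "0 + w \<in> cls w" unfolding cls using h(1) KD(1) by blast+
    ultimately show "x \<in> cls z <#>\<^bsub>FA\<^esub> cls w" unfolding set_mult_def by auto
  qed
  then show "cls z \<oplus>\<^bsub>SF\<^esub> cls w = cls (z + w)"
    by (simp add: Sym_fibre_def tensor_module_def Let_def FactGroup_def)
  have "(\<Union>x\<in>cls z. cls (act s x)) = (\<Union>x\<in>cls z. cls (act s z))"
  proof (rule SUP_cong)
    fix x assume "x \<in> cls z"
    then obtain h where "h \<in> Kk" "x = h + z" by (auto simp: cls)
    then show "cls (act s x) = cls (act s z)" by (simp add: cls_eq act_simps act_Kk)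
  qed simp
  moreover have "cls z \<noteq> {}" unfolding cls using KD(1) by blast
  ultimately show "s \<odot>\<^bsub>SF\<^esub> cls z = cls (act s z)"
    by (simp add: Sym_fibre_def tensor_module_def Let_def act_def[symmetric] cls_def[symmetric])
qed

lemma SF_piece: "Sym_fibre_piece f p \<nu> = cls ` carrier (free_Abelian_group (Sym_proj f ` Sx_piece \<nu> \<times> fib ` K0))"
  by (simp add: Sym_fibre_piece_def tensor_grading_def cls_def[abs_def] Sym_piece_def kappa_carrier)

end

section \<open>From polynomials over the large field to the fibre\<close>

lemma polys_induct [consumes 1, case_names zero single add]:
  assumes x: "x \<in> polys" and "P 0" "\<And>k c. (\<And>v. 0 \<le> lk k v) \<Longrightarrow> P (single k c)"
    "\<And>x y. P x \<Longrightarrow> P y \<Longrightarrow> P (x + y)"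
  shows "P (x :: 'a::comm_ring_1 laurent)"
proof -
  have "P (\<Sum>k\<in>K. single k (lk x k))" if "finite K" "K \<subseteq> keys x" for K
    using that by induction (use x in \<open>auto intro!: assms simp: polys_def\<close>)
  then show ?thesis by (subst pm_expand) simp
qed

lemma const_add: "const (a + b) = const a + const b" and const_0: "const 0 = 0"
  by (simp_all add: const_def single_add)

lemma lookup_R_to_Sx: "lk (R_to_Sx r) i = const (lk r i)"
  by (simp add: R_to_Sx_def Poly_Mapping.map.rep_eq "when_def" const_0)

lemma R_to_Sx_add: "R_to_Sx (r + r') = R_to_Sx r + R_to_Sx r'" and R_to_Sx_0: "R_to_Sx 0 = 0"
  and R_to_Sx_single: "R_to_Sx (single i c) = single i (const c)"
  by (rule poly_mapping_eqI; simp add: lookup_R_to_Sx lookup_add const_add const_0 lookup_single "when_def")+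

lemma single_const: "single i (c :: 'k::comm_ring_1) = const c * single i 1"
  by (simp add: const_def mult_single)

lemma lookup_mult_C: "lk (x * C c) k = lk x k * (c :: 'a::comm_ring_1)"
  using lookup_single_mult[of 0 c x k] by (simp add: C_def mult.commute)

text \<open>Only finitely many coefficients occur in one syzygy, so a maximal independent subset of
  these is basis enough.\<close>

lemma finite_basis:
  fixes h :: "'k::field \<Rightarrow> 'a::field"
  assumes h: "ring_hom_on h" and V: "finite V"
  obtains B r where "finite B" "\<forall>v\<in>V. (\<Sum>b\<in>B. h (r v b) * b) = v"
    "\<forall>c. (\<Sum>b\<in>B. h (c b) * b) = 0 \<longrightarrow> (\<forall>b\<in>B. c b = 0)"
proof -
  interpret vector_space "\<lambda>c w. h c * w"
    by unfold_locales (simp_all add: ring_hom_onD[OF h] algebra_simps)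
  obtain B where B: "B \<subseteq> V" "independent B" "V \<subseteq> span B" by (rule maximal_independent_subset)
  have fin: "finite B" by (rule finite_subset[OF B(1) V])
  show thesis
  proof (rule that[OF fin]; safe)
    fix v assume "v \<in> V"
    then show "(\<Sum>b\<in>B. h (representation B v b) * b) = v"
      using sum_representation_eq[OF B(2) _ fin order.refl] B(3) by blast
  next
    fix c b assume "(\<Sum>b\<in>B. h (c b) * b) = 0" "b \<in> B"
    then show "c b = 0" using independentD[OF B(2) fin order.refl] by blast
  qed
qed

context sym_fibre
begin

definition \<iota> :: "'k \<Rightarrow> 'a" where "\<iota> c = \<phi> (const c)"

lemma \<iota>: "ring_hom_on \<iota>"
  by (simp add: ring_hom_on_def \<iota>_def const_simps phom)

lemma \<iota>_K0: "\<iota> c \<in> K0"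
  unfolding \<iota>_def by (rule K0I)

abbreviation "\<epsilon> \<equiv> base_change \<iota>"

lemmas ehom = ring_hom_onD[OF ring_hom_base_change[OF \<iota>]]

lemma eps_sum: "\<epsilon> (\<Sum>j\<in>I. g j) = (\<Sum>j\<in>I. \<epsilon> (g j))"
  by (induction I rule: infinite_finite_induct) (simp_all add: ehom)

text \<open>Specialization at the point \<open>p\<close>: the variables x_i take their values in the
  residue field, and the coefficients in S are extended along \<open>\<iota>\<close>.\<close>

definition ev :: "'k Sx_poly \<Rightarrow> 'a laurent" where
  "ev = lin (\<lambda>i s. \<epsilon> s * C (\<phi> (single i 1)))"

lemma phi_single_0: "\<phi> (single 0 1) = 1"
  using phom(2) by simp

lemma phi_single_add: "\<phi> (single (i + j) 1) = \<phi> (single i 1) * \<phi> (single j 1)"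
  by (simp add: phom(4)[symmetric] mult_single)

lemma ring_hom_ev: "ring_hom_on ev"
  unfolding ev_def
  by (rule ring_hom_lin[OF ring_hom_base_change[OF \<iota>]]) (simp_all only: phi_single_0 phi_single_add C_simps)

lemmas evhom = ring_hom_onD[OF ring_hom_ev]

lemma ev_single: "ev (single i s) = \<epsilon> s * C (\<phi> (single i 1))"
  unfolding ev_def by (rule lin_single) (simp add: ehom distrib_right)

lemma ev_const: "ev (const s) = \<epsilon> s"
  unfolding const_def ev_single phi_single_0 by (simp add: C_simps)

lemma ev_var: "ev (var i) = C (\<phi> (var i))"
  unfolding var_def ev_single by (simp add: ehom)

lemma eps_const: "\<epsilon> (const c) = C (\<iota> c)"
  by (simp add: const_def base_change_single[OF \<iota>] intk_0 C_def)

lemma phi_single: "\<phi> (single i c) = \<iota> c * \<phi> (single i 1)"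
  using phom(4)[of "const c" "single i 1"] by (simp only: single_const[of i c] \<iota>_def)

lemma ev_R: "ev (R_to_Sx r) = C (\<phi> r)"
proof (induction r rule: pm_induct)
  case (single i c)
  show ?case by (simp only: R_to_Sx_single ev_single eps_const phi_single[of i c] C_simps)
qed (simp_all add: R_to_Sx_add R_to_Sx_0 evhom phom C_simps)

lemma ev_sum: "ev (\<Sum>j\<in>I. g j) = (\<Sum>j\<in>I. ev (g j))"
  by (induction I rule: infinite_finite_induct) (simp_all add: evhom)

lemma ev_polys: "ev F \<in> polys"
  unfolding ev_def lin_def by (intro polys_sum polys_mult base_change_polys[OF \<iota>] polys_C)

lemma ev_piece: "F \<in> Sx_piece \<nu> \<Longrightarrow> ev F \<in> piece \<nu>"
  unfolding ev_def lin_def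
proof (rule piece_sum)
  fix i assume "F \<in> Sx_piece \<nu>"
  then have "\<epsilon> (lk F i) \<in> piece \<nu>" by (auto simp: Sx_piece_def intro!: base_change_piece[OF \<iota>])
  from piece_mult[OF this piece_C] show "\<epsilon> (lk F i) * C (\<phi> (single i 1)) \<in> piece \<nu>" by simp
qed

definition J :: "'a laurent set" where
  "J = syz_ideal (\<lambda>i. \<epsilon> (f i)) (\<lambda>i. \<phi> (var i))"

lemmas JD = submodD[OF submod_syz_ideal[of "\<lambda>i. \<epsilon> (f i)" "\<lambda>i. \<phi> (var i)", folded J_def]]

lemma ev_sym_ideal: "F \<in> sym_ideal f \<Longrightarrow> ev F \<in> J"
proof -
  interpret cring "univ_ring :: 'k Sx_poly ring" by (rule cring_univ_ring)
  have "ideal {F. ev F \<in> J} univ_ring"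
    by (rule ideal_univ_ringI) (auto simp: evhom intro!: JD ev_polys)
  then have "sym_ideal f \<subseteq> {F. ev F \<in> J}"
    unfolding sym_ideal_def
  proof (rule genideal_minimal, safe)
    fix g assume g: "(\<Sum>i\<in>UNIV. g i * f i) = 0"
    have "(\<Sum>i\<in>UNIV. \<epsilon> (g i) * \<epsilon> (f i)) = \<epsilon> (\<Sum>i\<in>UNIV. g i * f i)" by (simp add: eps_sum ehom)
    also have "\<dots> = 0" using g by (simp add: ehom)
    finally show "ev (\<Sum>i\<in>UNIV. const (g i) * var i) \<in> J" unfolding J_def syz_ideal_def
      by (auto simp: ev_sum evhom ev_const ev_var intro!: exI[of _ "\<lambda>i. \<epsilon> (g i)"] base_change_polys[OF \<iota>])
  qed
  then show "F \<in> sym_ideal f \<Longrightarrow> ev F \<in> J" by blast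
qed

definition mon :: "(svar \<Rightarrow>\<^sub>0 int) \<Rightarrow> 'k Sx_poly" where
  "mon k = const (single (natk k) 1)"

text \<open>The retraction \<^term>\<open>ret\<close> onto the residue field makes sense of \<open>s\<^sup>k \<otimes> c\<close> for all coefficients
  \<^term>\<open>c\<close> of the large field.\<close>

definition rho0 where "rho0 = lin (\<lambda>k c. tens (mon k) (ret c))"

definition \<rho> where "\<rho> x = cls (rho0 x)"

definition \<tau> where "\<tau> F a = cls (tens F a)"

lemma tau_add: "a \<in> K0 \<Longrightarrow> \<tau> (F + G) a = \<tau> F a \<oplus>\<^bsub>SF\<^esub> \<tau> G a"
  and tau_R: "a \<in> K0 \<Longrightarrow> \<tau> (R_to_Sx r * F) a = \<tau> F (\<phi> r * a)"
  using rel_Kk[OF rel_intros(1), of a F G] rel_Kk[OF rel_intros(3), of a r F]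
  by (simp_all add: \<tau>_def SF_add cls_eq diff_diff_eq)

lemma tau_0': "a \<in> K0 \<Longrightarrow> \<tau> 0 a = cls 0"
  using KD(3)[OF rel_Kk[OF rel_intros(1), of a 0 0]] by (simp add: \<tau>_def cls_eq)

lemma rho0_mod: "tens (mon k) (ret (a + b)) - tens (mon k) (ret a) - tens (mon k) (ret b) \<in> Kk"
  unfolding ret(2) by (rule rel_Kk[OF rel_intros(2)[OF ret(1) ret(1)]])

lemma rho_add: "\<rho> (x + y) = \<rho> x \<oplus>\<^bsub>SF\<^esub> \<rho> y"
proof -
  have "rho0 (x + y) - rho0 x - rho0 y \<in> Kk"
    unfolding rho0_def by (rule lin_mod_add[OF addgrp_Kk rho0_mod])
  then show ?thesis by (simp add: \<rho>_def SF_add cls_eq diff_diff_eq)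
qed

lemma rho_0: "\<rho> 0 = cls 0"
  by (simp add: \<rho>_def rho0_def)

lemma rho_single: "\<rho> (single k c) = \<tau> (mon k) (ret c)"
proof -
  have "tens (mon k) (ret c) - rho0 (single k c) \<in> Kk"
    unfolding rho0_def by (rule lin_mod_single[OF addgrp_Kk rho0_mod])
  then show ?thesis by (simp add: \<rho>_def \<tau>_def cls_eq[symmetric])
qed

lemma cls_0_add: "cls 0 \<oplus>\<^bsub>SF\<^esub> cls 0 = cls 0"
  by (simp add: SF_add)

lemma smult_tau: "s \<odot>\<^bsub>SF\<^esub> \<tau> F a = \<tau> (const s * F) a"
  by (simp add: \<tau>_def SF_smult act_simps)

lemma smult_add: "s \<odot>\<^bsub>SF\<^esub> (\<rho> x \<oplus>\<^bsub>SF\<^esub> \<rho> y) = (s \<odot>\<^bsub>SF\<^esub> \<rho> x) \<oplus>\<^bsub>SF\<^esub> (s \<odot>\<^bsub>SF\<^esub> \<rho> y)"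
  by (simp add: \<rho>_def SF_add SF_smult act_simps)

lemma rho_smult:
  assumes "x \<in> polys"
  shows "s \<odot>\<^bsub>SF\<^esub> \<rho> x = \<rho> (\<epsilon> s * x)"
  using assms
proof (induction x rule: polys_induct)
  case zero
  show ?case by (simp add: rho_0 SF_smult act_simps)
next
  case (single l b)
  then have l: "\<And>v. 0 \<le> lk l v" by blast
  show ?case
  proof (induction s rule: pm_induct)
    case zero
    show ?case by (simp add: rho_single smult_tau const_0 tau_0' ret(1) ehom rho_0)
  next
    case (single k c)
    have mon: "const (single k c) * mon l = R_to_Sx (const c) * mon (intk k + l)"
      by (simp add: mon_def R_to_Sx_single const_def mult_single natk_add[OF l])
    have "single k c \<odot>\<^bsub>SF\<^esub> \<rho> (single l b) = \<tau> (mon (intk k + l)) (\<iota> c * ret b)"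
      unfolding rho_single smult_tau mon tau_R[OF ret(1)] \<iota>_def ..
    also have "\<dots> = \<rho> (single (intk k + l) (\<iota> c * b))"
      unfolding rho_single ret(3)[OF \<iota>_K0] ..
    also have "single (intk k + l) (\<iota> c * b) = \<epsilon> (single k c) * single l b"
      by (simp add: base_change_single[OF \<iota>] mult_single)
    finally show ?case .
  next
    case (add s s')
    have "(s + s') \<odot>\<^bsub>SF\<^esub> \<rho> (single l b)
        = (s \<odot>\<^bsub>SF\<^esub> \<rho> (single l b)) \<oplus>\<^bsub>SF\<^esub> (s' \<odot>\<^bsub>SF\<^esub> \<rho> (single l b))"
      by (simp add: rho_single smult_tau const_add distrib_right tau_add ret(1))
    then show ?case unfolding add by (simp add: rho_add[symmetric] ehom distrib_right)
  qed
next
  case (add x y)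
  then show ?case by (simp add: rho_add smult_add distrib_left)
qed

text \<open>Every monomial splits into an element of R and a monomial in the s- and t-variables. The
  former moves across the tensor sign and becomes its value under \<open>\<phi>\<close>.\<close>

lemma tau_ev: "\<tau> F (ret a) = \<rho> (ev F * C a)"
proof (induction F rule: pm_induct)
  case zero
  show ?case by (simp add: tau_0' ret(1) evhom rho_0)
next
  case (single i s)
  show ?case
  proof (induction s rule: pm_induct)
    case zero
    show ?case by (simp add: tau_0' ret(1) evhom rho_0)
  next
    case (single k c)
    have split: "single i (single k c) = R_to_Sx (single i c) * mon (intk k)"
      by (simp add: mon_def R_to_Sx_single const_def mult_single)
    have "\<tau> (single i (single k c)) (ret a) = \<tau> (mon (intk k)) (\<phi> (single i c) * ret a)"
      unfolding split tau_R[OF ret(1)] ..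
    also have "\<dots> = \<rho> (single (intk k) (\<phi> (single i c) * a))"
      unfolding rho_single ret(3)[OF K0I] ..
    also have "single (intk k) (\<phi> (single i c) * a)
        = ev (single i (single k c)) * C a"
      unfolding ev_single base_change_single[OF \<iota>] phi_single[of i c] by (simp add: C_def mult_single)
    finally show ?case .
  next
    case (add s s')
    then show ?case by (simp add: single_add tau_add ret(1) evhom distrib_right rho_add)
  qed
next
  case (add F G)
  then show ?case by (simp add: tau_add ret(1) evhom distrib_right rho_add)
qed

text \<open>Expanding the coefficients of a syzygy over the large field in a basis over \<open>k\<close> gives syzygies over \<open>k\<close>
  (flatness of the extension).\<close>

lemma rho_J: "x \<in> J \<Longrightarrow> \<rho> x = \<rho> 0"
proof -
  assume "x \<in> J"
  then obtain g where g: "\<And>i. g i \<in> polys" "(\<Sum>i\<in>UNIV. g i * \<epsilon> (f i)) = 0" "x = (\<Sum>i\<in>UNIV. g i * C (\<phi> (var i)))"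
    unfolding J_def syz_ideal_def by blast
  define V where "V = (\<Union>i. lk (g i) ` keys (g i))"
  have "finite V" unfolding V_def by auto
  then obtain B r where B: "finite B" "\<forall>v\<in>V. (\<Sum>b\<in>B. \<iota> (r v b) * b) = v"
    "\<forall>c. (\<Sum>b\<in>B. \<iota> (c b) * b) = 0 \<longrightarrow> (\<forall>b\<in>B. c b = 0)"
    by (rule finite_basis[OF \<iota>])
  \<comment> \<open>The component of \<open>g i\<close> along the basis element \<open>b\<close>,
    with coefficients in the base field.\<close>
  define G where "G i b = (\<Sum>k\<in>keys (g i). single (natk k) (r (lk (g i) k) b))" for i b
  have gG: "g i = (\<Sum>b\<in>B. \<epsilon> (G i b) * C b)" for i
  proof -
    have k: "intk (natk k) = k" if "k \<in> keys (g i)" for k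
      using g(1)[of i] that by (intro intk_natk) (simp add: polys_def)
    have "(\<Sum>b\<in>B. \<epsilon> (G i b) * C b)
        = (\<Sum>b\<in>B. \<Sum>k\<in>keys (g i). single k (\<iota> (r (lk (g i) k) b) * b))"
      by (intro sum.cong refl)
        (simp add: G_def eps_sum base_change_single[OF \<iota>] sum_distrib_right C_def mult_single k)
    also have "\<dots> = (\<Sum>k\<in>keys (g i). \<Sum>b\<in>B. single k (\<iota> (r (lk (g i) k) b) * b))"
      by (rule sum.swap)
    also have "\<dots> = (\<Sum>k\<in>keys (g i). single k (lk (g i) k))"
    proof (rule sum.cong[OF refl])
      fix k assume "k \<in> keys (g i)"
      then have "lk (g i) k \<in> V" by (auto simp: V_def)
      have "(\<Sum>b\<in>B. single k (h b)) = single k (\<Sum>b\<in>B. h b)" for h :: "'a \<Rightarrow> 'a"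
        by (induction B rule: infinite_finite_induct) (simp_all add: single_add)
      then show "(\<Sum>b\<in>B. single k (\<iota> (r (lk (g i) k) b) * b)) = single k (lk (g i) k)"
        using B(2) \<open>lk (g i) k \<in> V\<close> by simp
    qed
    also have "\<dots> = g i" by (rule pm_expand[symmetric])
    finally show ?thesis ..
  qed
  \<comment> \<open>Comparing coefficients of one monomial gives a relation between the elements of
    \<open>B\<close> over the base field, and these are independent.\<close>
  have syz: "(\<Sum>i\<in>UNIV. G i b * f i) = 0" if b: "b \<in> B" for b
  proof (rule poly_mapping_eqI)
    fix m
    have "0 = (\<Sum>i\<in>UNIV. (\<Sum>b\<in>B. \<epsilon> (G i b) * C b) * \<epsilon> (f i))"
      using g(2) by (simp only: gG[symmetric])
    also have "\<dots> = (\<Sum>i\<in>UNIV. \<Sum>b\<in>B. \<epsilon> (G i b * f i) * C b)"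
      by (simp only: sum_distrib_right ehom mult.assoc mult.commute[of "C _"])
    also have "\<dots> = (\<Sum>b\<in>B. \<epsilon> (\<Sum>i\<in>UNIV. G i b * f i) * C b)"
      by (subst sum.swap) (simp add: eps_sum sum_distrib_right)
    finally have "0 = lk (\<Sum>b\<in>B. \<epsilon> (\<Sum>i\<in>UNIV. G i b * f i) * C b) (intk m)" by simp
    also have "\<dots> = (\<Sum>b\<in>B. \<iota> (lk (\<Sum>i\<in>UNIV. G i b * f i) m) * b)"
      by (simp only: lookup_sum lookup_mult_C lookup_base_change[OF \<iota>])
    finally have "(\<Sum>b\<in>B. \<iota> (lk (\<Sum>i\<in>UNIV. G i b * f i) m) * b) = 0" ..
    then show "lk (\<Sum>i\<in>UNIV. G i b * f i) m = lk 0 m" using spec[OF B(3), of "\<lambda>b. lk (\<Sum>i\<in>UNIV. G i b * f i) m"] b by auto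
  qed
  interpret Sx: cring "univ_ring :: 'k Sx_poly ring" by (rule cring_univ_ring)
  have sym: "(\<Sum>i\<in>UNIV. const (G i b) * var i) \<in> sym_ideal f" if "b \<in> B" for b
    unfolding sym_ideal_def
    by (rule subsetD[OF Sx.genideal_self]) (use syz[OF that] in \<open>auto intro!: exI[of _ "\<lambda>i. G i b"]\<close>)
  let ?P = "\<lambda>b. \<Sum>i\<in>UNIV. const (G i b) * var i"
  have zero: "\<rho> (ev (?P b) * C b) = cls 0" if b: "b \<in> B" for b
  proof -
    have "Sym_proj f (?P b) = Sym_proj f 0" using sym[OF b] by (simp add: Sym_proj_eq)
    then have "\<tau> (?P b) (ret b) = \<tau> 0 (ret b)" by (simp add: \<tau>_def tens_def)
    then show ?thesis by (simp add: tau_ev[symmetric] tau_0' ret(1))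
  qed
  have "x = (\<Sum>i\<in>UNIV. \<Sum>b\<in>B. \<epsilon> (G i b) * C (\<phi> (var i)) * C b)"
    unfolding g(3) by (subst gG) (simp only: sum_distrib_right mult.assoc mult.commute[of "C _" "C _"])
  also have "\<dots> = (\<Sum>b\<in>B. ev (?P b) * C b)"
    by (subst sum.swap) (simp add: ev_sum evhom ev_const ev_var sum_distrib_right)
  finally have x: "x = (\<Sum>b\<in>B. ev (?P b) * C b)" .
  have "\<rho> (\<Sum>b\<in>B'. ev (?P b) * C b) = cls 0" if "finite B'" "B' \<subseteq> B" for B'
    using that by (induction B' rule: finite_induct) (simp_all add: rho_0 rho_add zero cls_0_add)
  then show "\<rho> x = \<rho> 0" using B(1) by (simp add: x rho_0)
qed

end

section \<open>The inverse map, and the graded pieces of the fibre\<close>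

context sym_fibre
begin

text \<open>The map \<open>F \<otimes> a \<mapsto> ev F * a\<close>, on representatives: it is well defined modulo \<^term>\<open>J\<close> and inverts
  \<^term>\<open>\<rho>\<close> there.\<close>

definition theta1 where
  "theta1 mn = ev (SOME F. Sym_proj f F = fst mn) * C (SOME a. a \<in> K0 \<and> fib a = snd mn)"

definition theta where "theta = lin (\<lambda>mn c. of_int c * theta1 mn)"

lemma theta_add: "theta (z + w) = theta z + theta w"
  unfolding theta_def by (rule lin_add) (simp add: distrib_right)

lemma theta_0: "theta 0 = 0"
  by (simp add: theta_def)

lemma theta_diff: "theta (z - w) = theta z - theta w"
  using theta_add[of "z - w" w] by simp

text \<open>The value \<open>a\<close> is recovered exactly by \<open>fib_inj\<close>. The chosen
  representative differs from \<open>F\<close> by an element of the symmetric ideal, which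
  \<open>ev\<close> sends into \<open>J\<close>.\<close>

lemma theta_tens:
  assumes "a \<in> K0"
  shows "theta (tens F a) - ev F * C a \<in> J"
proof -
  have val: "(SOME b. b \<in> K0 \<and> fib b = fib a) = a"
    by (rule some_equality) (use assms fib_inj in \<open>auto dest: fib_inj\<close>)
  have th: "theta (tens F a) = ev (SOME G. Sym_proj f G = Sym_proj f F) * C a"
  proof -
    have "theta (frag_of mn) = of_int 1 * theta1 mn" for mn
      unfolding theta_def by (rule lin_single) (simp add: distrib_right)
    then show ?thesis by (simp add: tens_def theta1_def val)
  qed
  let ?G = "SOME G. Sym_proj f G = Sym_proj f F"
  have "Sym_proj f ?G = Sym_proj f F" by (rule someI) simp
  then have "?G - F \<in> sym_ideal f" by (simp add: Sym_proj_eq)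
  then have "ev (?G - F) \<in> J" by (rule ev_sym_ideal)
  then have "C a * ev (?G - F) \<in> J" by (rule JD(4)[OF polys_C])
  then show ?thesis by (simp add: th evhom algebra_simps)
qed

text \<open>\<open>F, a \<mapsto> ev F * C a\<close> satisfies each tensor relation exactly, so
  \<open>theta\<close> satisfies it up to the errors of \<open>theta_tens\<close>, which lie in
  \<open>J\<close>.\<close>

lemma theta_Kk: "z \<in> Kk \<Longrightarrow> theta z \<in> J"
proof (rule Kk_map[OF theta_add])
  show J: "addgrp J" unfolding J_def by (rule addgrp_submod[OF submod_syz_ideal])
  let ?D = "\<lambda>F a. theta (tens F a) - ev F * C a"
  fix z assume "z \<in> rel"
  then show "theta z \<in> J"
  proof (cases rule: rel_cases)
    case (left F G a)
    have "theta z = ?D (F + G) a - ?D F a - ?D G a" by (simp only: left(2) theta_diff evhom) (simp add: algebra_simps)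
    also have "\<dots> \<in> J" by (intro addgrpD(2)[OF J] theta_tens left(1))
    finally show ?thesis .
  next
    case (right F a b)
    have "theta z = ?D F (a + b) - ?D F a - ?D F b" by (simp only: right(3) theta_diff C_simps) (simp add: algebra_simps)
    also have "\<dots> \<in> J" by (intro addgrpD(2)[OF J] theta_tens K0_add right(1,2))
    finally show ?thesis .
  next
    case (middle r F a)
    have "theta z = ?D (R_to_Sx r * F) a - ?D F (\<phi> r * a)" by (simp add: middle(2) theta_diff evhom ev_R C_simps mult_ac)
    also have "\<dots> \<in> J" by (intro addgrpD(2)[OF J] theta_tens K0_mult K0I middle(1))
    finally show ?thesis .
  qed
qed

text \<open>The polynomial ring over the residue field instead of the large field. On its
  coefficients \<open>ret\<close> is the identity, so nothing is lost there under
  \<open>\<rho>\<close> beyond \<open>J\<close>.\<close>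

definition SK :: "'a laurent set" where
  "SK = {x\<in>polys. \<forall>k. lk x k \<in> K0}"

lemma SK_add: "x \<in> SK \<Longrightarrow> y \<in> SK \<Longrightarrow> x + y \<in> SK"
  by (auto simp: SK_def lookup_add intro: polys_add K0_add)

lemma SK_0: "0 \<in> SK"
  by (simp add: SK_def K0_0)

lemma SK_eps_mult:
  assumes x: "x \<in> SK"
  shows "\<epsilon> s * x \<in> SK"
proof (induction s rule: pm_induct)
  case zero
  show ?case by (simp add: ehom SK_0)
next
  case (single k c)
  have "\<epsilon> (single k c) * x \<in> polys" using x by (intro polys_mult base_change_polys[OF \<iota>]) (simp add: SK_def)
  then show ?case using x by (simp add: SK_def base_change_single[OF \<iota>] lookup_single_mult K0_mult \<iota>_K0)
next
  case (add s s')
  then show ?case by (simp add: ehom distrib_right SK_add)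
qed

lemma SK_mult_C:
  assumes "x \<in> SK" "c \<in> K0"
  shows "x * C c \<in> SK"
  using assms by (auto simp: SK_def lookup_mult_C intro: polys_mult K0_mult)

lemma SK_diff: "x \<in> SK \<Longrightarrow> y \<in> SK \<Longrightarrow> x - y \<in> SK"
  by (auto simp: SK_def lookup_minus intro: polys_diff K0_diff)

lemma SK_ev: "ev F \<in> SK"
  unfolding ev_def lin_def
proof -
  have 1: "1 \<in> SK" by (auto simp: SK_def lookup_one "when_def" intro: K0_0 K0_1)
  have "\<epsilon> s * C (\<phi> r) \<in> SK" for s r
    using SK_mult_C[OF SK_eps_mult[OF 1] K0I] by simp
  then show "(\<Sum>i\<in>I. \<epsilon> (lk F i) * C (\<phi> (single i 1))) \<in> SK" for I
    by (induction I rule: infinite_finite_induct) (simp_all add: SK_0 SK_add)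
qed

lemma theta_rho0:
  assumes x: "x \<in> SK"
  shows "theta (rho0 x) - x \<in> J"
proof -
  have sum: "theta (sum g I) = (\<Sum>i\<in>I. theta (g i))" for g and I :: "(svar \<Rightarrow>\<^sub>0 int) set"
    by (induction I rule: infinite_finite_induct) (simp_all add: theta_add theta_0)
  have "theta (rho0 x) - x = (\<Sum>k\<in>keys x. theta (tens (mon k) (ret (lk x k))) - single k (lk x k))"
    using pm_expand[of x] by (simp add: rho0_def lin_def sum sum_subtractf)
  also have "\<dots> = (\<Sum>k\<in>keys x. theta (tens (mon k) (lk x k)) - ev (mon k) * C (lk x k))"
  proof (rule sum.cong[OF refl])
    fix k assume "k \<in> keys x"
    then have k: "intk (natk k) = k" using x by (intro intk_natk) (simp add: SK_def polys_def)
    have "ret (lk x k) = lk x k" using x by (intro ret(4)) (simp add: SK_def)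
    moreover have "ev (mon k) * C (lk x k) = single k (lk x k)"
      by (simp add: mon_def ev_const base_change_single[OF \<iota>] k C_def mult_single ring_hom_onD[OF \<iota>])
    ultimately show "theta (tens (mon k) (ret (lk x k))) - single k (lk x k)
        = theta (tens (mon k) (lk x k)) - ev (mon k) * C (lk x k)" by simp
  qed
  also have "\<dots> \<in> J"
    using x by (intro addgrpD(5)[OF addgrp_submod[OF submod_syz_ideal, of "\<lambda>i. \<epsilon> (f i)" "\<lambda>i. \<phi> (var i)", folded J_def]] theta_tens)
      (simp add: SK_def)
  finally show ?thesis .
qed

lemma rho_0_J:
  assumes x: "x \<in> SK" "\<rho> x = \<rho> 0"
  shows "x \<in> J"
proof -
  have "rho0 x \<in> Kk" using x(2) by (simp add: \<rho>_def cls_eq rho0_def)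
  then have "theta (rho0 x) - (theta (rho0 x) - x) \<in> J" by (intro JD(6) theta_Kk theta_rho0 x(1))
  then show ?thesis by simp
qed

lemma rho_diff: "\<rho> (x - y) = cls (rho0 x - rho0 y)"
proof -
  have "\<rho> x = \<rho> (x - y) \<oplus>\<^bsub>SF\<^esub> \<rho> y" using rho_add[of "x - y" y] by simp
  then have "rho0 x - (rho0 (x - y) + rho0 y) \<in> Kk" by (simp add: \<rho>_def SF_add cls_eq)
  then have "- (rho0 x - (rho0 (x - y) + rho0 y)) \<in> Kk" by (rule KD(3))
  also have "- (rho0 x - (rho0 (x - y) + rho0 y)) = rho0 (x - y) - (rho0 x - rho0 y)" by simp
  finally show ?thesis by (simp only: \<rho>_def cls_eq)
qed

text \<open>With \<open>Y\<close> a bihomogeneous piece or everything, one induction over formal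
  sums serves both the graded pieces and the carrier of the fibre.\<close>

lemma rho_span:
  assumes z: "keys z \<subseteq> Sym_proj f ` E \<times> fib ` K0"
    and Y: "0 \<in> Y" "\<And>x y. x \<in> Y \<Longrightarrow> y \<in> Y \<Longrightarrow> x - y \<in> Y" "\<And>F a. F \<in> E \<Longrightarrow> ev F * C a \<in> Y"
  shows "cls z \<in> \<rho> ` (SK \<inter> Y)"
  using z
proof (induction z rule: frag_induction)
  case zero
  show ?case using SK_0 Y(1) rho_0[symmetric] by blast
next
  case (one mn)
  then obtain F a where Fa: "F \<in> E" "a \<in> K0" "mn = (Sym_proj f F, fib a)" by blast
  have "cls (frag_of mn) = \<tau> F (ret a)" by (simp add: Fa(3) \<tau>_def tens_def ret(4)[OF Fa(2)])
  also have "\<dots> = \<rho> (ev F * C a)" by (rule tau_ev)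
  finally show ?case using SK_mult_C[OF SK_ev Fa(2)] Y(3)[OF Fa(1)] by blast
next
  case (diff z w)
  then obtain x y where xy: "x \<in> SK \<inter> Y" "y \<in> SK \<inter> Y" "cls z = \<rho> x" "cls w = \<rho> y" by blast
  have "(z - rho0 x) - (w - rho0 y) \<in> Kk" by (rule KD(2)) (use xy(3,4) in \<open>simp_all only: \<rho>_def cls_eq\<close>)
  also have "(z - rho0 x) - (w - rho0 y) = (z - w) - (rho0 x - rho0 y)" by simp
  finally have "cls (z - w) = \<rho> (x - y)" by (simp only: rho_diff cls_eq)
  then show ?case using xy SK_diff Y(2) by blast
qed

lemma rho0_keys: "keys (rho0 x) \<subseteq> (\<Union>k\<in>keys x. {(Sym_proj f (mon k), fib (ret (lk x k)))})"
  unfolding rho0_def lin_def tens_def using keys_sum[of "\<lambda>k. frag_of (Sym_proj f (mon k), fib (ret (lk x k)))"] by fastforce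

lemma SF_piece_eq: "Sym_fibre_piece f p \<nu> = \<rho> ` (SK \<inter> piece \<nu>)"
proof (intro subset_antisym subsetI)
  fix c assume "c \<in> Sym_fibre_piece f p \<nu>"
  then obtain z where z: "keys z \<subseteq> Sym_proj f ` Sx_piece \<nu> \<times> fib ` K0" "c = cls z"
    unfolding SF_piece by auto
  have "ev F * C a \<in> piece \<nu>" if "F \<in> Sx_piece \<nu>" for F a
    using piece_mult[OF ev_piece[OF that] piece_C] by simp
  then show "c \<in> \<rho> ` (SK \<inter> piece \<nu>)"
    unfolding z(2) by (intro rho_span[OF z(1)] piece_diff piece_0)
next
  fix c assume "c \<in> \<rho> ` (SK \<inter> piece \<nu>)"
  then obtain x where x: "x \<in> polys" "x \<in> piece \<nu>" "c = \<rho> x" by (auto simp: SK_def)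
  have "mon k \<in> Sx_piece \<nu>" if k: "k \<in> keys x" for k
  proof -
    have kv: "0 \<le> lk k v" for v using x(1) k by (simp add: polys_def)
    have "deg k = \<nu>" using x(2) k by (simp add: piece_def)
    then have "bidegree (natk k) = \<nu>" using kv by (simp add: bidegree_def deg_def)
    then show ?thesis by (auto simp: Sx_piece_def S_piece_def mon_def const_def lookup_single "when_def" split: if_splits)
  qed
  then have "rho0 x \<in> carrier (free_Abelian_group (Sym_proj f ` Sx_piece \<nu> \<times> fib ` K0))"
    using rho0_keys[of x] ret(1) by fastforce
  then show "c \<in> Sym_fibre_piece f p \<nu>" unfolding x(3) SF_piece \<rho>_def by (rule imageI)
qed

lemma SF_carrier_eq: "carrier SF = \<rho> ` polys"
proof (intro subset_antisym subsetI)
  fix c assume "c \<in> carrier SF"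
  then obtain z where z: "keys z \<subseteq> Sym_proj f ` UNIV \<times> fib ` K0" "c = cls z"
    unfolding SF_carrier by (auto simp: MR_simps kappa_carrier)
  then have "c \<in> \<rho> ` (SK \<inter> UNIV)" unfolding z(2) by (intro rho_span[OF z(1)]) auto
  then show "c \<in> \<rho> ` polys" by (auto simp: SK_def)
next
  fix c assume "c \<in> \<rho> ` polys"
  then obtain x where x: "c = cls (rho0 x)" by (auto simp: \<rho>_def)
  have "rho0 x \<in> carrier FA"
    unfolding rho0_def lin_def by (intro addgrpD(5)[OF addgrp_FA] tens_FA ret(1))
  then show "c \<in> carrier SF" unfolding x SF_carrier by (rule imageI)
qed

lemma cech_model: "cech_model SF \<rho> \<epsilon> SK J (Sym_fibre_piece f p)"
proof
  show "ring_hom_on \<epsilon>" by (rule ring_hom_base_change[OF \<iota>])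
  show "\<epsilon> a \<in> polys" for a by (rule base_change_polys[OF \<iota>])
  show "j < 4 \<Longrightarrow> \<epsilon> (B_gens ! j) = bgen j" for j by (rule base_change_B_gens[OF \<iota>])
  show "a \<in> S_piece \<delta> \<Longrightarrow> \<epsilon> a \<in> piece \<delta>" for a \<delta> by (rule base_change_piece[OF \<iota>])
  show "carrier SF = \<rho> ` polys" by (rule SF_carrier_eq)
  show "\<zero>\<^bsub>SF\<^esub> = \<rho> 0" by (simp add: SF_zero rho_0)
  show "\<rho> x \<oplus>\<^bsub>SF\<^esub> \<rho> y = \<rho> (x + y)" for x y by (simp add: rho_add)
  show "x \<in> polys \<Longrightarrow> a \<odot>\<^bsub>SF\<^esub> \<rho> x = \<rho> (\<epsilon> a * x)" for a x by (rule rho_smult)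
  show "SK \<subseteq> polys" by (auto simp: SK_def)
  show "submod J" unfolding J_def by (rule submod_syz_ideal)
qed (rule SK_0 SK_add SK_eps_mult rho_J rho_0_J SF_piece_eq; assumption?)+

end

theorem theorem19:
  fixes f :: "4 \<Rightarrow> 'k::field S_poly" and d1 d2 :: nat
    and p :: "'k R_poly set" and i :: int and \<nu> :: "int \<times> int"
  assumes "\<And>j. f j \<in> S_piece (int d1, int d2)"
    and "P3_has_dim (image_closure f) 2"
    and "birational_onto_image f"
    and "finite (base_locus f)"
    and "base_locus_lci f"
    and "primeideal p univ_ring"
    and "\<nu> \<notin> degree_region d1 d2"
  shows "HB_Sym_fibre_piece f p i \<nu> = {\<one>\<^bsub>HB_Sym_fibre f p i\<^esub>}"
proof -
  obtain \<phi> :: "'k R_poly \<Rightarrow> 'k adj adj adj adj" where \<phi>: "ring_hom_on \<phi>" "\<forall>F. \<phi> F = 0 \<longleftrightarrow> F \<in> p"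
    using prime_embedding[OF assms(6)] by blast
  interpret sym_fibre p \<phi> f using \<phi> by unfold_locales blast+
  obtain n1 n2 where \<nu>: "\<nu> = (n1, n2)" by (cases \<nu>)
  \<comment> \<open>Over the integers, failing \<open>n1 \<le> int d1 - 2\<close> means
    \<open>int d1 - 1 \<le> n1\<close>. The alternative is the failure of the third, conjunctive,
    condition of the region.\<close>
  have n: "int d1 - 1 \<le> n1" "int d2 - 1 \<le> n2" "2 * int d1 - 1 \<le> n1 \<or> 2 * int d2 - 1 \<le> n2"
    using assms(7) by (auto simp: \<nu> degree_region_def)
  have "cvanish polys J (n1, n2) i"
    unfolding J_def
    by (rule cvanish_syz_ideal[OF infinite_adj _ _ _ _ n])
      (auto intro: base_change_polys[OF \<iota>] base_change_piece[OF \<iota>] assms(1))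
  then show ?thesis
    unfolding HB_Sym_fibre_piece_def HB_Sym_fibre_def \<nu> by (rule cech_model.local_cohomology_piece_trivial[OF cech_model])
qed

end
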